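(* Let $E_{\mathrm{dG}}:(S_\ell^0)^d\to H^1_0(\Omega)^d$ be a linear operator such that, for all $v\in(S_\ell^0)^d$, $$\int_FE_{\mathrm{dG}}v\cdot m_F=\int_F\{\!\{v\}\!\}\cdot m_F\quad\forall F\in\mathcal F^i,\ m_F\in\mathbb P_{\ell-1}(F)^d,$$ $$\int_KE_{\mathrm{dG}}v\cdot m_K=\int_Kv\cdot m_K\quad\forall K\in\mathcal M,\ m_K\in\mathbb P_{\ell-2}(K)^d,$$ and $$\operatorname{div}E_{\mathrm{dG}}v=\operatorname{div}_{\mathrm{dG}}v .$$ Let $\eta>\overline\eta$, $\mu>0$ and $f\in H^{-1}(\Omega)$, and let $(u,p)$ and $(u_{\mathrm{dG}},p_{\mathrm{dG}})$ be the solutions of the Stokes problem and of the discrete problem, respectively. Then $$\|u-u_{\mathrm{dG}}\|_{\mathrm{dG}}\le C\,\delta_{\mathrm{dG}}\frac{1+\|E_{\mathrm{dG}}\|}{\underline\alpha_{\mathrm{dG}}}\inf_{w\in(S_\ell^0)^d}\|u-w\|_{\mathrm{dG}}$$ and $$\|p-p_{\mathrm{dG}}\|_{L^2(\Omega)}\le C\,\delta_{\mathrm{dG}}\frac{(1+\|E_{\mathrm{dG}}\|)^2}{\underline\alpha_{\mathrm{dG}}\beta_{\mathrm{dG}}}\,\mu\inf_{w\in(S_\ell^0)^d}\|u-w\|_{\mathrm{dG}}+\inf_{q\in\widehat S_{\ell-1}^0}\|p-q\|_{L^2(\Omega)} .$$ Here $C>0$ is a nondecreasing function of the shape constant $\gamma_{\mathcal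 M}$, which may also depend on $\Omega$, $d$, $\ell$, but is independent of $\mu$, $\eta$, $f$.
   Context: **Domain, mesh, spaces.** $d\in\{2,3\}$, $\ell\ge1$ is an integer, $\Omega\subseteq\mathbb R^d$ is an open bounded polyhedron with Lipschitz boundary. $H^1_0(\Omega)$ is normed by $\|\nabla\cdot\|_{L^2(\Omega)}$, $H^{-1}(\Omega):=(H^1_0(\Omega)^d)'$ with duality pairing $\langle\cdot,\cdot\rangle$, and $L^2_0(\Omega):=\{q\in L^2(\Omega):\int_\Omega q=0\}$. $\mathcal M$ is a face-to-face simplicial mesh of $\Omega$ with shape constant $\gamma_{\mathcal M}:=\max_{K\in\mathcal M}h_K/\rho_K$, where $h_K=\operatorname{diam}K$ and $\rho_K$ is the diameter of the largest ball inscribed in $K$. $\mathcal F$ and $\mathcal F^i$ are the sets of all, respectively all interior, faces of $\mathcal M$; $\Sigma:=\bigcup_{F\in\mathcal F}F$; $h|_F:=\operatorname{diam}F$; $n|_F:=n_F$ is a fixed unit normal of $F$, pointing outside $\Omega$ if $F\subseteq\partial\Omega$. $\nabla_{\mathcal M}$, $\operatorname{div}_{\mathcal M}$ are the elementwise (broken) gradient and divergence. For an interior face $F=K_1\cap K_2$ with $n_F$ pointing outside $K_1$, $[\![v]\!]=v|_{K_1}-v|_{K_2}$ and $\{\!\{v\}\!\}=\frac12(v|_{K_1}+v|_{K_2})$; on boundary faces $[\![v]\!]=\{\!\{v\}\!\}=v$; $\{\!\{\nabla v\}\!\}$ means $\{\!\{\nabla_{\mathcal M}v\}\!\}$. $\mathbb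 P_k$ denotes polynomials of total degree $\le k$, $\mathbb P_{-1}=\{0\}$. $S_k^0:=\{v:\Omega\to\mathbb R: v|_K\in\mathbb P_k(K)\ \forall K\in\mathcal M\}$, $\widehat S_k^0:=S_k^0\cap L^2_0(\Omega)$. **Stokes problem.** Find $u\in H^1_0(\Omega)^d$, $p\in L^2_0(\Omega)$ with $\mu\int_\Omega\nabla u:\nabla v-\int_\Omega p\operatorname{div}v=\langle f,v\rangle$ for all $v\in H^1_0(\Omega)^d$ and $\int_\Omega q\operatorname{div}u=0$ for all $q\in L^2_0(\Omega)$. **Discrete problem.** For a penalty parameter $\eta>0$, $a_{\mathrm{dG}}(w,v):=\int_\Omega\nabla_{\mathcal M}w:\nabla_{\mathcal M}v-\int_\Sigma\{\!\{\nabla w\}\!\}n\cdot[\![v]\!]-\int_\Sigma[\![w]\!]\cdot\{\!\{\nabla v\}\!\}n+\int_\Sigma\frac{\eta}{h}[\![w]\!]\cdot[\![v]\!]$, $b_{\mathrm{dG}}(w,q):=-\int_\Omega q\operatorname{div}_{\mathcal M}w+\int_\Sigma[\![w]\!]\cdot n\,\{\!\{q\}\!\}$. Find $u_{\mathrm{dG}}\in(S_\ell^0)^d$, $p_{\mathrm{dG}}\in\widehat S_{\ell-1}^0$ with $\mu\,a_{\mathrm{dG}}(u_{\mathrm{dG}},v)+b_{\mathrm{dG}}(v,p_{\mathrm{dG}})=\langle f,E_{\mathrm{dG}}v\rangle$ for all $v\in(S_\ell^0)^d$ and $b_{\mathrm{dG}}(u_{\mathrm{dG}},q)=0$ for all $q\in\widehat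 S_{\ell-1}^0$. The discrete divergence $\operatorname{div}_{\mathrm{dG}}:(S_\ell^0)^d\to\widehat S_{\ell-1}^0$ is defined by $\int_\Omega q\operatorname{div}_{\mathrm{dG}}w=-b_{\mathrm{dG}}(w,q)$ for all $q\in\widehat S_{\ell-1}^0$, and $Z_{\mathrm{dG}}:=\{w\in(S_\ell^0)^d:\operatorname{div}_{\mathrm{dG}}w=0\}$. **Norms and constants.** $\|w\|_{\mathrm{dG}}^2:=\int_\Omega|\nabla_{\mathcal M}w|^2+\int_\Sigma\frac\eta h|[\![w]\!]|^2$ on $H^1_0(\Omega)^d+(S_\ell^0)^d$. $\|E_{\mathrm{dG}}\|$ is the operator norm from $((S_\ell^0)^d,\|\cdot\|_{\mathrm{dG}})$ to $(H^1_0(\Omega)^d,\|\nabla\cdot\|_{L^2(\Omega)})$. $\overline\eta>0$ is a constant, depending only on $\gamma_{\mathcal M}$ and $\ell$, such that $\int_\Sigma h|\{\!\{v\}\!\}|^2\le\overline\eta\|v\|_{L^2(\Omega)}^2$ for all $v\in(S_\ell^0)^{d\times d}$. $\underline\alpha_{\mathrm{dG}}:=1-\sqrt{\overline\eta/\eta}$. $\beta_{\mathrm{dG}}\in(0,1]$ is an inf-sup constant: $\beta_{\mathrm{dG}}\|q\|_{L^2(\Omega)}\le\sup_{w\in(S_\ell^0)^d}b_{\mathrm{dG}}(w,q)/\|w\|_{\mathrm{dG}}$ for all $q\in\widehat S_{\ell-1}^0$ (it is known that one can take $\beta_{\mathrm{dG}}^{-1}\le C\max\{1,\sqrt\eta\}$).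 $\delta_{\mathrm{dG}}$ is a constant such that $\inf_{z\in Z_{\mathrm{dG}}}\|u-z\|_{\mathrm{dG}}\le\delta_{\mathrm{dG}}\inf_{w\in(S_\ell^0)^d}\|u-w\|_{\mathrm{dG}}$ for the Stokes velocity $u$. *)

theory Defs
  imports "HOL-Analysis.Analysis"
begin

section \<open>Lebesgue and Sobolev spaces\<close>

definition l2 :: "'a measure \<Rightarrow> ('a \<Rightarrow> 'b::euclidean_space) set" where
  "l2 M = {f \<in> borel_measurable M. integrable M (\<lambda>x. (norm (f x))\<^sup>2)}"

definition l2_norm :: "'a measure \<Rightarrow> ('a \<Rightarrow> 'b::euclidean_space) \<Rightarrow> real" where
  "l2_norm M f = sqrt (\<integral>x. (norm (f x))\<^sup>2 \<partial>M)"

definition l2_lim :: "'a measure \<Rightarrow> (nat \<Rightarrow> 'a \<Rightarrow> 'b::euclidean_space) \<Rightarrow> ('a \<Rightarrow> 'b) \<Rightarrow> bool" where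
  "l2_lim M \<phi> f \<longleftrightarrow> (\<forall>k. (\<lambda>x. \<phi> k x - f x) \<in> l2 M) \<and>
     (\<lambda>k. l2_norm M (\<lambda>x. \<phi> k x - f x)) \<longlonglongrightarrow> 0"

definition l2_0 :: "(real^'n) set \<Rightarrow> (real^'n \<Rightarrow> real) set" where
  "l2_0 \<Omega> = {q \<in> l2 (lebesgue_on \<Omega>). (\<integral>x. q x \<partial>lebesgue_on \<Omega>) = 0}"

definition gradient :: "(real^'n \<Rightarrow> real) \<Rightarrow> real^'n \<Rightarrow> real^'n" where
  "gradient f x = (\<chi> i. frechet_derivative f (at x) (axis i 1))"

text \<open>\<open>C\<^sup>\<infinity>\<close> on the whole space: \<open>f\<close> is differentiable and so, coinductively, are all partial
  derivatives of every order.\<close>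

coinductive smooth :: "(real^'n \<Rightarrow> real) \<Rightarrow> bool" where
  "(\<forall>x. f differentiable (at x)) \<Longrightarrow> (\<forall>i. smooth (\<lambda>x. gradient f x $ i)) \<Longrightarrow> smooth f"

definition test_function :: "(real^'n) set \<Rightarrow> (real^'n \<Rightarrow> real) \<Rightarrow> bool" where
  "test_function U \<phi> \<longleftrightarrow> smooth \<phi> \<and> compact (closure {x. \<phi> x \<noteq> 0}) \<and> closure {x. \<phi> x \<noteq> 0} \<subseteq> U"

text \<open>Both \<open>f\<close> and \<open>G\<close> are required to be square integrable, so this includes \<open>f \<in> H\<^sup>1(U)\<close>.\<close>

definition weak_gradient :: "(real^'n) set \<Rightarrow> (real^'n \<Rightarrow> real) \<Rightarrow> (real^'n \<Rightarrow> real^'n) \<Rightarrow> bool" where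
  "weak_gradient U f G \<longleftrightarrow> f \<in> l2 (lebesgue_on U) \<and> G \<in> l2 (lebesgue_on U) \<and>
     (\<forall>\<phi>. test_function U \<phi> \<longrightarrow>
        (\<integral>x. f x *\<^sub>R gradient \<phi> x \<partial>lebesgue_on U) = - (\<integral>x. \<phi> x *\<^sub>R G x \<partial>lebesgue_on U))"

definition wgrad :: "(real^'n) set \<Rightarrow> (real^'n \<Rightarrow> real) \<Rightarrow> real^'n \<Rightarrow> real^'n" where
  "wgrad U f = (SOME G. weak_gradient U f G)"

text \<open>Row \<open>i\<close> of the gradient of a vector field is the gradient of its \<open>i\<close>-th component; the inner
  product of \<^typ>\<open>real^'n^'n\<close> is the Frobenius product.\<close>

definition vgrad :: "(real^'n) set \<Rightarrow> (real^'n \<Rightarrow> real^'n) \<Rightarrow> real^'n \<Rightarrow> real^'n^'n" where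
  "vgrad U v x = (\<chi> i. wgrad U (\<lambda>y. v y $ i) x)"

definition vdiv :: "(real^'n) set \<Rightarrow> (real^'n \<Rightarrow> real^'n) \<Rightarrow> real^'n \<Rightarrow> real" where
  "vdiv U v x = trace (vgrad U v x)"

definition h1_lim :: "(real^'n) set \<Rightarrow> (nat \<Rightarrow> real^'n \<Rightarrow> real) \<Rightarrow> (real^'n \<Rightarrow> real) \<Rightarrow> bool" where
  "h1_lim U \<phi> f \<longleftrightarrow> (\<exists>G. weak_gradient U f G \<and> l2_lim (lebesgue_on U) \<phi> f \<and>
     l2_lim (lebesgue_on U) (\<lambda>k. gradient (\<phi> k)) G)"

definition h1_0 :: "(real^'n) set \<Rightarrow> (real^'n \<Rightarrow> real) set" where
  "h1_0 \<Omega> = {f. \<exists>\<phi>. (\<forall>k. test_function \<Omega> (\<phi> k)) \<and> h1_lim \<Omega> \<phi> f}"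

definition h1_0_vec :: "(real^'n) set \<Rightarrow> (real^'n \<Rightarrow> real^'n) set" where
  "h1_0_vec \<Omega> = {v. \<forall>i. (\<lambda>x. v x $ i) \<in> h1_0 \<Omega>}"

definition h1_0_norm :: "(real^'n) set \<Rightarrow> (real^'n \<Rightarrow> real^'n) \<Rightarrow> real" where
  "h1_0_norm \<Omega> v = l2_norm (lebesgue_on \<Omega>) (vgrad \<Omega> v)"

text \<open>The dual space \<open>H\<^sup>-\<^sup>1(\<Omega>)\<close>. Boundedness and linearity entail that \<open>f\<close> does not distinguish
  fields that agree almost everywhere.\<close>

definition h_minus1 :: "(real^'n) set \<Rightarrow> ((real^'n \<Rightarrow> real^'n) \<Rightarrow> real) set" where
  "h_minus1 \<Omega> = {f.
     (\<forall>v\<in>h1_0_vec \<Omega>. \<forall>w\<in>h1_0_vec \<Omega>. f (\<lambda>x. v x + w x) = f v + f w) \<and>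
     (\<forall>c. \<forall>v\<in>h1_0_vec \<Omega>. f (\<lambda>x. c *\<^sub>R v x) = c * f v) \<and>
     (\<exists>B. \<forall>v\<in>h1_0_vec \<Omega>. \<bar>f v\<bar> \<le> B * h1_0_norm \<Omega> v)}"

section \<open>Surface measure and traces\<close>

text \<open>For \<open>F\<close> contained in a hyperplane, the \<open>(d - 1)\<close>-dimensional Lebesgue measure of \<open>A \<subseteq> F\<close> is
  the \<open>d\<close>-dimensional Lebesgue measure of the right prism of height 1 over \<open>A\<close>. Hence the surface
  measure of \<open>F\<close> is the push-forward of Lebesgue measure on the prism over \<open>F\<close> under the orthogonal
  projection onto the hyperplane.\<close>

definition face_measure :: "(real^'n) set \<Rightarrow> (real^'n) measure" where
  "face_measure F = (let \<pi> = closest_point (affine hull F) in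
     distr (restrict_space lborel {y. \<pi> y \<in> F \<and> dist y (\<pi> y) \<le> 1/2}) borel \<pi>)"

text \<open>Trace on \<open>F \<subseteq> closure U\<close> of a function in \<open>H\<^sup>1(U)\<close>, by continuous extension from smooth
  functions; the second definition acts componentwise.\<close>

definition is_trace :: "(real^'n) set \<Rightarrow> (real^'n) set \<Rightarrow> (real^'n \<Rightarrow> real) \<Rightarrow> (real^'n \<Rightarrow> real) \<Rightarrow> bool" where
  "is_trace U F f g \<longleftrightarrow> (\<exists>\<phi>. (\<forall>k. smooth (\<phi> k)) \<and> h1_lim U \<phi> f \<and> l2_lim (face_measure F) \<phi> g)"

definition face_trace :: "(real^'n) set \<Rightarrow> (real^'n) set \<Rightarrow> (real^'n \<Rightarrow> 'b::euclidean_space) \<Rightarrow> real^'n \<Rightarrow> 'b" where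
  "face_trace U F v x = (\<Sum>b\<in>Basis. (SOME g. is_trace U F (\<lambda>y. v y \<bullet> b) g) x *\<^sub>R b)"

section \<open>Domains and meshes\<close>

definition lipschitz_boundary :: "(real^'n) set \<Rightarrow> bool" where
  "lipschitz_boundary \<Omega> \<longleftrightarrow> (\<forall>z\<in>frontier \<Omega>. \<exists>e r L \<phi>. norm e = 1 \<and> 0 < r \<and>
     L-lipschitz_on {y. y \<bullet> e = 0} \<phi> \<and>
     \<Omega> \<inter> ball z r = {x \<in> ball z r. \<phi> (x - (x \<bullet> e) *\<^sub>R e) < x \<bullet> e})"

definition polyhedral_domain :: "(real^'n) set \<Rightarrow> bool" where
  "polyhedral_domain \<Omega> \<longleftrightarrow> open \<Omega> \<and> bounded \<Omega> \<and> \<Omega> \<noteq> {} \<and> lipschitz_boundary \<Omega> \<and>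
     (\<exists>P. finite P \<and> (\<forall>Q\<in>P. polytope Q) \<and> closure \<Omega> = \<Union>P)"

definition simplicial_mesh :: "(real^'n) set \<Rightarrow> (real^'n) set set \<Rightarrow> bool" where
  "simplicial_mesh \<Omega> M \<longleftrightarrow> triangulation M \<and> (\<forall>K\<in>M. int CARD('n) simplex K) \<and> \<Union>M = closure \<Omega>"

definition shape_constant :: "(real^'n) set set \<Rightarrow> real" where
  "shape_constant M =
     Max ((\<lambda>K. diameter K / Sup {diameter (cball c r) | c r. cball c r \<subseteq> K}) ` M)"

definition faces :: "(real^'n) set set \<Rightarrow> (real^'n) set set" where
  "faces M = {F. \<exists>K\<in>M. F facet_of K}"

definition interior_faces :: "(real^'n) set \<Rightarrow> (real^'n) set set \<Rightarrow> (real^'n) set set" where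
  "interior_faces \<Omega> M = {F \<in> faces M. \<not> F \<subseteq> frontier \<Omega>}"

definition face_normals :: "(real^'n) set \<Rightarrow> (real^'n) set set \<Rightarrow> ((real^'n) set \<Rightarrow> real^'n) \<Rightarrow> bool" where
  "face_normals \<Omega> M n \<longleftrightarrow> (\<forall>F\<in>faces M. norm (n F) = 1 \<and> (\<forall>x\<in>F. \<forall>y\<in>F. n F \<bullet> (x - y) = 0) \<and>
     (F \<subseteq> frontier \<Omega> \<longrightarrow> (\<forall>x\<in>rel_interior F. \<exists>e>0. \<forall>t\<in>{0<..<e}. x + t *\<^sub>R n F \<notin> \<Omega>)))"

definition element_at :: "(real^'n) set set \<Rightarrow> (real^'n) set \<Rightarrow> real^'n \<Rightarrow> (real^'n) set" where
  "element_at M F \<nu> = (THE K. K \<in> M \<and> F facet_of K \<and> (\<forall>x\<in>K. \<forall>y\<in>F. \<nu> \<bullet> (x - y) \<le> 0))"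

definition jump :: "(real^'n) set \<Rightarrow> (real^'n) set set \<Rightarrow> ((real^'n) set \<Rightarrow> real^'n) \<Rightarrow> (real^'n) set \<Rightarrow>
    (real^'n \<Rightarrow> 'b::euclidean_space) \<Rightarrow> real^'n \<Rightarrow> 'b" where
  "jump \<Omega> M n F v x =
     (let K\<^sub>1 = element_at M F (n F); K\<^sub>2 = element_at M F (- n F) in
      if F \<in> interior_faces \<Omega> M
      then face_trace (interior K\<^sub>1) F v x - face_trace (interior K\<^sub>2) F v x
      else face_trace (interior K\<^sub>1) F v x)"

definition average :: "(real^'n) set \<Rightarrow> (real^'n) set set \<Rightarrow> ((real^'n) set \<Rightarrow> real^'n) \<Rightarrow> (real^'n) set \<Rightarrow>
    (real^'n \<Rightarrow> 'b::euclidean_space) \<Rightarrow> real^'n \<Rightarrow> 'b" where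
  "average \<Omega> M n F v x =
     (let K\<^sub>1 = element_at M F (n F); K\<^sub>2 = element_at M F (- n F) in
      if F \<in> interior_faces \<Omega> M
      then (1/2) *\<^sub>R (face_trace (interior K\<^sub>1) F v x + face_trace (interior K\<^sub>2) F v x)
      else face_trace (interior K\<^sub>1) F v x)"

definition broken_grad :: "(real^'n) set set \<Rightarrow> (real^'n \<Rightarrow> real^'n) \<Rightarrow> real^'n \<Rightarrow> real^'n^'n" where
  "broken_grad M v x = (\<Sum>K\<in>M. indicat_real (interior K) x *\<^sub>R vgrad (interior K) v x)"

definition broken_div :: "(real^'n) set set \<Rightarrow> (real^'n \<Rightarrow> real^'n) \<Rightarrow> real^'n \<Rightarrow> real" where
  "broken_div M v x = (\<Sum>K\<in>M. indicat_real (interior K) x * vdiv (interior K) v x)"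

definition skeleton_integral :: "(real^'n) set set \<Rightarrow> ((real^'n) set \<Rightarrow> real^'n \<Rightarrow> real) \<Rightarrow> real" where
  "skeleton_integral M g = (\<Sum>F\<in>faces M. \<integral>x. g F x \<partial>face_measure F)"

section \<open>Piecewise polynomials\<close>

text \<open>The degree bound is an integer, so that the space for \<open>k = -1\<close> is trivial. The spaces below are taken componentwise, and hence cover scalar, vector and
  matrix fields.\<close>

definition polynomials :: "int \<Rightarrow> (real^'n \<Rightarrow> real) set" where
  "polynomials k = {p. \<exists>c :: ('n \<Rightarrow> nat) \<Rightarrow> real.
     p = (\<lambda>x. \<Sum>\<alpha> | int (\<Sum>i\<in>UNIV. \<alpha> i) \<le> k. c \<alpha> * (\<Prod>i\<in>UNIV. (x $ i) ^ \<alpha> i))}"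

definition polynomials_vec :: "int \<Rightarrow> (real^'n \<Rightarrow> real^'n) set" where
  "polynomials_vec k = {m. \<forall>i. (\<lambda>x. m x $ i) \<in> polynomials k}"

text \<open>Elements are determined only up to null sets; normalising them to vanish off the open simplices
  selects exactly one representative of each.\<close>

definition pw_poly :: "int \<Rightarrow> (real^'n) set set \<Rightarrow> (real^'n \<Rightarrow> 'b::euclidean_space) set" where
  "pw_poly k M = {v. (\<forall>K\<in>M. \<forall>b\<in>Basis. \<exists>p\<in>polynomials k. \<forall>x\<in>interior K. v x \<bullet> b = p x) \<and>
     (\<forall>x. x \<notin> (\<Union>K\<in>M. interior K) \<longrightarrow> v x = 0)}"

definition pw_poly_0 :: "int \<Rightarrow> (real^'n) set \<Rightarrow> (real^'n) set set \<Rightarrow> (real^'n \<Rightarrow> real) set" where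
  "pw_poly_0 k \<Omega> M = pw_poly k M \<inter> l2_0 \<Omega>"

section \<open>The Stokes problem and its discretization\<close>

definition stokes_solution :: "(real^'n) set \<Rightarrow> real \<Rightarrow> ((real^'n \<Rightarrow> real^'n) \<Rightarrow> real) \<Rightarrow>
    (real^'n \<Rightarrow> real^'n) \<Rightarrow> (real^'n \<Rightarrow> real) \<Rightarrow> bool" where
  "stokes_solution \<Omega> \<mu> f u p \<longleftrightarrow> u \<in> h1_0_vec \<Omega> \<and> p \<in> l2_0 \<Omega> \<and>
     (\<forall>v\<in>h1_0_vec \<Omega>. \<mu> * (\<integral>x. vgrad \<Omega> u x \<bullet> vgrad \<Omega> v x \<partial>lebesgue_on \<Omega>)
        - (\<integral>x. p x * vdiv \<Omega> v x \<partial>lebesgue_on \<Omega>) = f v) \<and>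
     (\<forall>q\<in>l2_0 \<Omega>. (\<integral>x. q x * vdiv \<Omega> u x \<partial>lebesgue_on \<Omega>) = 0)"

definition a_dG :: "(real^'n) set \<Rightarrow> (real^'n) set set \<Rightarrow> ((real^'n) set \<Rightarrow> real^'n) \<Rightarrow> real \<Rightarrow>
    (real^'n \<Rightarrow> real^'n) \<Rightarrow> (real^'n \<Rightarrow> real^'n) \<Rightarrow> real" where
  "a_dG \<Omega> M n \<eta> w v =
     (\<integral>x. broken_grad M w x \<bullet> broken_grad M v x \<partial>lebesgue_on \<Omega>)
     - skeleton_integral M (\<lambda>F x. (average \<Omega> M n F (broken_grad M w) x *v n F) \<bullet> jump \<Omega> M n F v x)
     - skeleton_integral M (\<lambda>F x. jump \<Omega> M n F w x \<bullet> (average \<Omega> M n F (broken_grad M v) x *v n F))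
     + skeleton_integral M (\<lambda>F x. \<eta> / diameter F * (jump \<Omega> M n F w x \<bullet> jump \<Omega> M n F v x))"

definition b_dG :: "(real^'n) set \<Rightarrow> (real^'n) set set \<Rightarrow> ((real^'n) set \<Rightarrow> real^'n) \<Rightarrow>
    (real^'n \<Rightarrow> real^'n) \<Rightarrow> (real^'n \<Rightarrow> real) \<Rightarrow> real" where
  "b_dG \<Omega> M n w q =
     - (\<integral>x. q x * broken_div M w x \<partial>lebesgue_on \<Omega>)
     + skeleton_integral M (\<lambda>F x. (jump \<Omega> M n F w x \<bullet> n F) * average \<Omega> M n F q x)"

definition norm_dG :: "(real^'n) set \<Rightarrow> (real^'n) set set \<Rightarrow> ((real^'n) set \<Rightarrow> real^'n) \<Rightarrow> real \<Rightarrow>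
    (real^'n \<Rightarrow> real^'n) \<Rightarrow> real" where
  "norm_dG \<Omega> M n \<eta> w =
     sqrt ((\<integral>x. (norm (broken_grad M w x))\<^sup>2 \<partial>lebesgue_on \<Omega>)
       + skeleton_integral M (\<lambda>F x. \<eta> / diameter F * (norm (jump \<Omega> M n F w x))\<^sup>2))"

definition dG_solution :: "(real^'n) set \<Rightarrow> (real^'n) set set \<Rightarrow> ((real^'n) set \<Rightarrow> real^'n) \<Rightarrow> nat \<Rightarrow>
    real \<Rightarrow> real \<Rightarrow> ((real^'n \<Rightarrow> real^'n) \<Rightarrow> real) \<Rightarrow>
    ((real^'n \<Rightarrow> real^'n) \<Rightarrow> real^'n \<Rightarrow> real^'n) \<Rightarrow>
    (real^'n \<Rightarrow> real^'n) \<Rightarrow> (real^'n \<Rightarrow> real) \<Rightarrow> bool" where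
  "dG_solution \<Omega> M n l \<eta> \<mu> f E u\<^sub>h p\<^sub>h \<longleftrightarrow>
     u\<^sub>h \<in> pw_poly (int l) M \<and> p\<^sub>h \<in> pw_poly_0 (int l - 1) \<Omega> M \<and>
     (\<forall>v\<in>pw_poly (int l) M. \<mu> * a_dG \<Omega> M n \<eta> u\<^sub>h v + b_dG \<Omega> M n v p\<^sub>h = f (E v)) \<and>
     (\<forall>q\<in>pw_poly_0 (int l - 1) \<Omega> M. b_dG \<Omega> M n u\<^sub>h q = 0)"

definition div_dG :: "(real^'n) set \<Rightarrow> (real^'n) set set \<Rightarrow> ((real^'n) set \<Rightarrow> real^'n) \<Rightarrow> nat \<Rightarrow>
    (real^'n \<Rightarrow> real^'n) \<Rightarrow> real^'n \<Rightarrow> real" where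
  "div_dG \<Omega> M n l w = (THE g. g \<in> pw_poly_0 (int l - 1) \<Omega> M \<and>
     (\<forall>q\<in>pw_poly_0 (int l - 1) \<Omega> M. (\<integral>x. q x * g x \<partial>lebesgue_on \<Omega>) = - b_dG \<Omega> M n w q))"

definition Z_dG :: "(real^'n) set \<Rightarrow> (real^'n) set set \<Rightarrow> ((real^'n) set \<Rightarrow> real^'n) \<Rightarrow> nat \<Rightarrow>
    (real^'n \<Rightarrow> real^'n) set" where
  "Z_dG \<Omega> M n l = {w \<in> pw_poly (int l) M. div_dG \<Omega> M n l w = (\<lambda>x. 0)}"

text \<open>Linearity holds almost everywhere, as the elements of \<open>H\<^sup>1\<^sub>0(\<Omega>)\<^sup>d\<close> are classes of fields modulo
  null sets.\<close>

definition linear_into_h1_0 :: "(real^'n) set \<Rightarrow> (real^'n \<Rightarrow> real^'n) set \<Rightarrow>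
    ((real^'n \<Rightarrow> real^'n) \<Rightarrow> real^'n \<Rightarrow> real^'n) \<Rightarrow> bool" where
  "linear_into_h1_0 \<Omega> V E \<longleftrightarrow> (\<forall>v\<in>V. E v \<in> h1_0_vec \<Omega>) \<and>
     (\<forall>v\<in>V. \<forall>w\<in>V. AE x in lebesgue_on \<Omega>. E (\<lambda>y. v y + w y) x = E v x + E w x) \<and>
     (\<forall>c. \<forall>v\<in>V. AE x in lebesgue_on \<Omega>. E (\<lambda>y. c *\<^sub>R v y) x = c *\<^sub>R E v x)"

text \<open>The operator norm; the quotient is 0 at \<open>v = 0\<close> since division by 0 yields 0.\<close>

definition opnorm_dG :: "(real^'n) set \<Rightarrow> (real^'n) set set \<Rightarrow> ((real^'n) set \<Rightarrow> real^'n) \<Rightarrow> nat \<Rightarrow> real \<Rightarrow>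
    ((real^'n \<Rightarrow> real^'n) \<Rightarrow> real^'n \<Rightarrow> real^'n) \<Rightarrow> real" where
  "opnorm_dG \<Omega> M n l \<eta> E = (SUP v\<in>pw_poly (int l) M. h1_0_norm \<Omega> (E v) / norm_dG \<Omega> M n \<eta> v)"

end

theory Submission
  imports Defs
begin

text \<open>For piecewise polynomial \<open>z, w\<close>, elementwise integration by parts and the moment conditions give
  \<open>\<integral> \<nabla>z : \<nabla>(E w) = \<integral> \<nabla>z : \<nabla>w - \<integral>\<^sub>\<Sigma> {\<nabla>z} n \<cdot> [w]\<close> with broken gradients. As \<open>u\<close> has no jumps, the defect
  \<open>\<integral> \<nabla>u : \<nabla>(E w) - a(z, w)\<close> is therefore an expression in \<open>u - z\<close> only, bounded by
  \<open>(2 + \<parallel>E\<parallel>) \<parallel>u - z\<parallel> \<parallel>w\<parallel>\<close>. If \<open>w = u\<^sub>h - z\<close> is in the discrete kernel, then \<open>E w\<close> is divergence free; so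
  both pressures disappear when the Stokes problem is tested with \<open>E w\<close> and the discrete one with \<open>w\<close>,
  and coercivity gives the velocity estimate with the constant \<open>1 + (2 + \<parallel>E\<parallel>) / \<alpha> \<le> 3 (1 + \<parallel>E\<parallel>) / \<alpha>\<close>.
  For general test functions the same defect, with \<open>z = u\<^sub>h\<close>, controls the distance of \<open>p\<^sub>h\<close> to the
  \<open>L\<^sup>2\<close>-projection of \<open>p\<close> through the inf-sup condition. Both estimates hold with \<open>C = 6\<close>.

  The calculus needed for this rests on the divergence theorem on a simplex: derivatives in the
  direction of an edge are integrated along lines by Fubini's theorem, and the edges at a vertex span
  the space. It yields the trace inequality, hence existence and uniqueness of traces, and by density
  integration by parts on each element.\<close>

section \<open>Positive semidefinite forms and square integrable functions\<close>

text \<open>Inserting \<open>u\<close> into \<open>a_dG\<close> is avoided: \<open>u\<close> is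
  merely in \<open>h1_0_vec \<Omega>\<close>, so its normal derivative need not have a trace on a
  face. Only the discrete field \<open>z\<close> is integrated by parts, and \<open>u\<close> enters
  through its gradient and its vanishing jumps. The dependence on the mesh is carried by
  \<open>opnorm_dG\<close>, \<open>\<eta>bar\<close>, \<open>\<beta>\<close> and
  \<open>\<delta>\<close>; hence \<open>C\<close> can be constant. The 6 is the 3 of the velocity
  estimate times the 2 in \<open>2 + opnorm \<le> 2 * (1 + opnorm)\<close>. Two obstacles shape the
  formal part. Weak gradients and traces are values of \<open>SOME\<close>, so even linearity must
  be derived from existence and uniqueness, and it holds almost everywhere only. And
  \<open>opnorm_dG\<close> is a supremum of reals, which bounds nothing until the set is known to be
  bounded. Boundedness follows from finite dimension, provided that the dG norm is definite on
  piecewise polynomials; definiteness is shown by testing with primitives of bump functions instead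
  of a Poincare inequality. Finite dimension also supplies the representers behind
  \<open>div_dG\<close> and the projection of the pressure.\<close>

locale psd_form =
  fixes V :: "('a \<Rightarrow> 'b::real_vector) set" and A :: "('a \<Rightarrow> 'b) \<Rightarrow> ('a \<Rightarrow> 'b) \<Rightarrow> real"
  assumes add: "\<lbrakk>v \<in> V; w \<in> V\<rbrakk> \<Longrightarrow> (\<lambda>x. v x + w x) \<in> V"
    and scale: "v \<in> V \<Longrightarrow> (\<lambda>x. c *\<^sub>R v x) \<in> V"
    and sym: "\<lbrakk>v \<in> V; w \<in> V\<rbrakk> \<Longrightarrow> A v w = A w v"
    and form_add: "\<lbrakk>v \<in> V; w \<in> V; z \<in> V\<rbrakk> \<Longrightarrow> A (\<lambda>x. v x + w x) z = A v z + A w z"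
    and form_scale: "\<lbrakk>v \<in> V; z \<in> V\<rbrakk> \<Longrightarrow> A (\<lambda>x. c *\<^sub>R v x) z = c * A v z"
    and nonneg: "v \<in> V \<Longrightarrow> 0 \<le> A v v"
begin

lemma diff: assumes "v \<in> V" "w \<in> V" shows "(\<lambda>x. v x - w x) \<in> V"
  using add[OF assms(1) scale[OF assms(2), of "-1"]] by simp

lemma form_diff:
  assumes "v \<in> V" "w \<in> V" "z \<in> V" shows "A (\<lambda>x. v x - w x) z = A v z - A w z"
  using form_add[OF assms(1) scale[OF assms(2), of "-1"] assms(3)]
    form_scale[OF assms(2,3), of "-1"] by simp

lemma form_add_right:
  assumes "v \<in> V" "w \<in> V" "z \<in> V" shows "A z (\<lambda>x. v x + w x) = A z v + A z w"
  using form_add[OF assms] sym[OF add[OF assms(1,2)] assms(3)] sym[OF assms(1,3)] sym[OF assms(2,3)]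
  by simp

lemma form_scale_right:
  assumes "v \<in> V" "z \<in> V" shows "A z (\<lambda>x. c *\<^sub>R v x) = c * A z v"
  using form_scale[OF assms, of c] sym[OF scale[OF assms(1)] assms(2), of c] sym[OF assms] by simp

lemma form_diff_right:
  assumes "v \<in> V" "w \<in> V" "z \<in> V" shows "A z (\<lambda>x. v x - w x) = A z v - A z w"
  using form_diff[OF assms] sym[OF diff[OF assms(1,2)] assms(3)] sym[OF assms(1,3)] sym[OF assms(2,3)]
  by simp

lemma quadratic:
  assumes "v \<in> V" "w \<in> V"
  shows "A (\<lambda>x. v x + t *\<^sub>R w x) (\<lambda>x. v x + t *\<^sub>R w x) = A v v + 2 * t * A v w + t\<^sup>2 * A w w"
  using assms scale[OF assms(2), of t] add[OF assms(1) scale[OF assms(2), of t]]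
  by (simp add: form_add form_scale form_add_right form_scale_right sym[of w v]
      power2_eq_square algebra_simps)

text \<open>The forms act on functions rather than on classes modulo null sets, so they are only
  semidefinite and \<open>A w w = 0\<close> must be treated apart: the quadratic in \<open>t\<close>
  is then affine and bounded below, so its slope vanishes. Otherwise the minimiser of the quadratic
  is inserted.\<close>

lemma cauchy_schwarz_sq:
  assumes "v \<in> V" "w \<in> V"
  shows "(A v w)\<^sup>2 \<le> A v v * A w w"
proof -
  have pos: "0 \<le> A v v + 2 * t * A v w + t\<^sup>2 * A w w" for t
    using nonneg[OF add[OF assms(1) scale[OF assms(2), of t]]] quadratic[OF assms, of t] by simp
  show ?thesis
  proof (cases "A w w = 0")
    case True
    have "A v w = 0"
    proof (rule ccontr)
      assume "A v w \<noteq> 0"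
      \<comment> \<open>This \<open>t\<close> gives the affine function the value -1.\<close>
      with pos[of "- (A v v + 1) / (2 * A v w)"] True show False
        by (simp add: field_simps)
    qed
    with True show ?thesis by simp
  next
    case False
    with nonneg[OF assms(2)] have "A w w > 0" by simp
    with pos[of "- A v w / A w w"] show ?thesis
      by (simp add: field_simps power2_eq_square)
  qed
qed

lemma cauchy_schwarz:
  assumes "v \<in> V" "w \<in> V"
  shows "\<bar>A v w\<bar> \<le> sqrt (A v v) * sqrt (A w w)"
  using real_sqrt_le_mono[OF cauchy_schwarz_sq[OF assms]] by (simp add: real_sqrt_mult)

lemma minkowski:
  assumes "v \<in> V" "w \<in> V"
  shows "sqrt (A (\<lambda>x. v x + w x) (\<lambda>x. v x + w x)) \<le> sqrt (A v v) + sqrt (A w w)"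
proof (rule real_le_lsqrt)
  show "0 \<le> sqrt (A v v) + sqrt (A w w)"
    using nonneg assms by simp
  show "A (\<lambda>x. v x + w x) (\<lambda>x. v x + w x) \<le> (sqrt (A v v) + sqrt (A w w))\<^sup>2"
    using quadratic[OF assms, of 1] cauchy_schwarz[OF assms] nonneg[OF assms(1)] nonneg[OF assms(2)]
    by (simp add: power2_sum)
qed

lemma sqrt_form_scale: "v \<in> V \<Longrightarrow> sqrt (A (\<lambda>x. c *\<^sub>R v x) (\<lambda>x. c *\<^sub>R v x)) = \<bar>c\<bar> * sqrt (A v v)"
  using scale[of v c] by (simp add: form_scale form_scale_right real_sqrt_mult)

lemma minkowski_diff:
  assumes "v \<in> V" "w \<in> V"
  shows "sqrt (A (\<lambda>x. v x - w x) (\<lambda>x. v x - w x)) \<le> sqrt (A v v) + sqrt (A w w)"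
  using minkowski[OF assms(1) scale[OF assms(2), of "-1"]] sqrt_form_scale[OF assms(2), of "-1"]
  by simp

end

section \<open>Finite spans, representers and bounded seminorms\<close>

definition fspan :: "'i set \<Rightarrow> ('i \<Rightarrow> 'a \<Rightarrow> 'b::real_vector) \<Rightarrow> ('a \<Rightarrow> 'b) set" where
  "fspan I e = {v. \<exists>c. v = (\<lambda>x. \<Sum>i\<in>I. c i *\<^sub>R e i x)}"

lemma fspanI: "(\<lambda>x. \<Sum>i\<in>I. c i *\<^sub>R e i x) \<in> fspan I e"
  unfolding fspan_def by (intro CollectI exI[of _ c] refl)

lemma fspan_empty: "fspan {} e = {\<lambda>x. 0}"
  by (auto simp: fspan_def)

lemma fspan_insert:
  assumes "finite I" "i \<notin> I"
  shows "fspan (insert i I) e = {v. \<exists>w\<in>fspan I e. \<exists>c. v = (\<lambda>x. w x + c *\<^sub>R e i x)}"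
proof (intro set_eqI iffI)
  fix v assume "v \<in> fspan (insert i I) e"
  then obtain c where "v = (\<lambda>x. \<Sum>j\<in>insert i I. c j *\<^sub>R e j x)" by (auto simp: fspan_def)
  then have "v = (\<lambda>x. (\<Sum>j\<in>I. c j *\<^sub>R e j x) + c i *\<^sub>R e i x)"
    using assms by (simp add: add.commute)
  then show "v \<in> {v. \<exists>w\<in>fspan I e. \<exists>c. v = (\<lambda>x. w x + c *\<^sub>R e i x)}"
    by (intro CollectI bexI[OF _ fspanI] exI)
next
  fix v assume "v \<in> {v. \<exists>w\<in>fspan I e. \<exists>c. v = (\<lambda>x. w x + c *\<^sub>R e i x)}"
  then obtain c a where v: "v = (\<lambda>x. (\<Sum>j\<in>I. c j *\<^sub>R e j x) + a *\<^sub>R e i x)"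
    by (auto simp: fspan_def)
  have "(\<Sum>j\<in>insert i I. (c(i := a)) j *\<^sub>R e j x) = (\<Sum>j\<in>I. c j *\<^sub>R e j x) + a *\<^sub>R e i x" for x
  proof -
    have "(\<Sum>j\<in>I. (c(i := a)) j *\<^sub>R e j x) = (\<Sum>j\<in>I. c j *\<^sub>R e j x)"
      using assms by (intro sum.cong) auto
    then show ?thesis using assms by (simp add: add.commute)
  qed
  with v have "v = (\<lambda>x. \<Sum>j\<in>insert i I. (c(i := a)) j *\<^sub>R e j x)" by simp
  then show "v \<in> fspan (insert i I) e" by (simp only: fspanI)
qed

lemma fspan_zero: "(\<lambda>x. 0) \<in> fspan I e"
  using fspanI[of "\<lambda>_. 0" e I] by simp

lemma fspan_closed:
  assumes "finite I" "\<And>i. i \<in> I \<Longrightarrow> e i \<in> V" "(\<lambda>x. 0) \<in> V"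
    and "\<And>v w. \<lbrakk>v \<in> V; w \<in> V\<rbrakk> \<Longrightarrow> (\<lambda>x. v x + w x) \<in> V"
    and "\<And>v c. v \<in> V \<Longrightarrow> (\<lambda>x. c *\<^sub>R v x) \<in> V"
  shows "fspan I e \<subseteq> V"
  using assms(1,2)
proof (induction I)
  case empty
  then show ?case by (simp add: fspan_empty assms(3))
next
  case (insert i I)
  then have "(\<lambda>x. w x + c *\<^sub>R e i x) \<in> V" if "w \<in> fspan I e" for w c
    using that by (intro assms(4) assms(5)) auto
  then show ?case using insert.hyps by (auto simp: fspan_insert)
qed

lemma fspan_diff_scale:
  assumes "v \<in> fspan I e" "w \<in> fspan I e"
  shows "(\<lambda>x. v x + c *\<^sub>R w x) \<in> fspan I e"
proof -
  obtain a b where "v = (\<lambda>x. \<Sum>i\<in>I. a i *\<^sub>R e i x)" "w = (\<lambda>x. \<Sum>i\<in>I. b i *\<^sub>R e i x)"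
    using assms by (auto simp: fspan_def)
  then have "(\<lambda>x. v x + c *\<^sub>R w x) = (\<lambda>x. \<Sum>i\<in>I. (a i + c * b i) *\<^sub>R e i x)"
    by (simp add: scaleR_add_left sum.distrib scaleR_sum_right)
  then show ?thesis by (simp only: fspanI)
qed

context psd_form
begin

lemma fspan_subset: "\<lbrakk>finite I; \<And>i. i \<in> I \<Longrightarrow> e i \<in> V; (\<lambda>x. 0) \<in> V\<rbrakk> \<Longrightarrow> fspan I e \<subseteq> V"
  by (rule fspan_closed) (blast intro: add scale)+

text \<open>Gram-Schmidt by induction on the generators. The induction hypothesis is used twice: for
  \<open>A v (e i)\<close> it yields the projection \<open>g0\<close> of the new generator, for
  \<open>L\<close> the representer \<open>g1\<close> on the old span, which is then corrected along
  \<open>e' = e i - g0\<close>. The form may be degenerate; that \<open>L\<close> vanishes on null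
  vectors makes the correction solvable.\<close>

lemma riesz_fspan:
  assumes "finite I" "\<And>i. i \<in> I \<Longrightarrow> e i \<in> V" "(\<lambda>x. 0) \<in> V"
    and "\<And>v w. \<lbrakk>v \<in> V; w \<in> V\<rbrakk> \<Longrightarrow> L (\<lambda>x. v x + w x) = L v + L w"
    and "\<And>v c. v \<in> V \<Longrightarrow> L (\<lambda>x. c *\<^sub>R v x) = c * L v"
    and "\<And>v. \<lbrakk>v \<in> V; A v v = 0\<rbrakk> \<Longrightarrow> L v = 0"
  shows "\<exists>g\<in>fspan I e. \<forall>v\<in>fspan I e. A v g = L v"
  using assms(1,2,4-6)
proof (induction I arbitrary: L)
  case empty
  have "A (\<lambda>x. 0) (\<lambda>x. 0) = 0" "L (\<lambda>x. 0) = 0"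
    using form_scale[OF assms(3,3), of 0] empty.prems(3)[OF assms(3), of 0] by simp_all
  then show ?case by (simp add: fspan_empty)
next
  case (insert i I)
  note L_add = insert.prems(2) and L_scale = insert.prems(3) and L_zero = insert.prems(4)
  have sub: "fspan I e \<subseteq> V" using insert.prems(1) insert.hyps assms(3) by (intro fspan_subset) auto
  have ei: "e i \<in> V" using insert.prems(1) by simp
  have "\<exists>g\<in>fspan I e. \<forall>v\<in>fspan I e. A v g = A v (e i)"
  proof (rule insert.IH)
    show "A v (e i) = 0" if "v \<in> V" "A v v = 0" for v
      using cauchy_schwarz_sq[OF that(1) ei] that(2) by simp
  qed (use insert.prems(1) ei in \<open>auto simp: form_add form_scale\<close>)
  then obtain g0 where g0: "g0 \<in> fspan I e" "\<And>v. v \<in> fspan I e \<Longrightarrow> A v g0 = A v (e i)" by blast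
  have "\<exists>g\<in>fspan I e. \<forall>v\<in>fspan I e. A v g = L v"
    by (rule insert.IH) (use insert.prems in auto)
  then obtain g1 where g1: "g1 \<in> fspan I e" "\<And>v. v \<in> fspan I e \<Longrightarrow> A v g1 = L v" by blast
  define e' where "e' = (\<lambda>x. e i x - g0 x)"
  have g0V: "g0 \<in> V" and g1V: "g1 \<in> V" using g0 g1 sub by auto
  have e'V: "e' \<in> V" unfolding e'_def by (intro diff ei g0V)
  have orth: "A v e' = 0" if "v \<in> fspan I e" for v
    using that sub g0 ei g0V unfolding e'_def by (subst form_diff_right) auto
  \<comment> \<open>For a null vector \<open>e'\<close> the required value \<open>L e'\<close> is 0,
    and \<open>c = 0\<close> attains it.\<close>
  define c where "c = (if A e' e' = 0 then 0 else L e' / A e' e')"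
  define g where "g = (\<lambda>x. g1 x + c *\<^sub>R e' x)"
  have ceV: "(\<lambda>x. c *\<^sub>R e' x) \<in> V" using e'V by (rule scale)
  have gV: "g \<in> V" unfolding g_def by (intro add ceV g1V)
  have Ae'g: "A e' g = L e'"
  proof -
    have "A e' g = c * A e' e'"
      unfolding g_def using form_add_right[OF g1V ceV e'V] form_scale_right[OF e'V e'V, of c]
        orth[OF g1(1)] sym[OF e'V g1V] by simp
    then show ?thesis using L_zero[OF e'V] by (simp add: c_def)
  qed
  have Avg: "A v g = L v" if "v \<in> fspan I e" for v
    using that sub form_add_right[OF g1V ceV, of v] form_scale_right[OF e'V, of v c] orth[OF that] g1(2)[OF that]
    unfolding g_def by auto
  have "g = (\<lambda>x. (g1 x + (- c) *\<^sub>R g0 x) + c *\<^sub>R e i x)"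
    by (auto simp: g_def e'_def algebra_simps)
  then have gI: "g \<in> fspan (insert i I) e"
    using fspan_diff_scale[OF g1(1) g0(1), of "- c"] insert.hyps by (auto simp: fspan_insert)
  have "A v g = L v" if v: "v \<in> fspan (insert i I) e" for v
  proof -
    obtain w a where w: "w \<in> fspan I e" "v = (\<lambda>x. w x + a *\<^sub>R e i x)"
      using v insert.hyps by (auto simp: fspan_insert)
    \<comment> \<open>The multiple of \<open>g0\<close> hidden in \<open>e i\<close> is moved to the
      old span, where \<open>A v g = L v\<close> is known.\<close>
    define w' where "w' = (\<lambda>x. w x + a *\<^sub>R g0 x)"
    have w': "w' \<in> fspan I e" unfolding w'_def by (intro fspan_diff_scale w g0)
    have "v = (\<lambda>x. w' x + a *\<^sub>R e' x)" by (auto simp: w w'_def e'_def algebra_simps)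
    moreover have "A (\<lambda>x. w' x + a *\<^sub>R e' x) g = L w' + a * L e'"
      using form_add[OF _ scale[OF e'V] gV, of w' a] form_scale[OF e'V gV, of a] w' sub Avg[OF w'] Ae'g by auto
    moreover have "L (\<lambda>x. w' x + a *\<^sub>R e' x) = L w' + a * L e'"
      using L_add[OF _ scale[OF e'V], of w' a] L_scale[OF e'V, of a] w' sub by auto
    ultimately show ?thesis by simp
  qed
  with gI show ?case by blast
qed

text \<open>Equivalence of norms in finite dimension, for a possibly degenerate form. With
  \<open>e'\<close> orthogonal to the old span, \<open>A v v = A w' w' + a\<^sup>2 * A e' e'\<close>
  for \<open>v = w' + a e'\<close>; so each part is bounded by \<open>v\<close>, and the two
  constants add up.\<close>

lemma seminorm_bounded_fspan:
  assumes "finite I" "\<And>i. i \<in> I \<Longrightarrow> e i \<in> V" "(\<lambda>x. 0) \<in> V"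
    and "\<And>v w. \<lbrakk>v \<in> V; w \<in> V\<rbrakk> \<Longrightarrow> B (\<lambda>x. v x + w x) \<le> B v + B w"
    and "\<And>v c. v \<in> V \<Longrightarrow> B (\<lambda>x. c *\<^sub>R v x) = \<bar>c\<bar> * (B v :: real)"
    and "\<And>v. \<lbrakk>v \<in> V; A v v = 0\<rbrakk> \<Longrightarrow> B v = 0"
    and B_nonneg: "\<And>v. v \<in> V \<Longrightarrow> 0 \<le> B v"
  shows "\<exists>C\<ge>0. \<forall>v\<in>fspan I e. B v \<le> C * sqrt (A v v)"
  using assms(1,2)
proof (induction I)
  case empty
  have "A (\<lambda>x. 0) (\<lambda>x. 0) = 0" "B (\<lambda>x. 0) = 0"
    using form_scale[OF assms(3,3), of 0] assms(5)[OF assms(3), of 0] by simp_all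
  then show ?case by (auto simp: fspan_empty)
next
  case (insert i I)
  obtain C where C: "C \<ge> 0" "\<And>v. v \<in> fspan I e \<Longrightarrow> B v \<le> C * sqrt (A v v)"
    using insert.IH insert.prems by auto
  have sub: "fspan I e \<subseteq> V" using insert.prems(1) insert.hyps assms(3) by (intro fspan_subset) auto
  have ei: "e i \<in> V" using insert.prems(1) by simp
  have "\<exists>g\<in>fspan I e. \<forall>v\<in>fspan I e. A v g = A v (e i)"
  proof (rule riesz_fspan)
    show "A v (e i) = 0" if "v \<in> V" "A v v = 0" for v
      using cauchy_schwarz_sq[OF that(1) ei] that(2) by simp
  qed (use insert assms(3) ei in \<open>auto simp: form_add form_scale\<close>)
  then obtain g0 where g0: "g0 \<in> fspan I e" "\<And>v. v \<in> fspan I e \<Longrightarrow> A v g0 = A v (e i)" by blast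
  define e' where "e' = (\<lambda>x. e i x - g0 x)"
  have g0V: "g0 \<in> V" using g0 sub by auto
  have e'V: "e' \<in> V" unfolding e'_def by (intro diff ei g0V)
  have orth: "A v e' = 0" if "v \<in> fspan I e" for v
    using that sub g0 ei g0V unfolding e'_def by (subst form_diff_right) auto
  \<comment> \<open>If \<open>e'\<close> is null the quotient is 0, which is right because
    \<open>B e' = 0\<close> then.\<close>
  define D where "D = B e' / sqrt (A e' e')"
  have D: "D \<ge> 0" unfolding D_def using B_nonneg[OF e'V] nonneg[OF e'V] by simp
  have De: "B e' = D * sqrt (A e' e')" unfolding D_def using assms(6)[OF e'V] by auto
  have "B v \<le> (C + D) * sqrt (A v v)" if v: "v \<in> fspan (insert i I) e" for v
  proof -
    obtain w a where w: "w \<in> fspan I e" "v = (\<lambda>x. w x + a *\<^sub>R e i x)"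
      using v insert.hyps by (auto simp: fspan_insert)
    define w' where "w' = (\<lambda>x. w x + a *\<^sub>R g0 x)"
    have w': "w' \<in> fspan I e" unfolding w'_def by (intro fspan_diff_scale w g0)
    have w'V: "w' \<in> V" using w' sub by auto
    have veq: "v = (\<lambda>x. w' x + a *\<^sub>R e' x)" by (auto simp: w w'_def e'_def algebra_simps)
    have "A v v = A w' w' + a\<^sup>2 * A e' e'"
      unfolding veq using quadratic[OF w'V e'V, of a] orth[OF w'] by simp
    moreover have "0 \<le> A w' w'" "0 \<le> a\<^sup>2 * A e' e'" using nonneg w'V e'V by auto
    ultimately have le: "sqrt (A w' w') \<le> sqrt (A v v)" "sqrt (a\<^sup>2 * A e' e') \<le> sqrt (A v v)"
      by auto
    have "B v \<le> B w' + \<bar>a\<bar> * B e'"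
      unfolding veq using assms(4)[OF w'V scale[OF e'V], of a] assms(5)[OF e'V, of a] by simp
    also have "\<dots> \<le> C * sqrt (A w' w') + D * sqrt (a\<^sup>2 * A e' e')"
      using C(2)[OF w'] De by (simp add: real_sqrt_mult)
    also have "\<dots> \<le> C * sqrt (A v v) + D * sqrt (A v v)"
      using le C(1) D by (intro add_mono mult_left_mono)
    finally show ?thesis by (simp add: algebra_simps)
  qed
  then show ?case using C(1) D by (intro exI[of _ "C + D"]) auto
qed

end

section \<open>Square integrable functions: norm, limits, completeness\<close>

lemma l2_measurable [measurable_dest]: "f \<in> l2 M \<Longrightarrow> f \<in> borel_measurable M"
  by (simp add: l2_def)

lemma l2_inner_integrable:
  fixes f g :: "'a \<Rightarrow> 'b::euclidean_space"
  assumes "f \<in> l2 M" "g \<in> l2 M"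
  shows "integrable M (\<lambda>x. f x \<bullet> g x)"
proof (rule Bochner_Integration.integrable_bound)
  show "integrable M (\<lambda>x. (norm (f x))\<^sup>2 + (norm (g x))\<^sup>2)"
    using assms by (auto simp: l2_def)
  show "(\<lambda>x. f x \<bullet> g x) \<in> borel_measurable M"
    using assms by (auto simp: l2_def)
  show "AE x in M. norm (f x \<bullet> g x) \<le> norm ((norm (f x))\<^sup>2 + (norm (g x))\<^sup>2)"
  proof (rule AE_I2)
    fix x
    have "\<bar>f x \<bullet> g x\<bar> \<le> norm (f x) * norm (g x)" by (rule Cauchy_Schwarz_ineq2)
    also have "\<dots> \<le> (norm (f x))\<^sup>2 + (norm (g x))\<^sup>2"
      using sum_squares_bound[of "norm (f x)" "norm (g x)"]
        mult_nonneg_nonneg[OF norm_ge_zero[of "f x"] norm_ge_zero[of "g x"]] by linarith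
    finally show "norm (f x \<bullet> g x) \<le> norm ((norm (f x))\<^sup>2 + (norm (g x))\<^sup>2)" by simp
  qed
qed

lemma l2_add:
  assumes "f \<in> l2 M" "g \<in> l2 M" shows "(\<lambda>x. f x + g x) \<in> l2 M"
proof -
  have "integrable M (\<lambda>x. f x \<bullet> f x + g x \<bullet> g x + 2 * (f x \<bullet> g x))"
    using assms by (intro Bochner_Integration.integrable_add integrable_mult_right l2_inner_integrable)
  then have "integrable M (\<lambda>x. (norm (f x + g x))\<^sup>2)"
    by (simp add: power2_norm_eq_inner inner_add_left inner_add_right inner_commute algebra_simps)
  then show ?thesis using assms by (auto simp: l2_def)
qed

lemma l2_scale: "f \<in> l2 M \<Longrightarrow> (\<lambda>x. c *\<^sub>R f x) \<in> l2 M"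
  by (auto simp: l2_def power_mult_distrib)

lemma l2_zero: "(\<lambda>x. 0) \<in> l2 M"
  by (simp add: l2_def)

interpretation l2_form: psd_form "l2 M" "\<lambda>f g. \<integral>x. f x \<bullet> g x \<partial>M" for M :: "'a measure"
proof
  fix v w z :: "'a \<Rightarrow> 'b" and c assume v: "v \<in> l2 M" and w: "w \<in> l2 M" and z: "z \<in> l2 M"
  show "(\<integral>x. (v x + w x) \<bullet> z x \<partial>M) = (\<integral>x. v x \<bullet> z x \<partial>M) + (\<integral>x. w x \<bullet> z x \<partial>M)"
    using l2_inner_integrable[OF v z] l2_inner_integrable[OF w z] by (simp add: inner_add_left)
qed (auto intro: l2_add l2_scale simp: inner_commute)

lemma l2_norm_eq: "l2_norm M f = sqrt (\<integral>x. f x \<bullet> f x \<partial>M)"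
  by (simp add: l2_norm_def power2_norm_eq_inner)

lemma l2_norm_sq: "(l2_norm M f)\<^sup>2 = (\<integral>x. f x \<bullet> f x \<partial>M)"
  by (simp add: l2_norm_eq)

lemma l2_norm_nonneg: "0 \<le> l2_norm M f"
  by (simp add: l2_norm_def)

lemma l2_norm_triangle: "\<lbrakk>f \<in> l2 M; g \<in> l2 M\<rbrakk> \<Longrightarrow> l2_norm M (\<lambda>x. f x + g x) \<le> l2_norm M f + l2_norm M g"
  unfolding l2_norm_eq by (rule l2_form.minkowski)

lemma l2_norm_triangle_diff:
  "\<lbrakk>f \<in> l2 M; g \<in> l2 M\<rbrakk> \<Longrightarrow> l2_norm M (\<lambda>x. f x - g x) \<le> l2_norm M f + l2_norm M g"
  unfolding l2_norm_eq by (rule l2_form.minkowski_diff)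

lemma l2_norm_scale: "f \<in> l2 M \<Longrightarrow> l2_norm M (\<lambda>x. c *\<^sub>R f x) = \<bar>c\<bar> * l2_norm M f"
  unfolding l2_norm_eq by (rule l2_form.sqrt_form_scale)

lemma l2_cauchy_schwarz:
  "\<lbrakk>f \<in> l2 M; g \<in> l2 M\<rbrakk> \<Longrightarrow> \<bar>\<integral>x. f x \<bullet> g x \<partial>M\<bar> \<le> l2_norm M f * l2_norm M g"
  unfolding l2_norm_eq by (rule l2_form.cauchy_schwarz)

lemma l2_norm_eq_0:
  assumes "f \<in> l2 M" "l2_norm M f = 0" shows "AE x in M. f x = 0"
proof -
  have "(\<integral>x. (norm (f x))\<^sup>2 \<partial>M) = 0" using assms(2) by (simp add: l2_norm_def)
  moreover have "integrable M (\<lambda>x. (norm (f x))\<^sup>2)" using assms(1) by (simp add: l2_def)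
  ultimately have "AE x in M. (norm (f x))\<^sup>2 = 0"
    by (subst (asm) integral_nonneg_eq_0_iff_AE) auto
  then show ?thesis by simp
qed

lemma l2_cong_AE:
  assumes "f \<in> l2 M" "g \<in> borel_measurable M" "AE x in M. f x = g x"
  shows "g \<in> l2 M"
proof -
  have "integrable M (\<lambda>x. (norm (f x))\<^sup>2)" using assms(1) by (simp add: l2_def)
  then have "integrable M (\<lambda>x. (norm (g x))\<^sup>2)"
    by (rule integrable_cong_AE_imp) (use assms in \<open>auto simp: l2_def\<close>)
  then show ?thesis using assms by (simp add: l2_def)
qed

lemma l2_norm_cong_AE:
  assumes "f \<in> borel_measurable M" "g \<in> borel_measurable M" "AE x in M. f x = g x"
  shows "l2_norm M f = l2_norm M g"
proof -
  have "(\<integral>x. (norm (f x))\<^sup>2 \<partial>M) = (\<integral>x. (norm (g x))\<^sup>2 \<partial>M)"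
    by (rule integral_cong_AE) (use assms in auto)
  then show ?thesis by (simp add: l2_norm_def)
qed

lemma l2_linear_image:
  fixes T :: "'b::euclidean_space \<Rightarrow> 'c::euclidean_space"
  assumes "f \<in> l2 M" "bounded_linear T" shows "(\<lambda>x. T (f x)) \<in> l2 M"
proof -
  obtain B where B: "\<And>y. norm (T y) \<le> norm y * B" using bounded_linear.bounded[OF assms(2)] by blast
  have m: "T \<in> borel_measurable borel"
    using assms(2) by (intro borel_measurable_continuous_onI linear_continuous_on)
  have f: "f \<in> borel_measurable M" "integrable M (\<lambda>x. (norm (f x))\<^sup>2)" using assms(1) by (auto simp: l2_def)
  have "integrable M (\<lambda>x. (norm (T (f x)))\<^sup>2)"
  proof (rule Bochner_Integration.integrable_bound)
    show "integrable M (\<lambda>x. B\<^sup>2 * (norm (f x))\<^sup>2)" using f by simp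
    show "(\<lambda>x. (norm (T (f x)))\<^sup>2) \<in> borel_measurable M" using measurable_compose[OF f(1) m] by simp
    have "(norm (T (f x)))\<^sup>2 \<le> B\<^sup>2 * (norm (f x))\<^sup>2" for x
      using power_mono[OF B[of "f x"], of 2] by (simp add: power_mult_distrib mult.commute)
    then show "AE x in M. norm ((norm (T (f x)))\<^sup>2) \<le> norm (B\<^sup>2 * (norm (f x))\<^sup>2)" by simp
  qed
  then show ?thesis using measurable_compose[OF f(1) m] by (simp add: l2_def)
qed

lemma l2_componentwise:
  fixes f :: "'a \<Rightarrow> 'b::euclidean_space"
  assumes "\<And>b. b \<in> Basis \<Longrightarrow> (\<lambda>x. f x \<bullet> b) \<in> l2 M" shows "f \<in> l2 M"
proof -
  have sq: "(norm (f x))\<^sup>2 = (\<Sum>b\<in>Basis. (norm (f x \<bullet> b))\<^sup>2)" for x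
    unfolding power2_norm_eq_inner by (subst euclidean_inner) (simp add: power2_eq_square)
  have "f \<in> borel_measurable M"
    by (rule borel_measurable_euclidean_space[THEN iffD2]) (use assms in \<open>auto simp: l2_def\<close>)
  moreover have "integrable M (\<lambda>x. (norm (f x))\<^sup>2)"
    unfolding sq using assms by (intro Bochner_Integration.integrable_sum) (auto simp: l2_def)
  ultimately show ?thesis by (simp add: l2_def)
qed

lemma l2_lim_l2: "\<lbrakk>l2_lim M \<phi> f; \<And>k. \<phi> k \<in> l2 M\<rbrakk> \<Longrightarrow> f \<in> l2 M"
  using l2_form.diff[of "\<phi> 0" M "\<lambda>x. \<phi> 0 x - f x"] by (simp add: l2_lim_def)

lemma l2_lim_unique:
  assumes "l2_lim M \<phi> f" "l2_lim M \<phi> g" shows "AE x in M. f x = g x"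
proof -
  have le: "l2_norm M (\<lambda>x. f x - g x) \<le> l2_norm M (\<lambda>x. \<phi> k x - g x) + l2_norm M (\<lambda>x. \<phi> k x - f x)" for k
    using l2_norm_triangle_diff[of "\<lambda>x. \<phi> k x - g x" M "\<lambda>x. \<phi> k x - f x"] assms
    by (simp add: l2_lim_def)
  have "(\<lambda>k. l2_norm M (\<lambda>x. \<phi> k x - g x) + l2_norm M (\<lambda>x. \<phi> k x - f x)) \<longlonglongrightarrow> 0 + 0"
    using assms by (intro tendsto_add) (auto simp: l2_lim_def)
  then have "l2_norm M (\<lambda>x. f x - g x) \<le> 0 + 0"
    by (rule LIMSEQ_le_const) (use le in auto)
  then have "l2_norm M (\<lambda>x. f x - g x) = 0" using l2_norm_nonneg[of M "\<lambda>x. f x - g x"] by linarith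
  moreover have "(\<lambda>x. f x - g x) \<in> l2 M"
    using l2_form.diff[of "\<lambda>x. \<phi> 0 x - g x" M "\<lambda>x. \<phi> 0 x - f x"] assms by (simp add: l2_lim_def)
  ultimately have "AE x in M. f x - g x = 0" by (intro l2_norm_eq_0)
  then show ?thesis by simp
qed

lemma l2_lim_combine:
  assumes "l2_lim M \<phi> f" "l2_lim M \<psi> g"
  shows "l2_lim M (\<lambda>k x. \<phi> k x + c *\<^sub>R \<psi> k x) (\<lambda>x. f x + c *\<^sub>R g x)"
proof -
  have eq: "(\<lambda>x. \<phi> k x + c *\<^sub>R \<psi> k x - (f x + c *\<^sub>R g x)) = (\<lambda>x. (\<phi> k x - f x) + c *\<^sub>R (\<psi> k x - g x))" for k
    by (auto simp: algebra_simps)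
  have *: "(\<lambda>x. \<phi> k x - f x) \<in> l2 M" "(\<lambda>x. c *\<^sub>R (\<psi> k x - g x)) \<in> l2 M" "(\<lambda>x. \<psi> k x - g x) \<in> l2 M" for k
    using assms by (auto simp: l2_lim_def intro: l2_scale)
  have "(\<lambda>k. l2_norm M (\<lambda>x. \<phi> k x - f x) + \<bar>c\<bar> * l2_norm M (\<lambda>x. \<psi> k x - g x)) \<longlonglongrightarrow> 0 + \<bar>c\<bar> * 0"
    using assms by (intro tendsto_intros) (auto simp: l2_lim_def)
  then have "(\<lambda>k. l2_norm M (\<lambda>x. \<phi> k x - f x) + \<bar>c\<bar> * l2_norm M (\<lambda>x. \<psi> k x - g x)) \<longlonglongrightarrow> 0"
    by simp
  moreover have "l2_norm M (\<lambda>x. (\<phi> k x - f x) + c *\<^sub>R (\<psi> k x - g x))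
      \<le> l2_norm M (\<lambda>x. \<phi> k x - f x) + \<bar>c\<bar> * l2_norm M (\<lambda>x. \<psi> k x - g x)" for k
    using l2_norm_triangle[OF *(1)[of k] *(2)[of k]] l2_norm_scale[OF *(3)[of k], of c] by simp
  ultimately have "(\<lambda>k. l2_norm M (\<lambda>x. (\<phi> k x - f x) + c *\<^sub>R (\<psi> k x - g x))) \<longlonglongrightarrow> 0"
    by - (rule tendsto_sandwich[of "\<lambda>_. 0" _ sequentially "\<lambda>k. l2_norm M (\<lambda>x. \<phi> k x - f x) + \<bar>c\<bar> * l2_norm M (\<lambda>x. \<psi> k x - g x)"],
      simp_all add: l2_norm_nonneg)
  then show ?thesis
    unfolding l2_lim_def eq using l2_add[OF *(1,2)] by simp
qed

lemma l2_lim_cong_AE: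
  assumes "l2_lim M \<phi> f" "AE x in M. f x = g x" "f \<in> borel_measurable M" "g \<in> borel_measurable M"
  shows "l2_lim M \<phi> g"
proof -
  have mem: "(\<lambda>x. \<phi> k x - f x) \<in> l2 M" for k using assms(1) by (simp add: l2_lim_def)
  have "\<phi> k \<in> borel_measurable M" for k
    using borel_measurable_add[OF l2_measurable[OF mem[of k]] assms(3)] by simp
  then have g: "(\<lambda>x. \<phi> k x - g x) \<in> borel_measurable M" for k using assms(4) by measurable
  have ae: "AE x in M. \<phi> k x - f x = \<phi> k x - g x" for k using assms(2) by eventually_elim simp
  show ?thesis
    using assms(1) l2_cong_AE[OF mem g ae] l2_norm_cong_AE[OF l2_measurable[OF mem] g ae]
    by (simp add: l2_lim_def)
qed

lemma l2_lim_inner: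
  assumes "l2_lim M \<phi> f" "\<And>k. \<phi> k \<in> l2 M" "q \<in> l2 M"
  shows "(\<lambda>k. \<integral>x. \<phi> k x \<bullet> q x \<partial>M) \<longlonglongrightarrow> (\<integral>x. f x \<bullet> q x \<partial>M)"
proof (rule LIM_zero_cancel, rule tendsto_rabs_zero_cancel, rule tendsto_sandwich[of "\<lambda>_. 0"])
  have f: "f \<in> l2 M" using assms(1,2) by (rule l2_lim_l2)
  show "\<forall>\<^sub>F k in sequentially. \<bar>(\<integral>x. \<phi> k x \<bullet> q x \<partial>M) - (\<integral>x. f x \<bullet> q x \<partial>M)\<bar>
    \<le> l2_norm M (\<lambda>x. \<phi> k x - f x) * l2_norm M q"
  proof (rule eventuallyI)
    fix k
    have "(\<lambda>x. \<phi> k x - f x) \<in> l2 M" using assms(1) by (simp add: l2_lim_def)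
    from l2_cauchy_schwarz[OF this assms(3)]
    show "\<bar>(\<integral>x. \<phi> k x \<bullet> q x \<partial>M) - (\<integral>x. f x \<bullet> q x \<partial>M)\<bar> \<le> l2_norm M (\<lambda>x. \<phi> k x - f x) * l2_norm M q"
      by (simp only: l2_form.form_diff[OF assms(2)[of k] f assms(3)])
  qed
  have "(\<lambda>k. l2_norm M (\<lambda>x. \<phi> k x - f x) * l2_norm M q) \<longlonglongrightarrow> 0 * l2_norm M q"
    using assms(1) by (intro tendsto_intros) (auto simp: l2_lim_def)
  then show "(\<lambda>k. l2_norm M (\<lambda>x. \<phi> k x - f x) * l2_norm M q) \<longlonglongrightarrow> 0" by simp
qed auto

lemma (in finite_measure) l2_integrable:
  fixes f :: "'a \<Rightarrow> 'b::euclidean_space"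
  assumes "f \<in> l2 M" shows "integrable M f"
proof (rule Bochner_Integration.integrable_bound)
  show "integrable M (\<lambda>x. 1 + (norm (f x))\<^sup>2)" using assms by (simp add: l2_def)
  show "f \<in> borel_measurable M" using assms by (simp add: l2_def)
  have "norm (f x) \<le> 1 + (norm (f x))\<^sup>2" for x
    using sum_squares_bound[of 1 "norm (f x)"] norm_ge_zero[of "f x"] by (simp del: norm_ge_zero)
  then show "AE x in M. norm (f x) \<le> norm (1 + (norm (f x))\<^sup>2)" by simp
qed

lemma (in finite_measure) l1_le_l2_norm:
  fixes f :: "'a \<Rightarrow> 'b::euclidean_space"
  assumes "f \<in> l2 M" shows "(\<integral>x. norm (f x) \<partial>M) \<le> l2_norm M f * sqrt (measure M (space M))"
proof -
  have "(\<lambda>x. norm (f x)) \<in> l2 M" "(\<lambda>x. 1 :: real) \<in> l2 M" using assms by (auto simp: l2_def)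
  from l2_cauchy_schwarz[OF this] show ?thesis by (simp add: l2_norm_def)
qed

text \<open>Riesz-Fischer. Along a subsequence the successive differences have norm at most 2^-j;
  finiteness of the measure turns this into summable L1 norms, hence pointwise convergence almost
  everywhere. Fatou's lemma then bounds the distance of each term to the pointwise limit.\<close>

lemma (in finite_measure) l2_complete:
  fixes \<phi> :: "nat \<Rightarrow> 'a \<Rightarrow> real"
  assumes mem: "\<And>k. \<phi> k \<in> l2 M"
    and cauchy: "\<And>e. 0 < e \<Longrightarrow> \<exists>N. \<forall>m\<ge>N. \<forall>k\<ge>N. l2_norm M (\<lambda>x. \<phi> m x - \<phi> k x) < e"
  shows "\<exists>g. l2_lim M \<phi> g"
proof -
  have "\<forall>j. \<exists>N. \<forall>m\<ge>N. \<forall>k\<ge>N. l2_norm M (\<lambda>x. \<phi> m x - \<phi> k x) < (1/2)^j"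
    using cauchy by simp
  then obtain N where N: "\<And>j m k. \<lbrakk>N j \<le> m; N j \<le> k\<rbrakk> \<Longrightarrow> l2_norm M (\<lambda>x. \<phi> m x - \<phi> k x) < (1/2)^j"
    by metis
  \<comment> \<open>Summing all thresholds makes the subsequence monotone and at least
    \<open>N j\<close>; the extra \<open>j\<close> forces it to infinity.\<close>
  define r where "r j = (\<Sum>i\<le>j. N i) + j" for j
  have rN: "N j \<le> r j" for j
    unfolding r_def using member_le_sum[of j "{..j}" N] by simp
  have rS: "r j \<le> r (Suc j)" for j unfolding r_def by simp
  have r_ge: "j \<le> r j" for j unfolding r_def by simp
  define d where "d j x = \<phi> (r (Suc j)) x - \<phi> (r j) x" for j x
  have d_l2: "d j \<in> l2 M" for j unfolding d_def by (intro l2_form.diff mem)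
  have d_int: "integrable M (d j)" for j using d_l2 by (rule l2_integrable)
  have d_norm: "l2_norm M (d j) \<le> (1/2)^j" for j
    unfolding d_def using N[of j "r (Suc j)" "r j"] rN[of j] rS[of j] by simp
  define c where "c = sqrt (measure M (space M))"
  have d_le: "(\<integral>x. norm (d j x) \<partial>M) \<le> (1/2)^j * c" for j
    using l1_le_l2_norm[OF d_l2[of j]] mult_right_mono[OF d_norm, of c j] by (simp add: c_def)
  have "AE x in M. summable (\<lambda>j. norm (d j x))"
  proof -
    have summ: "summable (\<lambda>j. \<integral>x. norm (d j x) \<partial>M)"
    proof (rule summable_comparison_test)
      show "\<exists>N. \<forall>j\<ge>N. norm (\<integral>x. norm (d j x) \<partial>M) \<le> (1/2)^j * c"
        using d_le by (auto intro!: exI[of _ 0])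
      show "summable (\<lambda>j. (1/2)^j * c)" by (intro summable_mult2 summable_geometric) simp
    qed
    have "(\<integral>\<^sup>+x. (\<Sum>j. ennreal (norm (d j x))) \<partial>M) = (\<Sum>j. \<integral>\<^sup>+x. ennreal (norm (d j x)) \<partial>M)"
      using d_int by (intro nn_integral_suminf) auto
    also have "\<dots> = (\<Sum>j. ennreal (\<integral>x. norm (d j x) \<partial>M))"
      using d_int by (intro suminf_cong nn_integral_eq_integral) auto
    also have "\<dots> = ennreal (\<Sum>j. \<integral>x. norm (d j x) \<partial>M)"
      by (rule suminf_ennreal2[OF _ summ]) (rule Bochner_Integration.integral_nonneg, rule norm_ge_zero)
    finally have "(\<integral>\<^sup>+x. (\<Sum>j. ennreal (norm (d j x))) \<partial>M) \<noteq> \<infinity>" by simp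
    then have "AE x in M. (\<Sum>j. ennreal (norm (d j x))) \<noteq> \<infinity>"
      using d_int by (intro nn_integral_PInf_AE) auto
    then show ?thesis
    proof eventually_elim
      case (elim x)
      then show ?case by (intro summable_suminf_not_top) auto
    qed
  qed
  then have ae: "AE x in M. (\<lambda>j. \<phi> (r j) x) \<longlonglongrightarrow> lim (\<lambda>j. \<phi> (r j) x)"
  proof eventually_elim
    case (elim x)
    have "summable (\<lambda>j. d j x)" using elim by (rule summable_norm_cancel)
    moreover have "(\<Sum>j<n. d j x) = \<phi> (r n) x - \<phi> (r 0) x" for n
      unfolding d_def by (induction n) auto
    ultimately have "convergent (\<lambda>n. \<phi> (r n) x - \<phi> (r 0) x)"
      by (auto simp: summable_iff_convergent)
    then have "convergent (\<lambda>n. \<phi> (r n) x)"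
      using convergent_add[OF _ convergent_const, of "\<lambda>n. \<phi> (r n) x - \<phi> (r 0) x" "\<phi> (r 0) x"] by simp
    then show ?case by (simp add: convergent_LIMSEQ_iff)
  qed
  \<comment> \<open>Where the subsequence diverges the value is arbitrary; this is a null
    set.\<close>
  define g where "g x = lim (\<lambda>j. \<phi> (r j) x)" for x
  have \<phi>m: "\<phi> k \<in> borel_measurable M" for k using mem by (simp add: l2_def)
  have gm: "g \<in> borel_measurable M" unfolding g_def using \<phi>m by (rule borel_measurable_lim_metric)
  have fatou: "(\<integral>\<^sup>+x. ennreal ((norm (\<phi> k x - g x))\<^sup>2) \<partial>M) \<le> ennreal (e\<^sup>2)"
    if e: "0 < e" and K: "\<And>m. m \<ge> K \<Longrightarrow> l2_norm M (\<lambda>x. \<phi> k x - \<phi> m x) \<le> e" for k K e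
  proof -
    have "(\<integral>\<^sup>+x. ennreal ((norm (\<phi> k x - g x))\<^sup>2) \<partial>M)
        = (\<integral>\<^sup>+x. liminf (\<lambda>j. ennreal ((norm (\<phi> k x - \<phi> (r j) x))\<^sup>2)) \<partial>M)"
    proof (rule nn_integral_cong_AE)
      show "AE x in M. ennreal ((norm (\<phi> k x - g x))\<^sup>2) = liminf (\<lambda>j. ennreal ((norm (\<phi> k x - \<phi> (r j) x))\<^sup>2))"
        using ae
      proof eventually_elim
        case (elim x)
        have "(\<lambda>j. ennreal ((norm (\<phi> k x - \<phi> (r j) x))\<^sup>2)) \<longlonglongrightarrow> ennreal ((norm (\<phi> k x - g x))\<^sup>2)"
          using elim unfolding g_def by (intro tendsto_intros)
        then show ?case using lim_imp_Liminf by (metis sequentially_bot)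
      qed
    qed
    also have "\<dots> \<le> liminf (\<lambda>j. \<integral>\<^sup>+x. ennreal ((norm (\<phi> k x - \<phi> (r j) x))\<^sup>2) \<partial>M)"
      using \<phi>m by (intro nn_integral_liminf) auto
    also have "\<dots> \<le> liminf (\<lambda>j::nat. ennreal (e\<^sup>2))"
    proof (rule Liminf_mono, rule eventually_sequentiallyI[of K])
      fix j assume "K \<le> j"
      then have "l2_norm M (\<lambda>x. \<phi> k x - \<phi> (r j) x) \<le> e" using K r_ge[of j] by simp
      then have le: "(l2_norm M (\<lambda>x. \<phi> k x - \<phi> (r j) x))\<^sup>2 \<le> e\<^sup>2" by (simp add: l2_norm_nonneg power_mono)
      have "(\<lambda>x. \<phi> k x - \<phi> (r j) x) \<in> l2 M" by (intro l2_form.diff mem)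
      then have "(\<integral>\<^sup>+x. ennreal ((norm (\<phi> k x - \<phi> (r j) x))\<^sup>2) \<partial>M)
          = ennreal ((l2_norm M (\<lambda>x. \<phi> k x - \<phi> (r j) x))\<^sup>2)"
        by (subst nn_integral_eq_integral) (auto simp: l2_def l2_norm_def)
      then show "(\<integral>\<^sup>+x. ennreal ((norm (\<phi> k x - \<phi> (r j) x))\<^sup>2) \<partial>M) \<le> ennreal (e\<^sup>2)"
        using le by (simp add: ennreal_leI)
    qed
    also have "\<dots> = ennreal (e\<^sup>2)" by (simp add: Liminf_const)
    finally show ?thesis .
  qed
  have close: "(\<lambda>x. \<phi> k x - g x) \<in> l2 M \<and> l2_norm M (\<lambda>x. \<phi> k x - g x) \<le> e"
    if "0 < e" "\<And>m. m \<ge> K \<Longrightarrow> l2_norm M (\<lambda>x. \<phi> k x - \<phi> m x) \<le> e" for k K e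
  proof -
    have f: "(\<integral>\<^sup>+x. ennreal ((norm (\<phi> k x - g x))\<^sup>2) \<partial>M) \<le> ennreal (e\<^sup>2)"
      by (rule fatou[of e K]) (use that in auto)
    have int: "integrable M (\<lambda>x. (norm (\<phi> k x - g x))\<^sup>2)"
      using le_less_trans[OF f ennreal_less_top] \<phi>m gm by (intro integrableI_bounded) auto
    then have l: "(\<lambda>x. \<phi> k x - g x) \<in> l2 M" using \<phi>m gm by (simp add: l2_def)
    have "ennreal (\<integral>x. (norm (\<phi> k x - g x))\<^sup>2 \<partial>M) \<le> ennreal (e\<^sup>2)"
      using f int by (subst (asm) nn_integral_eq_integral) auto
    then have "(\<integral>x. (norm (\<phi> k x - g x))\<^sup>2 \<partial>M) \<le> e\<^sup>2" by (simp add: ennreal_le_iff)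
    then have "l2_norm M (\<lambda>x. \<phi> k x - g x) \<le> e"
      unfolding l2_norm_def using that(1) by (intro real_le_lsqrt) auto
    with l show ?thesis by simp
  qed
  \<comment> \<open>Closeness gives membership for the index \<open>N 0\<close>; the other terms
    differ from that one by an element of \<open>l2 M\<close>.\<close>
  have "(\<lambda>x. \<phi> k x - g x) \<in> l2 M" for k
  proof -
    have "(\<lambda>x. \<phi> (N 0) x - g x) \<in> l2 M"
      using close[of 1 "N 0" "N 0"] N[of 0 "N 0"] by (simp add: less_imp_le)
    from l2_add[OF l2_form.diff[OF mem[of k] mem[of "N 0"]] this] show ?thesis by simp
  qed
  moreover have "(\<lambda>k. l2_norm M (\<lambda>x. \<phi> k x - g x)) \<longlonglongrightarrow> 0"
  proof (rule LIMSEQ_I)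
    fix e :: real assume e: "0 < e"
    obtain K where K: "\<And>m k. \<lbrakk>m \<ge> K; k \<ge> K\<rbrakk> \<Longrightarrow> l2_norm M (\<lambda>x. \<phi> m x - \<phi> k x) < e/2"
      using cauchy[of "e/2"] e by auto
    have "l2_norm M (\<lambda>x. \<phi> k x - g x) < e" if "k \<ge> K" for k
      using close[of "e/2" K k] e K[OF that] by (simp add: less_imp_le)
    then show "\<exists>K. \<forall>k\<ge>K. norm (l2_norm M (\<lambda>x. \<phi> k x - g x) - 0) < e"
      by (auto intro!: exI[of _ K] simp: l2_norm_nonneg)
  qed
  ultimately show ?thesis by (auto simp: l2_lim_def)
qed

section \<open>Smooth functions\<close>

text \<open>The powers of \<open>t\<close> make the family closed under differentiation up to linear combinations.\<close>

definition flat :: "nat \<Rightarrow> real \<Rightarrow> real" where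
  "flat k t = (if 0 < t then exp (- 1 / t) / t ^ k else 0)"

text \<open>\<open>exp s \<ge> (1 + s / m) ^ m \<ge> (s / m) ^ m\<close> with
  \<open>s = 1 / t\<close> and \<open>m = k + 2\<close> gives
  \<open>exp (- 1 / t) \<le> m ^ m * t ^ m\<close>; division by \<open>t ^ k\<close> leaves a
  square.\<close>

lemma flat_le_square:
  fixes t :: real
  shows "\<bar>flat k t\<bar> \<le> real (k + 2) ^ (k + 2) * t\<^sup>2"
proof (cases "0 < t")
  case True
  define m where "m = k + 2"
  have "(1 / t / real m) ^ m \<le> (1 + 1 / t / real m) ^ m"
    using True by (intro power_mono) auto
  also have "(1 + 1 / t / real m) ^ m \<le> exp (1 / t)"
  proof (rule exp_ge_one_plus_x_over_n_power_n)
    show "- real m \<le> 1 / t" using True by (intro order_trans[of "- real m" 0 "1 / t"]) simp_all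
  qed (simp add: m_def)
  finally have le: "1 / (t ^ m * real m ^ m) \<le> exp (1 / t)"
    by (simp add: power_divide power_mult_distrib)
  have pos: "0 < t ^ m * real m ^ m" using True by (simp add: m_def)
  have "exp (- 1 / t) = 1 / exp (1 / t)" by (simp add: exp_minus field_simps)
  also have "\<dots> \<le> t ^ m * real m ^ m" using le pos by (simp add: field_simps)
  finally have "exp (- 1 / t) / t ^ k \<le> (t ^ m * real m ^ m) / t ^ k"
    using True by (intro divide_right_mono) auto
  also have "t ^ m = t ^ k * t\<^sup>2" by (simp add: m_def power_add power2_eq_square)
  also have "t ^ k * t\<^sup>2 * real m ^ m / t ^ k = real m ^ m * t\<^sup>2" using True by simp
  finally show ?thesis using True by (simp add: flat_def m_def)
qed (simp add: flat_def)

text \<open>At 0 the quadratic bound makes the difference quotient at most a multiple of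
  \<open>\<bar>h\<bar>\<close>, so every member of the family has derivative 0 there; elsewhere the
  formula is the quotient rule.\<close>

lemma flat_DERIV: "(flat k has_real_derivative flat (k + 2) t - real k * flat (k + 1) t) (at t)"
proof -
  consider "t < 0" | "t = 0" | "0 < t" by linarith
  then show ?thesis
  proof cases
    case 1
    have "((\<lambda>t. 0) has_real_derivative 0) (at t)" by simp
    then have "(flat k has_real_derivative 0) (at t)"
      by (rule has_field_derivative_transform_within_open[of _ _ _ "{..<0}"]) (use 1 in \<open>auto simp: flat_def\<close>)
    then show ?thesis using 1 by (simp add: flat_def)
  next
    case 2
    let ?C = "real (k + 2) ^ (k + 2)"
    have "((\<lambda>h. flat k h / h) \<longlongrightarrow> 0) (at 0)"
    proof (rule tendsto_rabs_zero_cancel, rule tendsto_sandwich[of "\<lambda>_. 0" _ _ "\<lambda>h. ?C * \<bar>h\<bar>"])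
      show "\<forall>\<^sub>F h in at 0. \<bar>flat k h / h\<bar> \<le> ?C * \<bar>h\<bar>"
      proof (rule eventually_at_filter[THEN iffD2, OF always_eventually], intro allI impI)
        fix h :: real assume h: "h \<noteq> 0"
        have "\<bar>flat k h\<bar> / \<bar>h\<bar> \<le> ?C * h\<^sup>2 / \<bar>h\<bar>" by (intro divide_right_mono flat_le_square) simp
        also have "\<dots> = ?C * \<bar>h\<bar>" using h by (simp add: power2_eq_square abs_if)
        finally show "\<bar>flat k h / h\<bar> \<le> ?C * \<bar>h\<bar>" by simp
      qed
      have "((\<lambda>h. ?C * \<bar>h\<bar>) \<longlongrightarrow> ?C * \<bar>0\<bar>) (at 0)" by (intro tendsto_intros)
      then show "((\<lambda>h. ?C * \<bar>h\<bar>) \<longlongrightarrow> 0) (at 0)" by simp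
    qed auto
    then have "(flat k has_real_derivative 0) (at 0)" by (simp add: DERIV_def flat_def)
    then show ?thesis using 2 by (simp add: flat_def)
  next
    case 3
    have "((\<lambda>t. exp (- 1 / t) / t ^ k) has_real_derivative
        (exp (- 1 / t) * (1 / t\<^sup>2) * t ^ k - exp (- 1 / t) * (real k * t ^ (k - 1))) / (t ^ k * t ^ k)) (at t)"
      using 3 by (auto intro!: derivative_eq_intros simp: power2_eq_square)
    moreover have "(exp (- 1 / t) * (1 / t\<^sup>2) * t ^ k - exp (- 1 / t) * (real k * t ^ (k - 1))) / (t ^ k * t ^ k)
       = exp (- 1 / t) / t ^ (k + 2) - real k * (exp (- 1 / t) / t ^ (k + 1))"
      using 3 by (cases k) (simp_all add: field_simps power2_eq_square)
    ultimately have "((\<lambda>t. exp (- 1 / t) / t ^ k) has_real_derivative flat (k + 2) t - real k * flat (k + 1) t) (at t)"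
      using 3 by (simp add: flat_def)
    then show ?thesis
      by (rule has_field_derivative_transform_within_open[of _ _ _ "{0<..}"]) (use 3 in \<open>auto simp: flat_def\<close>)
  qed
qed

lemma flat_0_bounds: "0 \<le> flat 0 t" "flat 0 t \<le> 1" "flat 0 t \<noteq> 0 \<longleftrightarrow> 0 < t"
  by (auto simp: flat_def)

lemma flat_0_scaled_tendsto:
  "(\<lambda>k. flat 0 (real (Suc k) * t)) \<longlonglongrightarrow> indicat_real {0<..} t"
proof (cases "0 < t")
  case True
  have "(\<lambda>k. exp (- (inverse (real (Suc k)) * (1 / t)))) \<longlonglongrightarrow> exp (- (0 * (1 / t)))"
    by (intro tendsto_intros LIMSEQ_inverse_real_of_nat)
  moreover have "flat 0 (real (Suc k) * t) = exp (- (inverse (real (Suc k)) * (1 / t)))" for k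
  proof -
    have "0 < real (Suc k) * t" using True by (intro mult_pos_pos) auto
    then show ?thesis by (simp add: flat_def inverse_eq_divide)
  qed
  ultimately show ?thesis using True by simp
next
  case False
  have "\<not> 0 < real (Suc k) * t" for k using False by (simp add: not_less mult_nonneg_nonpos)
  then show ?thesis using False by (simp add: flat_def)
qed

section \<open>Classical gradients and closure properties of smooth functions\<close>

lemma gradient_eqI:
  assumes "(f has_derivative (\<lambda>h. g \<bullet> h)) (at x)"
  shows "gradient f x = g"
proof (rule vec_eq_iff[THEN iffD2], rule allI)
  fix i
  show "gradient f x $ i = g $ i"
    unfolding gradient_def frechet_derivative_at[OF assms, symmetric] by (simp add: inner_axis)
qed

lemma gradient_derivative:
  fixes f :: "real^'n \<Rightarrow> real"
  assumes "f differentiable (at x)"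
  shows "(f has_derivative (\<lambda>h. gradient f x \<bullet> h)) (at x)"
proof -
  let ?D = "frechet_derivative f (at x)"
  have D: "(f has_derivative ?D) (at x)" using assms by (simp add: frechet_derivative_works)
  have lin: "linear ?D" using D by (simp add: has_derivative_linear)
  have "?D h = gradient f x \<bullet> h" for h
  proof -
    have "?D h = ?D (\<Sum>i\<in>UNIV. (h $ i) *\<^sub>R axis i 1)"
      using basis_expansion[of h] by (simp add: scalar_mult_eq_scaleR)
    also have "\<dots> = (\<Sum>i\<in>UNIV. h $ i * ?D (axis i 1))"
      using lin by (simp add: linear_sum linear_cmul)
    also have "\<dots> = gradient f x \<bullet> h"
      by (simp add: inner_vec_def gradient_def mult.commute)
    finally show ?thesis .
  qed
  then have "?D = (\<lambda>h. gradient f x \<bullet> h)" by auto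
  then show ?thesis using D by simp
qed

lemma smooth_differentiable: "smooth f \<Longrightarrow> f differentiable (at x)"
  by (erule smooth.cases) auto

lemma smooth_gradient: "smooth f \<Longrightarrow> smooth (\<lambda>x. gradient f x $ i)"
  by (erule smooth.cases) auto

lemma smooth_derivative: "smooth f \<Longrightarrow> (f has_derivative (\<lambda>h. gradient f x \<bullet> h)) (at x)"
  by (intro gradient_derivative smooth_differentiable)

lemma smooth_continuous: "smooth f \<Longrightarrow> continuous_on UNIV f"
  using smooth_differentiable
  by (intro differentiable_imp_continuous_on) (auto simp: differentiable_on_def)

lemma smooth_continuous_gradient: "smooth f \<Longrightarrow> continuous_on UNIV (gradient f)"
  using continuous_on_vec_lambda[of UNIV "\<lambda>i x. gradient f x $ i"] smooth_continuous[OF smooth_gradient[of f]]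
  by simp

lemma gradient_combine:
  assumes "f differentiable (at x)" "g differentiable (at x)"
  shows "gradient (\<lambda>x. f x + c * g x) x = gradient f x + c *\<^sub>R gradient g x"
  by (rule gradient_eqI) (auto intro!: derivative_eq_intros gradient_derivative assms
      simp: inner_add_left)

text \<open>The coinduction invariant is the set of all such combinations: a partial derivative of a
  combination is the combination of the partial derivatives.\<close>

lemma smooth_combine:
  assumes "smooth f" "smooth g"
  shows "smooth (\<lambda>x. f x + c * g x)"
proof -
  have "\<exists>f g. h = (\<lambda>x. f x + c * g x) \<and> smooth f \<and> smooth g \<Longrightarrow> smooth h" for h
  proof (coinduction arbitrary: h rule: smooth.coinduct)
    case smooth
    then obtain f g where h: "h = (\<lambda>x. f x + c * g x)" and f: "smooth f" and g: "smooth g" by blast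
    have "h differentiable (at x)" for x
      unfolding h using smooth_differentiable[OF f] smooth_differentiable[OF g]
      by (intro differentiable_add differentiable_mult) auto
    moreover have "(\<lambda>x. gradient h x $ i) = (\<lambda>x. gradient f x $ i + c * gradient g x $ i)" for i
      unfolding h using gradient_combine[OF smooth_differentiable[OF f] smooth_differentiable[OF g]] by auto
    then have "\<exists>f' g'. (\<lambda>x. gradient h x $ i) = (\<lambda>x. f' x + c * g' x) \<and> smooth f' \<and> smooth g'" for i
      by (intro exI[of _ "\<lambda>x. gradient f x $ i"] exI[of _ "\<lambda>x. gradient g x $ i"] conjI
          smooth_gradient f g) blast
    ultimately show ?case by (intro exI[of _ h]) simp
  qed
  then show ?thesis using assms by blast
qed

text \<open>This class is closed under partial derivatives, so its members are smooth by coinduction; it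
  contains all polynomials and sufficiently many bump functions.\<close>

inductive elementary :: "(real^'n \<Rightarrow> real) \<Rightarrow> bool" where
  const: "elementary (\<lambda>x. c)"
| coord: "elementary (\<lambda>x. x $ i)"
| flat: "elementary f \<Longrightarrow> elementary (\<lambda>x. flat k (f x))"
| antiderivative: "(\<And>t. (B has_real_derivative b t) (at t)) \<Longrightarrow> elementary (\<lambda>x. b (x $ i)) \<Longrightarrow> elementary (\<lambda>x. B (x $ i))"
| add: "elementary f \<Longrightarrow> elementary g \<Longrightarrow> elementary (\<lambda>x. f x + g x)"
| mult: "elementary f \<Longrightarrow> elementary g \<Longrightarrow> elementary (\<lambda>x. f x * g x)"

lemmas elementary_intros = elementary.const elementary.coord elementary.flat elementary.add elementary.mult

lemma elementary_deriv:
  "elementary (f :: real^'n \<Rightarrow> real) \<Longrightarrow>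
    \<exists>g. (\<forall>x. (f has_derivative (\<lambda>h. g x \<bullet> h)) (at x)) \<and> (\<forall>i. elementary (\<lambda>x. g x $ i))"
proof (induction rule: elementary.induct)
  case (const c)
  show ?case by (intro exI[of _ "\<lambda>x. 0"]) (auto intro: elementary_intros)
next
  case (coord i)
  have "((\<lambda>x::real^'n. x $ i) has_derivative (\<lambda>h. axis i 1 \<bullet> h)) (at x)" for x
    by (simp add: inner_axis' bounded_linear_imp_has_derivative bounded_linear_vec_nth)
  then show ?case by (intro exI[of _ "\<lambda>x. axis i 1"]) (auto intro: elementary_intros)
next
  case (flat f k)
  then obtain g where g: "\<And>x. (f has_derivative (\<lambda>h. g x \<bullet> h)) (at x)"
    "\<And>i. elementary (\<lambda>x. g x $ i)" by blast
  let ?d = "\<lambda>x. flat (k + 2) (f x) + (- real k) * flat (k + 1) (f x)"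
  have "((\<lambda>x. flat k (f x)) has_derivative (\<lambda>h. (?d x *\<^sub>R g x) \<bullet> h)) (at x)" for x
    using has_derivative_compose[OF g(1)[of x], of "flat k", OF flat_DERIV[THEN has_field_derivative_imp_has_derivative]]
    by (simp add: mult.commute)
  moreover have "elementary (\<lambda>x. (?d x *\<^sub>R g x) $ i)" for i
    unfolding vector_scaleR_component real_scaleR_def
    by (intro elementary_intros flat.hyps g(2))
  ultimately show ?case by (intro exI[of _ "\<lambda>x. ?d x *\<^sub>R g x"]) blast
next
  case (antiderivative B b i)
  have "((\<lambda>x::real^'n. x $ i) has_derivative (\<lambda>h. h $ i)) (at x)" for x
    by (simp add: bounded_linear_imp_has_derivative bounded_linear_vec_nth)
  from has_derivative_compose[OF this antiderivative.hyps(1)[THEN has_field_derivative_imp_has_derivative]]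
  have "((\<lambda>x. B (x $ i)) has_derivative (\<lambda>h. (b (x $ i) *\<^sub>R axis i 1) \<bullet> h)) (at x)" for x :: "real^'n"
    by (simp add: inner_axis')
  moreover have "elementary (\<lambda>x. (b (x $ i) *\<^sub>R axis i 1) $ j)" for j :: 'n
    unfolding vector_scaleR_component real_scaleR_def by (intro elementary_intros antiderivative.hyps(2))
  ultimately show ?case by (intro exI[of _ "\<lambda>x. b (x $ i) *\<^sub>R axis i 1"]) blast
next
  case (add f g)
  then obtain f' g' where *: "\<And>x. (f has_derivative (\<lambda>h. f' x \<bullet> h)) (at x)" "\<And>i. elementary (\<lambda>x. f' x $ i)"
    "\<And>x. (g has_derivative (\<lambda>h. g' x \<bullet> h)) (at x)" "\<And>i. elementary (\<lambda>x. g' x $ i)" by blast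
  have "((\<lambda>x. f x + g x) has_derivative (\<lambda>h. (f' x + g' x) \<bullet> h)) (at x)" for x
    unfolding inner_add_left by (intro has_derivative_add *)
  then show ?case using *(2,4) by (intro exI[of _ "\<lambda>x. f' x + g' x"]) (auto intro: elementary_intros)
next
  case (mult f g)
  then obtain f' g' where *: "\<And>x. (f has_derivative (\<lambda>h. f' x \<bullet> h)) (at x)" "\<And>i. elementary (\<lambda>x. f' x $ i)"
    "\<And>x. (g has_derivative (\<lambda>h. g' x \<bullet> h)) (at x)" "\<And>i. elementary (\<lambda>x. g' x $ i)" by blast
  have "((\<lambda>x. f x * g x) has_derivative (\<lambda>h. (f x *\<^sub>R g' x + g x *\<^sub>R f' x) \<bullet> h)) (at x)" for x
    using has_derivative_mult[OF *(1)[of x] *(3)[of x]] by (simp add: inner_add_left mult.commute)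
  moreover have "elementary (\<lambda>x. (f x *\<^sub>R g' x + g x *\<^sub>R f' x) $ i)" for i
    unfolding vector_add_component vector_scaleR_component real_scaleR_def
    by (intro elementary_intros mult.hyps *)
  ultimately show ?case by (intro exI[of _ "\<lambda>x. f x *\<^sub>R g' x + g x *\<^sub>R f' x"]) blast
qed

lemma elementary_smooth: "elementary f \<Longrightarrow> smooth f"
proof (coinduction arbitrary: f rule: smooth.coinduct)
  case smooth
  obtain g where g: "\<And>x. (f has_derivative (\<lambda>h. g x \<bullet> h)) (at x)" "\<And>i. elementary (\<lambda>x. g x $ i)"
    using elementary_deriv[OF smooth] by blast
  have "(\<lambda>x. gradient f x $ i) = (\<lambda>x. g x $ i)" for i using gradient_eqI[OF g(1)] by simp
  moreover have "f differentiable (at x)" for x using g(1) by (auto simp: differentiable_def)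
  ultimately show ?case using g(2) by auto
qed

lemma elementary_prod: "(\<And>i. i \<in> I \<Longrightarrow> elementary (f i)) \<Longrightarrow> elementary (\<lambda>x. \<Prod>i\<in>I. f i x)"
  by (induction I rule: infinite_finite_induct) (auto intro: elementary_intros)

lemma elementary_power: "elementary f \<Longrightarrow> elementary (\<lambda>x. f x ^ k)"
  by (induction k) (auto intro: elementary_intros)

text \<open>A two-sided cutoff in every coordinate, positive exactly on the open box. As
  \<open>k\<close> grows it tends to the indicator of the box, with values in [0, 1]; so integrals
  against bumps determine integrals over boxes by dominated convergence.\<close>

definition box_bump :: "real^'n \<Rightarrow> real^'n \<Rightarrow> nat \<Rightarrow> real^'n \<Rightarrow> real" where
  "box_bump a b k x = (\<Prod>i\<in>UNIV. flat 0 (real (Suc k) * (x $ i - a $ i)) * flat 0 (real (Suc k) * (b $ i - x $ i)))"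

lemma box_bump_smooth: "smooth (box_bump a b k)"
proof (rule elementary_smooth)
  have 1: "elementary (\<lambda>x. real (Suc k) * (x $ i + (- c)))" for i and c :: real
    by (intro elementary_intros)
  have 2: "elementary (\<lambda>x. real (Suc k) * (c + (- 1) * x $ i))" for i and c :: real
    by (intro elementary_intros)
  have "elementary (\<lambda>x. \<Prod>i\<in>UNIV. flat 0 (real (Suc k) * (x $ i + - a $ i)) * flat 0 (real (Suc k) * (b $ i + (- 1) * x $ i)))"
    by (intro elementary_prod elementary.mult elementary.flat 1 2)
  then show "elementary (box_bump a b k)" by (simp add: box_bump_def[abs_def])
qed

lemma mem_box_vec: "x \<in> box a b \<longleftrightarrow> (\<forall>i. a $ i < x $ i \<and> x $ i < b $ i)" for x :: "real^'n"
  by (simp add: mem_box_cart)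

lemma box_bump_nonzero: "box_bump a b k x \<noteq> 0 \<longleftrightarrow> x \<in> box a b"
proof -
  have "0 < real (Suc k) * t \<longleftrightarrow> 0 < t" for t by (simp add: zero_less_mult_iff)
  then show ?thesis
    by (simp add: box_bump_def mem_box_vec flat_0_bounds(3) del: of_nat_Suc)
qed

lemma box_bump_bounds: "0 \<le> box_bump a b k x" "box_bump a b k x \<le> 1"
  unfolding box_bump_def
  by (auto intro!: prod_nonneg prod_le_1 mult_nonneg_nonneg mult_le_one flat_0_bounds simp del: of_nat_Suc)

lemma box_bump_tendsto: "(\<lambda>k. box_bump a b k x) \<longlonglongrightarrow> indicat_real (box a b) x"
proof -
  have "(\<lambda>k. box_bump a b k x) \<longlonglongrightarrow>
      (\<Prod>i\<in>UNIV. indicat_real {0<..} (x $ i - a $ i) * indicat_real {0<..} (b $ i - x $ i))"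
    unfolding box_bump_def by (intro tendsto_prod tendsto_mult flat_0_scaled_tendsto)
  also have "(\<Prod>i\<in>UNIV. indicat_real {0<..} (x $ i - a $ i) * indicat_real {0<..} (b $ i - x $ i))
      = indicat_real (box a b) x"
  proof (cases "x \<in> box a b")
    case True then show ?thesis by (simp add: mem_box_vec)
  next
    case False
    then obtain i where "\<not> (a $ i < x $ i \<and> x $ i < b $ i)" by (auto simp: mem_box_vec)
    then have "indicat_real {0<..} (x $ i - a $ i) * indicat_real {0<..} (b $ i - x $ i) = 0"
      by (auto simp: indicator_def)
    then show ?thesis using False
      by (simp add: prod_zero_iff) blast
  qed
  finally show ?thesis .
qed

lemma box_bump_test_function:
  assumes "cbox a b \<subseteq> U"
  shows "test_function U (box_bump a b k)"
proof -
  have "{x. box_bump a b k x \<noteq> 0} = box a b" by (auto simp: box_bump_nonzero)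
  moreover have "closure (box a b) \<subseteq> cbox a b" by (intro closure_minimal box_subset_cbox closed_cbox)
  ultimately show ?thesis
    using assms bounded_box[of a b] by (auto simp: test_function_def box_bump_smooth compact_closure)
qed

text \<open>Positive and negative part are densities of two finite measures that agree on boxes.
  Boxes are closed under intersection and generate the Borel sets, so the measures and then the
  densities agree; \<open>max 0 (f x) = max 0 (- f x)\<close> leaves only 0.\<close>

lemma AE_zero_if_box_integrals_zero:
  fixes f :: "'a::euclidean_space \<Rightarrow> real"
  assumes f: "integrable lborel f"
    and zero: "\<And>c d. (\<integral>x. indicator (box c d) x * f x \<partial>lborel) = 0"
  shows "AE x in lborel. f x = 0"
proof -
  have fm [measurable]: "f \<in> borel_measurable borel" using f by auto
  have pm: "integrable lborel (\<lambda>x. max 0 (f x))" "integrable lborel (\<lambda>x. max 0 (- f x))"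
    using f by auto
  have emb: "emeasure (density lborel (\<lambda>x. ennreal (g x))) (box c d)
      = ennreal (\<integral>x. indicator (box c d) x * g x \<partial>lborel)"
    if g: "integrable lborel g" "\<And>x. 0 \<le> g x" for g :: "'a \<Rightarrow> real" and c d
  proof -
    have "emeasure (density lborel (\<lambda>x. ennreal (g x))) (box c d)
        = (\<integral>\<^sup>+x. ennreal (g x) * indicator (box c d) x \<partial>lborel)"
      using g by (intro emeasure_density) auto
    also have "\<dots> = (\<integral>\<^sup>+x. ennreal (indicator (box c d) x * g x) \<partial>lborel)"
      by (intro nn_integral_cong) (auto simp: indicator_def)
    also have "\<dots> = ennreal (\<integral>x. indicator (box c d) x * g x \<partial>lborel)"
      using g integrable_mult_indicator[of "box c d" lborel g]
      by (intro nn_integral_eq_integral) auto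
    finally show ?thesis .
  qed
  have eq: "(\<integral>x. indicator (box c d) x * max 0 (f x) \<partial>lborel)
      = (\<integral>x. indicator (box c d) x * max 0 (- f x) \<partial>lborel)" for c d
  proof -
    have int: "integrable lborel (\<lambda>x. indicator (box c d) x * max 0 (f x))"
      "integrable lborel (\<lambda>x. indicator (box c d) x * max 0 (- f x))"
      using integrable_mult_indicator[OF _ pm(1), of "box c d"]
        integrable_mult_indicator[OF _ pm(2), of "box c d"] by auto
    have "(\<integral>x. indicator (box c d) x * max 0 (f x) \<partial>lborel)
        - (\<integral>x. indicator (box c d) x * max 0 (- f x) \<partial>lborel)
      = (\<integral>x. indicator (box c d) x * max 0 (f x) - indicator (box c d) x * max 0 (- f x) \<partial>lborel)"
      using int by simp
    also have "\<dots> = (\<integral>x. indicator (box c d) x * f x \<partial>lborel)"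
      by (intro Bochner_Integration.integral_cong) (auto simp: max_def)
    finally show ?thesis using zero by simp
  qed
  have "density lborel (\<lambda>x. ennreal (max 0 (f x))) = density lborel (\<lambda>x. ennreal (max 0 (- f x)))"
  proof (rule measure_eqI_generator_eq)
    show "Int_stable (range (\<lambda>(a, b). box a b :: 'a set))"
      by (auto simp: Int_stable_def box_Int_box)
    show "sets (density lborel (\<lambda>x. ennreal (max 0 (f x)))) = sigma_sets UNIV (range (\<lambda>(a, b). box a b))"
      "sets (density lborel (\<lambda>x. ennreal (max 0 (- f x)))) = sigma_sets UNIV (range (\<lambda>(a, b). box a b))"
      by (simp_all add: borel_eq_box)
    show "range (\<lambda>n::nat. box (- (real n *\<^sub>R One)) (real n *\<^sub>R One)) \<subseteq> range (\<lambda>(a, b). box a b :: 'a set)"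
      by auto
    show "(\<Union>i. box (- (real i *\<^sub>R One)) (real i *\<^sub>R One)) = (UNIV :: 'a set)"
      by (rule UN_box_eq_UNIV)
    show "emeasure (density lborel (\<lambda>x. ennreal (max 0 (f x)))) (box (- (real i *\<^sub>R One)) (real i *\<^sub>R One)) \<noteq> \<infinity>" for i
      using emb[OF pm(1)] by simp
    fix X :: "'a set" assume "X \<in> range (\<lambda>(a, b). box a b)"
    then obtain c d where "X = box c d" by auto
    then show "emeasure (density lborel (\<lambda>x. ennreal (max 0 (f x)))) X
        = emeasure (density lborel (\<lambda>x. ennreal (max 0 (- f x)))) X"
      using emb[OF pm(1)] emb[OF pm(2)] eq by simp
  qed auto
  then have "AE x in lborel. ennreal (max 0 (f x)) = ennreal (max 0 (- f x))"
    by (intro sigma_finite_measure.density_unique[OF sigma_finite_lborel]) auto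
  then show ?thesis by eventually_elim (auto simp: max_def split: if_splits)
qed

lemma integral_lebesgue_on_restrict:
  fixes f :: "'a::euclidean_space \<Rightarrow> 'b::euclidean_space"
  assumes "S \<in> sets lebesgue" "T \<in> sets lebesgue" "S \<subseteq> T" "\<And>x. x \<in> T - S \<Longrightarrow> f x = 0"
  shows "(\<integral>x. f x \<partial>lebesgue_on S) = (\<integral>x. f x \<partial>lebesgue_on T)"
proof -
  have "(\<lambda>x. indicat_real S x *\<^sub>R f x) = (\<lambda>x. indicat_real T x *\<^sub>R f x)"
    using assms(3,4) by (auto simp: indicator_def fun_eq_iff)
  then show ?thesis using assms(1,2) by (simp add: integral_restrict_space)
qed

lemma integrable_lebesgue_on_mono:
  fixes f :: "'a::euclidean_space \<Rightarrow> 'b::euclidean_space"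
  assumes "integrable (lebesgue_on T) f" "S \<subseteq> T" "S \<in> sets lebesgue" "T \<in> sets lebesgue"
  shows "integrable (lebesgue_on S) f"
proof -
  have "integrable lebesgue (\<lambda>x. indicat_real S x *\<^sub>R (indicat_real T x *\<^sub>R f x))"
    using assms by (intro integrable_mult_indicator[OF assms(3)]) (simp add: integrable_restrict_space)
  moreover have "(\<lambda>x. indicat_real S x *\<^sub>R (indicat_real T x *\<^sub>R f x)) = (\<lambda>x. indicat_real S x *\<^sub>R f x)"
    using assms(2) by (auto simp: indicator_def fun_eq_iff)
  ultimately show ?thesis using assms(3) by (simp add: integrable_restrict_space)
qed

lemma l2_subset:
  assumes "f \<in> l2 (lebesgue_on T)" "S \<subseteq> T" "S \<in> sets lebesgue" "T \<in> sets lebesgue"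
  shows "f \<in> l2 (lebesgue_on S)"
proof -
  have "f \<in> borel_measurable (lebesgue_on S)"
    using assms by (auto simp: l2_def intro: measurable_restrict_mono)
  moreover have "integrable (lebesgue_on S) (\<lambda>x. (norm (f x))\<^sup>2)"
    using assms by (auto simp: l2_def intro: integrable_lebesgue_on_mono)
  ultimately show ?thesis by (simp add: l2_def)
qed

lemma integral_subset_le:
  fixes f :: "'a::euclidean_space \<Rightarrow> real"
  assumes "integrable (lebesgue_on T) f" "S \<subseteq> T" "S \<in> sets lebesgue" "T \<in> sets lebesgue" "\<And>x. 0 \<le> f x"
  shows "(\<integral>x. f x \<partial>lebesgue_on S) \<le> (\<integral>x. f x \<partial>lebesgue_on T)"
proof -
  have "integrable (lebesgue_on S) f" using integrable_lebesgue_on_mono[OF assms(1-4)] .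
  then show ?thesis
    using assms by (auto simp: integral_restrict_space integrable_restrict_space indicator_def
        intro!: integral_mono)
qed

lemma l2_lim_subset:
  assumes "l2_lim (lebesgue_on T) \<phi> f" "S \<subseteq> T" "S \<in> sets lebesgue" "T \<in> sets lebesgue"
  shows "l2_lim (lebesgue_on S) \<phi> f"
  unfolding l2_lim_def
proof (intro conjI allI)
  have mem: "(\<lambda>x. \<phi> k x - f x) \<in> l2 (lebesgue_on T)" for k using assms(1) by (simp add: l2_lim_def)
  show "(\<lambda>x. \<phi> k x - f x) \<in> l2 (lebesgue_on S)" for k using mem assms(2-4) by (rule l2_subset)
  have "l2_norm (lebesgue_on S) (\<lambda>x. \<phi> k x - f x) \<le> l2_norm (lebesgue_on T) (\<lambda>x. \<phi> k x - f x)" for k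
    unfolding l2_norm_def using mem[of k] assms
    by (intro real_sqrt_le_mono integral_subset_le) (auto simp: l2_def)
  then show "(\<lambda>k. l2_norm (lebesgue_on S) (\<lambda>x. \<phi> k x - f x)) \<longlonglongrightarrow> 0"
    using assms(1)
    by - (rule tendsto_sandwich[of "\<lambda>_. 0" _ sequentially "\<lambda>k. l2_norm (lebesgue_on T) (\<lambda>x. \<phi> k x - f x)"],
      simp_all add: l2_norm_nonneg l2_lim_def)
qed

lemma finite_measure_lebesgue_on_bounded:
  fixes S :: "'a::euclidean_space set"
  assumes "bounded S" "S \<in> sets lebesgue" shows "finite_measure (lebesgue_on S)"
  by (intro finite_measure_lebesgue_on bounded_set_imp_lmeasurable assms)

lemma continuous_l2:
  fixes f :: "'a::euclidean_space \<Rightarrow> 'b::euclidean_space"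
  assumes "continuous_on UNIV f" "bounded S" "S \<in> sets lebesgue"
  shows "f \<in> l2 (lebesgue_on S)"
proof -
  interpret finite_measure "lebesgue_on S" using assms by (intro finite_measure_lebesgue_on_bounded)
  have m: "f \<in> borel_measurable (lebesgue_on S)"
    using borel_measurable_continuous_onI[OF assms(1)]
    by (intro measurable_restrict_space1 measurable_completion) simp
  have "compact (f ` closure S)"
    using assms by (intro compact_continuous_image continuous_on_subset[OF assms(1)]) (auto simp: compact_closure)
  then obtain B where B: "\<And>x. x \<in> closure S \<Longrightarrow> norm (f x) \<le> B"
    using compact_imp_bounded bounded_iff by (metis imageI)
  have "norm ((norm (f x))\<^sup>2) \<le> B\<^sup>2" if "x \<in> S" for x
    using B[of x] that closure_subset[of S] by (auto intro!: power_mono)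
  then have "integrable (lebesgue_on S) (\<lambda>x. (norm (f x))\<^sup>2)"
    using m by (intro integrable_const_bound[where B = "B\<^sup>2"]) (auto intro: AE_I2)
  then show ?thesis using m by (simp add: l2_def)
qed

text \<open>Dominated convergence passes from bumps to indicators of boxes whose closed box lies in
  \<open>U\<close>. Countably many such boxes cover \<open>U\<close>, and inside each of them every
  box integral of \<open>h\<close> vanishes.\<close>

lemma fundamental_lemma:
  fixes h :: "real^'n \<Rightarrow> real"
  assumes U: "open U" "bounded U" and h: "h \<in> l2 (lebesgue_on U)"
    and zero: "\<And>a b k. cbox a b \<subseteq> U \<Longrightarrow> (\<integral>x. box_bump a b k x * h x \<partial>lebesgue_on U) = 0"
  shows "AE x in lebesgue_on U. h x = 0"
proof -
  have Um: "U \<in> sets lebesgue" using U by (auto intro: borel_open)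
  interpret finite_measure "lebesgue_on U" using U Um by (intro finite_measure_lebesgue_on_bounded)
  have hint: "integrable (lebesgue_on U) h" using h by (rule l2_integrable)
  then have hm [measurable]: "h \<in> borel_measurable (lebesgue_on U)" by auto
  have box_zero: "(\<integral>x. indicator (box c d) x * h x \<partial>lebesgue_on U) = 0" if "cbox c d \<subseteq> U" for c d
  proof -
    have "(\<lambda>k. \<integral>x. box_bump c d k x * h x \<partial>lebesgue_on U) \<longlonglongrightarrow> (\<integral>x. indicator (box c d) x * h x \<partial>lebesgue_on U)"
    proof (rule integral_dominated_convergence)
      show "integrable (lebesgue_on U) (\<lambda>x. norm (h x))" using hint by simp
      show "(\<lambda>x. box_bump c d k x * h x) \<in> borel_measurable (lebesgue_on U)" for k
        using continuous_l2[OF smooth_continuous[OF box_bump_smooth] U(2) Um, of c d k]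
        by (intro borel_measurable_times hm) (auto simp: l2_def)
      show "(\<lambda>x. indicat_real (box c d) x * h x) \<in> borel_measurable (lebesgue_on U)"
        by (intro borel_measurable_times hm measurable_restrict_space1 borel_measurable_indicator) auto
      show "AE x in lebesgue_on U. (\<lambda>k. box_bump c d k x * h x) \<longlonglongrightarrow> indicat_real (box c d) x * h x"
        by (intro AE_I2 tendsto_intros box_bump_tendsto)
      show "AE x in lebesgue_on U. norm (box_bump c d k x * h x) \<le> norm (h x)" for k
        using box_bump_bounds[of c d k] by (intro AE_I2) (simp add: abs_mult mult_left_le_one_le)
    qed
    then show ?thesis
      using zero[OF that] by (simp add: LIMSEQ_const_iff)
  qed
  define F where "F = {box a b | a b. cbox a b \<subseteq> U}"
  have "\<Union>F = U"
  proof (intro equalityI subsetI)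
    fix x assume "x \<in> U"
    then obtain a b where "cbox a b \<subseteq> U" "x \<in> box a b" using open_contains_cbox[OF U(1)] by metis
    then show "x \<in> \<Union>F" by (auto simp: F_def)
  qed (use box_subset_cbox in \<open>fastforce simp: F_def\<close>)
  moreover obtain D where "D \<subseteq> F" "countable D" "\<Union>D = \<Union>F"
    by (rule Lindelof[of F]) (auto simp: F_def)
  ultimately have D: "countable D" "\<Union>D = U" "\<And>X. X \<in> D \<Longrightarrow> \<exists>a b. X = box a b \<and> cbox a b \<subseteq> U"
    by (auto simp: F_def)
  have "AE x in lebesgue_on U. x \<in> X \<longrightarrow> h x = 0" if "X \<in> D" for X
  proof -
    obtain a b where ab: "X = box a b" "cbox a b \<subseteq> U" using D(3)[OF \<open>X \<in> D\<close>] by blast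
    have sub: "X \<subseteq> U" using ab box_subset_cbox by blast
    have "integrable (lebesgue_on U) (\<lambda>x. indicator X x *\<^sub>R h x)"
      using hint ab(1) sub Um by (intro integrable_mult_indicator) (simp_all add: sets_restrict_space_iff)
    then have "integrable lebesgue (\<lambda>x. indicator U x *\<^sub>R (indicator X x *\<^sub>R h x))"
      using Um by (simp add: integrable_restrict_space)
    moreover have ind: "(\<lambda>x. indicator U x *\<^sub>R (indicator X x *\<^sub>R h x)) = (\<lambda>x. indicator X x * h x)"
      using sub by (auto simp: indicator_def fun_eq_iff)
    ultimately have int: "integrable lebesgue (\<lambda>x. indicator X x * h x)" by simp
    \<comment> \<open>\<open>h\<close> is only Lebesgue measurable, while
      \<open>AE_zero_if_box_integrals_zero\<close> speaks of \<open>lborel\<close>; \<open>g\<close>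
      is a Borel representative of \<open>h\<close> cut off to the box.\<close>
    then obtain g where g [measurable]: "g \<in> borel_measurable lborel" and gh: "AE x in lborel. indicator X x * h x = g x"
      using completion_ex_borel_measurable_real[of "\<lambda>x. indicator X x * h x" lborel] by auto
    have gh': "AE x in lebesgue. indicator X x * h x = g x" using gh by (rule AE_completion)
    have gm: "g \<in> borel_measurable lebesgue" by (rule measurable_completion) simp
    have "integrable lebesgue g" using int gm gh' by (rule integrable_cong_AE_imp)
    then have gint: "integrable lborel g" using g by (simp add: integrable_completion)
    have "AE x in lborel. g x = 0"
    proof (rule AE_zero_if_box_integrals_zero[OF gint])
      fix c d
      have "(\<integral>x. indicator (box c d) x * g x \<partial>lborel) = (\<integral>x. indicator (box c d) x * g x \<partial>lebesgue)"
        by (rule integral_completion[symmetric]) simp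
      also have "\<dots> = (\<integral>x. indicator (box c d) x * (indicator X x * h x) \<partial>lebesgue)"
      proof (rule integral_cong_AE)
        have bm: "indicat_real (box c d) \<in> borel_measurable lebesgue" by (intro borel_measurable_indicator) auto
        show "(\<lambda>x. indicator (box c d) x * g x) \<in> borel_measurable lebesgue"
          by (rule borel_measurable_times[OF bm gm])
        show "(\<lambda>x. indicator (box c d) x * (indicator X x * h x)) \<in> borel_measurable lebesgue"
          by (rule borel_measurable_times[OF bm borel_measurable_integrable[OF int]])
      qed (use gh' in auto)
      also have "\<dots> = (\<integral>x. indicator U x *\<^sub>R (indicator (box c d \<inter> X) x * h x) \<partial>lebesgue)"
        using sub by (intro Bochner_Integration.integral_cong) (auto simp: indicator_def)
      also have "\<dots> = (\<integral>x. indicator (box c d \<inter> X) x * h x \<partial>lebesgue_on U)"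
        using Um by (simp add: integral_restrict_space)
      also have "\<dots> = 0"
      proof -
        obtain s t where st: "box c d \<inter> X = box s t" unfolding ab box_Int_box by blast
        \<comment> \<open>For an empty \<open>box s t\<close> nothing is known about
          \<open>cbox s t\<close>, but then the integral is 0.\<close>
        show ?thesis
        proof (cases "box s t = {}")
          case False
          have "cbox s t = closure (box s t)" using False by (simp add: closure_box)
          also have "\<dots> \<subseteq> cbox a b" using st ab(1) box_subset_cbox[of a b] by (intro closure_minimal) auto
          finally show ?thesis using box_zero[of s t] ab(2) st by auto
        qed (simp add: st)
      qed
      finally show "(\<integral>x. indicator (box c d) x * g x \<partial>lborel) = 0" .
    qed
    then have "AE x in lebesgue. g x = 0" by (rule AE_completion)
    with gh' have "AE x in lebesgue. x \<in> X \<longrightarrow> h x = 0" by eventually_elim (auto simp: indicator_def)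
    then show ?thesis using Um by (simp add: AE_restrict_space_iff) (erule eventually_mono, simp)
  qed
  then have "AE x in lebesgue_on U. \<forall>X\<in>D. x \<in> X \<longrightarrow> h x = 0"
    using D(1) by (intro AE_ball_countable[THEN iffD2]) auto
  then show ?thesis
    using AE_space by eventually_elim (use D(2) in auto)
qed

section \<open>Surface measure of a hyperplane\<close>

text \<open>Thickness 1 matches the height of the prism in \<open>face_measure\<close>. A line along
  which the slab coordinate runs at unit speed meets the slab in a piece of length 1.\<close>

abbreviation unit_slab :: "real \<Rightarrow> ennreal" where
  "unit_slab t \<equiv> indicator {- (1/2)..1/2} t"

lemma nn_integral_translate:
  fixes f :: "'a::euclidean_space \<Rightarrow> ennreal"
  assumes [measurable]: "f \<in> borel_measurable borel"
  shows "(\<integral>\<^sup>+x. f (x + a) \<partial>lborel) = (\<integral>\<^sup>+x. f x \<partial>lborel)"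
proof -
  have "(\<integral>\<^sup>+x. f x \<partial>lborel) = (\<integral>\<^sup>+x. f x \<partial>distr lborel borel ((+) a))"
    by (simp only: lborel_distr_plus)
  also have "\<dots> = (\<integral>\<^sup>+x. f (x + a) \<partial>lborel)"
    by (subst nn_integral_distr) (auto simp: add.commute)
  finally show ?thesis ..
qed

lemma nn_integral_unit_slab: "(\<integral>\<^sup>+s. unit_slab (s + t) \<partial>lborel) = 1"
proof -
  have "(\<integral>\<^sup>+s. unit_slab (s + t) \<partial>lborel) = (\<integral>\<^sup>+s. unit_slab s \<partial>lborel)"
    by (rule nn_integral_translate) measurable
  also have "\<dots> = 1" by simp
  finally show ?thesis .
qed

lemma unit_slab_minus: "unit_slab (- t) = unit_slab t"
  by (auto simp: indicator_def)

lemma nn_integral_unit_slab_diff: "(\<integral>\<^sup>+s. unit_slab (t - s) \<partial>lborel) = 1"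
  using nn_integral_unit_slab[of "- t"] unit_slab_minus[of "t - _"] by simp

lemma nn_integral_unit_slab_divide:
  assumes "\<nu> \<noteq> 0" shows "(\<integral>\<^sup>+s. unit_slab (s / \<nu>) \<partial>lborel) = ennreal \<bar>\<nu>\<bar>"
proof -
  have "(\<integral>\<^sup>+s. unit_slab (s / \<nu>) \<partial>lborel) = \<bar>\<nu>\<bar> * (\<integral>\<^sup>+s. unit_slab ((0 + \<nu> * s) / \<nu>) \<partial>lborel)"
    using assms by (intro nn_integral_real_affine) auto
  also have "(\<integral>\<^sup>+s. unit_slab ((0 + \<nu> * s) / \<nu>) \<partial>lborel) = (\<integral>\<^sup>+s. unit_slab s \<partial>lborel)"
    using assms by simp
  finally show ?thesis by simp
qed

text \<open>Every line parallel to \<open>v\<close> is met once by the hyperplane \<open>w \<bullet> x = c\<close>; the slab around it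
  carries the measure of the set of lines.\<close>

lemma nn_integral_lines:
  fixes f :: "'a::euclidean_space \<Rightarrow> ennreal"
  assumes [measurable]: "f \<in> borel_measurable borel" and wv: "w \<bullet> v = 1"
  shows "(\<integral>\<^sup>+x. unit_slab (w \<bullet> x - c) * (\<integral>\<^sup>+s. f (x - (w \<bullet> x - c) *\<^sub>R v + s *\<^sub>R v) \<partial>lborel) \<partial>lborel)
    = (\<integral>\<^sup>+x. f x \<partial>lborel)"
proof -
  have shift: "(\<integral>\<^sup>+s. f (x - (w \<bullet> x - c) *\<^sub>R v + s *\<^sub>R v) \<partial>lborel) = (\<integral>\<^sup>+s. f (x + s *\<^sub>R v) \<partial>lborel)" for x
    using nn_integral_translate[of "\<lambda>s. f (x + s *\<^sub>R v)" "- (w \<bullet> x - c)"]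
    by (simp add: algebra_simps)
  have "(\<integral>\<^sup>+x. unit_slab (w \<bullet> x - c) * (\<integral>\<^sup>+s. f (x + s *\<^sub>R v) \<partial>lborel) \<partial>lborel)
      = (\<integral>\<^sup>+x. \<integral>\<^sup>+s. unit_slab (w \<bullet> x - c) * f (x + s *\<^sub>R v) \<partial>lborel \<partial>lborel)"
    by (subst nn_integral_cmult) auto
  also have "\<dots> = (\<integral>\<^sup>+s. \<integral>\<^sup>+x. unit_slab (w \<bullet> x - c) * f (x + s *\<^sub>R v) \<partial>lborel \<partial>lborel)"
    by (rule lborel_pair.Fubini'[symmetric]) measurable
  also have "\<dots> = (\<integral>\<^sup>+s. \<integral>\<^sup>+x. unit_slab (w \<bullet> x - c - s) * f x \<partial>lborel \<partial>lborel)"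
  proof (rule nn_integral_cong)
    fix s :: real
    show "(\<integral>\<^sup>+x. unit_slab (w \<bullet> x - c) * f (x + s *\<^sub>R v) \<partial>lborel)
        = (\<integral>\<^sup>+x. unit_slab (w \<bullet> x - c - s) * f x \<partial>lborel)"
      using nn_integral_translate[of "\<lambda>x. unit_slab (w \<bullet> x - c - s) * f x" "s *\<^sub>R v"]
      by (simp add: inner_add_right wv)
  qed
  also have "\<dots> = (\<integral>\<^sup>+x. \<integral>\<^sup>+s. unit_slab (w \<bullet> x - c - s) * f x \<partial>lborel \<partial>lborel)"
    by (rule lborel_pair.Fubini') measurable
  also have "\<dots> = (\<integral>\<^sup>+x. f x \<partial>lborel)"
    by (subst nn_integral_multc) (auto simp: nn_integral_unit_slab_diff)
  finally show ?thesis by (simp only: shift)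
qed

text \<open>For integrands constant along \<open>v\<close>, any hyperplane transversal to
  \<open>v\<close> can label the lines: a line through the slab of \<open>w\<close> meets the slab
  of \<open>w'\<close> in a piece of length 1, whatever the offsets.\<close>

lemma nn_integral_lines_independent:
  fixes f :: "'a::euclidean_space \<Rightarrow> ennreal"
  assumes [measurable]: "f \<in> borel_measurable borel" and wv: "w \<bullet> v = 1" "w' \<bullet> v = 1"
    and inv: "\<And>x s. f (x + s *\<^sub>R v) = f x"
  shows "(\<integral>\<^sup>+x. unit_slab (w \<bullet> x - c) * f x \<partial>lborel) = (\<integral>\<^sup>+x. unit_slab (w' \<bullet> x - c') * f x \<partial>lborel)"
proof -
  have "(\<integral>\<^sup>+s. unit_slab (w' \<bullet> (x - (w \<bullet> x - c) *\<^sub>R v + s *\<^sub>R v) - c')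
      * f (x - (w \<bullet> x - c) *\<^sub>R v + s *\<^sub>R v) \<partial>lborel) = f x" for x
  proof -
    have "f (x - (w \<bullet> x - c) *\<^sub>R v + s *\<^sub>R v) = f x" for s
      using inv[of x "s - (w \<bullet> x - c)"] by (simp add: algebra_simps)
    moreover have "w' \<bullet> (x - (w \<bullet> x - c) *\<^sub>R v + s *\<^sub>R v) - c' = s + (w' \<bullet> x - (w \<bullet> x - c) - c')" for s
      by (simp add: wv inner_add_right inner_diff_right)
    ultimately show ?thesis
      by (simp only: diff_diff_eq add_diff_eq[symmetric] nn_integral_multc[of "\<lambda>s. unit_slab (s + _)"]) (simp add: nn_integral_multc nn_integral_unit_slab)
  qed
  then show ?thesis
    using nn_integral_lines[of "\<lambda>x. unit_slab (w' \<bullet> x - c') * f x" w v c] wv(1) by simp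
qed

text \<open>The projection along \<open>v\<close> is compared with the one along the normal
  \<open>N\<close>. After splitting the volume integral along \<open>N\<close>, the two projected
  points differ by \<open>s *\<^sub>R u\<close> with \<open>u\<close> tangential, which translation
  invariance removes; what remains of the oblique slab is its thickness
  \<open>\<bar>\<nu>\<bar>\<close> in direction \<open>N\<close>.\<close>

lemma nn_integral_shear:
  fixes f :: "'a::euclidean_space \<Rightarrow> ennreal"
  assumes [measurable]: "f \<in> borel_measurable borel" and N: "norm N = 1" and \<nu>: "N \<bullet> v = \<nu>" "\<nu> \<noteq> 0"
  shows "(\<integral>\<^sup>+x. unit_slab ((N \<bullet> x - c) / \<nu>) * f (x - ((N \<bullet> x - c) / \<nu>) *\<^sub>R v) \<partial>lborel)
    = ennreal \<bar>\<nu>\<bar> * (\<integral>\<^sup>+x. unit_slab (N \<bullet> x - c) * f (x - (N \<bullet> x - c) *\<^sub>R N) \<partial>lborel)"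
proof -
  have NN: "N \<bullet> N = 1" using N by (simp add: dot_square_norm)
  define u where "u = N - (1 / \<nu>) *\<^sub>R v"
  have Nu: "N \<bullet> u = 0" by (simp add: u_def inner_diff_right NN \<nu>)
  let ?g = "\<lambda>x. unit_slab ((N \<bullet> x - c) / \<nu>) * f (x - ((N \<bullet> x - c) / \<nu>) *\<^sub>R v)"
  have e1: "N \<bullet> (x - (N \<bullet> x - c) *\<^sub>R N + s *\<^sub>R N) - c = s" for x s
    by (simp add: inner_add_right inner_diff_right NN)
  have e2: "x - (N \<bullet> x - c) *\<^sub>R N + s *\<^sub>R N - (s / \<nu>) *\<^sub>R v = x - (N \<bullet> x - c) *\<^sub>R N + s *\<^sub>R u" for x s
    by (simp add: u_def algebra_simps)
  have g: "?g (x - (N \<bullet> x - c) *\<^sub>R N + s *\<^sub>R N) = unit_slab (s / \<nu>) * f (x - (N \<bullet> x - c) *\<^sub>R N + s *\<^sub>R u)" for x s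
    by (simp only: e1 e2)
  have "(\<integral>\<^sup>+x. ?g x \<partial>lborel) = (\<integral>\<^sup>+x. unit_slab (N \<bullet> x - c) *
      (\<integral>\<^sup>+s. unit_slab (s / \<nu>) * f (x - (N \<bullet> x - c) *\<^sub>R N + s *\<^sub>R u) \<partial>lborel) \<partial>lborel)"
    using nn_integral_lines[of ?g N N c, OF _ NN] by (simp add: g)
  also have "\<dots> = (\<integral>\<^sup>+x. \<integral>\<^sup>+s. unit_slab (N \<bullet> x - c) *
      (unit_slab (s / \<nu>) * f (x - (N \<bullet> x - c) *\<^sub>R N + s *\<^sub>R u)) \<partial>lborel \<partial>lborel)"
    by (subst nn_integral_cmult) auto
  also have "\<dots> = (\<integral>\<^sup>+s. \<integral>\<^sup>+x. unit_slab (N \<bullet> x - c) *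
      (unit_slab (s / \<nu>) * f (x - (N \<bullet> x - c) *\<^sub>R N + s *\<^sub>R u)) \<partial>lborel \<partial>lborel)"
    by (rule lborel_pair.Fubini'[symmetric]) measurable
  also have "\<dots> = (\<integral>\<^sup>+s. unit_slab (s / \<nu>) * (\<integral>\<^sup>+x. unit_slab (N \<bullet> x - c) * f (x - (N \<bullet> x - c) *\<^sub>R N) \<partial>lborel) \<partial>lborel)"
  proof (rule nn_integral_cong)
    fix s :: real
    have "(\<integral>\<^sup>+x. unit_slab (N \<bullet> x - c) * (unit_slab (s / \<nu>) * f (x - (N \<bullet> x - c) *\<^sub>R N + s *\<^sub>R u)) \<partial>lborel)
        = unit_slab (s / \<nu>) * (\<integral>\<^sup>+x. unit_slab (N \<bullet> x - c) * f (x - (N \<bullet> x - c) *\<^sub>R N + s *\<^sub>R u) \<partial>lborel)"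
      by (subst nn_integral_cmult[symmetric]) (auto simp: ac_simps)
    also have "(\<integral>\<^sup>+x. unit_slab (N \<bullet> x - c) * f (x - (N \<bullet> x - c) *\<^sub>R N + s *\<^sub>R u) \<partial>lborel)
        = (\<integral>\<^sup>+x. unit_slab (N \<bullet> x - c) * f (x - (N \<bullet> x - c) *\<^sub>R N) \<partial>lborel)"
      using nn_integral_translate[of "\<lambda>x. unit_slab (N \<bullet> x - c) * f (x - (N \<bullet> x - c) *\<^sub>R N)" "s *\<^sub>R u"]
      by (simp add: inner_add_right Nu algebra_simps)
    finally show "(\<integral>\<^sup>+x. unit_slab (N \<bullet> x - c) * (unit_slab (s / \<nu>) * f (x - (N \<bullet> x - c) *\<^sub>R N + s *\<^sub>R u)) \<partial>lborel)
        = unit_slab (s / \<nu>) * (\<integral>\<^sup>+x. unit_slab (N \<bullet> x - c) * f (x - (N \<bullet> x - c) *\<^sub>R N) \<partial>lborel)" .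
  qed
  also have "\<dots> = ennreal \<bar>\<nu>\<bar> * (\<integral>\<^sup>+x. unit_slab (N \<bullet> x - c) * f (x - (N \<bullet> x - c) *\<^sub>R N) \<partial>lborel)"
    by (subst nn_integral_multc) (auto simp: nn_integral_unit_slab_divide[OF \<nu>(2)])
  finally show ?thesis .
qed

lemma closest_point_hyperplane:
  fixes N :: "'a::euclidean_space"
  assumes "norm N = 1"
  shows "closest_point {x. N \<bullet> x = c} x = x - (N \<bullet> x - c) *\<^sub>R N"
proof (rule closest_point_unique[symmetric])
  have NN: "N \<bullet> N = 1" using assms by (simp add: dot_square_norm)
  show "convex {x. N \<bullet> x = c}" "closed {x. N \<bullet> x = c}" by (rule convex_hyperplane closed_hyperplane)+
  show "x - (N \<bullet> x - c) *\<^sub>R N \<in> {x. N \<bullet> x = c}" by (simp add: inner_diff_right NN)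
  show "\<forall>z\<in>{x. N \<bullet> x = c}. dist x (x - (N \<bullet> x - c) *\<^sub>R N) \<le> dist x z"
  proof
    fix z assume "z \<in> {x. N \<bullet> x = c}"
    then have "\<bar>N \<bullet> x - c\<bar> = \<bar>N \<bullet> (x - z)\<bar>" by (simp add: inner_diff_right)
    also have "\<dots> \<le> norm N * norm (x - z)" by (rule Cauchy_Schwarz_ineq2)
    finally show "dist x (x - (N \<bullet> x - c) *\<^sub>R N) \<le> dist x z" using assms by (simp add: dist_norm)
  qed
qed

text \<open>Unfolds the push-forward: a face integral becomes a volume integral over a slab, the
  form in which Fubini's theorem applies to it.\<close>

lemma nn_integral_face_measure:
  fixes f :: "real^'n \<Rightarrow> ennreal"
  assumes f [measurable]: "f \<in> borel_measurable borel" and N: "norm N = 1"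
    and aff: "affine hull F = {x. N \<bullet> x = c}" and F [measurable]: "F \<in> sets borel"
  shows "(\<integral>\<^sup>+x. f x \<partial>face_measure F) =
    (\<integral>\<^sup>+x. unit_slab (N \<bullet> x - c) * (indicator F (x - (N \<bullet> x - c) *\<^sub>R N) * f (x - (N \<bullet> x - c) *\<^sub>R N)) \<partial>lborel)"
proof -
  have \<pi>: "closest_point (affine hull F) = (\<lambda>x. x - (N \<bullet> x - c) *\<^sub>R N)"
    unfolding aff using closest_point_hyperplane[OF N] by auto
  have dist: "dist y (y - (N \<bullet> y - c) *\<^sub>R N) = \<bar>N \<bullet> y - c\<bar>" for y using N by (simp add: dist_norm)
  let ?P = "{y. y - (N \<bullet> y - c) *\<^sub>R N \<in> F \<and> N \<bullet> y - c \<in> {- (1/2)..1/2}}"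
  have abs: "\<bar>t\<bar> \<le> 1/2 \<longleftrightarrow> t \<in> {- (1/2)..1/2}" for t :: real by auto
  have P: "?P \<in> sets borel" by measurable
  have "(\<integral>\<^sup>+x. f x \<partial>face_measure F) = (\<integral>\<^sup>+x. f (x - (N \<bullet> x - c) *\<^sub>R N) \<partial>restrict_space lborel ?P)"
    unfolding face_measure_def Let_def \<pi> dist abs by (rule nn_integral_distr) (auto intro!: measurable_restrict_space1)
  also have "\<dots> = (\<integral>\<^sup>+x. f (x - (N \<bullet> x - c) *\<^sub>R N) * indicator ?P x \<partial>lborel)"
    using P by (intro nn_integral_restrict_space) simp
  also have "\<dots> = (\<integral>\<^sup>+x. unit_slab (N \<bullet> x - c) * (indicator F (x - (N \<bullet> x - c) *\<^sub>R N) * f (x - (N \<bullet> x - c) *\<^sub>R N)) \<partial>lborel)"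
    by (intro nn_integral_cong) (auto simp: indicator_def)
  finally show ?thesis .
qed

text \<open>The changes of variables are proved for nonnegative integrands; applied to positive and
  negative part they transfer both integrability and the value of the integral to real
  integrands.\<close>

lemma integral_eq_if_nn_integrals_eq:
  fixes f :: "'a \<Rightarrow> real" and g :: "'b \<Rightarrow> real"
  assumes f: "integrable M f" and g: "g \<in> borel_measurable N"
    and "(\<integral>\<^sup>+x. ennreal (f x) \<partial>M) = (\<integral>\<^sup>+x. ennreal (g x) \<partial>N)"
    and "(\<integral>\<^sup>+x. ennreal (- f x) \<partial>M) = (\<integral>\<^sup>+x. ennreal (- g x) \<partial>N)"
  shows "integrable N g" "(\<integral>x. f x \<partial>M) = (\<integral>x. g x \<partial>N)"
proof -
  show g': "integrable N g" using assms by (simp add: real_integrable_def)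
  show "(\<integral>x. f x \<partial>M) = (\<integral>x. g x \<partial>N)"
    using assms by (simp add: real_lebesgue_integral_def[OF f] real_lebesgue_integral_def[OF g'])
qed

section \<open>The divergence theorem on a simplex\<close>

text \<open>\<open>w a \<bullet> x - c a\<close> is the barycentric coordinate of \<open>x\<close> at the vertex \<open>a\<close>.\<close>

locale nsimplex =
  fixes K C :: "(real^'n) set" and w :: "real^'n \<Rightarrow> real^'n" and c :: "real^'n \<Rightarrow> real"
  assumes finite_vertices: "finite C" and card_vertices: "card C = CARD('n) + 1"
    and bary_vertex: "\<And>a b. \<lbrakk>a \<in> C; b \<in> C\<rbrakk> \<Longrightarrow> w a \<bullet> b - c a = (if a = b then 1 else 0)"
    and bary_sum: "\<And>x. (\<Sum>a\<in>C. w a \<bullet> x - c a) = 1"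
    and bary_expand: "\<And>x. (\<Sum>a\<in>C. (w a \<bullet> x - c a) *\<^sub>R a) = x"
    and hull: "K = convex hull C" and independent_vertices: "\<not> affine_dependent C"

text \<open>By affine independence some linear functional takes the value -1 on all edges
  \<open>b - a\<close> at a vertex \<open>a\<close>; with offset \<open>g a - 1\<close> it becomes
  the barycentric coordinate of \<open>a\<close>. Expanding a point in the vertices, whose affine
  hull is the whole space, gives the two sum formulas.\<close>

lemma simplex_nsimplex:
  fixes K :: "(real^'n) set"
  assumes "int CARD('n) simplex K"
  obtains C w c where "nsimplex K C w c"
proof -
  obtain C where C: "finite C" "\<not> affine_dependent C" "card C = CARD('n) + 1" "K = convex hull C"
    using assms unfolding simplex by (metis of_nat_1 of_nat_add of_nat_eq_iff)
  have "\<exists>w c. \<forall>b\<in>C. w \<bullet> b - c = (if a = b then 1 else 0)" if a: "a \<in> C" for a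
  proof -
    let ?S = "(\<lambda>b. b - a) ` (C - {a})"
    have "independent ?S"
      using C(2) a affine_dependent_iff_dependent2[of a C] by (simp add: dependent_raw_def)
    then obtain g :: "real^'n \<Rightarrow> real" where g: "linear g" "\<And>x. x \<in> ?S \<Longrightarrow> g x = - 1"
      using linear_independent_extend[of ?S "\<lambda>_. - 1"] by auto
    have gw: "g x = adjoint g 1 \<bullet> x" for x using adjoint_works[OF g(1), of x 1] by (simp add: inner_commute)
    have "adjoint g 1 \<bullet> b - (g a - 1) = (if a = b then 1 else 0)" if "b \<in> C" for b
    proof (cases "a = b")
      case False
      then have "g (b - a) = - 1" using that by (intro g) auto
      then show ?thesis using False linear_diff[OF g(1), of b a] by (simp add: gw)
    qed (simp add: gw)
    then show ?thesis by blast
  qed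
  then obtain w c where wc: "\<And>a b. \<lbrakk>a \<in> C; b \<in> C\<rbrakk> \<Longrightarrow> w a \<bullet> b - c a = (if a = b then 1 else 0)"
    by metis
  have "(\<Sum>a\<in>C. w a \<bullet> x - c a) = 1 \<and> (\<Sum>a\<in>C. (w a \<bullet> x - c a) *\<^sub>R a) = x" for x
  proof -
    have "affine hull C = UNIV" using C by (intro affine_independent_span_eq) auto
    then have "x \<in> affine hull C" by simp
    then obtain u where u: "sum u C = 1" "(\<Sum>b\<in>C. u b *\<^sub>R b) = x"
      using affine_hull_finite[OF C(1)] by auto
    have "w a \<bullet> x - c a = u a" if a: "a \<in> C" for a
    proof -
      have "w a \<bullet> x - c a = (\<Sum>b\<in>C. u b * (w a \<bullet> b)) - (\<Sum>b\<in>C. u b) * c a"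
        by (simp add: u(1) u(2)[symmetric] inner_sum_right)
      also have "\<dots> = (\<Sum>b\<in>C. u b * (w a \<bullet> b - c a))"
        by (simp add: sum_subtractf sum_distrib_right right_diff_distrib)
      also have "\<dots> = (\<Sum>b\<in>C. if a = b then u b else 0)"
        using wc[OF a] by (intro sum.cong) auto
      finally show ?thesis using C(1) a by simp
    qed
    then show ?thesis using u by simp
  qed
  then have "nsimplex K C w c" using C wc by unfold_locales auto
  then show ?thesis using that by blast
qed

context nsimplex
begin

definition lam :: "real^'n \<Rightarrow> real^'n \<Rightarrow> real" where "lam a x = w a \<bullet> x - c a"

definition face :: "real^'n \<Rightarrow> (real^'n) set" where "face a = {x \<in> K. lam a x = 0}"

lemma lam_vertex: "\<lbrakk>a \<in> C; b \<in> C\<rbrakk> \<Longrightarrow> lam a b = (if a = b then 1 else 0)"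
  unfolding lam_def by (rule bary_vertex)

lemma lam_sum: "(\<Sum>a\<in>C. lam a x) = 1"
  unfolding lam_def by (rule bary_sum)

lemma lam_expand: "(\<Sum>a\<in>C. lam a x *\<^sub>R a) = x"
  unfolding lam_def by (rule bary_expand)

lemma w_inner_diff: "w a \<bullet> (x - y) = lam a x - lam a y"
  by (simp add: lam_def inner_diff_right)

lemma lam_combination:
  assumes "a \<in> C" "S \<subseteq> C" "sum u S = 1"
  shows "lam a (\<Sum>b\<in>S. u b *\<^sub>R b) = (if a \<in> S then u a else 0)"
proof -
  have "lam a (\<Sum>b\<in>S. u b *\<^sub>R b) = (\<Sum>b\<in>S. u b * (w a \<bullet> b)) - (\<Sum>b\<in>S. u b) * c a"
    by (simp add: lam_def assms(3) inner_sum_right)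
  also have "\<dots> = (\<Sum>b\<in>S. u b * lam a b)"
    by (simp add: sum_subtractf sum_distrib_right right_diff_distrib lam_def)
  also have "\<dots> = (\<Sum>b\<in>S. if a = b then u b else 0)"
    using lam_vertex[OF assms(1)] assms(2) by (intro sum.cong) auto
  finally show ?thesis using finite_subset[OF assms(2) finite_vertices] by simp
qed

lemma mem_K: "x \<in> K \<longleftrightarrow> (\<forall>a\<in>C. 0 \<le> lam a x)"
proof
  assume "x \<in> K"
  then obtain u where u: "\<And>b. b \<in> C \<Longrightarrow> 0 \<le> u b" "sum u C = 1" "(\<Sum>b\<in>C. u b *\<^sub>R b) = x"
    unfolding hull convex_hull_finite[OF finite_vertices] by auto
  then show "\<forall>a\<in>C. 0 \<le> lam a x" using lam_combination[of _ C u] by auto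
next
  assume "\<forall>a\<in>C. 0 \<le> lam a x"
  then show "x \<in> K" unfolding hull convex_hull_finite[OF finite_vertices]
    using lam_sum[of x] lam_expand[of x] by (intro CollectI exI[of _ "\<lambda>a. lam a x"]) auto
qed

lemma face_eq_hull: assumes "a \<in> C" shows "face a = convex hull (C - {a})"
proof (intro equalityI subsetI)
  fix x assume "x \<in> face a"
  then have x: "\<And>b. b \<in> C \<Longrightarrow> 0 \<le> lam b x" "lam a x = 0" by (auto simp: face_def mem_K)
  have "(\<Sum>b\<in>C - {a}. lam b x) = 1" "(\<Sum>b\<in>C - {a}. lam b x *\<^sub>R b) = x"
    using lam_sum[of x] lam_expand[of x] assms x(2) finite_vertices by (simp_all add: sum_diff1)
  then show "x \<in> convex hull (C - {a})"
    using finite_vertices x(1) by (subst convex_hull_finite) (auto intro!: exI[of _ "\<lambda>b. lam b x"])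
next
  fix x assume "x \<in> convex hull (C - {a})"
  then obtain u where u: "\<And>b. b \<in> C - {a} \<Longrightarrow> 0 \<le> u b" "sum u (C - {a}) = 1" "(\<Sum>b\<in>C - {a}. u b *\<^sub>R b) = x"
    using finite_vertices by (subst (asm) convex_hull_finite) auto
  have "lam b x = (if b \<in> C - {a} then u b else 0)" if "b \<in> C" for b
    using lam_combination[OF that _ u(2)] u(3) by auto
  then show "x \<in> face a" using u(1) assms by (auto simp: face_def mem_K)
qed

lemma affine_hull_face: assumes "a \<in> C" shows "affine hull (face a) = {x. lam a x = 0}"
proof (intro equalityI subsetI)
  fix x assume "x \<in> affine hull (face a)"
  then have "x \<in> affine hull (C - {a})" by (simp add: face_eq_hull[OF assms] affine_hull_convex_hull)
  then obtain u where u: "sum u (C - {a}) = 1" "(\<Sum>b\<in>C - {a}. u b *\<^sub>R b) = x"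
    using finite_vertices by (subst (asm) affine_hull_finite) auto
  then show "x \<in> {x. lam a x = 0}" using lam_combination[OF assms, of "C - {a}" u] by auto
next
  fix x assume "x \<in> {x. lam a x = 0}"
  then have "(\<Sum>b\<in>C - {a}. lam b x) = 1" "(\<Sum>b\<in>C - {a}. lam b x *\<^sub>R b) = x"
    using lam_sum[of x] lam_expand[of x] assms finite_vertices by (simp_all add: sum_diff1)
  then have "x \<in> affine hull (C - {a})"
    using finite_vertices by (subst affine_hull_finite) (auto intro!: exI[of _ "\<lambda>b. lam b x"])
  then show "x \<in> affine hull (face a)" by (simp add: face_eq_hull[OF assms] affine_hull_convex_hull)
qed

lemma card_vertices_ge_2: "2 \<le> card C"
  using card_vertices zero_less_card_finite[where 'a = 'n] by simp

lemma facet_of_iff: "F facet_of K \<longleftrightarrow> (\<exists>a\<in>C. F = face a)"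
  using facet_of_convex_hull_affine_independent_alt[OF independent_vertices, of F] card_vertices_ge_2
    face_eq_hull unfolding hull[symmetric] by auto

lemma inj_face: "inj_on face C"
proof (rule inj_onI, rule ccontr)
  fix a b assume ab: "a \<in> C" "b \<in> C" "face a = face b" "a \<noteq> b"
  have "b \<in> face a" using ab(1,2,4) lam_vertex by (auto simp: face_def mem_K)
  then have "b \<in> face b" using ab(3) by simp
  then show False using lam_vertex[OF ab(2,2)] by (simp add: face_def)
qed

lemma facets_eq: "{F. F facet_of K} = face ` C"
  using facet_of_iff by auto

lemma compact_K: "compact K"
  unfolding hull using finite_vertices by (intro compact_convex_hull finite_imp_compact)

lemma compact_face: "a \<in> C \<Longrightarrow> compact (face a)"
  unfolding face_eq_hull using finite_vertices by (intro compact_convex_hull finite_imp_compact) auto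

lemma w_nonzero: assumes "a \<in> C" shows "w a \<noteq> 0"
proof
  assume "w a = 0"
  obtain b where "b \<in> C" "b \<noteq> a"
    using card_vertices_ge_2 assms finite_vertices by (metis card_1_singleton_iff card_le_Suc0_iff_eq
        is_singletonI is_singleton_def not_less_eq_eq numeral_2_eq_2)
  then show False using lam_vertex[OF assms assms] lam_vertex[OF assms, of b] \<open>w a = 0\<close>
    by (simp add: lam_def)
qed

lemma face_hyperplane:
  assumes "a \<in> C"
  shows "affine hull (face a) = {x. ((1 / norm (w a)) *\<^sub>R w a) \<bullet> x = c a / norm (w a)}"
  unfolding affine_hull_face[OF assms] using w_nonzero[OF assms] by (auto simp: lam_def field_simps)

text \<open>The shear formula for the unit normal \<open>w a / norm (w a)\<close>: along
  \<open>v\<close> the coordinate \<open>lam a\<close> changes at rate \<open>t\<close>, so the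
  normal component of \<open>v\<close> is \<open>t / norm (w a)\<close>.\<close>

lemma nn_integral_face_line:
  fixes f :: "real^'n \<Rightarrow> ennreal"
  assumes [measurable]: "f \<in> borel_measurable borel" and a: "a \<in> C" and t: "w a \<bullet> v = t" "t \<noteq> 0"
  shows "(\<integral>\<^sup>+x. unit_slab (lam a x / t) *
      (indicator (face a) (x - (lam a x / t) *\<^sub>R v) * f (x - (lam a x / t) *\<^sub>R v)) \<partial>lborel)
    = ennreal (\<bar>t\<bar> / norm (w a)) * (\<integral>\<^sup>+x. f x \<partial>face_measure (face a))"
proof -
  let ?N = "(1 / norm (w a)) *\<^sub>R w a" and ?c = "c a / norm (w a)"
  note w0 = w_nonzero[OF a]
  have N: "norm ?N = 1" using w0 by simp
  have F [measurable]: "face a \<in> sets borel" using compact_face[OF a] by (simp add: compact_imp_closed borel_closed)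
  have eq: "(?N \<bullet> x - ?c) / (t / norm (w a)) = lam a x / t" for x
    using w0 t(2) by (simp add: lam_def field_simps)
  have nu: "?N \<bullet> v = t / norm (w a)" "t / norm (w a) \<noteq> 0" using t w0 by simp_all
  show ?thesis
    using nn_integral_shear[of "\<lambda>x. indicator (face a) x * f x" ?N v "t / norm (w a)" ?c, OF _ N nu]
      nn_integral_face_measure[OF assms(1) N face_hyperplane[OF a] F]
    by (simp only: eq abs_divide abs_norm_cancel) measurable
qed

lemma face_measure_finite: assumes "a \<in> C" shows "finite_measure (face_measure (face a))"
proof
  let ?N = "(1 / norm (w a)) *\<^sub>R w a" and ?c = "c a / norm (w a)"
  have N: "norm ?N = 1" using w_nonzero[OF assms] by simp
  have F [measurable]: "face a \<in> sets borel"
    using compact_face[OF assms] by (simp add: compact_imp_closed borel_closed)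
  obtain B where B: "\<And>x. x \<in> face a \<Longrightarrow> norm x \<le> B"
    using compact_imp_bounded[OF compact_face[OF assms]] bounded_iff by metis
  have "emeasure (face_measure (face a)) (space (face_measure (face a))) = (\<integral>\<^sup>+x. 1 \<partial>face_measure (face a))"
    by simp
  also have "\<dots> = (\<integral>\<^sup>+x. unit_slab (?N \<bullet> x - ?c) * (indicator (face a) (x - (?N \<bullet> x - ?c) *\<^sub>R ?N) * 1) \<partial>lborel)"
    by (rule nn_integral_face_measure[OF _ N face_hyperplane[OF assms] F]) simp
  also have "\<dots> \<le> (\<integral>\<^sup>+x. indicator (cball (0 :: real^'n) (B + 1)) x \<partial>lborel)"
  proof (rule nn_integral_mono)
    fix x
    have "norm x \<le> B + 1" if "x - (?N \<bullet> x - ?c) *\<^sub>R ?N \<in> face a" "?N \<bullet> x - ?c \<in> {- (1/2)..1/2}"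
    proof -
      have "norm x \<le> norm (x - (?N \<bullet> x - ?c) *\<^sub>R ?N) + norm ((?N \<bullet> x - ?c) *\<^sub>R ?N)"
        using norm_triangle_ineq[of "x - (?N \<bullet> x - ?c) *\<^sub>R ?N" "(?N \<bullet> x - ?c) *\<^sub>R ?N"] by simp
      also have "norm ((?N \<bullet> x - ?c) *\<^sub>R ?N) = \<bar>?N \<bullet> x - ?c\<bar>" using N by (simp only: norm_scaleR) simp
      also have "t \<in> {- (1/2)..1/2} \<Longrightarrow> \<bar>t\<bar> \<le> 1" for t :: real by (auto simp: abs_le_iff)
      from this[OF that(2)] have "\<bar>?N \<bullet> x - ?c\<bar> \<le> 1" .
      finally show ?thesis using B[OF that(1)] by linarith
    qed
    then show "unit_slab (?N \<bullet> x - ?c) * (indicator (face a) (x - (?N \<bullet> x - ?c) *\<^sub>R ?N) * 1)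
        \<le> indicator (cball 0 (B + 1)) x"
      by (auto simp: indicator_def simp del: inner_scaleR_left)
  qed
  also have "\<dots> = emeasure lborel (cball (0 :: real^'n) (B + 1))" by simp
  also have "\<dots> < \<infinity>" by (rule emeasure_bounded_finite) simp
  finally show "emeasure (face_measure (face a)) (space (face_measure (face a))) \<noteq> \<infinity>" by simp
qed

lemma AE_face_measure: assumes "a \<in> C" shows "AE x in face_measure (face a). x \<in> face a"
proof -
  let ?N = "(1 / norm (w a)) *\<^sub>R w a" and ?c = "c a / norm (w a)"
  have N: "norm ?N = 1" using w_nonzero[OF assms] by simp
  have F [measurable]: "face a \<in> sets borel"
    using compact_face[OF assms] by (simp add: compact_imp_closed borel_closed)
  have s: "sets (face_measure (face a)) = sets borel" by (simp add: face_measure_def Let_def)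
  have "(\<integral>\<^sup>+x. indicator (- face a) x \<partial>face_measure (face a)) = 0"
    by (subst nn_integral_face_measure[OF _ N face_hyperplane[OF assms] F])
      (auto simp: indicator_def nn_integral_0_iff_AE simp del: inner_scaleR_left)
  moreover have "(\<integral>\<^sup>+x. indicator (- face a) x \<partial>face_measure (face a)) = emeasure (face_measure (face a)) (- face a)"
    using F s by (intro nn_integral_indicator) (auto simp: Compl_in_sets_lebesgue)
  ultimately show ?thesis
    using F s by (intro AE_I[of _ _ "- face a"]) auto
qed

end

lemma sets_face_measure [simp, measurable_cong]: "sets (face_measure F) = sets borel"
  by (simp add: face_measure_def Let_def)

lemma space_face_measure [simp]: "space (face_measure F) = UNIV"
  by (simp add: face_measure_def Let_def)

context nsimplex
begin

lemma continuous_l2_face: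
  fixes g :: "real^'n \<Rightarrow> 'b::euclidean_space"
  assumes "continuous_on UNIV g" "a \<in> C"
  shows "g \<in> l2 (face_measure (face a))"
proof -
  interpret finite_measure "face_measure (face a)" using assms(2) by (rule face_measure_finite)
  have m: "g \<in> borel_measurable (face_measure (face a))"
    using borel_measurable_continuous_onI[OF assms(1)] by (simp cong: measurable_cong_sets)
  have "bounded (g ` face a)"
    using compact_face[OF assms(2)] continuous_on_subset[OF assms(1)]
    by (intro compact_imp_bounded compact_continuous_image) auto
  then obtain B where B: "\<And>x. x \<in> face a \<Longrightarrow> norm (g x) \<le> B" by (auto simp: bounded_iff)
  have "AE x in face_measure (face a). norm ((norm (g x))\<^sup>2) \<le> B\<^sup>2"
    using AE_face_measure[OF assms(2)]
  proof eventually_elim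
    case (elim x)
    then show ?case using B[of x] by (simp add: power_mono)
  qed
  then have "integrable (face_measure (face a)) (\<lambda>x. (norm (g x))\<^sup>2)"
    using m by (intro integrable_const_bound[where B = "B\<^sup>2"]) auto
  then show ?thesis using m by (simp add: l2_def)
qed

lemma continuous_integrable_face:
  fixes g :: "real^'n \<Rightarrow> 'b::euclidean_space"
  assumes "continuous_on UNIV g" "a \<in> C"
  shows "integrable (face_measure (face a)) g"
  using finite_measure.l2_integrable[OF face_measure_finite continuous_l2_face] assms by blast

text \<open>Passage from nonnegative to real integrands. Projection \<open>p\<close> and slab
  coordinate \<open>l\<close> are kept abstract because both ends of an edge use this, with the same
  slab but different projections.\<close>

lemma integral_face_line:
  fixes g :: "real^'n \<Rightarrow> real"
  assumes g: "continuous_on UNIV g" and a: "a \<in> C" and p [measurable]: "p \<in> borel_measurable borel"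
    and l [measurable]: "l \<in> borel_measurable borel" and k: "0 \<le> k"
    and nn: "\<And>f :: real^'n \<Rightarrow> ennreal. f \<in> borel_measurable borel \<Longrightarrow>
      (\<integral>\<^sup>+x. unit_slab (l x) * (indicator (face a) (p x) * f (p x)) \<partial>lborel) = ennreal k * (\<integral>\<^sup>+x. f x \<partial>face_measure (face a))"
  shows "integrable lborel (\<lambda>x. indicator {- (1/2)..1/2} (l x) * (indicator (face a) (p x) * g (p x)))"
    and "(\<integral>x. indicator {- (1/2)..1/2} (l x) * (indicator (face a) (p x) * g (p x)) \<partial>(lborel :: (real^'n) measure))
      = k * (\<integral>x. g x \<partial>face_measure (face a))"
proof -
  have F [measurable]: "face a \<in> sets borel"
    using compact_face[OF a] by (simp add: compact_imp_closed borel_closed)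
  have gm [measurable]: "g \<in> borel_measurable borel" using g by (rule borel_measurable_continuous_onI)
  let ?h = "\<lambda>x. indicator {- (1/2)..1/2} (l x) * (indicator (face a) (p x) * g (p x)) :: real"
  have int: "integrable (face_measure (face a)) (\<lambda>x. k * g x)"
    using continuous_integrable_face[OF g a] by simp
  have hm: "?h \<in> borel_measurable lborel" by measurable
  have *: "(\<integral>\<^sup>+x. ennreal (k * f x) \<partial>face_measure (face a))
      = (\<integral>\<^sup>+x. ennreal (indicator {- (1/2)..1/2} (l x) * (indicator (face a) (p x) * f (p x))) \<partial>(lborel :: (real^'n) measure))"
    if [measurable]: "f \<in> borel_measurable borel" for f :: "real^'n \<Rightarrow> real"
  proof -
    have "(\<integral>\<^sup>+x. ennreal (k * f x) \<partial>face_measure (face a)) = ennreal k * (\<integral>\<^sup>+x. ennreal (f x) \<partial>face_measure (face a))"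
      using k by (subst nn_integral_cmult[symmetric]) (auto simp: ennreal_mult')
    also have "\<dots> = (\<integral>\<^sup>+x. unit_slab (l x) * (indicator (face a) (p x) * ennreal (f (p x))) \<partial>lborel)"
      by (rule nn[symmetric]) measurable
    also have "\<dots> = (\<integral>\<^sup>+x. ennreal (indicator {- (1/2)..1/2} (l x) * (indicator (face a) (p x) * f (p x))) \<partial>lborel)"
      by (intro nn_integral_cong) (auto simp: indicator_def)
    finally show ?thesis .
  qed
  note eqs = integral_eq_if_nn_integrals_eq[OF int hm *[OF gm]]
  have "(\<integral>\<^sup>+x. ennreal (- (k * g x)) \<partial>face_measure (face a)) = (\<integral>\<^sup>+x. ennreal (- ?h x) \<partial>lborel)"
    using *[of "\<lambda>x. - g x"] by simp
  note eqs = eqs[OF this]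
  show "integrable lborel ?h" by (rule eqs(1))
  show "(\<integral>x. ?h x \<partial>lborel) = k * (\<integral>x. g x \<partial>face_measure (face a))" using eqs(2) by simp
qed

text \<open>Along \<open>i - j\<close> the coordinate of \<open>i\<close> rises, that of
  \<open>j\<close> falls and all others are constant. So a line in this direction enters
  \<open>K\<close> through \<open>face i\<close> and leaves through \<open>face j\<close>, and the
  fundamental theorem of calculus on the chord leaves the difference of the two end values.
  Integration over the set of lines turns these into face integrals.\<close>

lemma divergence_edge:
  fixes \<phi> :: "real^'n \<Rightarrow> real" and G :: "real^'n \<Rightarrow> real^'n"
  assumes deriv: "\<And>x. (\<phi> has_derivative (\<lambda>h. G x \<bullet> h)) (at x)" and G: "continuous_on UNIV G"
    and i: "i \<in> C" and j: "j \<in> C" and ij: "i \<noteq> j"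
  shows "(\<integral>x. indicator K x * (G x \<bullet> (i - j)) \<partial>lborel) =
    (1 / norm (w j)) * (\<integral>x. \<phi> x \<partial>face_measure (face j)) - (1 / norm (w i)) * (\<integral>x. \<phi> x \<partial>face_measure (face i))"
proof -
  define v where "v = i - j"
  have lam_v: "w k \<bullet> v = (if k = i then 1 else if k = j then - 1 else 0)" if "k \<in> C" for k
    unfolding v_def w_inner_diff using lam_vertex[OF that i] lam_vertex[OF that j] ij by auto
  have lam_line: "lam k (x + s *\<^sub>R v) = lam k x + s * (if k = i then 1 else if k = j then - 1 else 0)"
    if "k \<in> C" for k x s
    using lam_v[OF that] by (simp add: lam_def inner_add_right)
  have wi: "w i \<bullet> v = 1" and wj: "w j \<bullet> v = - 1" using lam_v[OF i] lam_v[OF j] ij by auto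
  have K [measurable]: "K \<in> sets borel" using compact_K by (simp add: compact_imp_closed borel_closed)
  have \<phi>: "continuous_on UNIV \<phi>"
    using deriv by (meson continuous_at_imp_continuous_on has_derivative_continuous)
  have lam_m [measurable]: "lam k \<in> borel_measurable borel" for k unfolding lam_def by measurable
  have Gv: "continuous_on UNIV (\<lambda>x. G x \<bullet> v)" using G by (intro continuous_intros)
  have Gvm [measurable]: "(\<lambda>x. G x \<bullet> v) \<in> borel_measurable borel" using Gv by (rule borel_measurable_continuous_onI)
  let ?T = "indicat_real {- (1/2)..1/2}"
  \<comment> \<open>The points where the line through \<open>x\<close> meets the hyperplanes of
    \<open>face i\<close> and \<open>face j\<close>.\<close>
  let ?p = "\<lambda>x. x - lam i x *\<^sub>R v" and ?q = "\<lambda>x. x + lam j x *\<^sub>R v"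
  let ?h = "\<lambda>x. indicator K x * (G x \<bullet> v)"
  have hint: "integrable lborel ?h"
    using borel_integrable_compact[OF compact_K continuous_on_subset[OF Gv]]
    by (simp add: indicator_def if_distrib mult_ac cong: if_cong)
  \<comment> \<open>The slab at the hyperplane of \<open>face i\<close> carries the set of lines and
    \<open>s\<close> runs along each of them; \<open>nn_integral_lines\<close> identifies the
    integral with that of \<open>?h\<close>.\<close>
  let ?P = "\<lambda>(x, s). ?T (lam i x) * ?h (?p x + s *\<^sub>R v)"
  have Pm: "?P \<in> borel_measurable (lborel \<Otimes>\<^sub>M lborel)" by measurable
  have nnP: "(\<integral>\<^sup>+z. ennreal (Q z) \<partial>(lborel \<Otimes>\<^sub>M lborel)) = (\<integral>\<^sup>+x. ennreal (f x) \<partial>lborel)"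
    if [measurable]: "f \<in> borel_measurable borel" and Q: "Q = (\<lambda>(x, s). ?T (lam i x) * f (?p x + s *\<^sub>R v))"
    for f and Q :: "(real^'n) \<times> real \<Rightarrow> real"
  proof -
    have "(\<integral>\<^sup>+z. ennreal (Q z) \<partial>(lborel \<Otimes>\<^sub>M lborel))
        = (\<integral>\<^sup>+x. \<integral>\<^sup>+s. ennreal (?T (lam i x) * f (?p x + s *\<^sub>R v)) \<partial>lborel \<partial>lborel)"
      unfolding Q by (subst lborel.nn_integral_fst[symmetric]) auto
    also have "\<dots> = (\<integral>\<^sup>+x. unit_slab (w i \<bullet> x - c i) * (\<integral>\<^sup>+s. ennreal (f (?p x + s *\<^sub>R v)) \<partial>lborel) \<partial>lborel)"
      by (intro nn_integral_cong, subst nn_integral_cmult[symmetric])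
        (auto simp: indicator_def lam_def intro!: nn_integral_cong)
    also have "\<dots> = (\<integral>\<^sup>+x. ennreal (f x) \<partial>lborel)"
      using nn_integral_lines[OF _ wi, of "\<lambda>x. ennreal (f x)" "c i"] by (simp add: lam_def)
    finally show ?thesis .
  qed
  have Pint: "integrable (lborel \<Otimes>\<^sub>M lborel) ?P" and Peq: "(\<integral>x. ?h x \<partial>lborel) = (\<integral>z. ?P z \<partial>(lborel \<Otimes>\<^sub>M lborel))"
    using integral_eq_if_nn_integrals_eq[OF hint Pm] nnP[of ?h ?P] nnP[of "\<lambda>x. - ?h x" "\<lambda>z. - ?P z"]
    by (simp_all add: case_prod_unfold)
  have inner: "(\<integral>s. ?T (lam i x) * ?h (?p x + s *\<^sub>R v) \<partial>lborel)
      = ?T (lam i x) * (indicator (face j) (?q x) * \<phi> (?q x)) - ?T (lam i x) * (indicator (face i) (?p x) * \<phi> (?p x))" for x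
  proof -
    have lam_p: "lam k (?p x) = (if k = i then 0 else if k = j then lam j x + lam i x else lam k x)" if "k \<in> C" for k
      using lam_line[OF that, of x "- lam i x"] ij by auto
    have lam_q: "lam k (?q x) = (if k = i then lam i x + lam j x else if k = j then 0 else lam k x)" if "k \<in> C" for k
      using lam_line[OF that, of x "lam j x"] ij by auto
    have q: "?q x = ?p x + (lam i x + lam j x) *\<^sub>R v" by (simp add: algebra_simps)
    have pq: "?p x \<in> face i \<longleftrightarrow> ?q x \<in> face j"
      unfolding face_def mem_Collect_eq mem_K using lam_p lam_q i j ij by auto
    \<comment> \<open>In multiples of \<open>v\<close>, the chord has length
      \<open>lam i x + lam j x\<close>, a quantity that is constant along the line.\<close>
    have memK: "?p x + s *\<^sub>R v \<in> K \<longleftrightarrow> ?p x \<in> face i \<and> s \<in> {0..lam i x + lam j x}" for s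
    proof
      assume K: "?p x + s *\<^sub>R v \<in> K"
      have 1: "0 \<le> lam k (?p x) + s * (if k = i then 1 else if k = j then - 1 else 0)" if "k \<in> C" for k
      proof -
        have "0 \<le> lam k (?p x + s *\<^sub>R v)" using K that by (auto simp: mem_K)
        then show ?thesis unfolding lam_line[OF that] .
      qed
      have "0 \<le> s" "s \<le> lam i x + lam j x" using 1[OF i] 1[OF j] lam_p[OF i] lam_p[OF j] ij by auto
      moreover have "0 \<le> lam k (?p x)" if "k \<in> C" for k
        using 1[OF that] lam_p[OF that] \<open>0 \<le> s\<close> \<open>s \<le> lam i x + lam j x\<close> by (auto split: if_splits)
      ultimately show "?p x \<in> face i \<and> s \<in> {0..lam i x + lam j x}"
        using lam_p[OF i] by (auto simp: face_def mem_K)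
    next
      assume *: "?p x \<in> face i \<and> s \<in> {0..lam i x + lam j x}"
      then have "0 \<le> lam k (?p x + s *\<^sub>R v)" if "k \<in> C" for k
        using lam_line[OF that, of "?p x" s] that lam_p[OF that] by (auto simp: face_def mem_K)
      then show "?p x + s *\<^sub>R v \<in> K" by (simp add: mem_K)
    qed
    show ?thesis
    proof (cases "?p x \<in> face i")
      case False
      then have "(\<lambda>s. ?T (lam i x) * ?h (?p x + s *\<^sub>R v)) = (\<lambda>s. 0)" by (simp add: memK fun_eq_iff)
      then show ?thesis using False pq by simp
    next
      case True
      have le: "0 \<le> lam i x + lam j x"
        using True lam_p[OF j] ij j by (auto simp: face_def mem_K split: if_splits)
      have DE: "((\<lambda>s. \<phi> (?p x + s *\<^sub>R v)) has_real_derivative (G (?p x + s *\<^sub>R v) \<bullet> v)) (at s)" for s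
      proof -
        have "((\<lambda>s. ?p x + s *\<^sub>R v) has_derivative (\<lambda>h. h *\<^sub>R v)) (at s)"
          by (auto intro!: derivative_eq_intros)
        from has_derivative_compose[OF this deriv]
        show ?thesis by (simp add: has_field_derivative_def mult_commute_abs)
      qed
      have cont: "isCont (\<lambda>s. G (?p x + s *\<^sub>R v) \<bullet> v) s" for s
      proof -
        have "isCont G y" for y using G by (simp add: continuous_on_eq_continuous_at)
        then show ?thesis by (intro continuous_intros isCont_o2[of _ "\<lambda>s. ?p x + s *\<^sub>R v" G])
      qed
      have "(\<integral>s. ?T (lam i x) * ?h (?p x + s *\<^sub>R v) \<partial>lborel)
          = ?T (lam i x) * (\<integral>s. (G (?p x + s *\<^sub>R v) \<bullet> v) * indicator {0..lam i x + lam j x} s \<partial>lborel)"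
        using True by (subst Bochner_Integration.integral_mult_right_zero[symmetric])
          (intro Bochner_Integration.integral_cong refl, simp add: indicator_def memK)
      also have "(\<integral>s. (G (?p x + s *\<^sub>R v) \<bullet> v) * indicator {0..lam i x + lam j x} s \<partial>lborel)
          = \<phi> (?p x + (lam i x + lam j x) *\<^sub>R v) - \<phi> (?p x + 0 *\<^sub>R v)"
        by (rule integral_FTC_Icc_real[OF le DE cont])
      also have "?p x + (lam i x + lam j x) *\<^sub>R v = ?q x" by (rule q[symmetric])
      finally show ?thesis using True pq by (simp add: right_diff_distrib)
    qed
  qed
  have nn_i: "(\<integral>\<^sup>+x. unit_slab (lam i x) * (indicator (face i) (?p x) * f (?p x)) \<partial>lborel)
      = ennreal (1 / norm (w i)) * (\<integral>\<^sup>+x. f x \<partial>face_measure (face i))"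
    if "f \<in> borel_measurable borel" for f :: "real^'n \<Rightarrow> ennreal"
    using nn_integral_face_line[OF that i wi] by simp
  \<comment> \<open>The lines are still labelled by the slab at \<open>face i\<close>. As
    \<open>?q\<close> is constant along lines, the slab may be moved to the hyperplane of
    \<open>face j\<close>; \<open>- w j\<close> takes the place of \<open>w j\<close> because
    \<open>w j \<bullet> v = - 1\<close>.\<close>
  have nn_j: "(\<integral>\<^sup>+x. unit_slab (lam i x) * (indicator (face j) (?q x) * f (?q x)) \<partial>lborel)
      = ennreal (1 / norm (w j)) * (\<integral>\<^sup>+x. f x \<partial>face_measure (face j))"
    if [measurable]: "f \<in> borel_measurable borel" for f :: "real^'n \<Rightarrow> ennreal"
  proof -
    have Fj [measurable]: "face j \<in> sets borel"
      using compact_face[OF j] by (simp add: compact_imp_closed borel_closed)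
    have "lam j (x + s *\<^sub>R v) = lam j x - s" for x s using lam_line[OF j, of x s] ij by simp
    then have qinv: "?q (x + s *\<^sub>R v) = ?q x" for x s by (simp only:) (simp add: scaleR_diff_left)
    have e1: "(- w j) \<bullet> x - (- c j) = lam j x / (- 1)" for x by (simp add: lam_def)
    have e2: "?q x = x - (lam j x / (- 1)) *\<^sub>R v" for x by simp
    have "(\<integral>\<^sup>+x. unit_slab (w i \<bullet> x - c i) * (indicator (face j) (?q x) * f (?q x)) \<partial>lborel)
        = (\<integral>\<^sup>+x. unit_slab ((- w j) \<bullet> x - (- c j)) * (indicator (face j) (?q x) * f (?q x)) \<partial>lborel)"
    proof (rule nn_integral_lines_independent[of _ _ v])
      show "indicator (face j) (?q (x + s *\<^sub>R v)) * f (?q (x + s *\<^sub>R v)) = indicator (face j) (?q x) * f (?q x)" for x s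
        by (simp only: qinv)
    qed (simp_all add: wi wj)
    also have "\<dots> = (\<integral>\<^sup>+x. unit_slab (lam j x / (- 1)) *
        (indicator (face j) (x - (lam j x / (- 1)) *\<^sub>R v) * f (x - (lam j x / (- 1)) *\<^sub>R v)) \<partial>lborel)"
      by (simp only: e1 e2)
    also have "\<dots> = ennreal (\<bar>- 1\<bar> / norm (w j)) * (\<integral>\<^sup>+x. f x \<partial>face_measure (face j))"
      by (rule nn_integral_face_line[OF that j wj]) simp
    finally show ?thesis by (simp add: lam_def)
  qed
  have pm: "?p \<in> borel_measurable borel" "?q \<in> borel_measurable borel" by measurable
  note I = integral_face_line[OF \<phi> i pm(1) lam_m _ nn_i]
  note J = integral_face_line[OF \<phi> j pm(2) lam_m _ nn_j]
  have "(\<integral>x. ?h x \<partial>lborel) = (\<integral>x. \<integral>s. ?T (lam i x) * ?h (?p x + s *\<^sub>R v) \<partial>lborel \<partial>lborel)"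
    unfolding Peq using lborel_pair.integral_fst'[OF Pint] by simp
  also have "\<dots> = (\<integral>x. ?T (lam i x) * (indicator (face j) (?q x) * \<phi> (?q x)) \<partial>lborel)
      - (\<integral>x. ?T (lam i x) * (indicator (face i) (?p x) * \<phi> (?p x)) \<partial>lborel)"
    unfolding inner using I(1) J(1) by (intro Bochner_Integration.integral_diff) auto
  also have "\<dots> = (1 / norm (w j)) * (\<integral>x. \<phi> x \<partial>face_measure (face j)) - (1 / norm (w i)) * (\<integral>x. \<phi> x \<partial>face_measure (face i))"
    using I(2) J(2) by simp
  finally show ?thesis by (simp add: v_def)
qed

text \<open>\<open>- w a / norm (w a)\<close> is the outer unit normal of \<open>face a\<close>.
  Both sides are linear in \<open>v\<close>, so their difference is \<open>q \<bullet> v\<close> for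
  a fixed vector \<open>q\<close>, and \<open>q\<close> is orthogonal to all edges at
  \<open>a0\<close> by \<open>divergence_edge\<close>.\<close>

lemma divergence:
  fixes \<phi> :: "real^'n \<Rightarrow> real" and G :: "real^'n \<Rightarrow> real^'n"
  assumes deriv: "\<And>x. (\<phi> has_derivative (\<lambda>h. G x \<bullet> h)) (at x)" and G: "continuous_on UNIV G"
  shows "(\<integral>x. G x \<bullet> v \<partial>lebesgue_on K) =
    - (\<Sum>a\<in>C. (w a \<bullet> v / norm (w a)) * (\<integral>x. \<phi> x \<partial>face_measure (face a)))"
proof -
  have K: "K \<in> sets borel" using compact_K by (simp add: compact_imp_closed borel_closed)
  let ?S = "\<lambda>a. \<integral>x. \<phi> x \<partial>face_measure (face a)"
  have int: "integrable lborel (\<lambda>x. indicator K x *\<^sub>R G x)"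
    using borel_integrable_compact[OF compact_K continuous_on_subset[OF G]]
    by (simp add: indicator_def if_distrib cong: if_cong)
  define q where "q = (\<integral>x. indicator K x *\<^sub>R G x \<partial>lborel) + (\<Sum>a\<in>C. (?S a / norm (w a)) *\<^sub>R w a)"
  have q: "q \<bullet> y = (\<integral>x. indicator K x * (G x \<bullet> y) \<partial>lborel) + (\<Sum>a\<in>C. (w a \<bullet> y / norm (w a)) * ?S a)" for y
  proof -
    have "(\<integral>x. indicator K x *\<^sub>R G x \<partial>lborel) \<bullet> y = (\<integral>x. (indicator K x *\<^sub>R G x) \<bullet> y \<partial>lborel)"
      using int by (intro integral_inner_left[symmetric])
    then show ?thesis by (simp add: q_def inner_add_left inner_sum_left ac_simps)
  qed
  obtain a0 where a0: "a0 \<in> C" using card_vertices_ge_2 by fastforce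
  have "q \<bullet> (i - a0) = 0" if i: "i \<in> C" for i
  proof (cases "i = a0")
    case False
    have "(\<Sum>a\<in>C. (w a \<bullet> (i - a0) / norm (w a)) * ?S a)
        = (\<Sum>a\<in>C. (if a = i then ?S i / norm (w i) else 0) - (if a = a0 then ?S a0 / norm (w a0) else 0))"
      unfolding w_inner_diff using lam_vertex[OF _ i] lam_vertex[OF _ a0] False by (intro sum.cong) auto
    also have "\<dots> = ?S i / norm (w i) - ?S a0 / norm (w a0)"
      using finite_vertices i a0 by (simp add: sum_subtractf)
    finally show ?thesis using divergence_edge[OF deriv G i a0 False] by (simp add: q)
  qed simp
  \<comment> \<open>The barycentric expansion of \<open>v + a0\<close>, minus
    \<open>a0\<close>.\<close>
  moreover have "v = (\<Sum>a\<in>C. lam a (v + a0) *\<^sub>R (a - a0))"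
    using lam_expand[of "v + a0"] lam_sum[of "v + a0"]
    by (simp add: scaleR_diff_right sum_subtractf scaleR_sum_left[symmetric])
  ultimately have "q \<bullet> v = 0"
    by (metis (no_types, lifting) inner_scaleR_right inner_sum_right mult_zero_right sum.neutral)
  then have "(\<integral>x. indicator K x * (G x \<bullet> v) \<partial>lborel) = - (\<Sum>a\<in>C. (w a \<bullet> v / norm (w a)) * ?S a)"
    by (simp add: q)
  moreover have "(\<integral>x. G x \<bullet> v \<partial>lebesgue_on K) = (\<integral>x. indicator K x * (G x \<bullet> v) \<partial>lborel)"
  proof -
    have "(\<lambda>x. G x \<bullet> v) \<in> borel_measurable borel"
      using G by (intro borel_measurable_continuous_onI continuous_intros)
    then have "(\<lambda>x. indicator K x * (G x \<bullet> v)) \<in> borel_measurable lborel" using K by measurable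
    then show ?thesis using K by (simp add: integral_restrict_space integral_completion)
  qed
  ultimately show ?thesis by simp
qed

end

section \<open>Weak gradients and traces\<close>

lemma l2_scaleR_integrable:
  fixes f :: "'a \<Rightarrow> real" and g :: "'a \<Rightarrow> 'b::euclidean_space"
  assumes "f \<in> l2 M" "g \<in> l2 M"
  shows "integrable M (\<lambda>x. f x *\<^sub>R g x)"
proof (rule Bochner_Integration.integrable_bound)
  show "integrable M (\<lambda>x. (norm (f x))\<^sup>2 + (norm (g x))\<^sup>2)"
    using assms by (auto simp: l2_def)
  show "(\<lambda>x. f x *\<^sub>R g x) \<in> borel_measurable M"
    using assms by (auto simp: l2_def)
  have "norm (f x) * norm (g x) \<le> (norm (f x))\<^sup>2 + (norm (g x))\<^sup>2" for x
    using sum_squares_bound[of "norm (f x)" "norm (g x)"]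
      mult_nonneg_nonneg[OF norm_ge_zero[of "f x"] norm_ge_zero[of "g x"]] by linarith
  then show "AE x in M. norm (f x *\<^sub>R g x) \<le> norm ((norm (f x))\<^sup>2 + (norm (g x))\<^sup>2)" by simp
qed

lemma l2_nth: "f \<in> l2 M \<Longrightarrow> (\<lambda>x. f x $ i) \<in> l2 M"
  by (rule l2_linear_image[OF _ bounded_linear_vec_nth])

lemma l2_vec:
  fixes f :: "'a \<Rightarrow> ('b::euclidean_space)^'n"
  assumes "\<And>i. (\<lambda>x. f x $ i) \<in> l2 M" shows "f \<in> l2 M"
proof (rule l2_componentwise)
  fix b :: "'b^'n" assume "b \<in> Basis"
  then obtain i c where b: "b = axis i c" "c \<in> Basis" by (auto simp: Basis_vec_def)
  have "(\<lambda>x. f x $ i \<bullet> c) \<in> l2 M" using assms[of i] by (rule l2_linear_image) (rule bounded_linear_inner_left)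
  then show "(\<lambda>x. f x \<bullet> b) \<in> l2 M" by (simp add: b inner_axis)
qed

lemma test_function_l2:
  assumes "test_function U \<phi>" "bounded U" "U \<in> sets lebesgue"
  shows "\<phi> \<in> l2 (lebesgue_on U)" "gradient \<phi> \<in> l2 (lebesgue_on U)"
  using assms smooth_continuous[of \<phi>] smooth_continuous_gradient[of \<phi>]
  by (auto simp: test_function_def intro: continuous_l2)

lemma gradient_zero_outside:
  assumes "x \<notin> closure {x. \<phi> x \<noteq> 0}"
  shows "gradient \<phi> x = 0"
proof (rule gradient_eqI)
  have "((\<lambda>x. 0 :: real) has_derivative (\<lambda>h. 0)) (at x)" by simp
  then have "(\<phi> has_derivative (\<lambda>h. 0)) (at x)"
  proof (rule has_derivative_transform_within_open[of _ _ _ _ "- closure {x. \<phi> x \<noteq> 0}"])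
    show "0 = \<phi> y" if "y \<in> - closure {x. \<phi> x \<noteq> 0}" for y
      using that closure_subset[of "{x. \<phi> x \<noteq> 0}"] by auto
  qed (use assms in auto)
  then show "(\<phi> has_derivative (\<lambda>h. 0 \<bullet> h)) (at x)" by simp
qed

lemma weak_gradient_iff:
  assumes U: "open U" "bounded U"
  shows "weak_gradient U f G \<longleftrightarrow> f \<in> l2 (lebesgue_on U) \<and> G \<in> l2 (lebesgue_on U) \<and>
    (\<forall>\<phi> i. test_function U \<phi> \<longrightarrow>
      (\<integral>x. f x * gradient \<phi> x $ i \<partial>lebesgue_on U) = - (\<integral>x. \<phi> x * G x $ i \<partial>lebesgue_on U))"
proof (cases "f \<in> l2 (lebesgue_on U) \<and> G \<in> l2 (lebesgue_on U)")
  case True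
  have Um: "U \<in> sets lebesgue" using U by auto
  have "((\<integral>x. f x *\<^sub>R gradient \<phi> x \<partial>lebesgue_on U) = - (\<integral>x. \<phi> x *\<^sub>R G x \<partial>lebesgue_on U)) \<longleftrightarrow>
    (\<forall>i. (\<integral>x. f x * gradient \<phi> x $ i \<partial>lebesgue_on U) = - (\<integral>x. \<phi> x * G x $ i \<partial>lebesgue_on U))"
    if t: "test_function U \<phi>" for \<phi>
  proof -
    have int: "integrable (lebesgue_on U) (\<lambda>x. f x *\<^sub>R gradient \<phi> x)" "integrable (lebesgue_on U) (\<lambda>x. \<phi> x *\<^sub>R G x)"
      using test_function_l2[OF t U(2) Um] True by (auto intro: l2_scaleR_integrable)
    have "(\<integral>x. f x *\<^sub>R gradient \<phi> x \<partial>lebesgue_on U) $ i = (\<integral>x. f x * gradient \<phi> x $ i \<partial>lebesgue_on U)"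
      "(\<integral>x. \<phi> x *\<^sub>R G x \<partial>lebesgue_on U) $ i = (\<integral>x. \<phi> x * G x $ i \<partial>lebesgue_on U)" for i
      using integral_bounded_linear[OF bounded_linear_vec_nth[of i] int(1)]
        integral_bounded_linear[OF bounded_linear_vec_nth[of i] int(2)] by simp_all
    then show ?thesis by (simp add: vec_eq_iff)
  qed
  then show ?thesis using True unfolding weak_gradient_def by blast
qed (auto simp: weak_gradient_def)

lemma weak_gradient_unique:
  assumes U: "open U" "bounded U" and "weak_gradient U f G" "weak_gradient U f H"
  shows "AE x in lebesgue_on U. G x = H x"
proof -
  have Um: "U \<in> sets lebesgue" using U by auto
  note G = assms(3)[unfolded weak_gradient_iff[OF U]] and H = assms(4)[unfolded weak_gradient_iff[OF U]]
  have "AE x in lebesgue_on U. G x $ i - H x $ i = 0" for i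
  proof (rule fundamental_lemma[OF U])
    have Gi: "(\<lambda>x. G x $ i) \<in> l2 (lebesgue_on U)" and Hi: "(\<lambda>x. H x $ i) \<in> l2 (lebesgue_on U)"
      using G H by (auto intro: l2_nth)
    then show "(\<lambda>x. G x $ i - H x $ i) \<in> l2 (lebesgue_on U)" by (rule l2_form.diff)
    fix a b k assume "cbox a b \<subseteq> U"
    then have t: "test_function U (box_bump a b k)" by (rule box_bump_test_function)
    define \<phi> where "\<phi> = box_bump a b k"
    note t = t[folded \<phi>_def]
    have \<phi>: "\<phi> \<in> l2 (lebesgue_on U)" using test_function_l2[OF t U(2) Um] by simp
    have "(\<integral>x. \<phi> x * (G x $ i - H x $ i) \<partial>lebesgue_on U)
        = (\<integral>x. \<phi> x * G x $ i \<partial>lebesgue_on U) - (\<integral>x. \<phi> x * H x $ i \<partial>lebesgue_on U)"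
      using l2_form.form_diff_right[OF Gi Hi \<phi>] by simp
    also have "\<dots> = 0"
    proof -
      have "(\<integral>x. f x * gradient \<phi> x $ i \<partial>lebesgue_on U) = - (\<integral>x. \<phi> x * G x $ i \<partial>lebesgue_on U)"
        "(\<integral>x. f x * gradient \<phi> x $ i \<partial>lebesgue_on U) = - (\<integral>x. \<phi> x * H x $ i \<partial>lebesgue_on U)"
        using G H t by blast+
      then show ?thesis by linarith
    qed
    finally show "(\<integral>x. box_bump a b k x * (G x $ i - H x $ i) \<partial>lebesgue_on U) = 0" by (simp only: \<phi>_def)
  qed
  then have "AE x in lebesgue_on U. \<forall>i. G x $ i - H x $ i = 0" by (simp only: AE_all_countable) blast
  then show ?thesis by eventually_elim (simp add: vec_eq_iff)
qed

lemma weak_gradient_combine: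
  assumes U: "open U" "bounded U" and "weak_gradient U f G" "weak_gradient U g H"
  shows "weak_gradient U (\<lambda>x. f x + c * g x) (\<lambda>x. G x + c *\<^sub>R H x)"
proof -
  have Um: "U \<in> sets lebesgue" using U by auto
  note G = assms(3)[unfolded weak_gradient_iff[OF U]] and H = assms(4)[unfolded weak_gradient_iff[OF U]]
  have l2: "(\<lambda>x. c * g x) \<in> l2 (lebesgue_on U)" "(\<lambda>x. c *\<^sub>R H x) \<in> l2 (lebesgue_on U)"
    using H l2_scale[of g _ c] l2_scale[of H _ c] by auto
  have "(\<integral>x. (f x + c * g x) * gradient \<phi> x $ i \<partial>lebesgue_on U) = - (\<integral>x. \<phi> x * (G x + c *\<^sub>R H x) $ i \<partial>lebesgue_on U)"
    if t: "test_function U \<phi>" for \<phi> i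
  proof -
    have \<phi>: "\<phi> \<in> l2 (lebesgue_on U)" "(\<lambda>x. gradient \<phi> x $ i) \<in> l2 (lebesgue_on U)"
      using test_function_l2[OF t U(2) Um] by (auto intro: l2_nth)
    have fg: "f \<in> l2 (lebesgue_on U)" "g \<in> l2 (lebesgue_on U)" "(\<lambda>x. G x $ i) \<in> l2 (lebesgue_on U)"
      "(\<lambda>x. H x $ i) \<in> l2 (lebesgue_on U)" using G H by (auto intro: l2_nth)
    show ?thesis
      using l2_form.form_add[OF fg(1) l2_scale[OF fg(2), of c] \<phi>(2)] l2_form.form_scale[OF fg(2) \<phi>(2), of c]
        l2_form.form_add_right[OF fg(3) l2_scale[OF fg(4), of c] \<phi>(1)] l2_form.form_scale_right[OF fg(4) \<phi>(1), of c]
        G H t by simp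
  qed
  then show ?thesis using G H l2 by (auto simp: weak_gradient_iff[OF U] intro!: l2_add)
qed

lemma weak_gradient_subset:
  assumes U: "open U" "bounded U" and V: "open V" "V \<subseteq> U" and f: "weak_gradient U f G"
  shows "weak_gradient V f G"
proof -
  have bV: "bounded V" using U V bounded_subset by blast
  have m: "U \<in> sets lebesgue" "V \<in> sets lebesgue" using U V by auto
  note G = f[unfolded weak_gradient_iff[OF U]]
  have "(\<integral>x. f x * gradient \<phi> x $ i \<partial>lebesgue_on V) = - (\<integral>x. \<phi> x * G x $ i \<partial>lebesgue_on V)"
    if t: "test_function V \<phi>" for \<phi> i
  proof -
    have tU: "test_function U \<phi>" using t V(2) by (auto simp: test_function_def)
    have z: "\<phi> x = 0" "gradient \<phi> x = 0" if "x \<in> U - V" for x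
      using t that gradient_zero_outside[of x \<phi>] closure_subset[of "{x. \<phi> x \<noteq> 0}"]
      by (auto simp: test_function_def)
    have "(\<integral>x. f x * gradient \<phi> x $ i \<partial>lebesgue_on V) = (\<integral>x. f x * gradient \<phi> x $ i \<partial>lebesgue_on U)"
      "(\<integral>x. \<phi> x * G x $ i \<partial>lebesgue_on V) = (\<integral>x. \<phi> x * G x $ i \<partial>lebesgue_on U)"
      using z m V(2) by (auto intro!: integral_lebesgue_on_restrict)
    then show ?thesis using G tU by simp
  qed
  then show ?thesis
    using G l2_subset[of f U V] l2_subset[of G U V] V(2) m by (auto simp: weak_gradient_iff[OF V(1) bV])
qed

lemma weak_gradient_cong_AE:
  assumes U: "open U" "bounded U" and f: "weak_gradient U f G"
    and ae: "AE x in lebesgue_on U. f x = f' x" and m: "f' \<in> borel_measurable (lebesgue_on U)"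
  shows "weak_gradient U f' G"
proof -
  have Um: "U \<in> sets lebesgue" using U by auto
  note G = f[unfolded weak_gradient_iff[OF U]]
  have "(\<integral>x. f' x * gradient \<phi> x $ i \<partial>lebesgue_on U) = (\<integral>x. f x * gradient \<phi> x $ i \<partial>lebesgue_on U)"
    if t: "test_function U \<phi>" for \<phi> i
  proof (rule integral_cong_AE)
    have "(\<lambda>x. gradient \<phi> x $ i) \<in> borel_measurable (lebesgue_on U)"
      using test_function_l2[OF t U(2) Um] by (intro l2_measurable l2_nth)
    then show "(\<lambda>x. f' x * gradient \<phi> x $ i) \<in> borel_measurable (lebesgue_on U)"
      "(\<lambda>x. f x * gradient \<phi> x $ i) \<in> borel_measurable (lebesgue_on U)"
      using m G by (auto simp: l2_def)
  qed (use ae in eventually_elim, simp)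
  moreover have "f' \<in> l2 (lebesgue_on U)" by (rule l2_cong_AE[OF _ m ae]) (use G in simp)
  ultimately show ?thesis unfolding weak_gradient_iff[OF U] using G by simp
qed

lemma weak_gradient_wgrad: "weak_gradient U f G \<Longrightarrow> weak_gradient U f (wgrad U f)"
  unfolding wgrad_def by (rule someI[of "weak_gradient U f"])

lemma wgrad_AE:
  assumes "open U" "bounded U" "weak_gradient U f G"
  shows "AE x in lebesgue_on U. wgrad U f x = G x"
  using weak_gradient_unique[OF assms(1,2) weak_gradient_wgrad assms(3)] assms(3) by blast

text \<open>On Lipschitz domains this is all of \<open>H\<^sup>1(U)\<close>; only the density of smooth functions is needed.\<close>

definition h1s :: "(real^'n) set \<Rightarrow> (real^'n \<Rightarrow> real) set" where
  "h1s U = {f. \<exists>\<phi>. (\<forall>k. smooth (\<phi> k)) \<and> h1_lim U \<phi> f}"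

lemma h1_lim_combine:
  assumes U: "open U" "bounded U" and sm: "\<And>k. smooth (\<phi> k)" "\<And>k. smooth (\<psi> k)"
    and "h1_lim U \<phi> f" "h1_lim U \<psi> g"
  shows "h1_lim U (\<lambda>k x. \<phi> k x + c * \<psi> k x) (\<lambda>x. f x + c * g x)"
proof -
  obtain G H where G: "weak_gradient U f G" "l2_lim (lebesgue_on U) \<phi> f" "l2_lim (lebesgue_on U) (\<lambda>k. gradient (\<phi> k)) G"
    and H: "weak_gradient U g H" "l2_lim (lebesgue_on U) \<psi> g" "l2_lim (lebesgue_on U) (\<lambda>k. gradient (\<psi> k)) H"
    using assms(5,6) by (auto simp: h1_lim_def)
  have "gradient (\<lambda>x. \<phi> k x + c * \<psi> k x) = (\<lambda>x. gradient (\<phi> k) x + c *\<^sub>R gradient (\<psi> k) x)" for k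
    using gradient_combine[OF smooth_differentiable[OF sm(1)] smooth_differentiable[OF sm(2)]] by auto
  then show ?thesis
    unfolding h1_lim_def
    using weak_gradient_combine[OF U G(1) H(1), of c] l2_lim_combine[OF G(2) H(2), of c] l2_lim_combine[OF G(3) H(3), of c]
    by (intro exI[of _ "\<lambda>x. G x + c *\<^sub>R H x"]) simp
qed

lemma h1s_combine:
  assumes U: "open U" "bounded U" and "f \<in> h1s U" "g \<in> h1s U"
  shows "(\<lambda>x. f x + c * g x) \<in> h1s U"
proof -
  obtain \<phi> \<psi> where *: "\<And>k. smooth (\<phi> k)" "h1_lim U \<phi> f" "\<And>k. smooth (\<psi> k)" "h1_lim U \<psi> g"
    using assms by (auto simp: h1s_def)
  have "smooth (\<lambda>x. \<phi> k x + c * \<psi> k x)" for k using * by (intro smooth_combine)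
  then show ?thesis using h1_lim_combine[OF U *(1,3,2,4), of c] unfolding h1s_def
    by (intro CollectI exI[of _ "\<lambda>k x. \<phi> k x + c * \<psi> k x"]) simp
qed

lemma h1_lim_subset:
  assumes U: "open U" "bounded U" and V: "open V" "V \<subseteq> U" and "h1_lim U \<phi> f"
  shows "h1_lim V \<phi> f"
proof -
  have m: "U \<in> sets lebesgue" "V \<in> sets lebesgue" using U V by auto
  obtain G where G: "weak_gradient U f G" "l2_lim (lebesgue_on U) \<phi> f" "l2_lim (lebesgue_on U) (\<lambda>k. gradient (\<phi> k)) G"
    using assms(5) by (auto simp: h1_lim_def)
  show ?thesis
    unfolding h1_lim_def
    by (intro exI[of _ G] conjI weak_gradient_subset[OF U V G(1)] l2_lim_subset[OF G(2) V(2) m(2,1)]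
        l2_lim_subset[OF G(3) V(2) m(2,1)])
qed

lemma h1_lim_cong_AE:
  assumes U: "open U" "bounded U" and f: "h1_lim U \<phi> f"
    and ae: "AE x in lebesgue_on U. f x = f' x" and m: "f' \<in> borel_measurable (lebesgue_on U)"
  shows "h1_lim U \<phi> f'"
proof -
  obtain G where G: "weak_gradient U f G" "l2_lim (lebesgue_on U) \<phi> f" "l2_lim (lebesgue_on U) (\<lambda>k. gradient (\<phi> k)) G"
    using f by (auto simp: h1_lim_def)
  have "f \<in> borel_measurable (lebesgue_on U)" using G(1) by (simp add: weak_gradient_def l2_def)
  then show ?thesis
    unfolding h1_lim_def
    by (intro exI[of _ G] conjI weak_gradient_cong_AE[OF U G(1) ae m] l2_lim_cong_AE[OF G(2) ae _ m] G(3))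
qed

lemma h1_lim_weak_gradient: "h1_lim U \<phi> f \<Longrightarrow> weak_gradient U f (wgrad U f)"
  using weak_gradient_wgrad by (auto simp: h1_lim_def)

lemma h1s_weak_gradient: "f \<in> h1s U \<Longrightarrow> weak_gradient U f (wgrad U f)"
  using h1_lim_weak_gradient by (auto simp: h1s_def)

lemma h1_lim_gradient:
  assumes U: "open U" "bounded U" and f: "h1_lim U \<phi> f"
  shows "l2_lim (lebesgue_on U) \<phi> f" "l2_lim (lebesgue_on U) (\<lambda>k. gradient (\<phi> k)) (wgrad U f)"
proof -
  obtain G where G: "weak_gradient U f G" "l2_lim (lebesgue_on U) \<phi> f" "l2_lim (lebesgue_on U) (\<lambda>k. gradient (\<phi> k)) G"
    using f by (auto simp: h1_lim_def)
  show "l2_lim (lebesgue_on U) \<phi> f" by fact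
  have ae: "AE x in lebesgue_on U. G x = wgrad U f x"
    using weak_gradient_unique[OF U G(1) h1_lim_weak_gradient[OF f]] .
  show "l2_lim (lebesgue_on U) (\<lambda>k. gradient (\<phi> k)) (wgrad U f)"
    using G(3) ae by (rule l2_lim_cong_AE) (use G(1) h1_lim_weak_gradient[OF f] in \<open>auto simp: weak_gradient_def l2_def\<close>)
qed

text \<open>Equality of predicates, not only of traces up to null sets: \<open>SOME\<close> then
  picks the same function for both, and \<open>face_trace\<close> agrees everywhere.\<close>

lemma is_trace_cong_AE:
  assumes U: "open U" "bounded U" and ae: "AE x in lebesgue_on U. f x = f' x"
    and m: "f \<in> borel_measurable (lebesgue_on U)" "f' \<in> borel_measurable (lebesgue_on U)"
  shows "is_trace U F f = is_trace U F f'"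
proof -
  have ae': "AE x in lebesgue_on U. f' x = f x" using ae by eventually_elim simp
  have "h1_lim U \<phi> f \<longleftrightarrow> h1_lim U \<phi> f'" for \<phi>
    using h1_lim_cong_AE[OF U _ ae m(2)] h1_lim_cong_AE[OF U _ ae' m(1)] by (rule iffI)
  then show ?thesis by (simp add: is_trace_def fun_eq_iff)
qed

lemma is_trace_combine:
  assumes U: "open U" "bounded U" and "is_trace U F f s" "is_trace U F g t"
  shows "is_trace U F (\<lambda>x. f x + c * g x) (\<lambda>x. s x + c * t x)"
proof -
  obtain \<phi> \<psi> where *: "\<And>k. smooth (\<phi> k)" "h1_lim U \<phi> f" "l2_lim (face_measure F) \<phi> s"
    "\<And>k. smooth (\<psi> k)" "h1_lim U \<psi> g" "l2_lim (face_measure F) \<psi> t"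
    using assms(3,4) by (auto simp: is_trace_def)
  have "smooth (\<lambda>x. \<phi> k x + c * \<psi> k x)" for k using * by (intro smooth_combine)
  then show ?thesis
    unfolding is_trace_def
    using h1_lim_combine[OF U *(1,4,2,5), of c] l2_lim_combine[OF *(3,6), of c]
    by (intro exI[of _ "\<lambda>k x. \<phi> k x + c * \<psi> k x"]) simp
qed

text \<open>The cut-off integrands agree almost everywhere on the whole space. By completeness of
  Lebesgue measure they are measurable together or not at all, and in the latter case both integrals
  are 0 by convention.\<close>

lemma integral_lebesgue_on_null_diff:
  fixes f :: "'a::euclidean_space \<Rightarrow> 'b::euclidean_space"
  assumes "S \<in> sets lebesgue" "T \<in> sets lebesgue" "S \<subseteq> T" "negligible (T - S)"
  shows "(\<integral>x. f x \<partial>lebesgue_on T) = (\<integral>x. f x \<partial>lebesgue_on S)"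
proof -
  let ?f = "\<lambda>x. indicat_real T x *\<^sub>R f x" and ?g = "\<lambda>x. indicat_real S x *\<^sub>R f x"
  have "AE x in lebesgue. x \<notin> T - S"
    using assms(4) by (intro AE_not_in) (simp add: negligible_iff_null_sets)
  then have ae: "AE x in lebesgue. ?f x = ?g x"
    by eventually_elim (use assms(3) in \<open>auto simp: indicator_def\<close>)
  have ae': "AE x in lebesgue. ?g x = ?f x" using ae by eventually_elim (rule sym)
  have "(\<integral>x. ?f x \<partial>lebesgue) = (\<integral>x. ?g x \<partial>lebesgue)"
  proof (cases "?f \<in> borel_measurable lebesgue")
    case True
    then show ?thesis using borel_measurable_AE[OF True ae] ae by (intro integral_cong_AE)
  next
    case False
    then have "?g \<notin> borel_measurable lebesgue" using borel_measurable_AE[OF _ ae'] by blast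
    then have n: "\<not> integrable lebesgue ?f" "\<not> integrable lebesgue ?g"
      using False borel_measurable_integrable[of lebesgue ?f] borel_measurable_integrable[of lebesgue ?g] by blast+
    show ?thesis by (simp only: not_integrable_integral_eq[OF n(1)] not_integrable_integral_eq[OF n(2)])
  qed
  then show ?thesis using assms(1,2) by (simp add: integral_restrict_space)
qed

section \<open>Traces and integration by parts on one simplex\<close>

context nsimplex
begin

lemma isCont_lam: "continuous_on UNIV (lam a)"
  unfolding lam_def by (intro continuous_intros)

lemma interior_K: "interior K = {x. \<forall>a\<in>C. 0 < lam a x}"
proof (intro equalityI subsetI CollectI ballI)
  fix x a assume x: "x \<in> interior K" and a: "a \<in> C"
  obtain e where e: "e > 0" "ball x e \<subseteq> K" using x mem_interior by blast
  \<comment> \<open>The step has half the radius as its length: it stays in the ball and lowers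
    \<open>lam a\<close> by a positive amount.\<close>
  define d where "d = e / (2 * norm (w a))"
  have d: "0 < d" using e w_nonzero[OF a] by (simp add: d_def)
  have "x - d *\<^sub>R w a \<in> ball x e" using e w_nonzero[OF a] by (simp add: dist_norm d_def)
  then have "0 \<le> lam a (x - d *\<^sub>R w a)" using e(2) a mem_K by blast
  also have "\<dots> = lam a x - d * (w a \<bullet> w a)" by (simp add: lam_def inner_diff_right)
  finally have "d * (w a \<bullet> w a) \<le> lam a x" by simp
  moreover have "0 < d * (w a \<bullet> w a)" using d w_nonzero[OF a] by (intro mult_pos_pos) simp_all
  ultimately show "0 < lam a x" by linarith
next
  fix x assume x: "x \<in> {x. \<forall>a\<in>C. 0 < lam a x}"
  have "open {x. \<forall>a\<in>C. 0 < lam a x}"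
  proof -
    have "{x. \<forall>a\<in>C. 0 < lam a x} = (\<Inter>a\<in>C. {x. 0 < lam a x})" by auto
    then show ?thesis using finite_vertices isCont_lam
      by (auto intro!: open_INT open_Collect_less continuous_on_const)
  qed
  moreover have "{x. \<forall>a\<in>C. 0 < lam a x} \<subseteq> K" by (auto simp: mem_K less_imp_le)
  ultimately show "x \<in> interior K" using x by (meson interior_maximal subsetD)
qed

lemma K_sets: "K \<in> sets lebesgue" "interior K \<in> sets lebesgue"
  using compact_K by (auto simp: compact_imp_closed)

lemma bounded_interior: "bounded (interior K)"
  using compact_imp_bounded[OF compact_K] bounded_subset interior_subset by blast

lemma negligible_boundary: "negligible (K - interior K)"
proof -
  have "convex K" unfolding hull by simp
  then have "negligible (frontier K)" by (rule negligible_convex_frontier)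
  moreover have "K - interior K \<subseteq> frontier K" using closure_subset by (auto simp: frontier_def)
  ultimately show ?thesis by (rule negligible_subset)
qed

lemma integral_interior: "(\<integral>x. f x \<partial>lebesgue_on K) = (\<integral>x. f x \<partial>lebesgue_on (interior K))"
  for f :: "real^'n \<Rightarrow> 'b::euclidean_space"
  by (rule integral_lebesgue_on_null_diff[OF K_sets(2,1) interior_subset negligible_boundary])

lemma integration_by_parts_smooth:
  assumes "smooth \<phi>" "smooth \<psi>"
  shows "(\<integral>x. (gradient \<phi> x \<bullet> v) * \<psi> x + \<phi> x * (gradient \<psi> x \<bullet> v) \<partial>lebesgue_on (interior K))
    = - (\<Sum>a\<in>C. (w a \<bullet> v / norm (w a)) * (\<integral>x. \<phi> x * \<psi> x \<partial>face_measure (face a)))"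
proof -
  have "((\<lambda>x. \<phi> x * \<psi> x) has_derivative (\<lambda>h. (\<phi> x *\<^sub>R gradient \<psi> x + \<psi> x *\<^sub>R gradient \<phi> x) \<bullet> h)) (at x)" for x
    using has_derivative_mult[OF smooth_derivative[OF assms(1)] smooth_derivative[OF assms(2)], of x]
    by (simp add: inner_add_left mult.commute)
  moreover have "continuous_on UNIV (\<lambda>x. \<phi> x *\<^sub>R gradient \<psi> x + \<psi> x *\<^sub>R gradient \<phi> x)"
    using assms by (intro continuous_intros smooth_continuous smooth_continuous_gradient)
  ultimately have "(\<integral>x. (\<phi> x *\<^sub>R gradient \<psi> x + \<psi> x *\<^sub>R gradient \<phi> x) \<bullet> v \<partial>lebesgue_on K)
      = - (\<Sum>a\<in>C. (w a \<bullet> v / norm (w a)) * (\<integral>x. \<phi> x * \<psi> x \<partial>face_measure (face a)))"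
    by (rule divergence)
  then show ?thesis by (simp add: integral_interior inner_add_left algebra_simps)
qed

lemma smooth_l2: "smooth \<phi> \<Longrightarrow> \<phi> \<in> l2 (lebesgue_on (interior K))"
  by (intro continuous_l2 smooth_continuous bounded_interior K_sets)

lemma smooth_gradient_l2: "smooth \<phi> \<Longrightarrow> gradient \<phi> \<in> l2 (lebesgue_on (interior K))"
  by (intro continuous_l2 smooth_continuous_gradient bounded_interior K_sets)

text \<open>A test function vanishes on every face, because a face contains no interior point; so no
  boundary term survives in the integration by parts.\<close>

lemma smooth_weak_gradient:
  assumes "smooth \<phi>" shows "weak_gradient (interior K) \<phi> (gradient \<phi>)"
proof -
  have "(\<integral>x. \<phi> x * gradient \<psi> x $ i \<partial>lebesgue_on (interior K)) = - (\<integral>x. \<psi> x * gradient \<phi> x $ i \<partial>lebesgue_on (interior K))"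
    if t: "test_function (interior K) \<psi>" for \<psi> i
  proof -
    have s: "smooth \<psi>" using t by (simp add: test_function_def)
    have int: "integrable (lebesgue_on (interior K)) (\<lambda>x. gradient \<phi> x $ i * \<psi> x)"
      "integrable (lebesgue_on (interior K)) (\<lambda>x. \<phi> x * gradient \<psi> x $ i)"
      using l2_inner_integrable[OF l2_nth[OF smooth_gradient_l2[OF assms], of i] smooth_l2[OF s]]
        l2_inner_integrable[OF smooth_l2[OF assms] l2_nth[OF smooth_gradient_l2[OF s], of i]] by simp_all
    have "(\<integral>x. \<phi> x * \<psi> x \<partial>face_measure (face a)) = 0" if a: "a \<in> C" for a
    proof (rule integral_eq_zero_AE)
      show "AE x in face_measure (face a). \<phi> x * \<psi> x = 0"
        using AE_face_measure[OF a]
      proof eventually_elim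
        case (elim x)
        then have "x \<notin> interior K" using a by (force simp: interior_K face_def)
        then have "\<psi> x = 0" using t closure_subset[of "{x. \<psi> x \<noteq> 0}"] by (auto simp: test_function_def)
        then show ?case by simp
      qed
    qed
    then have "(\<integral>x. gradient \<phi> x $ i * \<psi> x + \<phi> x * gradient \<psi> x $ i \<partial>lebesgue_on (interior K)) = 0"
      using integration_by_parts_smooth[OF assms s, of "axis i 1"] by (simp add: inner_axis)
    then show ?thesis using int by (simp add: mult.commute)
  qed
  then show ?thesis
    using smooth_l2[OF assms] smooth_gradient_l2[OF assms]
    by (auto simp: weak_gradient_iff[OF open_interior bounded_interior])
qed

lemma l2_lim_const: "l2_lim M (\<lambda>k. f) f"
  by (simp add: l2_lim_def l2_zero l2_norm_def)

lemma smooth_h1_lim: "smooth \<phi> \<Longrightarrow> h1_lim (interior K) (\<lambda>k. \<phi>) \<phi>"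
  unfolding h1_lim_def by (intro exI[of _ "gradient \<phi>"] conjI smooth_weak_gradient l2_lim_const)

lemma smooth_h1s: "smooth \<phi> \<Longrightarrow> \<phi> \<in> h1s (interior K)"
  unfolding h1s_def using smooth_h1_lim by (intro CollectI exI[of _ "\<lambda>k. \<phi>"]) simp

lemma smooth_is_trace: "smooth \<phi> \<Longrightarrow> is_trace (interior K) F \<phi> \<phi>"
  unfolding is_trace_def using smooth_h1_lim l2_lim_const by (intro exI[of _ "\<lambda>k. \<phi>"]) simp

text \<open>Divergence theorem for the field \<open>(\<phi> x)\<^sup>2 *\<^sub>R (x - a)\<close>. It
  is tangential on every face through \<open>a\<close>, and on the opposite face its flux density is
  \<open>(\<phi> x)\<^sup>2 / norm (w a)\<close>, since \<open>w a \<bullet> (x - a) = - 1\<close>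
  there. So the boundary integral is a multiple of the wanted one, and the divergence is bounded by
  Young's inequality.\<close>

lemma trace_inequality:
  assumes a: "a \<in> C"
  shows "\<exists>B\<ge>0. \<forall>\<phi>. smooth \<phi> \<longrightarrow> l2_norm (face_measure (face a)) \<phi>
    \<le> B * (l2_norm (lebesgue_on (interior K)) \<phi> + l2_norm (lebesgue_on (interior K)) (gradient \<phi>))"
proof -
  let ?M = "lebesgue_on (interior K)"
  obtain R0 where R0: "\<And>x. x \<in> K \<Longrightarrow> norm x \<le> R0"
    using compact_imp_bounded[OF compact_K] bounded_iff by metis
  define R where "R = \<bar>R0\<bar> + norm a"
  have R: "norm (x - a) \<le> R" if "x \<in> K" for x
    using R0[OF that] norm_triangle_ineq4[of x a] unfolding R_def by linarith
  have R_pos: "0 \<le> R" by (simp add: R_def)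
  \<comment> \<open>\<open>norm (w a)\<close> is the inverse height of \<open>a\<close> over its
    face, \<open>real CARD('n)\<close> the divergence of \<open>x - a\<close>, and \<open>R\<close>
    bounds its length.\<close>
  define B where "B = sqrt (norm (w a) * (real CARD('n) + R))"
  have B_sq: "B\<^sup>2 = norm (w a) * (real CARD('n) + R)" using R_pos by (simp add: B_def)
  have "l2_norm (face_measure (face a)) \<phi> \<le> B * (l2_norm ?M \<phi> + l2_norm ?M (gradient \<phi>))" if s: "smooth \<phi>" for \<phi>
  proof -
    define \<psi> where "\<psi> i x = (x $ i - a $ i) * (\<phi> x)\<^sup>2" for i x
    define D where "D i x = (\<phi> x)\<^sup>2 *\<^sub>R axis i 1 + (2 * (x $ i - a $ i) * \<phi> x) *\<^sub>R gradient \<phi> x" for i x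
    have cg: "continuous_on UNIV (gradient \<phi>)" "continuous_on UNIV \<phi>"
      using s smooth_continuous smooth_continuous_gradient by auto
    have D_cont: "continuous_on UNIV (D i)" for i unfolding D_def by (intro continuous_intros cg)
    have deriv: "(\<psi> i has_derivative (\<lambda>h. D i x \<bullet> h)) (at x)" for i x
      unfolding \<psi>_def D_def
      by (rule has_derivative_eq_rhs, (rule derivative_eq_intros smooth_derivative[OF s]
            bounded_linear.has_derivative[OF bounded_linear_vec_nth] refl)+)
        (auto simp: inner_add_left inner_axis' algebra_simps power2_eq_square)
    have div: "(\<integral>x. D i x \<bullet> axis i 1 \<partial>?M)
        = - (\<Sum>b\<in>C. (w b \<bullet> axis i 1 / norm (w b)) * (\<integral>x. \<psi> i x \<partial>face_measure (face b)))" for i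
      using divergence[OF deriv D_cont] integral_interior[of "\<lambda>x. D i x \<bullet> axis i 1"] by simp
    have \<psi>_cont: "continuous_on UNIV (\<psi> i)" for i unfolding \<psi>_def by (intro continuous_intros cg)
    have faces: "(\<Sum>i\<in>UNIV. (w b \<bullet> axis i 1) * (\<integral>x. \<psi> i x \<partial>face_measure (face b)))
        = (if b = a then - (\<integral>x. (\<phi> x)\<^sup>2 \<partial>face_measure (face a)) else 0)" if b: "b \<in> C" for b
    proof -
      have "(\<Sum>i\<in>UNIV. (w b \<bullet> axis i 1) * (\<integral>x. \<psi> i x \<partial>face_measure (face b)))
          = (\<integral>x. (\<Sum>i\<in>UNIV. w b $ i * \<psi> i x) \<partial>face_measure (face b))"
        using continuous_integrable_face[OF \<psi>_cont b] by (simp add: inner_axis)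
      also have "\<dots> = (\<integral>x. (if b = a then - (\<phi> x)\<^sup>2 else 0) \<partial>face_measure (face b))"
      proof (rule integral_cong_AE)
        show "AE x in face_measure (face b). (\<Sum>i\<in>UNIV. w b $ i * \<psi> i x) = (if b = a then - (\<phi> x)\<^sup>2 else 0)"
          using AE_face_measure[OF b]
        proof eventually_elim
          case (elim x)
          have "(\<Sum>i\<in>UNIV. w b $ i * \<psi> i x) = (w b \<bullet> (x - a)) * (\<phi> x)\<^sup>2"
            by (simp add: \<psi>_def inner_vec_def sum_distrib_right mult.assoc)
          also have "w b \<bullet> (x - a) = (if b = a then - 1 else 0)"
            using elim lam_vertex[OF b a] by (simp add: w_inner_diff face_def)
          finally show ?case by simp
        qed
        show "(\<lambda>x. \<Sum>i\<in>UNIV. w b $ i * \<psi> i x) \<in> borel_measurable (face_measure (face b))"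
          using borel_measurable_continuous_onI[OF \<psi>_cont] by (simp cong: measurable_cong_sets)
        show "(\<lambda>x. if b = a then - (\<phi> x)\<^sup>2 else 0) \<in> borel_measurable (face_measure (face b))"
          using borel_measurable_continuous_onI[OF cg(2)] by (simp cong: measurable_cong_sets)
      qed
      finally show ?thesis by simp
    qed
    have "(\<Sum>i\<in>UNIV. \<integral>x. D i x \<bullet> axis i 1 \<partial>?M)
        = - (\<Sum>b\<in>C. (1 / norm (w b)) * (\<Sum>i\<in>UNIV. (w b \<bullet> axis i 1) * (\<integral>x. \<psi> i x \<partial>face_measure (face b))))"
      unfolding div sum_negf by (subst sum.swap) (simp add: sum_distrib_left)
    also have "\<dots> = - (\<Sum>b\<in>C. if b = a then - (1 / norm (w a)) * (\<integral>x. (\<phi> x)\<^sup>2 \<partial>face_measure (face a)) else 0)"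
      using faces by (intro arg_cong[where f = uminus] sum.cong) auto
    also have "\<dots> = (1 / norm (w a)) * (\<integral>x. (\<phi> x)\<^sup>2 \<partial>face_measure (face a))"
      using a finite_vertices by simp
    finally have "(\<integral>x. (\<phi> x)\<^sup>2 \<partial>face_measure (face a)) = norm (w a) * (\<Sum>i\<in>UNIV. \<integral>x. D i x \<bullet> axis i 1 \<partial>?M)"
      using w_nonzero[OF a] by simp
    also have "(\<Sum>i\<in>UNIV. \<integral>x. D i x \<bullet> axis i 1 \<partial>?M) = (\<integral>x. (\<Sum>i\<in>UNIV. D i x \<bullet> axis i 1) \<partial>?M)"
    proof (rule Bochner_Integration.integral_sum[symmetric])
      fix i
      interpret finite_measure ?M by (intro finite_measure_lebesgue_on_bounded bounded_interior K_sets)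
      have "continuous_on UNIV (\<lambda>x. D i x \<bullet> axis i 1)" by (intro continuous_intros D_cont)
      then show "integrable ?M (\<lambda>x. D i x \<bullet> axis i 1)"
        by (intro l2_integrable continuous_l2 bounded_interior K_sets)
    qed
    also have "\<dots> \<le> (\<integral>x. (real CARD('n) + R) * ((norm (\<phi> x))\<^sup>2 + (norm (gradient \<phi> x))\<^sup>2) \<partial>?M)"
    proof (rule integral_mono_AE)
      show "AE x in ?M. (\<Sum>i\<in>UNIV. D i x \<bullet> axis i 1) \<le> (real CARD('n) + R) * ((norm (\<phi> x))\<^sup>2 + (norm (gradient \<phi> x))\<^sup>2)"
      proof (rule AE_I2)
        fix x assume "x \<in> space ?M"
        then have x: "x \<in> K" using interior_subset by auto
        have "(\<Sum>i\<in>UNIV. D i x \<bullet> axis i 1) = real CARD('n) * (\<phi> x)\<^sup>2 + 2 * \<phi> x * ((x - a) \<bullet> gradient \<phi> x)"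
        proof -
          have "D i x \<bullet> axis i 1 = (\<phi> x)\<^sup>2 + 2 * \<phi> x * ((x $ i - a $ i) * gradient \<phi> x $ i)" for i
            unfolding D_def inner_add_left inner_scaleR_left inner_axis_axis inner_axis by simp
          then show ?thesis by (simp add: sum.distrib inner_vec_def sum_distrib_left)
        qed
        also have "2 * \<phi> x * ((x - a) \<bullet> gradient \<phi> x) \<le> 2 * \<bar>\<phi> x\<bar> * (R * norm (gradient \<phi> x))"
        proof -
          have "\<bar>(x - a) \<bullet> gradient \<phi> x\<bar> \<le> norm (x - a) * norm (gradient \<phi> x)" by (rule Cauchy_Schwarz_ineq2)
          also have "\<dots> \<le> R * norm (gradient \<phi> x)" using R[OF x] by (intro mult_right_mono) auto
          finally have "\<bar>2 * \<phi> x * ((x - a) \<bullet> gradient \<phi> x)\<bar> \<le> 2 * \<bar>\<phi> x\<bar> * (R * norm (gradient \<phi> x))"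
            by (simp add: abs_mult mult_left_mono)
          then show ?thesis by linarith
        qed
        also have "2 * \<bar>\<phi> x\<bar> * (R * norm (gradient \<phi> x)) \<le> R * ((norm (\<phi> x))\<^sup>2 + (norm (gradient \<phi> x))\<^sup>2)"
          using mult_left_mono[OF sum_squares_bound[of "\<bar>\<phi> x\<bar>" "norm (gradient \<phi> x)"] R_pos]
          by (simp add: ac_simps)
        finally have "(\<Sum>i\<in>UNIV. D i x \<bullet> axis i 1) \<le> real CARD('n) * (\<phi> x)\<^sup>2 + R * ((norm (\<phi> x))\<^sup>2 + (norm (gradient \<phi> x))\<^sup>2)"
          by simp
        also have "\<dots> \<le> (real CARD('n) + R) * ((norm (\<phi> x))\<^sup>2 + (norm (gradient \<phi> x))\<^sup>2)"
          by (simp add: algebra_simps)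
        finally show "(\<Sum>i\<in>UNIV. D i x \<bullet> axis i 1) \<le> (real CARD('n) + R) * ((norm (\<phi> x))\<^sup>2 + (norm (gradient \<phi> x))\<^sup>2)" .
      qed
      show "integrable ?M (\<lambda>x. (real CARD('n) + R) * ((norm (\<phi> x))\<^sup>2 + (norm (gradient \<phi> x))\<^sup>2))"
        using smooth_l2[OF s] smooth_gradient_l2[OF s] by (simp add: l2_def)
      show "integrable ?M (\<lambda>x. \<Sum>i\<in>UNIV. D i x \<bullet> axis i 1)"
      proof (rule Bochner_Integration.integrable_sum)
        fix i
        interpret finite_measure ?M by (intro finite_measure_lebesgue_on_bounded bounded_interior K_sets)
        have "continuous_on UNIV (\<lambda>x. D i x \<bullet> axis i 1)" by (intro continuous_intros D_cont)
        then show "integrable ?M (\<lambda>x. D i x \<bullet> axis i 1)"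
          by (intro l2_integrable continuous_l2 bounded_interior K_sets)
      qed
    qed
    also have "\<dots> = (real CARD('n) + R) * ((l2_norm ?M \<phi>)\<^sup>2 + (l2_norm ?M (gradient \<phi>))\<^sup>2)"
      using smooth_l2[OF s] smooth_gradient_l2[OF s] by (simp add: l2_def l2_norm_def)
    finally have "(l2_norm (face_measure (face a)) \<phi>)\<^sup>2 \<le> B\<^sup>2 * ((l2_norm ?M \<phi>)\<^sup>2 + (l2_norm ?M (gradient \<phi>))\<^sup>2)"
      using mult_left_mono[OF _ norm_ge_zero[of "w a"]] by (simp add: B_sq l2_norm_def mult.assoc)
    also have "\<dots> \<le> B\<^sup>2 * (l2_norm ?M \<phi> + l2_norm ?M (gradient \<phi>))\<^sup>2"
      by (intro mult_left_mono) (simp_all add: power2_sum l2_norm_nonneg)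
    also have "\<dots> = (B * (l2_norm ?M \<phi> + l2_norm ?M (gradient \<phi>)))\<^sup>2" by (simp add: power_mult_distrib)
    finally show ?thesis
      by (rule power2_le_imp_le) (simp add: B_def l2_norm_nonneg R_pos)
  qed
  moreover have "0 \<le> B" using R_pos by (simp add: B_def)
  ultimately show ?thesis by blast
qed

lemma l2_norm_triangle_sub:
  assumes "(\<lambda>x. f x - h x) \<in> l2 M" "(\<lambda>x. g x - h x) \<in> l2 M"
  shows "l2_norm M (\<lambda>x. f x - g x) \<le> l2_norm M (\<lambda>x. f x - h x) + l2_norm M (\<lambda>x. g x - h x)"
  using l2_norm_triangle_diff[OF assms] by simp

text \<open>By the trace inequality for differences the restrictions to the face form a Cauchy
  sequence. The limit belongs to the given sequence, which allows one sequence to serve all faces of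
  an element, and several elements at once.\<close>

lemma h1_lim_trace_exists:
  assumes a: "a \<in> C" and sm: "\<And>k. smooth (\<phi> k)" and lim: "h1_lim (interior K) \<phi> f"
  shows "\<exists>g. l2_lim (face_measure (face a)) \<phi> g"
proof -
  let ?M = "lebesgue_on (interior K)" and ?F = "face_measure (face a)"
  interpret finite_measure ?F using a by (rule face_measure_finite)
  obtain B where B: "0 \<le> B" "\<And>\<phi>. smooth \<phi> \<Longrightarrow> l2_norm ?F \<phi> \<le> B * (l2_norm ?M \<phi> + l2_norm ?M (gradient \<phi>))"
    using trace_inequality[OF a] by blast
  note lims = h1_lim_gradient[OF open_interior bounded_interior lim]
  let ?e = "\<lambda>k. l2_norm ?M (\<lambda>x. \<phi> k x - f x) + l2_norm ?M (\<lambda>x. gradient (\<phi> k) x - wgrad (interior K) f x)"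
  have e_lim: "?e \<longlonglongrightarrow> 0 + 0" using lims by (intro tendsto_add) (auto simp: l2_lim_def)
  have le: "l2_norm ?F (\<lambda>x. \<phi> m x - \<phi> k x) \<le> B * (?e m + ?e k)" for m k
  proof -
    have g: "gradient (\<lambda>x. \<phi> m x - \<phi> k x) = (\<lambda>x. gradient (\<phi> m) x - gradient (\<phi> k) x)"
      using gradient_combine[OF smooth_differentiable[OF sm[of m]] smooth_differentiable[OF sm[of k]], where c = "-1"] by auto
    have "smooth (\<lambda>x. \<phi> m x - \<phi> k x)" using smooth_combine[OF sm[of m] sm[of k], where c = "-1"] by simp
    from B(2)[OF this] have "l2_norm ?F (\<lambda>x. \<phi> m x - \<phi> k x)
        \<le> B * (l2_norm ?M (\<lambda>x. \<phi> m x - \<phi> k x) + l2_norm ?M (\<lambda>x. gradient (\<phi> m) x - gradient (\<phi> k) x))"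
      by (simp only: g)
    also have "\<dots> \<le> B * (?e m + ?e k)"
    proof (rule mult_left_mono[OF _ B(1)])
      have "(\<lambda>x. \<phi> k x - f x) \<in> l2 ?M" "(\<lambda>x. gradient (\<phi> k) x - wgrad (interior K) f x) \<in> l2 ?M" for k
        using lims by (auto simp: l2_lim_def)
      then show "l2_norm ?M (\<lambda>x. \<phi> m x - \<phi> k x) + l2_norm ?M (\<lambda>x. gradient (\<phi> m) x - gradient (\<phi> k) x) \<le> ?e m + ?e k"
        using l2_norm_triangle_sub[of "\<phi> m" f ?M "\<phi> k"]
          l2_norm_triangle_sub[of "gradient (\<phi> m)" "wgrad (interior K) f" ?M "gradient (\<phi> k)"] by simp
    qed
    finally show ?thesis .
  qed
  show ?thesis
  proof (rule l2_complete)
    show "\<phi> k \<in> l2 ?F" for k by (intro continuous_l2_face smooth_continuous sm a)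
    fix e :: real assume e: "0 < e"
    \<comment> \<open>\<open>B\<close> may be 0; adding 1 keeps the quotient meaningful.\<close>
    define d where "d = e / (2 * (B + 1))"
    have d: "0 < d" using e B(1) by (simp add: d_def)
    obtain N where N: "\<And>k. k \<ge> N \<Longrightarrow> ?e k < d"
      using LIMSEQ_D[OF e_lim d] by (auto simp: abs_less_iff)
    have "l2_norm ?F (\<lambda>x. \<phi> m x - \<phi> k x) < e" if "m \<ge> N" "k \<ge> N" for m k
    proof -
      have "B * (?e m + ?e k) \<le> B * (d + d)" using N[OF that(1)] N[OF that(2)] B(1) by (intro mult_left_mono) auto
      also have "\<dots> < (B + 1) * (d + d)" using d by (intro mult_strict_right_mono) auto
      also have "2 * (B + 1) * d = e"
      proof -
        have "2 * (B + 1) \<noteq> 0" using B(1) by simp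
        then show ?thesis unfolding d_def by (metis nonzero_mult_div_cancel_left times_divide_eq_right)
      qed
      then have "(B + 1) * (d + d) = e" by (simp add: algebra_simps)
      finally show ?thesis using le[of m k] by linarith
    qed
    then show "\<exists>N. \<forall>m\<ge>N. \<forall>k\<ge>N. l2_norm ?F (\<lambda>x. \<phi> m x - \<phi> k x) < e" by blast
  qed
qed

text \<open>The difference of the two sequences tends to 0 together with its gradient, since the
  weak gradient of 0 is 0 almost everywhere. By the trace inequality its restriction to the face
  tends to 0 as well.\<close>

lemma trace_unique:
  assumes a: "a \<in> C" and sm: "\<And>k. smooth (\<phi> k)" "\<And>k. smooth (\<psi> k)"
    and lim: "h1_lim (interior K) \<phi> f" "h1_lim (interior K) \<psi> f"
    and tr: "l2_lim (face_measure (face a)) \<phi> s" "l2_lim (face_measure (face a)) \<psi> t"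
  shows "AE x in face_measure (face a). s x = t x"
proof -
  let ?M = "lebesgue_on (interior K)" and ?F = "face_measure (face a)"
  obtain B where B: "0 \<le> B" "\<And>\<phi>. smooth \<phi> \<Longrightarrow> l2_norm ?F \<phi> \<le> B * (l2_norm ?M \<phi> + l2_norm ?M (gradient \<phi>))"
    using trace_inequality[OF a] by blast
  note U = open_interior bounded_interior
  let ?d = "\<lambda>k x. \<phi> k x + (-1) * \<psi> k x"
  have sd: "smooth (?d k)" for k by (intro smooth_combine sm)
  have "h1_lim (interior K) ?d (\<lambda>x. f x + (-1) * f x)" by (rule h1_lim_combine[OF U sm lim])
  then have h: "h1_lim (interior K) ?d (\<lambda>x. 0)" by simp
  have w0: "weak_gradient (interior K) (\<lambda>x. 0) (\<lambda>x. 0)"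
    by (simp add: weak_gradient_def l2_zero)
  have z: "AE x in ?M. wgrad (interior K) (\<lambda>x. 0) x = 0" by (rule wgrad_AE[OF U w0])
  have g: "l2_lim ?M (\<lambda>k. gradient (?d k)) (\<lambda>x. 0)"
    using h1_lim_gradient(2)[OF U h] z
    by (rule l2_lim_cong_AE) (use h1_lim_weak_gradient[OF h] in \<open>auto simp: weak_gradient_def l2_def\<close>)
  have "(\<lambda>k. B * (l2_norm ?M (?d k) + l2_norm ?M (gradient (?d k)))) \<longlonglongrightarrow> B * (0 + 0)"
    using g h1_lim_gradient(1)[OF U h] by (intro tendsto_intros) (auto simp: l2_lim_def)
  then have lim0: "(\<lambda>k. l2_norm ?F (?d k)) \<longlonglongrightarrow> 0"
    using B(2)[OF sd]
    by - (rule tendsto_sandwich[of "\<lambda>_. 0" _ sequentially "\<lambda>k. B * (l2_norm ?M (?d k) + l2_norm ?M (gradient (?d k)))"],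
        simp_all add: l2_norm_nonneg)
  have "?d k \<in> l2 ?F" for k by (intro continuous_l2_face smooth_continuous sd a)
  then have "l2_lim ?F ?d (\<lambda>x. 0)" using lim0 by (simp add: l2_lim_def)
  moreover have "l2_lim ?F ?d (\<lambda>x. s x + (-1) * t x)" using l2_lim_combine[OF tr, of "-1"] by simp
  ultimately have "AE x in ?F. 0 = s x + (-1) * t x" by (rule l2_lim_unique)
  then show ?thesis by eventually_elim simp
qed

lemma is_trace_exists:
  assumes "a \<in> C" "f \<in> h1s (interior K)" shows "\<exists>g. is_trace (interior K) (face a) f g"
proof -
  obtain \<phi> where \<phi>: "\<And>k. smooth (\<phi> k)" "h1_lim (interior K) \<phi> f" using assms(2) by (auto simp: h1s_def)
  obtain g where "l2_lim (face_measure (face a)) \<phi> g" using h1_lim_trace_exists[OF assms(1) \<phi>] by blast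
  then show ?thesis using \<phi> unfolding is_trace_def by (intro exI[of _ g] exI[of _ \<phi>]) simp
qed

lemma is_trace_unique:
  assumes "a \<in> C" "is_trace (interior K) (face a) f s" "is_trace (interior K) (face a) f t"
  shows "AE x in face_measure (face a). s x = t x"
proof -
  obtain \<phi> \<psi> where "\<And>k. smooth (\<phi> k)" "h1_lim (interior K) \<phi> f" "l2_lim (face_measure (face a)) \<phi> s"
    "\<And>k. smooth (\<psi> k)" "h1_lim (interior K) \<psi> f" "l2_lim (face_measure (face a)) \<psi> t"
    using assms(2,3) by (auto simp: is_trace_def)
  then show ?thesis by (intro trace_unique[OF assms(1), of \<phi> \<psi> f])
qed

lemma is_trace_l2:
  assumes "a \<in> C" "is_trace (interior K) (face a) f s" shows "s \<in> l2 (face_measure (face a))"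
proof -
  obtain \<phi> where \<phi>: "\<And>k. smooth (\<phi> k)" "l2_lim (face_measure (face a)) \<phi> s"
    using assms(2) by (auto simp: is_trace_def)
  show ?thesis by (rule l2_lim_l2[OF \<phi>(2)]) (intro continuous_l2_face smooth_continuous \<phi>(1) assms(1))
qed

lemma integration_by_parts:
  assumes f: "f \<in> h1s (interior K)" and q: "smooth q"
    and tr: "\<And>a. a \<in> C \<Longrightarrow> is_trace (interior K) (face a) f (t a)"
  shows "(\<integral>x. (wgrad (interior K) f x \<bullet> v) * q x + f x * (gradient q x \<bullet> v) \<partial>lebesgue_on (interior K))
    = - (\<Sum>a\<in>C. (w a \<bullet> v / norm (w a)) * (\<integral>x. t a x * q x \<partial>face_measure (face a)))"
proof -
  let ?M = "lebesgue_on (interior K)"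
  note U = open_interior bounded_interior
  obtain \<phi> where \<phi>: "\<And>k. smooth (\<phi> k)" "h1_lim (interior K) \<phi> f" using f by (auto simp: h1s_def)
  note lims = h1_lim_gradient[OF U \<phi>(2)]
  have qv: "(\<lambda>x. q x *\<^sub>R v) \<in> l2 ?M" "(\<lambda>x. gradient q x \<bullet> v) \<in> l2 ?M"
    by (intro continuous_l2 bounded_interior K_sets continuous_on_scaleR continuous_on_inner continuous_on_const
        smooth_continuous smooth_continuous_gradient q)+
  have wl: "weak_gradient (interior K) f (wgrad (interior K) f)" using f by (rule h1s_weak_gradient)
  have int: "integrable ?M (\<lambda>x. (G x \<bullet> v) * q x)" "integrable ?M (\<lambda>x. g x * (gradient q x \<bullet> v))"
    if "G \<in> l2 ?M" "g \<in> l2 ?M" for G and g :: "real^'n \<Rightarrow> real"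
    using l2_inner_integrable[OF that(1) qv(1)] l2_inner_integrable[OF that(2) qv(2)] by (simp_all add: mult.commute)
  have "(\<lambda>k. \<integral>x. gradient (\<phi> k) x \<bullet> (q x *\<^sub>R v) \<partial>?M) \<longlonglongrightarrow> (\<integral>x. wgrad (interior K) f x \<bullet> (q x *\<^sub>R v) \<partial>?M)"
    by (rule l2_lim_inner[OF lims(2) smooth_gradient_l2[OF \<phi>(1)] qv(1)])
  moreover have "(\<lambda>k. \<integral>x. \<phi> k x \<bullet> (gradient q x \<bullet> v) \<partial>?M) \<longlonglongrightarrow> (\<integral>x. f x \<bullet> (gradient q x \<bullet> v) \<partial>?M)"
    by (rule l2_lim_inner[OF lims(1) smooth_l2[OF \<phi>(1)] qv(2)])
  ultimately have "(\<lambda>k. (\<integral>x. gradient (\<phi> k) x \<bullet> (q x *\<^sub>R v) \<partial>?M) + (\<integral>x. \<phi> k x \<bullet> (gradient q x \<bullet> v) \<partial>?M))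
      \<longlonglongrightarrow> (\<integral>x. wgrad (interior K) f x \<bullet> (q x *\<^sub>R v) \<partial>?M) + (\<integral>x. f x \<bullet> (gradient q x \<bullet> v) \<partial>?M)"
    by (rule tendsto_add)
  moreover have "(\<integral>x. gradient (\<phi> k) x \<bullet> (q x *\<^sub>R v) \<partial>?M) + (\<integral>x. \<phi> k x \<bullet> (gradient q x \<bullet> v) \<partial>?M)
      = - (\<Sum>a\<in>C. (w a \<bullet> v / norm (w a)) * (\<integral>x. \<phi> k x * q x \<partial>face_measure (face a)))" for k
    using integration_by_parts_smooth[OF \<phi>(1)[of k] q, of v] int[OF smooth_gradient_l2[OF \<phi>(1)[of k]] smooth_l2[OF \<phi>(1)[of k]]]
    by (simp add: mult.commute)
  moreover have "(\<integral>x. wgrad (interior K) f x \<bullet> (q x *\<^sub>R v) \<partial>?M) + (\<integral>x. f x \<bullet> (gradient q x \<bullet> v) \<partial>?M)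
      = (\<integral>x. (wgrad (interior K) f x \<bullet> v) * q x + f x * (gradient q x \<bullet> v) \<partial>?M)"
    using int[of "wgrad (interior K) f" f] wl by (simp add: weak_gradient_def mult.commute)
  moreover have "(\<lambda>k. - (\<Sum>a\<in>C. (w a \<bullet> v / norm (w a)) * (\<integral>x. \<phi> k x * q x \<partial>face_measure (face a))))
      \<longlonglongrightarrow> - (\<Sum>a\<in>C. (w a \<bullet> v / norm (w a)) * (\<integral>x. t a x * q x \<partial>face_measure (face a)))"
  proof (intro tendsto_minus tendsto_sum tendsto_mult tendsto_const)
    fix a assume a: "a \<in> C"
    \<comment> \<open>The trace on this face may stem from another approximating sequence;
      \<open>trace_unique\<close> moves it to the sequence used for the volume terms.\<close>
    obtain \<psi> where \<psi>: "\<And>k. smooth (\<psi> k)" "h1_lim (interior K) \<psi> f" "l2_lim (face_measure (face a)) \<psi> (t a)"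
      using tr[OF a] by (auto simp: is_trace_def)
    obtain s where s: "l2_lim (face_measure (face a)) \<phi> s" using h1_lim_trace_exists[OF a \<phi>] by blast
    have \<phi>F: "\<phi> k \<in> l2 (face_measure (face a))" for k by (intro continuous_l2_face smooth_continuous \<phi>(1) a)
    have "AE x in face_measure (face a). s x = t a x" by (rule trace_unique[OF a \<phi>(1) \<psi>(1) \<phi>(2) \<psi>(2) s \<psi>(3)])
    then have "l2_lim (face_measure (face a)) \<phi> (t a)"
      by (rule l2_lim_cong_AE[OF s]) (use l2_lim_l2[OF s \<phi>F] is_trace_l2[OF a tr[OF a]] in \<open>auto simp: l2_def\<close>)
    from l2_lim_inner[OF this \<phi>F continuous_l2_face[OF smooth_continuous[OF q] a]]
    show "(\<lambda>k. \<integral>x. \<phi> k x * q x \<partial>face_measure (face a)) \<longlonglongrightarrow> (\<integral>x. t a x * q x \<partial>face_measure (face a))" by simp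
  qed
  ultimately show ?thesis using LIMSEQ_unique by simp blast
qed

section \<open>Unit normals of the faces of a simplex\<close>

lemma vertex_other: assumes "a \<in> C" obtains b where "b \<in> C" "b \<noteq> a"
  using card_vertices_ge_2 assms finite_vertices
  by (metis card_1_singleton_iff card_le_Suc0_iff_eq not_less_eq_eq numeral_2_eq_2)

lemma vertex_mem: "b \<in> C \<Longrightarrow> b \<in> K" "\<lbrakk>a \<in> C; b \<in> C; b \<noteq> a\<rbrakk> \<Longrightarrow> b \<in> face a"
  using lam_vertex by (auto simp: mem_K face_def)

text \<open>With \<open>t\<close> the value of \<open>\<nu>\<close> on the edge from
  \<open>b0\<close> to \<open>a\<close>, the vector \<open>\<nu> - t *\<^sub>R w a\<close>
  annihilates all edges at \<open>b0\<close>: those inside the face because both vectors do, the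
  remaining one by the choice of \<open>t\<close>. Edges span, so it is 0.\<close>

lemma normal_cases:
  assumes a: "a \<in> C" and \<nu>: "norm \<nu> = 1" "\<And>x y. \<lbrakk>x \<in> face a; y \<in> face a\<rbrakk> \<Longrightarrow> \<nu> \<bullet> (x - y) = 0"
  shows "\<nu> = - (1 / norm (w a)) *\<^sub>R w a \<or> \<nu> = (1 / norm (w a)) *\<^sub>R w a"
proof -
  obtain b0 where b0: "b0 \<in> C" "b0 \<noteq> a" using vertex_other[OF a] .
  define t where "t = \<nu> \<bullet> (a - b0)"
  have "(\<nu> - t *\<^sub>R w a) \<bullet> (b - b0) = 0" if b: "b \<in> C" for b
  proof (cases "b = a")
    case True
    then show ?thesis using lam_vertex[OF a a] lam_vertex[OF a b0(1)] b0
      by (simp add: t_def inner_diff_left w_inner_diff)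
  next
    case False
    have "\<nu> \<bullet> (b - b0) = 0" using \<nu>(2)[OF vertex_mem(2)[OF a b False] vertex_mem(2)[OF a b0]] .
    then show ?thesis using lam_vertex[OF a b] lam_vertex[OF a b0(1)] b0 False
      by (simp add: inner_diff_left w_inner_diff)
  qed
  moreover have "y = (\<Sum>b\<in>C. lam b (y + b0) *\<^sub>R (b - b0))" for y
    using lam_expand[of "y + b0"] lam_sum[of "y + b0"]
    by (simp add: scaleR_diff_right sum_subtractf scaleR_sum_left[symmetric])
  ultimately have "(\<nu> - t *\<^sub>R w a) \<bullet> y = 0" for y
    by (metis (no_types, lifting) inner_scaleR_right inner_sum_right mult_zero_right sum.neutral)
  from this[of "\<nu> - t *\<^sub>R w a"] have eq: "\<nu> = t *\<^sub>R w a" by simp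
  have "\<bar>t\<bar> * norm (w a) = 1" using \<nu>(1) eq by (metis norm_scaleR)
  then have "\<bar>t\<bar> = 1 / norm (w a)" using w_nonzero[OF a] by (simp add: field_simps)
  then have "t = - (1 / norm (w a)) \<or> t = 1 / norm (w a)" by linarith
  then show ?thesis using eq by auto
qed

lemma normal_inner:
  "a \<in> C \<Longrightarrow> y \<in> face a \<Longrightarrow> (- (1 / norm (w a)) *\<^sub>R w a) \<bullet> (x - y) = - lam a x / norm (w a)"
  by (simp add: w_inner_diff face_def)

lemma outward_normal:
  assumes a: "a \<in> C" and \<nu>: "norm \<nu> = 1" "\<And>x y. \<lbrakk>x \<in> K; y \<in> face a\<rbrakk> \<Longrightarrow> \<nu> \<bullet> (x - y) \<le> 0"
  shows "\<nu> = - (1 / norm (w a)) *\<^sub>R w a"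
proof -
  obtain b0 where b0: "b0 \<in> C" "b0 \<noteq> a" using vertex_other[OF a] .
  have "\<nu> \<bullet> (x - y) = 0" if "x \<in> face a" "y \<in> face a" for x y
    using \<nu>(2)[of x y] \<nu>(2)[of y x] that by (auto simp: face_def inner_diff_right)
  then have "\<nu> = - (1 / norm (w a)) *\<^sub>R w a \<or> \<nu> = (1 / norm (w a)) *\<^sub>R w a"
    using normal_cases[OF a \<nu>(1)] by blast
  moreover have "\<nu> \<noteq> (1 / norm (w a)) *\<^sub>R w a"
  proof
    assume "\<nu> = (1 / norm (w a)) *\<^sub>R w a"
    then have "\<nu> \<bullet> (a - b0) = 1 / norm (w a)"
      using lam_vertex[OF a a] lam_vertex[OF a b0(1)] b0 by (simp add: w_inner_diff)
    then show False using \<nu>(2)[OF vertex_mem(1)[OF a] vertex_mem(2)[OF a b0]] w_nonzero[OF a] by simp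
  qed
  ultimately show ?thesis by blast
qed

text \<open>A segment from the vertex \<open>b\<close> to a relative interior point can be prolonged
  a little within the face. At the prolonged point the coordinate of \<open>b\<close> is
  \<open>(1 - e) + e * lam b x\<close> with \<open>e > 1\<close>, and it is still
  nonnegative.\<close>

lemma rel_interior_face_pos:
  assumes a: "a \<in> C" and x: "x \<in> rel_interior (face a)" and b: "b \<in> C" "b \<noteq> a"
  shows "0 < lam b x"
proof -
  have "convex (face a)" by (simp add: face_eq_hull[OF a])
  then obtain e where e: "e > 1" "(1 - e) *\<^sub>R b + e *\<^sub>R x \<in> face a"
    using convex_rel_interior_if[OF _ x] hull_subset[of "face a" affine] vertex_mem(2)[OF a b] by blast
  have "lam b ((1 - e) *\<^sub>R b + e *\<^sub>R x) = (1 - e) * lam b b + e * lam b x"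
    by (simp add: lam_def inner_add_right algebra_simps)
  then have "0 \<le> (1 - e) + e * lam b x" using e(2) b lam_vertex[OF b(1) b(1)] by (auto simp: face_def mem_K)
  then have "0 < e * lam b x" using e(1) by linarith
  then show ?thesis using e(1) by (simp add: zero_less_mult_iff)
qed

text \<open>Going inwards, the coordinate of \<open>a\<close> grows linearly from 0, while the
  others start positive and stay so for a short time by continuity.\<close>

lemma inner_points:
  assumes a: "a \<in> C" and x: "x \<in> rel_interior (face a)"
  shows "\<exists>e>0. \<forall>t. 0 < t \<and> t < e \<longrightarrow> x - t *\<^sub>R (- (1 / norm (w a)) *\<^sub>R w a) \<in> interior K"
proof -
  let ?\<nu> = "- (1 / norm (w a)) *\<^sub>R w a"
  have xF: "x \<in> face a" using x rel_interior_subset by blast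
  have "\<forall>\<^sub>F t in at_right 0. 0 < lam b (x - t *\<^sub>R ?\<nu>)" if b: "b \<in> C" for b
  proof (cases "b = a")
    case True
    have "0 < lam b (x - t *\<^sub>R ?\<nu>)" if t: "0 < t" for t
    proof -
      have "lam a (x - t *\<^sub>R ?\<nu>) = lam a x + t * norm (w a)"
        using w_nonzero[OF a] by (simp add: lam_def inner_diff_right inner_add_right dot_square_norm power2_eq_square)
      then show ?thesis using True xF t w_nonzero[OF a] by (simp add: face_def)
    qed
    then show ?thesis by (auto simp: eventually_at_filter)
  next
    case False
    have "((\<lambda>t. lam b (x - t *\<^sub>R ?\<nu>)) \<longlongrightarrow> lam b (x - 0 *\<^sub>R ?\<nu>)) (at_right 0)"
      unfolding lam_def by (intro tendsto_intros)
    then show ?thesis using rel_interior_face_pos[OF a x b False] by (intro order_tendstoD(1)) auto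
  qed
  then have "\<forall>\<^sub>F t in at_right 0. \<forall>b\<in>C. 0 < lam b (x - t *\<^sub>R ?\<nu>)"
    using finite_vertices by (simp add: eventually_ball_finite)
  then obtain e where "e > 0" "\<And>t. \<lbrakk>0 < t; t < e\<rbrakk> \<Longrightarrow> \<forall>b\<in>C. 0 < lam b (x - t *\<^sub>R ?\<nu>)"
    by (auto simp: eventually_at_right_field)
  then show ?thesis by (intro exI[of _ e]) (auto simp: interior_K)
qed

end

lemma face_trace_inner:
  "b \<in> Basis \<Longrightarrow> face_trace U F v x \<bullet> b = (SOME g. is_trace U F (\<lambda>y. v y \<bullet> b) g) x"
  by (simp add: face_trace_def inner_sum_left_Basis)

lemma face_trace_is_trace:
  assumes "b \<in> Basis" "\<exists>g. is_trace U F (\<lambda>y. v y \<bullet> b) g"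
  shows "is_trace U F (\<lambda>y. v y \<bullet> b) (\<lambda>x. face_trace U F v x \<bullet> b)"
  using someI_ex[OF assms(2)] by (simp add: face_trace_inner[OF assms(1)])

section \<open>Piecewise polynomials\<close>

abbreviation multi_indices :: "int \<Rightarrow> ('n::finite \<Rightarrow> nat) set" where
  "multi_indices k \<equiv> {\<alpha>. int (\<Sum>i\<in>UNIV. \<alpha> i) \<le> k}"

definition monomial :: "('n \<Rightarrow> nat) \<Rightarrow> real^'n \<Rightarrow> real" where
  "monomial \<alpha> x = (\<Prod>i\<in>UNIV. (x $ i) ^ \<alpha> i)"

lemma finite_multi_indices: "finite (multi_indices k :: ('n::finite \<Rightarrow> nat) set)"
proof (rule finite_subset)
  show "multi_indices k \<subseteq> (\<Pi>\<^sub>E i\<in>(UNIV :: 'n set). {..nat k})"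
  proof
    fix \<alpha> :: "'n \<Rightarrow> nat" assume \<alpha>: "\<alpha> \<in> multi_indices k"
    have "\<alpha> i \<le> nat k" for i
    proof -
      have "\<alpha> i \<le> (\<Sum>i\<in>UNIV. \<alpha> i)" by (rule member_le_sum) auto
      then have "int (\<alpha> i) \<le> int (\<Sum>i\<in>UNIV. \<alpha> i)" by (simp only: of_nat_le_iff)
      then have "int (\<alpha> i) \<le> k" using \<alpha> unfolding mem_Collect_eq by linarith
      then show ?thesis by linarith
    qed
    then show "\<alpha> \<in> (\<Pi>\<^sub>E i\<in>(UNIV :: 'n set). {..nat k})" by auto
  qed
qed (intro finite_PiE, auto)

lemma polynomials_eq_fspan: "polynomials k = fspan (multi_indices k) monomial"
  by (auto simp: polynomials_def fspan_def monomial_def)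

lemma polynomials_zero: "(\<lambda>x. 0) \<in> polynomials k"
  unfolding polynomials_eq_fspan by (rule fspan_zero)

lemma polynomials_combine: "\<lbrakk>p \<in> polynomials k; q \<in> polynomials k\<rbrakk> \<Longrightarrow> (\<lambda>x. p x + c * q x) \<in> polynomials k"
  unfolding polynomials_eq_fspan using fspan_diff_scale[of p _ _ q c] by simp

lemma polynomials_add: "\<lbrakk>p \<in> polynomials k; q \<in> polynomials k\<rbrakk> \<Longrightarrow> (\<lambda>x. p x + q x) \<in> polynomials k"
  using polynomials_combine[of p k q 1] by simp

lemma polynomials_scale: "p \<in> polynomials k \<Longrightarrow> (\<lambda>x. c * p x) \<in> polynomials k"
  using polynomials_combine[OF polynomials_zero, of p k c] by simp

lemma polynomials_sum:
  "(\<And>i. i \<in> I \<Longrightarrow> p i \<in> polynomials k) \<Longrightarrow> (\<lambda>x. \<Sum>i\<in>I. p i x) \<in> polynomials k"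
  by (induction I rule: infinite_finite_induct) (auto intro: polynomials_zero polynomials_add)

lemma fspan_generator:
  assumes "finite I" "i \<in> I" shows "e i \<in> fspan I e"
proof -
  have "(\<Sum>j\<in>I. (if j = i then 1 else 0) *\<^sub>R e j x) = e i x" for x
  proof -
    have "(\<Sum>j\<in>I. (if j = i then 1 else 0) *\<^sub>R e j x) = (\<Sum>j\<in>I. if j = i then e j x else 0)"
      by (intro sum.cong) auto
    then show ?thesis using assms by simp
  qed
  then have "e i = (\<lambda>x. \<Sum>j\<in>I. (if j = i then 1 else 0) *\<^sub>R e j x)" by auto
  also have "\<dots> \<in> fspan I e" by (rule fspanI)
  finally show ?thesis .
qed

lemma monomial_mem: "\<alpha> \<in> multi_indices k \<Longrightarrow> monomial \<alpha> \<in> polynomials k"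
  unfolding polynomials_eq_fspan by (rule fspan_generator[OF finite_multi_indices])

lemma polynomials_subset_closed:
  assumes "\<And>\<alpha>. \<alpha> \<in> multi_indices k \<Longrightarrow> monomial \<alpha> \<in> V" "(\<lambda>x. 0) \<in> V"
    and "\<And>v w. \<lbrakk>v \<in> V; w \<in> V\<rbrakk> \<Longrightarrow> (\<lambda>x. v x + w x) \<in> V"
    and "\<And>v c. v \<in> V \<Longrightarrow> (\<lambda>x. c *\<^sub>R v x) \<in> V"
  shows "polynomials k \<subseteq> V"
  unfolding polynomials_eq_fspan by (rule fspan_closed[OF finite_multi_indices assms]) auto

lemma polynomials_mono: assumes "k \<le> k'" shows "polynomials k \<subseteq> polynomials k'"
proof (rule polynomials_subset_closed)
  show "monomial \<alpha> \<in> polynomials k'" if "\<alpha> \<in> multi_indices k" for \<alpha> :: "'a \<Rightarrow> nat"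
    using that assms by (intro monomial_mem) auto
qed (auto intro: polynomials_zero polynomials_add polynomials_scale)

lemma monomial_smooth: "smooth (monomial \<alpha>)"
proof -
  have "elementary (\<lambda>x. \<Prod>i\<in>UNIV. (x $ i) ^ \<alpha> i)"
    by (intro elementary_prod elementary_power elementary.coord)
  then show ?thesis by (simp add: monomial_def[abs_def] elementary_smooth)
qed

lemma smooth_zero: "smooth (\<lambda>x. 0)"
  by (intro elementary_smooth elementary.const)

lemma smooth_add: "\<lbrakk>smooth f; smooth g\<rbrakk> \<Longrightarrow> smooth (\<lambda>x. f x + g x)"
  using smooth_combine[of f g 1] by simp

lemma smooth_scale: "smooth f \<Longrightarrow> smooth (\<lambda>x. c * f x)"
  using smooth_combine[OF smooth_zero, of f c] by simp

lemma polynomials_smooth: assumes "p \<in> polynomials k" shows "smooth p"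
proof -
  have "polynomials k \<subseteq> Collect smooth"
    by (rule polynomials_subset_closed) (simp_all add: monomial_smooth smooth_zero smooth_add smooth_scale)
  then show ?thesis using assms by blast
qed

lemma gradient_nth_eqI:
  fixes f :: "real^'n \<Rightarrow> real"
  assumes "smooth f" "((\<lambda>t. f (x + t *\<^sub>R axis i 1)) has_real_derivative D) (at 0)"
  shows "gradient f x $ i = D"
proof -
  have "((\<lambda>t. x + t *\<^sub>R axis i 1) has_derivative (\<lambda>h. h *\<^sub>R axis i 1)) (at 0)"
    by (auto intro!: derivative_eq_intros)
  from has_derivative_compose[OF this smooth_derivative[OF assms(1)]]
  have "((\<lambda>t. f (x + t *\<^sub>R axis i 1)) has_real_derivative (gradient f x $ i)) (at 0)"
    by (simp add: has_field_derivative_def mult_commute_abs inner_axis)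
  then show ?thesis using assms(2) by (rule DERIV_unique)
qed

lemma gradient_monomial:
  "gradient (monomial \<alpha>) x $ i = real (\<alpha> i) * monomial (\<alpha>(i := \<alpha> i - 1)) x"
proof (rule gradient_nth_eqI[OF monomial_smooth])
  let ?R = "\<Prod>j\<in>UNIV - {i}. (x $ j) ^ \<alpha> j"
  have split: "monomial \<beta> y = (y $ i) ^ \<beta> i * (\<Prod>j\<in>UNIV - {i}. (y $ j) ^ \<beta> j)" for \<beta> y
    unfolding monomial_def by (subst prod.remove[of UNIV i]) auto
  have line: "monomial \<alpha> (x + t *\<^sub>R axis i 1) = (x $ i + t) ^ \<alpha> i * ?R" for t
    unfolding split by (auto simp: axis_def intro!: prod.cong)
  have "monomial (\<alpha>(i := \<alpha> i - 1)) x = (x $ i) ^ (\<alpha> i - 1) * ?R"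
    unfolding split by (auto intro!: prod.cong)
  moreover have "((\<lambda>t. (x $ i + t) ^ \<alpha> i * ?R) has_real_derivative
      real (\<alpha> i) * (x $ i + 0) ^ (\<alpha> i - 1) * ?R) (at 0)"
    by (auto intro!: derivative_eq_intros)
  ultimately show "((\<lambda>t. monomial \<alpha> (x + t *\<^sub>R axis i 1)) has_real_derivative
      real (\<alpha> i) * monomial (\<alpha>(i := \<alpha> i - 1)) x) (at 0)"
    unfolding line by (simp add: mult.assoc)
qed

lemma polynomials_gradient:
  assumes "p \<in> polynomials k" shows "(\<lambda>x. gradient p x $ i) \<in> polynomials (k - 1)"
proof -
  let ?V = "{p. smooth p \<and> (\<lambda>x. gradient p x $ i) \<in> polynomials (k - 1)}"
  have comb: "(\<lambda>x. v x + c * u x) \<in> ?V" if "v \<in> ?V" "u \<in> ?V" for v u c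
  proof -
    have "(\<lambda>x. gradient (\<lambda>x. v x + c * u x) x $ i) = (\<lambda>x. gradient v x $ i + c * gradient u x $ i)"
      using that by (simp add: gradient_combine smooth_differentiable)
    then show ?thesis using that by (auto intro: smooth_combine polynomials_combine)
  qed
  have zero: "(\<lambda>x. 0) \<in> ?V"
  proof -
    have "gradient (\<lambda>x. 0) x = 0" for x :: "real^'a" by (rule gradient_eqI) simp
    then show ?thesis by (simp add: smooth_zero polynomials_zero)
  qed
  have "polynomials k \<subseteq> ?V"
  proof (rule polynomials_subset_closed)
    fix \<alpha> :: "'a \<Rightarrow> nat" assume \<alpha>: "\<alpha> \<in> multi_indices k"
    \<comment> \<open>For exponent 0 natural subtraction does not lower the degree of the monomial;
      there the factor 0 saves the bound.\<close>
    have "(\<lambda>x. gradient (monomial \<alpha>) x $ i) \<in> polynomials (k - 1)"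
    proof (cases "\<alpha> i = 0")
      case True
      then show ?thesis by (simp add: gradient_monomial polynomials_zero)
    next
      case False
      let ?\<beta> = "\<alpha>(i := \<alpha> i - 1)"
      have "(\<Sum>j\<in>UNIV. ?\<beta> j) + 1 = (\<Sum>j\<in>UNIV. \<alpha> j)"
        using False by (simp add: sum.remove[of UNIV i])
      then have "int (\<Sum>j\<in>UNIV. ?\<beta> j) + 1 = int (\<Sum>j\<in>UNIV. \<alpha> j)" by (metis of_nat_1 of_nat_add)
      then have "?\<beta> \<in> multi_indices (k - 1)" using \<alpha> unfolding mem_Collect_eq by linarith
      then show ?thesis unfolding gradient_monomial by (intro polynomials_scale monomial_mem)
    qed
    then show "monomial \<alpha> \<in> ?V" by (simp add: monomial_smooth)
  next
    show "(\<lambda>x. v x + u x) \<in> ?V" if "v \<in> ?V" "u \<in> ?V" for v u using comb[OF that, of 1] by simp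
    show "(\<lambda>x. c *\<^sub>R v x) \<in> ?V" if "v \<in> ?V" for v c using comb[OF zero that, of c] by simp
  qed (rule zero)
  then show ?thesis using assms by blast
qed

lemma constant_polynomial: "0 \<le> k \<Longrightarrow> (\<lambda>x. c) \<in> polynomials k"
  using polynomials_scale[OF monomial_mem[of "\<lambda>_. 0" k], of c] by (simp add: monomial_def)

lemma pw_poly_add: "\<lbrakk>v \<in> pw_poly k M; u \<in> pw_poly k M\<rbrakk> \<Longrightarrow> (\<lambda>x. v x + u x) \<in> pw_poly k M"
proof -
  assume v: "v \<in> pw_poly k M" and u: "u \<in> pw_poly k M"
  have "\<exists>p\<in>polynomials k. \<forall>x\<in>interior K. (v x + u x) \<bullet> b = p x" if Kb: "K \<in> M" "b \<in> Basis" for K b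
  proof -
    obtain p q where "p \<in> polynomials k" "\<forall>x\<in>interior K. v x \<bullet> b = p x"
      "q \<in> polynomials k" "\<forall>x\<in>interior K. u x \<bullet> b = q x"
      using v u Kb unfolding pw_poly_def by blast
    then show ?thesis by (intro bexI[OF _ polynomials_add[of p k q]]) (auto simp: inner_add_left)
  qed
  then show ?thesis using v u by (simp add: pw_poly_def)
qed

lemma pw_poly_scale: "v \<in> pw_poly k M \<Longrightarrow> (\<lambda>x. c *\<^sub>R v x) \<in> pw_poly k M"
proof -
  assume v: "v \<in> pw_poly k M"
  have "\<exists>p\<in>polynomials k. \<forall>x\<in>interior K. (c *\<^sub>R v x) \<bullet> b = p x" if Kb: "K \<in> M" "b \<in> Basis" for K b
  proof -
    obtain p where "p \<in> polynomials k" "\<forall>x\<in>interior K. v x \<bullet> b = p x"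
      using v Kb unfolding pw_poly_def by blast
    then show ?thesis by (intro bexI[OF _ polynomials_scale[of p k c]]) auto
  qed
  then show ?thesis using v by (simp add: pw_poly_def)
qed

lemma pw_poly_zero: "(\<lambda>x. 0) \<in> pw_poly k M"
  unfolding pw_poly_def using polynomials_zero[of k] by auto

lemma pw_poly_mono: "k \<le> k' \<Longrightarrow> pw_poly k M \<subseteq> pw_poly k' M"
  unfolding pw_poly_def using polynomials_mono[of k k'] by blast

text \<open>Near a boundary point the domain lies strictly above a Lipschitz graph. The points
  straight below the boundary point come arbitrarily close to it, yet they lie in an open set that
  misses \<open>\<Omega>\<close> and hence its closure. This excludes cracks and keeps the open
  elements inside \<open>\<Omega>\<close>.\<close>

lemma interior_closure_lipschitz:
  fixes \<Omega> :: "(real^'n) set"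
  assumes "lipschitz_boundary \<Omega>" "open \<Omega>"
  shows "interior (closure \<Omega>) = \<Omega>"
proof
  show "\<Omega> \<subseteq> interior (closure \<Omega>)" using assms(2) closure_subset by (intro interior_maximal)
  show "interior (closure \<Omega>) \<subseteq> \<Omega>"
  proof (rule ccontr)
    assume "\<not> interior (closure \<Omega>) \<subseteq> \<Omega>"
    then obtain z where z: "z \<in> interior (closure \<Omega>)" "z \<notin> \<Omega>" by blast
    then have "z \<in> frontier \<Omega>" using assms(2) interior_subset by (auto simp: frontier_def interior_open)
    then obtain e r L and \<phi> :: "real^'n \<Rightarrow> real" where e: "norm e = 1" "0 < r" "L-lipschitz_on {y. y \<bullet> e = 0} \<phi>"
      "\<Omega> \<inter> ball z r = {x \<in> ball z r. \<phi> (x - (x \<bullet> e) *\<^sub>R e) < x \<bullet> e}"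
      using assms(1) unfolding lipschitz_boundary_def by blast
    have mem: "x \<in> \<Omega> \<longleftrightarrow> \<phi> (x - (x \<bullet> e) *\<^sub>R e) < x \<bullet> e" if "x \<in> ball z r" for x
    proof -
      have "x \<in> \<Omega> \<inter> ball z r \<longleftrightarrow> \<phi> (x - (x \<bullet> e) *\<^sub>R e) < x \<bullet> e" unfolding e(4) using that by simp
      then show ?thesis using that by blast
    qed
    have ee: "e \<bullet> e = 1" using e(1) by (simp add: dot_square_norm)
    define P where "P x = x - (x \<bullet> e) *\<^sub>R e" for x
    have P0: "P x \<bullet> e = 0" for x by (simp add: P_def inner_diff_left ee)
    have P_cont: "continuous_on UNIV P" unfolding P_def by (intro continuous_intros)
    have c: "continuous_on UNIV (\<lambda>x. \<phi> (P x))"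
      by (rule continuous_on_compose2[OF lipschitz_on_continuous_on[OF e(3)] P_cont]) (simp add: image_subset_iff P0)
    have "z \<in> ball z r" using e(2) by simp
    then have ge: "z \<bullet> e \<le> \<phi> (P z)" using z(2) mem[of z] unfolding P_def by simp
    define B where "B = ball z r \<inter> {x. x \<bullet> e < \<phi> (P x)}"
    have "open B" unfolding B_def using c by (intro open_Int open_ball open_Collect_less continuous_intros) auto
    moreover have "B \<inter> \<Omega> = {}" using mem unfolding B_def P_def by force
    ultimately have B: "B \<inter> closure \<Omega> = {}" by (simp add: open_Int_closure_eq_empty)
    obtain d where d: "d > 0" "ball z d \<subseteq> closure \<Omega>" using z(1) mem_interior by blast
    \<comment> \<open>Small enough for the point below the graph to stay in both balls.\<close>
    define s where "s = min d r / 2"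
    have s: "0 < s" "s < d" "s < r" using d e(2) by (auto simp: s_def)
    have Pz: "P (z - s *\<^sub>R e) = P z" by (simp add: P_def inner_diff_left ee algebra_simps)
    have "(z - s *\<^sub>R e) \<bullet> e < \<phi> (P (z - s *\<^sub>R e))" using s(1) ge unfolding Pz by (simp add: inner_diff_left ee)
    then have "z - s *\<^sub>R e \<in> B" unfolding B_def using s e(1) by (simp add: dist_norm)
    moreover have "z - s *\<^sub>R e \<in> closure \<Omega>" using d(2) s e(1) by (auto simp: dist_norm)
    ultimately show False using B by blast
  qed
qed

section \<open>Meshes\<close>

locale dg_mesh =
  fixes \<Omega> :: "(real^'n) set" and M :: "(real^'n) set set" and n :: "(real^'n) set \<Rightarrow> real^'n"
  assumes dim: "2 \<le> CARD('n)" and domain: "polyhedral_domain \<Omega>"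
    and mesh: "simplicial_mesh \<Omega> M" and normals: "face_normals \<Omega> M n"
begin

lemma open_\<Omega>: "open \<Omega>" and bounded_\<Omega>: "bounded \<Omega>" and \<Omega>_nonempty: "\<Omega> \<noteq> {}"
  using domain by (auto simp: polyhedral_domain_def)

lemma \<Omega>_sets: "\<Omega> \<in> sets lebesgue"
  using open_\<Omega> by auto

lemma finite_M: "finite M"
  using mesh by (simp add: simplicial_mesh_def triangulation_def)

lemma simplex_M: "K \<in> M \<Longrightarrow> int CARD('n) simplex K"
  using mesh by (simp add: simplicial_mesh_def)

lemma M_Union: "\<Union>M = closure \<Omega>"
  using mesh by (simp add: simplicial_mesh_def)

lemma inter_face: "\<lbrakk>K \<in> M; K' \<in> M\<rbrakk> \<Longrightarrow> (K \<inter> K') face_of K"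
  using mesh unfolding simplicial_mesh_def triangulation_def by blast

lemma M_sets: assumes "K \<in> M" shows "K \<in> sets lebesgue" "interior K \<in> sets lebesgue" "bounded (interior K)" "negligible (K - interior K)"
proof -
  obtain C w c where "nsimplex K C w c" using simplex_nsimplex[OF simplex_M[OF assms]] .
  then interpret nsimplex K C w c .
  show "K \<in> sets lebesgue" "interior K \<in> sets lebesgue" "bounded (interior K)" "negligible (K - interior K)"
    by (rule K_sets bounded_interior negligible_boundary)+
qed

lemma interior_subset_\<Omega>: assumes "K \<in> M" shows "interior K \<subseteq> \<Omega>"
proof -
  have "K \<subseteq> closure \<Omega>" using assms M_Union by blast
  then have "interior K \<subseteq> interior (closure \<Omega>)" by (rule interior_mono)
  then show ?thesis using interior_closure_lipschitz domain by (auto simp: polyhedral_domain_def)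
qed

text \<open>The common part is a face of \<open>K\<close> by the face-to-face property, and a face
  that contains a relative interior point of \<open>K\<close> is all of \<open>K\<close>.\<close>

lemma face_meets_interior:
  assumes "K \<in> M" "K' \<in> M" "x \<in> interior K" "x \<in> K'" shows "K \<subseteq> K'"
proof -
  have "x \<in> rel_interior K" using assms(3) interior_subset_rel_interior by blast
  then have "K \<subseteq> K \<inter> K'"
    using assms(3,4) interior_subset by (intro subset_of_face_of[OF inter_face[OF assms(1,2)]]) auto
  then show ?thesis by blast
qed

lemma disjoint_interiors: assumes "K \<in> M" "K' \<in> M" "x \<in> interior K" "x \<in> interior K'" shows "K = K'"
  using face_meets_interior[OF assms(1,2,3)] face_meets_interior[OF assms(2,1,4)] assms(3,4) interior_subset
  by blast

lemma negligible_skeleton: "negligible (\<Omega> - (\<Union>K\<in>M. interior K))"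
proof (rule negligible_subset)
  show "negligible (\<Union>K\<in>M. K - interior K)" using finite_M M_sets(4) by (intro negligible_Union) auto
  show "\<Omega> - (\<Union>K\<in>M. interior K) \<subseteq> (\<Union>K\<in>M. K - interior K)"
    using closure_subset[of \<Omega>] M_Union by blast
qed

lemma AE_\<Omega>I:
  assumes "\<And>K. K \<in> M \<Longrightarrow> AE x in lebesgue_on (interior K). P x"
  shows "AE x in lebesgue_on \<Omega>. P x"
proof -
  have "AE x in lebesgue. x \<in> interior K \<longrightarrow> P x" if "K \<in> M" for K
    using assms[OF that] M_sets(2)[OF that] by (simp add: AE_restrict_space_iff)
  then have "AE x in lebesgue. \<forall>K\<in>M. x \<in> interior K \<longrightarrow> P x"
    using finite_M by (intro AE_finite_allI)
  moreover have "AE x in lebesgue. x \<notin> \<Omega> - (\<Union>K\<in>M. interior K)"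
    using negligible_skeleton by (intro AE_not_in) (simp add: negligible_iff_null_sets)
  ultimately have "AE x in lebesgue. x \<in> \<Omega> \<longrightarrow> P x" by eventually_elim blast
  then show ?thesis using \<Omega>_sets by (simp add: AE_restrict_space_iff)
qed

lemma AE_\<Omega>D:
  assumes "AE x in lebesgue_on \<Omega>. P x" "K \<in> M" shows "AE x in lebesgue_on (interior K). P x"
proof -
  have "AE x in lebesgue. x \<in> \<Omega> \<longrightarrow> P x" using assms(1) \<Omega>_sets by (simp add: AE_restrict_space_iff)
  then have "AE x in lebesgue. x \<in> interior K \<longrightarrow> P x"
    by eventually_elim (use interior_subset_\<Omega>[OF assms(2)] in blast)
  then show ?thesis using M_sets(2)[OF assms(2)] by (simp add: AE_restrict_space_iff)
qed

lemma integral_\<Omega>: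
  fixes f :: "real^'n \<Rightarrow> real"
  assumes "integrable (lebesgue_on \<Omega>) f"
  shows "(\<integral>x. f x \<partial>lebesgue_on \<Omega>) = (\<Sum>K\<in>M. \<integral>x. f x \<partial>lebesgue_on (interior K))"
proof -
  let ?U = "\<Union>K\<in>M. interior K"
  have U: "?U \<in> sets lebesgue" using M_sets finite_M by auto
  have sub: "?U \<subseteq> \<Omega>" using interior_subset_\<Omega> by blast
  have "(\<integral>x. f x \<partial>lebesgue_on \<Omega>) = (\<integral>x. f x \<partial>lebesgue_on ?U)"
    by (rule integral_lebesgue_on_null_diff[OF U \<Omega>_sets sub negligible_skeleton])
  also have "\<dots> = (\<integral>x. (\<Sum>K\<in>M. indicator (interior K) x * f x) \<partial>lebesgue)"
  proof -
    have "indicator ?U x = (\<Sum>K\<in>M. indicat_real (interior K) x)" for x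
    proof (rule indicator_UN_disjoint[OF finite_M])
      show "disjoint_family_on interior M"
        unfolding disjoint_family_on_def using disjoint_interiors by blast
    qed
    then have "indicator ?U x *\<^sub>R f x = (\<Sum>K\<in>M. indicator (interior K) x * f x)" for x
      by (simp add: sum_distrib_right)
    then show ?thesis using U by (simp add: integral_restrict_space)
  qed
  also have "\<dots> = (\<Sum>K\<in>M. \<integral>x. indicator (interior K) x * f x \<partial>lebesgue)"
  proof (rule Bochner_Integration.integral_sum)
    fix K assume K: "K \<in> M"
    have "integrable (lebesgue_on (interior K)) f"
      by (rule integrable_lebesgue_on_mono[OF assms interior_subset_\<Omega>[OF K] M_sets(2)[OF K] \<Omega>_sets])
    then show "integrable lebesgue (\<lambda>x. indicator (interior K) x * f x)"
      using M_sets(2)[OF K] by (simp add: integrable_restrict_space)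
  qed
  also have "\<dots> = (\<Sum>K\<in>M. \<integral>x. f x \<partial>lebesgue_on (interior K))"
    using M_sets by (intro sum.cong) (simp_all add: integral_restrict_space)
  finally show ?thesis .
qed

section \<open>Faces, outward normals and neighbouring elements\<close>

definition outward :: "(real^'n) set \<Rightarrow> (real^'n) set \<Rightarrow> real^'n \<Rightarrow> bool" where
  "outward K F \<nu> \<longleftrightarrow> norm \<nu> = 1 \<and> (\<forall>x\<in>K. \<forall>y\<in>F. \<nu> \<bullet> (x - y) \<le> 0)"

lemma facet_simplex:
  assumes "K \<in> M" "F facet_of K"
  obtains C w c a where "nsimplex K C w c" "a \<in> C" "F = nsimplex.face K w c a"
proof -
  obtain C w c where s: "nsimplex K C w c" using simplex_nsimplex[OF simplex_M[OF assms(1)]] .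
  then show ?thesis using that nsimplex.facet_of_iff[OF s, of F] assms(2) by blast
qed

lemma finite_faces: "finite (faces M)"
proof -
  have "faces M = (\<Union>K\<in>M. {F. F facet_of K})" by (auto simp: faces_def)
  moreover have "finite {F. F facet_of K}" if K: "K \<in> M" for K
  proof -
    obtain C w c where s: "nsimplex K C w c" using simplex_nsimplex[OF simplex_M[OF K]] .
    then show ?thesis using nsimplex.facets_eq[OF s] nsimplex.finite_vertices[OF s] by simp
  qed
  ultimately show ?thesis using finite_M by simp
qed

lemma outward_cases:
  assumes "K \<in> M" "F facet_of K" shows "outward K F (n F) \<or> outward K F (- n F)"
proof -
  obtain C w c a where s: "nsimplex K C w c" and a: "a \<in> C" "F = nsimplex.face K w c a"
    using facet_simplex[OF assms] .
  interpret nsimplex K C w c by (rule s)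
  have F: "F \<in> faces M" using assms by (auto simp: faces_def)
  have nF: "norm (n F) = 1" "\<And>x y. \<lbrakk>x \<in> F; y \<in> F\<rbrakk> \<Longrightarrow> n F \<bullet> (x - y) = 0"
    using normals F by (auto simp: face_normals_def)
  have "n F = - (1 / norm (w a)) *\<^sub>R w a \<or> n F = (1 / norm (w a)) *\<^sub>R w a"
    by (rule normal_cases[OF a(1)]) (use nF a(2) in auto)
  moreover have "outward K F (- (1 / norm (w a)) *\<^sub>R w a)"
    unfolding outward_def
  proof (intro conjI ballI)
    show "norm (- (1 / norm (w a)) *\<^sub>R w a) = 1" using w_nonzero[OF a(1)] by simp
    fix x y assume xy: "x \<in> K" "y \<in> F"
    then have "0 \<le> lam a x" using a(1) mem_K by blast
    then show "- (1 / norm (w a)) *\<^sub>R w a \<bullet> (x - y) \<le> 0"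
      using xy(2) unfolding a(2) by (simp only: normal_inner[OF a(1)]) simp
  qed
  ultimately show ?thesis by auto
qed

lemma outward_inner_points:
  assumes "K \<in> M" "F facet_of K" "outward K F \<nu>" "x \<in> rel_interior F"
  shows "\<exists>e>0. \<forall>t. 0 < t \<and> t < e \<longrightarrow> x - t *\<^sub>R \<nu> \<in> interior K"
proof -
  obtain C w c a where s: "nsimplex K C w c" and a: "a \<in> C" "F = nsimplex.face K w c a"
    using facet_simplex[OF assms(1,2)] .
  interpret nsimplex K C w c by (rule s)
  have "\<nu> = - (1 / norm (w a)) *\<^sub>R w a"
    using assms(3) a by (intro outward_normal) (auto simp: outward_def)
  then show ?thesis using inner_points[OF a(1)] assms(4) a(2) by simp
qed

lemma facet_rel_interior_nonempty:
  assumes "F facet_of K" "convex K" obtains x where "x \<in> rel_interior F"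
  using assms by (metis all_not_in_conv facet_of_def facet_of_imp_face_of face_of_imp_convex rel_interior_eq_empty)

text \<open>From a relative interior point of \<open>F\<close>, short steps along
  \<open>- \<nu>\<close> lead into the interiors of both elements, which are disjoint unless the
  elements coincide.\<close>

lemma outward_unique:
  assumes "K \<in> M" "F facet_of K" "outward K F \<nu>" "K' \<in> M" "F facet_of K'" "outward K' F \<nu>"
  shows "K = K'"
proof -
  have "convex K" using convex_simplex simplex_M assms(1) by blast
  then obtain x where x: "x \<in> rel_interior F" using facet_rel_interior_nonempty[OF assms(2)] by blast
  obtain e where e: "e > 0" "\<And>t. \<lbrakk>0 < t; t < e\<rbrakk> \<Longrightarrow> x - t *\<^sub>R \<nu> \<in> interior K"
    using outward_inner_points[OF assms(1-3) x] by blast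
  obtain e' where e': "e' > 0" "\<And>t. \<lbrakk>0 < t; t < e'\<rbrakk> \<Longrightarrow> x - t *\<^sub>R \<nu> \<in> interior K'"
    using outward_inner_points[OF assms(4-6) x] by blast
  define t where "t = min e e' / 2"
  have "0 < t" "t < e" "t < e'" using e(1) e'(1) by (auto simp: t_def)
  then show ?thesis using disjoint_interiors[OF assms(1,4) e(2) e'(2)] by blast
qed

end

context dg_mesh
begin

lemma facet_subset: "F facet_of K \<Longrightarrow> F \<subseteq> K"
  by (meson facet_of_imp_face_of face_of_imp_subset)

text \<open>Points just outside \<open>K\<close>, on a ray from \<open>x\<close> along
  \<open>\<nu>\<close>, are covered by finitely many elements; so one element contains infinitely
  many of them and, being closed, also their limit \<open>x\<close>. As \<open>x\<close> is
  relatively interior to \<open>F\<close>, the face-to-face property puts all of \<open>F\<close>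
  into that element.\<close>

lemma interior_face_neighbour:
  assumes F: "F \<in> interior_faces \<Omega> M" and K: "K \<in> M" "F facet_of K" and \<nu>: "outward K F \<nu>"
    and \<nu>n: "\<nu> = n F \<or> \<nu> = - n F"
  shows "\<exists>K'\<in>M. F facet_of K' \<and> outward K' F (- \<nu>)"
proof -
  have cK: "convex K" using convex_simplex simplex_M K(1) by blast
  have "F \<subseteq> closure \<Omega>" using facet_subset[OF K(2)] K(1) M_Union by blast
  then obtain y where y: "y \<in> F" "y \<in> \<Omega>"
    using F open_\<Omega> by (auto simp: interior_faces_def frontier_def interior_open)
  have cF: "convex F" using K(2) by (meson facet_of_imp_face_of face_of_imp_convex)
  \<comment> \<open>The relative interior is dense in \<open>F\<close> and \<open>\<Omega>\<close>
    is open, so a point of \<open>F\<close> in \<open>\<Omega>\<close> can be moved into it.\<close>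
  have "y \<in> closure (rel_interior F)" using y(1) convex_closure_rel_interior[OF cF] closure_subset by blast
  then obtain x where x: "x \<in> rel_interior F" "x \<in> \<Omega>"
    using open_\<Omega> y(2) open_Int_closure_eq_empty[OF open_\<Omega>, of "rel_interior F"] by blast
  have xF: "x \<in> F" using x(1) rel_interior_subset by blast
  obtain e where e: "e > 0" "ball x e \<subseteq> \<Omega>" using open_\<Omega> x(2) open_contains_ball by blast
  have n\<nu>: "norm \<nu> = 1" using \<nu> by (simp add: outward_def)
  define t where "t k = e / real (k + 2)" for k
  have t: "0 < t k" "t k < e" for k using e(1) by (auto simp: t_def field_simps add_pos_nonneg)
  have t0: "t \<longlonglongrightarrow> 0"
    unfolding t_def using LIMSEQ_ignore_initial_segment[OF lim_const_over_n[of e], of 2] by simp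
  have "x + t k *\<^sub>R \<nu> \<in> \<Union>M" for k
  proof -
    have "x + t k *\<^sub>R \<nu> \<in> ball x e" using t[of k] n\<nu> by (simp add: dist_norm)
    then show ?thesis using e(2) closure_subset M_Union by blast
  qed
  then have "\<forall>k. \<exists>S. S \<in> M \<and> x + t k *\<^sub>R \<nu> \<in> S" by blast
  then obtain S where S: "\<And>k. S k \<in> M" "\<And>k. x + t k *\<^sub>R \<nu> \<in> S k" by (metis choice_iff)
  have "finite (range S)" using S(1) finite_M by (meson finite_subset image_subsetI)
  then obtain k0 where k0: "infinite {k. S k = S k0}"
    using pigeonhole_infinite[of UNIV S] by auto
  define K' where "K' = S k0"
  have K'M: "K' \<in> M" using S(1) by (simp add: K'_def)
  have inK': "x + t k *\<^sub>R \<nu> \<in> K'" if "S k = S k0" for k using S(2)[of k] that by (simp add: K'_def)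
  have xK': "x \<in> K'"
  proof -
    obtain r :: "nat \<Rightarrow> nat" where r: "strict_mono r" "\<And>k. S (r k) = S k0"
      using infinite_enumerate[OF k0] by auto
    have "(\<lambda>k. x + t (r k) *\<^sub>R \<nu>) \<longlonglongrightarrow> x + 0 *\<^sub>R \<nu>"
      using LIMSEQ_subseq_LIMSEQ[OF t0 r(1)] by (intro tendsto_intros) (simp add: o_def)
    moreover have "closed K'" using closed_simplex simplex_M[OF K'M] by blast
    ultimately show ?thesis using inK'[OF r(2)] closed_sequentially[of K' "\<lambda>k. x + t (r k) *\<^sub>R \<nu>"] by simp
  qed
  have notK: "x + t k *\<^sub>R \<nu> \<notin> K" for k
  proof
    assume "x + t k *\<^sub>R \<nu> \<in> K"
    then have "\<nu> \<bullet> ((x + t k *\<^sub>R \<nu>) - x) \<le> 0" using \<nu> xF unfolding outward_def by blast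
    then show False using t[of k] n\<nu> by (simp add: dot_square_norm)
  qed
  have "K' \<noteq> K" using S(2)[of k0] notK[of k0] by (auto simp: K'_def)
  have "F \<subseteq> K \<inter> K'"
    using x(1) xF xK' facet_subset[OF K(2)]
    by (intro subset_of_face_of[OF inter_face[OF K(1) K'M]]) auto
  then have FI: "F face_of (K \<inter> K')"
    by (rule face_of_subset[OF facet_of_imp_face_of[OF K(2)] _ Int_lower1])
  have "(K \<inter> K') face_of K'" using inter_face[OF K'M K(1)] by (simp only: Int_commute)
  with FI have "F face_of K'" by (rule face_of_trans)
  moreover have "aff_dim K = aff_dim K'" using aff_dim_simplex simplex_M K(1) K'M by metis
  ultimately have fac: "F facet_of K'" using K(2) by (simp add: facet_of_def)
  have "\<not> outward K' F \<nu>" using outward_unique[OF K'M fac _ K \<nu>] \<open>K' \<noteq> K\<close> by blast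
  then have "outward K' F (- \<nu>)" using outward_cases[OF K'M fac] \<nu>n by auto
  then show ?thesis using K'M fac by blast
qed

lemma element_at_eq:
  assumes "K \<in> M" "F facet_of K" "outward K F \<nu>" shows "element_at M F \<nu> = K"
  unfolding element_at_def
proof (rule the_equality)
  show "K \<in> M \<and> F facet_of K \<and> (\<forall>x\<in>K. \<forall>y\<in>F. \<nu> \<bullet> (x - y) \<le> 0)" using assms by (simp add: outward_def)
  fix K' assume K': "K' \<in> M \<and> F facet_of K' \<and> (\<forall>x\<in>K'. \<forall>y\<in>F. \<nu> \<bullet> (x - y) \<le> 0)"
  then have "outward K' F \<nu>" using assms(3) by (simp add: outward_def)
  then show "K' = K" using outward_unique[OF _ _ _ assms] K' by blast
qed

abbreviation K1 where "K1 F \<equiv> element_at M F (n F)"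
abbreviation K2 where "K2 F \<equiv> element_at M F (- n F)"

lemma interior_face:
  assumes F: "F \<in> interior_faces \<Omega> M"
  shows "K1 F \<in> M" "F facet_of K1 F" "outward (K1 F) F (n F)"
    "K2 F \<in> M" "F facet_of K2 F" "outward (K2 F) F (- n F)"
    "K1 F \<noteq> K2 F" "{K \<in> M. F facet_of K} = {K1 F, K2 F}"
proof -
  obtain K where K: "K \<in> M" "F facet_of K" using F by (auto simp: interior_faces_def faces_def)
  obtain A B where A: "A \<in> M" "F facet_of A" "outward A F (n F)" and B: "B \<in> M" "F facet_of B" "outward B F (- n F)"
    using outward_cases[OF K] interior_face_neighbour[OF F K, of "n F"] interior_face_neighbour[OF F K, of "- n F"] K by auto
  note eq = element_at_eq[OF A] element_at_eq[OF B]
  show "K1 F \<in> M" "F facet_of K1 F" "outward (K1 F) F (n F)"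
    "K2 F \<in> M" "F facet_of K2 F" "outward (K2 F) F (- n F)" using A B by (simp_all add: eq)
  show "K1 F \<noteq> K2 F"
  proof
    assume "K1 F = K2 F"
    then have AB: "A = B" by (simp add: eq)
    have "convex A" using convex_simplex simplex_M A(1) by blast
    then obtain x where x: "x \<in> rel_interior F" using facet_rel_interior_nonempty[OF A(2)] by blast
    obtain e where e: "e > 0" "\<And>t. \<lbrakk>0 < t; t < e\<rbrakk> \<Longrightarrow> x - t *\<^sub>R n F \<in> interior A"
      using outward_inner_points[OF A x] by blast
    have "x - (e/2) *\<^sub>R n F \<in> A" using e(2)[of "e/2"] e(1) interior_subset by auto
    then have "(- n F) \<bullet> ((x - (e/2) *\<^sub>R n F) - x) \<le> 0"
      using B(3) AB x rel_interior_subset unfolding outward_def by blast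
    then show False using A(3) e(1) by (simp add: outward_def dot_square_norm)
  qed
  show "{K \<in> M. F facet_of K} = {K1 F, K2 F}"
  proof (intro equalityI subsetI)
    fix K assume "K \<in> {K \<in> M. F facet_of K}"
    then have "K = A \<or> K = B" using outward_cases[of K F] outward_unique[OF _ _ _ A] outward_unique[OF _ _ _ B] by blast
    then show "K \<in> {K1 F, K2 F}" by (auto simp: eq)
  qed (use A B in \<open>auto simp: eq\<close>)
qed

text \<open>If \<open>- n F\<close> were outward, short steps from a relative interior point along
  \<open>n F\<close> would lead into an element and so into \<open>\<Omega>\<close>, against the
  orientation demanded in \<open>face_normals\<close>.\<close>

lemma boundary_face:
  assumes F: "F \<in> faces M" "F \<notin> interior_faces \<Omega> M"
  shows "K1 F \<in> M" "F facet_of K1 F" "outward (K1 F) F (n F)" "{K \<in> M. F facet_of K} = {K1 F}" "F \<subseteq> frontier \<Omega>"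
proof -
  show fr: "F \<subseteq> frontier \<Omega>" using F by (simp add: interior_faces_def)
  have out: "outward K F (n F)" if K: "K \<in> M" "F facet_of K" for K
  proof (rule ccontr)
    assume "\<not> outward K F (n F)"
    then have o: "outward K F (- n F)" using outward_cases[OF K] by blast
    have "convex K" using convex_simplex simplex_M K(1) by blast
    then obtain x where x: "x \<in> rel_interior F" using facet_rel_interior_nonempty[OF K(2)] by blast
    obtain e where e: "e > 0" "\<And>t. \<lbrakk>0 < t; t < e\<rbrakk> \<Longrightarrow> x - t *\<^sub>R (- n F) \<in> interior K"
      using outward_inner_points[OF K o x] by blast
    have "\<forall>x\<in>rel_interior F. \<exists>e>0. \<forall>t\<in>{0<..<e}. x + t *\<^sub>R n F \<notin> \<Omega>"
      using normals F(1) fr unfolding face_normals_def by simp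
    from bspec[OF this x] obtain e' where e': "e' > 0" "\<forall>t\<in>{0<..<e'}. x + t *\<^sub>R n F \<notin> \<Omega>" by blast
    define t where "t = min e e' / 2"
    have "0 < t" "t < e" "t < e'" using e(1) e'(1) by (auto simp: t_def)
    then show False using e(2)[of t] bspec[OF e'(2), of t] interior_subset_\<Omega>[OF K(1)] by auto
  qed
  obtain A where A: "A \<in> M" "F facet_of A" using F(1) by (auto simp: faces_def)
  note eq = element_at_eq[OF A out[OF A]]
  show "K1 F \<in> M" "F facet_of K1 F" "outward (K1 F) F (n F)" using A out[OF A] by (simp_all add: eq)
  show "{K \<in> M. F facet_of K} = {K1 F}"
  proof (intro equalityI subsetI)
    fix K assume "K \<in> {K \<in> M. F facet_of K}"
    then have K: "K \<in> M" "F facet_of K" by auto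
    have "K = A" by (rule outward_unique[OF K out[OF K] A out[OF A]])
    then show "K \<in> {K1 F}" by (simp add: eq)
  qed (simp add: eq A)
qed

lemma K1_facet: assumes "F \<in> faces M" shows "K1 F \<in> M" "F facet_of K1 F" "outward (K1 F) F (n F)"
proof -
  have "K1 F \<in> M \<and> F facet_of K1 F \<and> outward (K1 F) F (n F)"
  proof (cases "F \<in> interior_faces \<Omega> M")
    case True
    then show ?thesis by (intro conjI interior_face)
  next
    case False
    then show ?thesis by (intro conjI boundary_face assms)
  qed
  then show "K1 F \<in> M" "F facet_of K1 F" "outward (K1 F) F (n F)" by simp_all
qed

text \<open>Meaningful for facets \<open>F\<close> of \<open>K\<close> only: an element other than
  \<open>K1 F\<close> that has \<open>F\<close> as a facet lies on the other side and has outward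
  normal \<open>- n F\<close>.\<close>

definition onormal :: "(real^'n) set \<Rightarrow> (real^'n) set \<Rightarrow> real^'n" where
  "onormal K F = (if K = K1 F then n F else - n F)"

lemma onormal_outward: assumes "K \<in> M" "F facet_of K" shows "outward K F (onormal K F)"
proof -
  have F: "F \<in> faces M" using assms by (auto simp: faces_def)
  show ?thesis
  proof (cases "K = K1 F")
    case True
    then show ?thesis using K1_facet[OF F] by (simp add: onormal_def)
  next
    case False
    have "\<not> outward K F (n F)"
    proof
      assume "outward K F (n F)"
      then have "K = K1 F" by (rule outward_unique[OF assms _ K1_facet[OF F]])
      then show False using False by simp
    qed
    then show ?thesis using False outward_cases[OF assms] by (simp add: onormal_def)
  qed
qed

text \<open>Double counting of the pairs of an element and one of its facets; this turns the element
  boundaries of integration by parts into face integrals.\<close>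

lemma sum_facets:
  fixes g :: "(real^'n) set \<Rightarrow> (real^'n) set \<Rightarrow> real"
  shows "(\<Sum>K\<in>M. \<Sum>F | F facet_of K. g K F)
    = (\<Sum>F\<in>faces M. if F \<in> interior_faces \<Omega> M then g (K1 F) F + g (K2 F) F else g (K1 F) F)"
proof -
  have "(\<Sum>K\<in>M. \<Sum>F | F facet_of K. g K F) = (\<Sum>K\<in>M. \<Sum>F | F \<in> faces M \<and> F facet_of K. g K F)"
    by (intro sum.cong) (auto simp: faces_def)
  also have "\<dots> = (\<Sum>F\<in>faces M. \<Sum>K | K \<in> M \<and> F facet_of K. g K F)"
    by (rule sum.swap_restrict[OF finite_M finite_faces])
  also have "\<dots> = (\<Sum>F\<in>faces M. if F \<in> interior_faces \<Omega> M then g (K1 F) F + g (K2 F) F else g (K1 F) F)"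
  proof (intro sum.cong refl)
    fix F assume F: "F \<in> faces M"
    show "(\<Sum>K | K \<in> M \<and> F facet_of K. g K F)
        = (if F \<in> interior_faces \<Omega> M then g (K1 F) F + g (K2 F) F else g (K1 F) F)"
    proof (cases "F \<in> interior_faces \<Omega> M")
      case True
      then show ?thesis using interior_face(7)[OF True] by (simp add: interior_face(8)[OF True])
    next
      case False
      then show ?thesis by (simp add: boundary_face(4)[OF F False])
    qed
  qed
  finally show ?thesis .
qed

lemma facet_facts:
  assumes "K \<in> M" "F facet_of K"
  shows "finite_measure (face_measure F)" "AE x in face_measure F. x \<in> F" "compact F"
    "\<And>g :: real^'n \<Rightarrow> 'b::euclidean_space. continuous_on UNIV g \<Longrightarrow> g \<in> l2 (face_measure F)"
    "\<And>f. f \<in> h1s (interior K) \<Longrightarrow> \<exists>g. is_trace (interior K) F f g"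
    "\<And>f s. is_trace (interior K) F f s \<Longrightarrow> s \<in> l2 (face_measure F)"
    "\<And>f s t. \<lbrakk>is_trace (interior K) F f s; is_trace (interior K) F f t\<rbrakk> \<Longrightarrow> AE x in face_measure F. s x = t x"
proof -
  obtain C w c a where s: "nsimplex K C w c" and a: "a \<in> C" "F = nsimplex.face K w c a"
    using facet_simplex[OF assms] .
  interpret nsimplex K C w c by (rule s)
  show "finite_measure (face_measure F)" "AE x in face_measure F. x \<in> F" "compact F"
    unfolding a(2) by (rule face_measure_finite[OF a(1)] AE_face_measure[OF a(1)] compact_face[OF a(1)])+
  show "g \<in> l2 (face_measure F)" if "continuous_on UNIV g" for g :: "real^'n \<Rightarrow> 'b"
    using continuous_l2_face[OF that a(1)] a(2) by simp
  show "\<exists>g. is_trace (interior K) F f g" if "f \<in> h1s (interior K)" for f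
    using is_trace_exists[OF a(1) that] a(2) by simp
  show "s \<in> l2 (face_measure F)" if "is_trace (interior K) F f s" for f s
    using is_trace_l2[OF a(1)] that a(2) by simp
  show "AE x in face_measure F. s x = t x" if "is_trace (interior K) F f s" "is_trace (interior K) F f t" for f s t
    using is_trace_unique[OF a(1), of f s t] that unfolding a(2) .
qed

lemma element_facts:
  assumes "K \<in> M"
  shows "\<And>\<phi>. smooth \<phi> \<Longrightarrow> weak_gradient (interior K) \<phi> (gradient \<phi>)"
    "\<And>\<phi>. smooth \<phi> \<Longrightarrow> \<phi> \<in> h1s (interior K)"
    "\<And>\<phi> F. smooth \<phi> \<Longrightarrow> is_trace (interior K) F \<phi> \<phi>"
    "finite {F. F facet_of K}"
proof -
  obtain C w c where s: "nsimplex K C w c" using simplex_nsimplex[OF simplex_M[OF assms]] .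
  interpret nsimplex K C w c by (rule s)
  show "weak_gradient (interior K) \<phi> (gradient \<phi>)" "\<phi> \<in> h1s (interior K)" "is_trace (interior K) F \<phi> \<phi>"
    if "smooth \<phi>" for \<phi> F using that by (rule smooth_weak_gradient smooth_h1s smooth_is_trace)+
  show "finite {F. F facet_of K}" using facets_eq finite_vertices by simp
qed

lemma element_parts:
  assumes K: "K \<in> M" and f: "f \<in> h1s (interior K)" and q: "smooth q"
    and tr: "\<And>F. F facet_of K \<Longrightarrow> is_trace (interior K) F f (t F)"
  shows "(\<integral>x. (wgrad (interior K) f x \<bullet> v) * q x + f x * (gradient q x \<bullet> v) \<partial>lebesgue_on (interior K))
    = (\<Sum>F | F facet_of K. (onormal K F \<bullet> v) * (\<integral>x. t F x * q x \<partial>face_measure F))"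
proof -
  obtain C w c where s: "nsimplex K C w c" using simplex_nsimplex[OF simplex_M[OF K]] .
  interpret nsimplex K C w c by (rule s)
  have "(\<integral>x. (wgrad (interior K) f x \<bullet> v) * q x + f x * (gradient q x \<bullet> v) \<partial>lebesgue_on (interior K))
      = - (\<Sum>a\<in>C. (w a \<bullet> v / norm (w a)) * (\<integral>x. t (face a) x * q x \<partial>face_measure (face a)))"
    by (rule integration_by_parts[OF f q]) (use tr facet_of_iff in blast)
  also have "\<dots> = (\<Sum>a\<in>C. (onormal K (face a) \<bullet> v) * (\<integral>x. t (face a) x * q x \<partial>face_measure (face a)))"
    unfolding sum_negf[symmetric]
  proof (intro sum.cong refl)
    fix a assume a: "a \<in> C"
    then have "outward K (face a) (onormal K (face a))" using facet_of_iff K by (intro onormal_outward) auto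
    then have "onormal K (face a) = - (1 / norm (w a)) *\<^sub>R w a"
      by (intro outward_normal[OF a]) (auto simp: outward_def)
    then have "onormal K (face a) \<bullet> v = - (w a \<bullet> v / norm (w a))" by simp
    then show "- ((w a \<bullet> v / norm (w a)) * (\<integral>x. t (face a) x * q x \<partial>face_measure (face a)))
        = (onormal K (face a) \<bullet> v) * (\<integral>x. t (face a) x * q x \<partial>face_measure (face a))" by simp
  qed
  also have "\<dots> = (\<Sum>F | F facet_of K. (onormal K F \<bullet> v) * (\<integral>x. t F x * q x \<partial>face_measure F))"
    unfolding facets_eq by (simp add: sum.reindex[OF inj_face])
  finally show ?thesis .
qed

text \<open>A face has as many vertices as the dimension, hence at least two. The weight
  \<open>\<eta> / diameter F\<close> is therefore a genuine positive penalty.\<close>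

lemma diameter_face_pos: assumes "F \<in> faces M" shows "0 < diameter F"
proof -
  obtain K where K: "K \<in> M" "F facet_of K" using assms by (auto simp: faces_def)
  obtain C w c a where s: "nsimplex K C w c" and a: "a \<in> C" "F = nsimplex.face K w c a"
    using facet_simplex[OF K] .
  interpret nsimplex K C w c by (rule s)
  obtain b where b: "b \<in> C" "b \<noteq> a" using vertex_other[OF a(1)] .
  have "1 \<le> card (C - {a} - {b})" using card_vertices dim a(1) b finite_vertices by simp
  then have "C - {a} - {b} \<noteq> {}" by (metis card.empty not_one_le_zero)
  then obtain b' where b': "b' \<in> C" "b' \<noteq> a" "b \<noteq> b'" by blast
  have "b \<in> F" "b' \<in> F" using vertex_mem(2)[OF a(1)] a(2) b b' by auto
  moreover have "bounded F" using facet_facts(3)[OF K] compact_imp_bounded by blast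
  ultimately have "dist b b' \<le> diameter F" by (intro diameter_bounded_bound)
  moreover have "0 < dist b b'" using b'(3) by simp
  ultimately show ?thesis by linarith
qed

section \<open>Admissible fields, elementwise limits of smooth functions: traces, jumps,
  averages\<close>

definition adm :: "(real^'n \<Rightarrow> 'b::euclidean_space) \<Rightarrow> bool" where
  "adm v \<longleftrightarrow> (\<forall>K\<in>M. \<forall>b\<in>Basis. (\<lambda>x. v x \<bullet> b) \<in> h1s (interior K))"

abbreviation tr :: "(real^'n) set \<Rightarrow> (real^'n) set \<Rightarrow> (real^'n \<Rightarrow> 'b::euclidean_space) \<Rightarrow> real^'n \<Rightarrow> 'b" where
  "tr K F v \<equiv> face_trace (interior K) F v"

lemma adm_combine:
  fixes v u :: "real^'n \<Rightarrow> 'b::euclidean_space"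
  assumes "adm v" "adm u" shows "adm (\<lambda>x. v x + c *\<^sub>R u x)"
  unfolding adm_def
proof (intro ballI)
  fix K and b :: 'b assume "K \<in> M" "b \<in> Basis"
  then have "(\<lambda>x. v x \<bullet> b + c * (u x \<bullet> b)) \<in> h1s (interior K)"
    using assms M_sets(3)[of K] by (intro h1s_combine) (auto simp: adm_def)
  then show "(\<lambda>x. (v x + c *\<^sub>R u x) \<bullet> b) \<in> h1s (interior K)" by (simp add: inner_add_left)
qed

lemma tr_is_trace:
  assumes "adm v" "K \<in> M" "F facet_of K" "b \<in> Basis"
  shows "is_trace (interior K) F (\<lambda>y. v y \<bullet> b) (\<lambda>x. tr K F v x \<bullet> b)"
  using assms by (intro face_trace_is_trace facet_facts(5)[OF assms(2,3)]) (auto simp: adm_def)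

lemma tr_l2: assumes "adm v" "K \<in> M" "F facet_of K" shows "tr K F v \<in> l2 (face_measure F)"
  by (rule l2_componentwise) (rule facet_facts(6)[OF assms(2,3) tr_is_trace[OF assms]])

lemma AE_componentwise:
  fixes f g :: "'a \<Rightarrow> 'b::euclidean_space"
  assumes "\<And>b. b \<in> Basis \<Longrightarrow> AE x in N. f x \<bullet> b = g x \<bullet> b" shows "AE x in N. f x = g x"
proof -
  have "AE x in N. \<forall>b\<in>Basis. f x \<bullet> b = g x \<bullet> b" using assms by (intro AE_finite_allI) auto
  then show ?thesis
  proof eventually_elim
    case (elim x)
    then show ?case by - (rule euclidean_eqI, blast)
  qed
qed

lemma tr_combine:
  fixes v u :: "real^'n \<Rightarrow> 'b::euclidean_space"
  assumes v: "adm v" and u: "adm u" and K: "K \<in> M" "F facet_of K"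
  shows "AE x in face_measure F. tr K F (\<lambda>x. v x + c *\<^sub>R u x) x = tr K F v x + c *\<^sub>R tr K F u x"
proof (rule AE_componentwise)
  fix b :: 'b assume b: "b \<in> Basis"
  have "is_trace (interior K) F (\<lambda>x. v x \<bullet> b + c * (u x \<bullet> b)) (\<lambda>x. tr K F v x \<bullet> b + c * (tr K F u x \<bullet> b))"
    using tr_is_trace[OF v K b] tr_is_trace[OF u K b] M_sets(3)[OF K(1)] by (intro is_trace_combine) auto
  moreover have "is_trace (interior K) F (\<lambda>x. v x \<bullet> b + c * (u x \<bullet> b)) (\<lambda>x. tr K F (\<lambda>x. v x + c *\<^sub>R u x) x \<bullet> b)"
    using tr_is_trace[OF adm_combine[OF v u] K b, of c] by (simp add: inner_add_left)
  ultimately have "AE x in face_measure F. tr K F (\<lambda>x. v x + c *\<^sub>R u x) x \<bullet> b = tr K F v x \<bullet> b + c * (tr K F u x \<bullet> b)"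
    by (intro facet_facts(7)[OF K])
  then show "AE x in face_measure F. tr K F (\<lambda>x. v x + c *\<^sub>R u x) x \<bullet> b = (tr K F v x + c *\<^sub>R tr K F u x) \<bullet> b"
    by eventually_elim (simp add: inner_add_left)
qed

lemma tr_eqI:
  assumes "adm v" "K \<in> M" "F facet_of K" "\<And>b. b \<in> Basis \<Longrightarrow> is_trace (interior K) F (\<lambda>y. v y \<bullet> b) (\<lambda>x. g x \<bullet> b)"
  shows "AE x in face_measure F. tr K F v x = g x"
  by (rule AE_componentwise) (rule facet_facts(7)[OF assms(2,3) tr_is_trace[OF assms(1-3)] assms(4)])

lemma tr_cong_AE:
  assumes "K \<in> M" "AE x in lebesgue_on (interior K). v x = u x"
    "v \<in> borel_measurable (lebesgue_on (interior K))" "u \<in> borel_measurable (lebesgue_on (interior K))"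
  shows "tr K F v = tr K F u"
proof -
  have "is_trace (interior K) F (\<lambda>y. v y \<bullet> b) = is_trace (interior K) F (\<lambda>y. u y \<bullet> b)" for b
  proof (rule is_trace_cong_AE[OF open_interior M_sets(3)[OF assms(1)]])
    show "AE x in lebesgue_on (interior K). v x \<bullet> b = u x \<bullet> b" using assms(2) by eventually_elim simp
  qed (use assms in auto)
  then show ?thesis by (simp add: face_trace_def fun_eq_iff)
qed

lemma h1s_cong_AE:
  assumes "open U" "bounded U" "f \<in> h1s U" "AE x in lebesgue_on U. f x = f' x" "f' \<in> borel_measurable (lebesgue_on U)"
  shows "f' \<in> h1s U"
proof -
  obtain \<phi> where "\<And>k. smooth (\<phi> k)" "h1_lim U \<phi> f" using assms(3) by (auto simp: h1s_def)
  then show ?thesis using h1_lim_cong_AE[OF assms(1,2) _ assms(4,5), of \<phi>] unfolding h1s_def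
    by (intro CollectI exI[of _ \<phi>]) simp
qed

lemma locally_smooth:
  assumes K: "K \<in> M" and p: "smooth p" and eq: "\<And>x. x \<in> interior K \<Longrightarrow> f x = p x"
  shows "f \<in> borel_measurable (lebesgue_on (interior K))" "f \<in> h1s (interior K)"
    "AE x in lebesgue_on (interior K). wgrad (interior K) f x = gradient p x"
    "is_trace (interior K) F f p"
proof -
  note U = open_interior M_sets(3)[OF K]
  have pm: "p \<in> borel_measurable (lebesgue_on (interior K))"
    using element_facts(1)[OF K p] by (simp add: weak_gradient_def l2_def)
  have ae: "AE x in lebesgue_on (interior K). p x = f x" using eq by (intro AE_I2) auto
  show fm: "f \<in> borel_measurable (lebesgue_on (interior K))"
    using pm by (rule measurable_cong[THEN iffD1, rotated]) (auto simp: eq)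
  show "f \<in> h1s (interior K)" by (rule h1s_cong_AE[OF U element_facts(2)[OF K p] ae fm])
  show "AE x in lebesgue_on (interior K). wgrad (interior K) f x = gradient p x"
    by (rule wgrad_AE[OF U weak_gradient_cong_AE[OF U element_facts(1)[OF K p] ae fm]])
  show "is_trace (interior K) F f p"
    using is_trace_cong_AE[OF U ae pm fm] element_facts(3)[OF K p] by metis
qed

lemma pw_poly_adm: "v \<in> pw_poly k M \<Longrightarrow> adm v"
  unfolding adm_def
proof (intro ballI)
  fix K and b :: 'a assume v: "v \<in> pw_poly k M" and K: "K \<in> M" and b: "b \<in> Basis"
  then obtain p where "p \<in> polynomials k" "\<forall>x\<in>interior K. v x \<bullet> b = p x"
    unfolding pw_poly_def by blast
  then show "(\<lambda>x. v x \<bullet> b) \<in> h1s (interior K)"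
    by (intro locally_smooth(2)[OF K polynomials_smooth]) auto
qed

end

lemma l2_inner_combine:
  fixes f g h k :: "'a \<Rightarrow> 'b::euclidean_space"
  assumes "f \<in> l2 N" "g \<in> l2 N" "h \<in> l2 N" "k \<in> l2 N" "AE x in N. k x = f x + c *\<^sub>R g x"
  shows "(\<integral>x. k x \<bullet> h x \<partial>N) = (\<integral>x. f x \<bullet> h x \<partial>N) + c * (\<integral>x. g x \<bullet> h x \<partial>N)"
proof -
  have "(\<integral>x. k x \<bullet> h x \<partial>N) = (\<integral>x. (f x + c *\<^sub>R g x) \<bullet> h x \<partial>N)"
    by (rule integral_cong_AE) (use assms in \<open>auto simp: l2_def\<close>)
  also have "\<dots> = (\<integral>x. f x \<bullet> h x \<partial>N) + (\<integral>x. (c *\<^sub>R g x) \<bullet> h x \<partial>N)"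
    by (rule l2_form.form_add[OF assms(1) l2_scale[OF assms(2)] assms(3)])
  finally show ?thesis by (simp only: l2_form.form_scale[OF assms(2,3)])
qed

lemma l2_extend:
  fixes f :: "'a::euclidean_space \<Rightarrow> 'b::euclidean_space"
  assumes "f \<in> l2 (lebesgue_on S)" "S \<in> sets lebesgue" "T \<in> sets lebesgue"
  shows "(\<lambda>x. indicat_real S x *\<^sub>R f x) \<in> l2 (lebesgue_on T)"
proof -
  have m: "(\<lambda>x. indicat_real S x *\<^sub>R f x) \<in> borel_measurable lebesgue"
    using assms(1,2) borel_measurable_restrict_space_iff[of S lebesgue f] by (simp add: l2_def)
  have "integrable lebesgue (\<lambda>x. indicat_real S x *\<^sub>R (norm (f x))\<^sup>2)"
    using assms(1,2) by (simp add: l2_def integrable_restrict_space)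
  then have "integrable lebesgue (\<lambda>x. indicat_real T x *\<^sub>R (indicat_real S x *\<^sub>R (norm (f x))\<^sup>2))"
    by (rule integrable_mult_indicator[OF assms(3)])
  moreover have "(norm (indicat_real S x *\<^sub>R f x))\<^sup>2 = indicat_real S x *\<^sub>R (norm (f x))\<^sup>2" for x
    by (simp add: indicator_def)
  ultimately have "integrable (lebesgue_on T) (\<lambda>x. (norm (indicat_real S x *\<^sub>R f x))\<^sup>2)"
    using assms(3) by (simp add: integrable_restrict_space)
  then show ?thesis using measurable_restrict_space1[OF m] by (simp add: l2_def)
qed

lemma l2_sum:
  "(\<And>i. i \<in> I \<Longrightarrow> f i \<in> l2 N) \<Longrightarrow> (\<lambda>x. \<Sum>i\<in>I. f i x) \<in> l2 N"
  by (induction I rule: infinite_finite_induct) (auto intro: l2_zero l2_add)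

lemma vgrad_nth: "vgrad U v x $ i = wgrad U (\<lambda>y. v y $ i) x"
  by (simp add: vgrad_def)

lemma basis_vec: "b \<in> Basis \<longleftrightarrow> (\<exists>i. b = axis i 1)" for b :: "real^'n"
  by (auto simp: Basis_vec_def)

context dg_mesh
begin

lemma broken_grad_interior:
  assumes "K \<in> M" "x \<in> interior K" shows "broken_grad M v x = vgrad (interior K) v x"
proof -
  have "broken_grad M v x = (\<Sum>L\<in>M. if L = K then vgrad (interior K) v x else 0)"
    unfolding broken_grad_def
  proof (intro sum.cong refl)
    fix L assume "L \<in> M"
    then have "x \<in> interior L \<longleftrightarrow> L = K" using assms disjoint_interiors by blast
    then show "indicat_real (interior L) x *\<^sub>R vgrad (interior L) v x = (if L = K then vgrad (interior K) v x else 0)"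
      by (simp add: indicator_def)
  qed
  then show ?thesis using finite_M assms(1) by simp
qed

lemma adm_component:
  fixes v :: "real^'n \<Rightarrow> real^'n"
  assumes "adm v" "K \<in> M" shows "(\<lambda>y. v y $ i) \<in> h1s (interior K)"
proof -
  have "axis i 1 \<in> (Basis :: (real^'n) set)" unfolding basis_vec by blast
  with assms have "(\<lambda>y. v y \<bullet> axis i 1) \<in> h1s (interior K)" unfolding adm_def by blast
  then show ?thesis by (simp add: inner_axis)
qed

lemma vgrad_l2:
  fixes v :: "real^'n \<Rightarrow> real^'n"
  assumes "adm v" "K \<in> M" shows "vgrad (interior K) v \<in> l2 (lebesgue_on (interior K))"
proof (rule l2_vec)
  fix i
  show "(\<lambda>x. vgrad (interior K) v x $ i) \<in> l2 (lebesgue_on (interior K))"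
    unfolding vgrad_nth using h1s_weak_gradient[OF adm_component[OF assms]] by (simp add: weak_gradient_def)
qed

lemma broken_grad_l2: "adm v \<Longrightarrow> broken_grad M v \<in> l2 (lebesgue_on \<Omega>)"
  unfolding broken_grad_def[abs_def] by (intro l2_sum l2_extend vgrad_l2 M_sets \<Omega>_sets)

lemma AE_vecI:
  fixes f g :: "'a \<Rightarrow> 'b^'n"
  assumes "\<And>i. AE x in N. f x $ i = g x $ i" shows "AE x in N. f x = g x"
proof -
  have "AE x in N. \<forall>i\<in>UNIV. f x $ i = g x $ i" using assms by (intro AE_finite_allI) auto
  then show ?thesis by eventually_elim (simp add: vec_eq_iff)
qed

lemma broken_grad_combine:
  fixes v u :: "real^'n \<Rightarrow> real^'n"
  assumes "adm v" "adm u"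
  shows "AE x in lebesgue_on \<Omega>. broken_grad M (\<lambda>x. v x + c *\<^sub>R u x) x = broken_grad M v x + c *\<^sub>R broken_grad M u x"
proof (rule AE_\<Omega>I)
  fix K assume K: "K \<in> M"
  note U = open_interior M_sets(3)[OF K]
  have "AE x in lebesgue_on (interior K). vgrad (interior K) (\<lambda>x. v x + c *\<^sub>R u x) x
      = vgrad (interior K) v x + c *\<^sub>R vgrad (interior K) u x"
  proof (rule AE_vecI)
    fix i
    have "weak_gradient (interior K) (\<lambda>y. v y $ i + c * u y $ i)
        (\<lambda>x. wgrad (interior K) (\<lambda>y. v y $ i) x + c *\<^sub>R wgrad (interior K) (\<lambda>y. u y $ i) x)"
      by (intro weak_gradient_combine[OF U] h1s_weak_gradient adm_component assms K)
    from wgrad_AE[OF U this]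
    show "AE x in lebesgue_on (interior K). vgrad (interior K) (\<lambda>x. v x + c *\<^sub>R u x) x $ i
      = (vgrad (interior K) v x + c *\<^sub>R vgrad (interior K) u x) $ i" by (simp add: vgrad_nth)
  qed
  moreover have "AE x in lebesgue_on (interior K). x \<in> interior K" using AE_space by eventually_elim simp
  ultimately show "AE x in lebesgue_on (interior K). broken_grad M (\<lambda>x. v x + c *\<^sub>R u x) x
      = broken_grad M v x + c *\<^sub>R broken_grad M u x"
    by eventually_elim (simp add: broken_grad_interior[OF K])
qed

lemma jump_eq: "F \<in> faces M \<Longrightarrow> jump \<Omega> M n F v x = tr (K1 F) F v x - (if F \<in> interior_faces \<Omega> M then tr (K2 F) F v x else 0)"
  by (simp add: jump_def Let_def)

lemma average_eq: "average \<Omega> M n F v x = (if F \<in> interior_faces \<Omega> M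
    then (1/2) *\<^sub>R (tr (K1 F) F v x + tr (K2 F) F v x) else tr (K1 F) F v x)"
  by (simp add: average_def Let_def)

lemma tr_face_l2:
  assumes "adm v" "F \<in> faces M"
  shows "tr (K1 F) F v \<in> l2 (face_measure F)" "F \<in> interior_faces \<Omega> M \<Longrightarrow> tr (K2 F) F v \<in> l2 (face_measure F)"
  using tr_l2[OF assms(1) K1_facet(1,2)[OF assms(2)]] tr_l2[OF assms(1) interior_face(4,5)] by simp_all

lemma jump_l2: assumes "adm v" "F \<in> faces M" shows "jump \<Omega> M n F v \<in> l2 (face_measure F)"
proof -
  have "(\<lambda>x. tr (K1 F) F v x - (if F \<in> interior_faces \<Omega> M then tr (K2 F) F v x else 0)) \<in> l2 (face_measure F)"
    using tr_face_l2[OF assms] by (cases "F \<in> interior_faces \<Omega> M") (simp_all add: l2_form.diff)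
  then show ?thesis by (simp add: jump_eq[OF assms(2), abs_def])
qed

lemma average_l2: assumes "adm v" "F \<in> faces M" shows "average \<Omega> M n F v \<in> l2 (face_measure F)"
  using tr_face_l2[OF assms] unfolding average_eq[abs_def]
  by (cases "F \<in> interior_faces \<Omega> M") (simp_all only: if_True if_False l2_scale l2_add)

lemma tr_face_combine:
  fixes v u :: "real^'n \<Rightarrow> 'b::euclidean_space"
  assumes "adm v" "adm u" "F \<in> faces M"
  shows "AE x in face_measure F. tr (K1 F) F (\<lambda>x. v x + c *\<^sub>R u x) x = tr (K1 F) F v x + c *\<^sub>R tr (K1 F) F u x"
    "F \<in> interior_faces \<Omega> M \<Longrightarrow> AE x in face_measure F. tr (K2 F) F (\<lambda>x. v x + c *\<^sub>R u x) x = tr (K2 F) F v x + c *\<^sub>R tr (K2 F) F u x"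
  by (rule tr_combine[OF assms(1,2) K1_facet(1,2)[OF assms(3)]], rule tr_combine[OF assms(1,2) interior_face(4,5)])

lemma jump_combine:
  fixes v u :: "real^'n \<Rightarrow> 'b::euclidean_space"
  assumes "adm v" "adm u" "F \<in> faces M"
  shows "AE x in face_measure F. jump \<Omega> M n F (\<lambda>x. v x + c *\<^sub>R u x) x = jump \<Omega> M n F v x + c *\<^sub>R jump \<Omega> M n F u x"
proof (cases "F \<in> interior_faces \<Omega> M")
  case True
  from tr_face_combine(1)[OF assms, of c] tr_face_combine(2)[OF assms True, of c] show ?thesis
    by eventually_elim (simp add: jump_eq[OF assms(3)] True algebra_simps)
next
  case False
  from tr_face_combine(1)[OF assms, of c] show ?thesis
    by eventually_elim (simp add: jump_eq[OF assms(3)] False)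
qed

lemma average_combine:
  fixes v u :: "real^'n \<Rightarrow> 'b::euclidean_space"
  assumes "adm v" "adm u" "F \<in> faces M"
  shows "AE x in face_measure F. average \<Omega> M n F (\<lambda>x. v x + c *\<^sub>R u x) x = average \<Omega> M n F v x + c *\<^sub>R average \<Omega> M n F u x"
proof (cases "F \<in> interior_faces \<Omega> M")
  case True
  from tr_face_combine(1)[OF assms, of c] tr_face_combine(2)[OF assms True, of c] show ?thesis
    by eventually_elim (simp add: average_eq True algebra_simps)
next
  case False
  from tr_face_combine(1)[OF assms, of c] show ?thesis
    by eventually_elim (simp add: average_eq False)
qed

section \<open>The bilinear forms of the method: gradient, jump penalty, face flux\<close>

definition Gf :: "(real^'n \<Rightarrow> real^'n) \<Rightarrow> (real^'n \<Rightarrow> real^'n) \<Rightarrow> real" where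
  "Gf w v = (\<integral>x. broken_grad M w x \<bullet> broken_grad M v x \<partial>lebesgue_on \<Omega>)"

definition Jf :: "real \<Rightarrow> (real^'n \<Rightarrow> real^'n) \<Rightarrow> (real^'n \<Rightarrow> real^'n) \<Rightarrow> real" where
  "Jf \<eta> w v = skeleton_integral M (\<lambda>F x. \<eta> / diameter F * (jump \<Omega> M n F w x \<bullet> jump \<Omega> M n F v x))"

definition Sf :: "(real^'n \<Rightarrow> real^'n) \<Rightarrow> (real^'n \<Rightarrow> real^'n) \<Rightarrow> real" where
  "Sf w v = skeleton_integral M (\<lambda>F x. (average \<Omega> M n F (broken_grad M w) x *v n F) \<bullet> jump \<Omega> M n F v x)"

lemma Gf_combine: "\<lbrakk>adm v; adm u; adm z\<rbrakk> \<Longrightarrow> Gf (\<lambda>x. v x + c *\<^sub>R u x) z = Gf v z + c * Gf u z"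
  unfolding Gf_def by (intro l2_inner_combine broken_grad_l2 adm_combine broken_grad_combine)

lemma Jf_eq: "Jf \<eta> w v = (\<Sum>F\<in>faces M. \<eta> / diameter F * (\<integral>x. jump \<Omega> M n F w x \<bullet> jump \<Omega> M n F v x \<partial>face_measure F))"
  unfolding Jf_def skeleton_integral_def by simp

lemma Jf_combine:
  fixes v u z :: "real^'n \<Rightarrow> real^'n"
  assumes "adm v" "adm u" "adm z"
  shows "Jf \<eta> (\<lambda>x. v x + c *\<^sub>R u x) z = Jf \<eta> v z + c * Jf \<eta> u z"
proof -
  have "(\<integral>x. jump \<Omega> M n F (\<lambda>x. v x + c *\<^sub>R u x) x \<bullet> jump \<Omega> M n F z x \<partial>face_measure F)
      = (\<integral>x. jump \<Omega> M n F v x \<bullet> jump \<Omega> M n F z x \<partial>face_measure F) + c * (\<integral>x. jump \<Omega> M n F u x \<bullet> jump \<Omega> M n F z x \<partial>face_measure F)"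
    if "F \<in> faces M" for F
    using that assms by (intro l2_inner_combine jump_l2 adm_combine jump_combine)
  then show ?thesis
    by (simp add: Jf_eq sum.distrib[symmetric] sum_distrib_left algebra_simps)
qed

lemma Jf_nonneg: "0 < \<eta> \<Longrightarrow> 0 \<le> Jf \<eta> v v"
  unfolding Jf_eq using diameter_face_pos by (intro sum_nonneg mult_nonneg_nonneg) (auto intro: less_imp_le)

lemma Gf_nonneg: "0 \<le> Gf v v"
  unfolding Gf_def by simp

lemma psd_G: "psd_form (Collect adm) Gf"
proof
  fix v w z :: "real^'n \<Rightarrow> real^'n" and c
  assume v: "v \<in> Collect adm" and w: "w \<in> Collect adm" and z: "z \<in> Collect adm"
  show "(\<lambda>x. v x + w x) \<in> Collect adm" using adm_combine[of v w 1] v w by simp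
  show "Gf (\<lambda>x. v x + w x) z = Gf v z + Gf w z" using Gf_combine[of v w z 1] v w z by simp
next
  fix v z :: "real^'n \<Rightarrow> real^'n" and c
  assume v: "v \<in> Collect adm" and z: "z \<in> Collect adm"
  have z0: "adm (\<lambda>x. 0 :: real^'n)" using pw_poly_adm[OF pw_poly_zero] .
  have G0: "Gf (\<lambda>x. 0) z = 0" using Gf_combine[OF z0 z0, of z "-1"] z by simp
  show "(\<lambda>x. c *\<^sub>R v x) \<in> Collect adm" using adm_combine[OF z0, of v c] v by simp
  show "Gf (\<lambda>x. c *\<^sub>R v x) z = c * Gf v z" using Gf_combine[OF z0, of v z c] v z G0 by simp
qed (auto simp: Gf_def inner_commute)

lemma psd_J: assumes "0 < \<eta>" shows "psd_form (Collect adm) (Jf \<eta>)"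
proof
  fix v w z :: "real^'n \<Rightarrow> real^'n" and c
  assume v: "v \<in> Collect adm" and w: "w \<in> Collect adm" and z: "z \<in> Collect adm"
  show "(\<lambda>x. v x + w x) \<in> Collect adm" using adm_combine[of v w 1] v w by simp
  show "Jf \<eta> (\<lambda>x. v x + w x) z = Jf \<eta> v z + Jf \<eta> w z" using Jf_combine[of v w z \<eta> 1] v w z by simp
next
  fix v z :: "real^'n \<Rightarrow> real^'n" and c
  assume v: "v \<in> Collect adm" and z: "z \<in> Collect adm"
  have z0: "adm (\<lambda>x. 0 :: real^'n)" using pw_poly_adm[OF pw_poly_zero] .
  have J0: "Jf \<eta> (\<lambda>x. 0) z = 0" using Jf_combine[OF z0 z0, of z \<eta> "-1"] z by simp
  show "(\<lambda>x. c *\<^sub>R v x) \<in> Collect adm" using adm_combine[OF z0, of v c] v by simp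
  show "Jf \<eta> (\<lambda>x. c *\<^sub>R v x) z = c * Jf \<eta> v z" using Jf_combine[OF z0, of v z \<eta> c] v z J0 by simp
next
  fix v :: "real^'n \<Rightarrow> real^'n" show "0 \<le> Jf \<eta> v v" by (rule Jf_nonneg[OF assms])
qed (simp add: Jf_eq inner_commute)

lemma psd_dG: assumes "0 < \<eta>" shows "psd_form (Collect adm) (\<lambda>w v. Gf w v + Jf \<eta> w v)"
proof -
  interpret G: psd_form "Collect adm" Gf by (rule psd_G)
  interpret J: psd_form "Collect adm" "Jf \<eta>" by (rule psd_J[OF assms])
  show ?thesis
  proof
    fix v w z :: "real^'n \<Rightarrow> real^'n" and c
    assume v: "v \<in> Collect adm" and w: "w \<in> Collect adm" and z: "z \<in> Collect adm"
    show "(\<lambda>x. v x + w x) \<in> Collect adm" by (rule G.add[OF v w])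
    show "Gf (\<lambda>x. v x + w x) z + Jf \<eta> (\<lambda>x. v x + w x) z = Gf v z + Jf \<eta> v z + (Gf w z + Jf \<eta> w z)"
      by (simp only: G.form_add[OF v w z] J.form_add[OF v w z])
    show "Gf v w + Jf \<eta> v w = Gf w v + Jf \<eta> w v"
      by (simp only: G.sym[OF v w] J.sym[OF v w])
  next
    fix v z :: "real^'n \<Rightarrow> real^'n" and c
    assume v: "v \<in> Collect adm" and z: "z \<in> Collect adm"
    show "(\<lambda>x. c *\<^sub>R v x) \<in> Collect adm" by (rule G.scale[OF v])
    show "Gf (\<lambda>x. c *\<^sub>R v x) z + Jf \<eta> (\<lambda>x. c *\<^sub>R v x) z = c * (Gf v z + Jf \<eta> v z)"
      by (simp only: G.form_scale[OF v z] J.form_scale[OF v z] distrib_left)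
    show "0 \<le> Gf v v + Jf \<eta> v v" using G.nonneg[OF v] J.nonneg[OF v] by simp
  qed
qed

lemma norm_dG_eq: "norm_dG \<Omega> M n \<eta> w = sqrt (Gf w w + Jf \<eta> w w)"
  by (simp add: norm_dG_def Gf_def Jf_def power2_norm_eq_inner)

lemma norm_dG_sq: "0 < \<eta> \<Longrightarrow> (norm_dG \<Omega> M n \<eta> w)\<^sup>2 = Gf w w + Jf \<eta> w w"
  unfolding norm_dG_eq using Gf_nonneg[of w] Jf_nonneg[of \<eta> w] by simp

lemma a_dG_eq: "a_dG \<Omega> M n \<eta> w v = Gf w v - Sf w v - Sf v w + Jf \<eta> w v"
  by (simp add: a_dG_def Gf_def Sf_def Jf_def inner_commute)

section \<open>Broken gradients of piecewise polynomials\<close>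

lemma pw_poly_piece:
  assumes "v \<in> pw_poly k M" "K \<in> M" "b \<in> Basis"
  obtains p where "p \<in> polynomials k" "\<And>x. x \<in> interior K \<Longrightarrow> v x \<bullet> b = p x"
  using assms unfolding pw_poly_def by blast

lemma pw_poly_pieces_vec:
  fixes v :: "real^'n \<Rightarrow> real^'n"
  assumes "v \<in> pw_poly k M"
  obtains p where "\<And>K i. K \<in> M \<Longrightarrow> p K i \<in> polynomials k" "\<And>K i x. \<lbrakk>K \<in> M; x \<in> interior K\<rbrakk> \<Longrightarrow> v x $ i = p K i x"
proof -
  have "\<forall>K i. \<exists>p. K \<in> M \<longrightarrow> p \<in> polynomials k \<and> (\<forall>x\<in>interior K. v x $ i = p x)"
  proof (intro allI)
    fix K i
    show "\<exists>p. K \<in> M \<longrightarrow> p \<in> polynomials k \<and> (\<forall>x\<in>interior K. v x $ i = p x)"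
    proof (cases "K \<in> M")
      case True
      obtain p where "p \<in> polynomials k" "\<And>x. x \<in> interior K \<Longrightarrow> v x \<bullet> axis i 1 = p x"
        using pw_poly_piece[OF assms True, of "axis i 1"] by (auto simp: basis_vec)
      then show ?thesis by (auto simp: inner_axis)
    qed simp
  qed
  then obtain p where "\<forall>K i. K \<in> M \<longrightarrow> p K i \<in> polynomials k \<and> (\<forall>x\<in>interior K. v x $ i = p K i x)"
    by (simp only: choice_iff) blast
  then show ?thesis using that[of p] by blast
qed

text \<open>The broken gradient involves a choice of weak gradient, so it is piecewise polynomial only
  almost everywhere; the traces do not see the difference.\<close>

lemma broken_grad_pw_poly:
  fixes w :: "real^'n \<Rightarrow> real^'n"
  assumes w: "w \<in> pw_poly k M"
    and p: "\<And>K i. K \<in> M \<Longrightarrow> p K i \<in> polynomials k" "\<And>K i x. \<lbrakk>K \<in> M; x \<in> interior K\<rbrakk> \<Longrightarrow> w x $ i = p K i x"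
  shows "\<exists>g\<in>pw_poly (k - 1) M. (\<forall>K\<in>M. \<forall>x\<in>interior K. g x = (\<chi> i. gradient (p K i) x))
    \<and> (AE x in lebesgue_on \<Omega>. broken_grad M w x = g x)
    \<and> (\<forall>K\<in>M. \<forall>F. tr K F (broken_grad M w) = tr K F g)"
proof -
  define g where "g x = (\<Sum>K\<in>M. indicat_real (interior K) x *\<^sub>R (\<chi> i. gradient (p K i) x))" for x
  have g: "g x = (\<chi> i. gradient (p K i) x)" if K: "K \<in> M" "x \<in> interior K" for K x
  proof -
    have "g x = (\<Sum>L\<in>M. if L = K then (\<chi> i. gradient (p K i) x) else 0)"
      unfolding g_def
    proof (intro sum.cong refl)
      fix L assume "L \<in> M"
      then have "x \<in> interior L \<longleftrightarrow> L = K" using K disjoint_interiors by blast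
      then show "indicat_real (interior L) x *\<^sub>R (\<chi> i. gradient (p L i) x) = (if L = K then (\<chi> i. gradient (p K i) x) else 0)"
        by (simp add: indicator_def)
    qed
    then show ?thesis using finite_M K(1) by simp
  qed
  have gp: "g \<in> pw_poly (k - 1) M"
    unfolding pw_poly_def
  proof (intro CollectI conjI ballI allI impI)
    fix K and b :: "real^'n^'n" assume K: "K \<in> M" and b: "b \<in> Basis"
    obtain i j where ij: "b = axis i (axis j 1)" using b by (auto simp: Basis_vec_def)
    have "g x \<bullet> b = gradient (p K i) x $ j" if "x \<in> interior K" for x
      using g[OF K that] by (simp add: ij inner_axis)
    then show "\<exists>q\<in>polynomials (k - 1). \<forall>x\<in>interior K. g x \<bullet> b = q x"
      using polynomials_gradient[OF p(1)[OF K, of i], of j] by (intro bexI[of _ "\<lambda>x. gradient (p K i) x $ j"]) auto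
  next
    fix x assume "x \<notin> (\<Union>K\<in>M. interior K)"
    then show "g x = 0" by (auto simp: g_def indicator_def intro!: sum.neutral)
  qed
  have wm: "broken_grad M w \<in> borel_measurable (lebesgue_on \<Omega>)"
    using broken_grad_l2[OF pw_poly_adm[OF w]] by (simp add: l2_def)
  have aeK: "AE x in lebesgue_on (interior K). broken_grad M w x = g x" if K: "K \<in> M" for K
  proof -
    have "AE x in lebesgue_on (interior K). vgrad (interior K) w x = (\<chi> i. gradient (p K i) x)"
    proof (rule AE_vecI)
      fix i
      show "AE x in lebesgue_on (interior K). vgrad (interior K) w x $ i = (\<chi> i. gradient (p K i) x) $ i"
        using locally_smooth(3)[OF K polynomials_smooth[OF p(1)[OF K, of i]] p(2)[OF K]]
        by (simp add: vgrad_nth)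
    qed
    moreover have "AE x in lebesgue_on (interior K). x \<in> interior K" using AE_space by eventually_elim simp
    ultimately show ?thesis by eventually_elim (simp add: broken_grad_interior[OF K] g[OF K])
  qed
  have "tr K F (broken_grad M w) = tr K F g" if K: "K \<in> M" for K F
  proof (rule tr_cong_AE[OF K aeK[OF K]])
    show "broken_grad M w \<in> borel_measurable (lebesgue_on (interior K))"
      by (rule l2_measurable[OF l2_subset[OF broken_grad_l2[OF pw_poly_adm[OF w]] interior_subset_\<Omega>[OF K] M_sets(2)[OF K] \<Omega>_sets]])
    show "g \<in> borel_measurable (lebesgue_on (interior K))"
    proof (rule borel_measurable_euclidean_space[THEN iffD2], intro ballI)
      fix b :: "real^'n^'n" assume b: "b \<in> Basis"
      obtain q where "q \<in> polynomials (k - 1)" "\<And>x. x \<in> interior K \<Longrightarrow> g x \<bullet> b = q x"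
        using pw_poly_piece[OF gp K b] by blast
      then show "(\<lambda>x. g x \<bullet> b) \<in> borel_measurable (lebesgue_on (interior K))"
        by (intro locally_smooth(1)[OF K polynomials_smooth]) auto
    qed
  qed
  then show ?thesis using gp g AE_\<Omega>I[OF aeK] by (intro bexI[of _ g] conjI ballI allI)
qed

lemma average_broken_grad:
  fixes w :: "real^'n \<Rightarrow> real^'n"
  assumes "w \<in> pw_poly k M"
  shows "\<exists>g\<in>pw_poly (k - 1) M. (AE x in lebesgue_on \<Omega>. broken_grad M w x = g x)
    \<and> (\<forall>F\<in>faces M. average \<Omega> M n F (broken_grad M w) = average \<Omega> M n F g)"
proof -
  obtain p where p: "\<And>K i. K \<in> M \<Longrightarrow> p K i \<in> polynomials k" "\<And>K i x. \<lbrakk>K \<in> M; x \<in> interior K\<rbrakk> \<Longrightarrow> w x $ i = p K i x"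
    using pw_poly_pieces_vec[OF assms] by blast
  obtain g where g: "g \<in> pw_poly (k - 1) M" "AE x in lebesgue_on \<Omega>. broken_grad M w x = g x"
    "\<And>K F. K \<in> M \<Longrightarrow> tr K F (broken_grad M w) = tr K F g"
    using broken_grad_pw_poly[where p = p, OF assms p] by blast
  have "average \<Omega> M n F (broken_grad M w) = average \<Omega> M n F g" if F: "F \<in> faces M" for F
  proof
    fix x
    show "average \<Omega> M n F (broken_grad M w) x = average \<Omega> M n F g x"
      unfolding average_eq using g(3)[OF K1_facet(1)[OF F], of F] g(3)[OF interior_face(4), of F F] by simp
  qed
  then show ?thesis using g by blast
qed

lemma pw_poly_l2: assumes "v \<in> pw_poly k M" shows "v \<in> l2 (lebesgue_on \<Omega>)"
proof -
  have "(\<lambda>x. \<Sum>K\<in>M. indicat_real (interior K) x *\<^sub>R v x) \<in> l2 (lebesgue_on \<Omega>)"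
  proof (rule l2_sum, rule l2_extend[OF _ M_sets(2) \<Omega>_sets])
    fix K assume K: "K \<in> M"
    show "v \<in> l2 (lebesgue_on (interior K))"
    proof (rule l2_componentwise)
      fix b :: 'a assume b: "b \<in> Basis"
      show "(\<lambda>x. v x \<bullet> b) \<in> l2 (lebesgue_on (interior K))"
        using h1s_weak_gradient[of "\<lambda>x. v x \<bullet> b" "interior K"] pw_poly_adm[OF assms] K b
        by (auto simp: adm_def weak_gradient_def)
    qed
  qed
  moreover have "(\<Sum>K\<in>M. indicat_real (interior K) x *\<^sub>R v x) = v x" for x
  proof (cases "x \<in> (\<Union>K\<in>M. interior K)")
    case True
    then obtain K where K: "K \<in> M" "x \<in> interior K" by blast
    have "(\<Sum>L\<in>M. indicat_real (interior L) x *\<^sub>R v x) = (\<Sum>L\<in>M. if L = K then v x else 0)"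
    proof (intro sum.cong refl)
      fix L assume "L \<in> M"
      then have "x \<in> interior L \<longleftrightarrow> L = K" using K disjoint_interiors by blast
      then show "indicat_real (interior L) x *\<^sub>R v x = (if L = K then v x else 0)" by (simp add: indicator_def)
    qed
    then show ?thesis using K finite_M by simp
  next
    case False
    then show ?thesis using assms by (simp add: pw_poly_def)
  qed
  ultimately show ?thesis by simp
qed

end

context dg_mesh
begin

section \<open>Fields with zero boundary values on the mesh\<close>

lemma h1_0_approx:
  assumes "f \<in> h1_0 \<Omega>"
  shows "\<exists>\<phi>. (\<forall>k. test_function \<Omega> (\<phi> k)) \<and> (\<forall>k. smooth (\<phi> k)) \<and> h1_lim \<Omega> \<phi> f"
proof -
  obtain \<phi> where "\<And>k. test_function \<Omega> (\<phi> k)" "h1_lim \<Omega> \<phi> f" using assms by (auto simp: h1_0_def)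
  then show ?thesis by (intro exI[of _ \<phi>]) (simp add: test_function_def)
qed

lemma h1_lim_element: "h1_lim \<Omega> \<phi> f \<Longrightarrow> K \<in> M \<Longrightarrow> h1_lim (interior K) \<phi> f"
  by (rule h1_lim_subset[OF open_\<Omega> bounded_\<Omega> open_interior interior_subset_\<Omega>])

lemma is_trace_element: "is_trace \<Omega> F f g \<Longrightarrow> K \<in> M \<Longrightarrow> is_trace (interior K) F f g"
  unfolding is_trace_def using h1_lim_element by blast

lemma h1_0_h1s:
  assumes "f \<in> h1_0 \<Omega>" "K \<in> M" shows "f \<in> h1s (interior K)"
proof -
  obtain \<phi> where "\<forall>k. smooth (\<phi> k)" "h1_lim \<Omega> \<phi> f" using h1_0_approx[OF assms(1)] by blast
  then show ?thesis unfolding h1s_def using h1_lim_element[OF _ assms(2), of \<phi> f]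
    by (intro CollectI exI[of _ \<phi>]) simp
qed

lemma h1_0_weak_gradient:
  assumes "f \<in> h1_0 \<Omega>" shows "weak_gradient \<Omega> f (wgrad \<Omega> f)"
proof -
  obtain \<phi> where "h1_lim \<Omega> \<phi> f" using h1_0_approx[OF assms] by blast
  then show ?thesis by (rule h1_lim_weak_gradient)
qed

lemma h1_0_wgrad_element:
  assumes "f \<in> h1_0 \<Omega>" "K \<in> M"
  shows "AE x in lebesgue_on (interior K). wgrad (interior K) f x = wgrad \<Omega> f x"
  by (rule wgrad_AE[OF open_interior M_sets(3)[OF assms(2)]
      weak_gradient_subset[OF open_\<Omega> bounded_\<Omega> open_interior interior_subset_\<Omega>[OF assms(2)] h1_0_weak_gradient[OF assms(1)]]])

lemma h1_0_trace_exists: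
  assumes f: "f \<in> h1_0 \<Omega>" and F: "F \<in> faces M"
  shows "\<exists>g. is_trace \<Omega> F f g"
proof -
  obtain \<phi> where \<phi>: "\<And>k. smooth (\<phi> k)" "h1_lim \<Omega> \<phi> f" using h1_0_approx[OF f] by blast
  note K = K1_facet(1,2)[OF F]
  obtain C w c a where s: "nsimplex (K1 F) C w c" and a: "a \<in> C" "F = nsimplex.face (K1 F) w c a"
    using facet_simplex[OF K] .
  obtain g where "l2_lim (face_measure F) \<phi> g"
    using nsimplex.h1_lim_trace_exists[OF s a(1) \<phi>(1) h1_lim_element[OF \<phi>(2) K(1)]] unfolding a(2)[symmetric] by blast
  then show ?thesis using \<phi> unfolding is_trace_def by (intro exI[of _ g] exI[of _ \<phi>]) simp
qed

text \<open>Test functions vanish on the boundary, since their support lies in the open set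
  \<open>\<Omega>\<close>; the approximating sequence is 0 on the face already before the
  limit.\<close>

lemma h1_0_trace_boundary:
  assumes f: "f \<in> h1_0 \<Omega>" and F: "F \<in> faces M" "F \<notin> interior_faces \<Omega> M"
  shows "is_trace (interior (K1 F)) F f (\<lambda>x. 0)"
proof -
  obtain \<phi> where \<phi>: "\<And>k. test_function \<Omega> (\<phi> k)" "\<And>k. smooth (\<phi> k)" "h1_lim \<Omega> \<phi> f" using h1_0_approx[OF f] by blast
  note K = K1_facet(1,2)[OF F(1)]
  have \<phi>F: "\<phi> k \<in> l2 (face_measure F)" for k by (intro facet_facts(4)[OF K] smooth_continuous \<phi>(2))
  have "AE x in face_measure F. \<phi> k x = 0" for k
    using facet_facts(2)[OF K]
  proof eventually_elim
    case (elim x)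
    then have "x \<notin> \<Omega>" using boundary_face(5)[OF F] open_\<Omega> by (auto simp: frontier_def interior_open)
    then show ?case using \<phi>(1)[of k] closure_subset[of "{x. \<phi> k x \<noteq> 0}"] by (auto simp: test_function_def)
  qed
  then have "l2_norm (face_measure F) (\<phi> k) = l2_norm (face_measure F) (\<lambda>x. 0 :: real)" for k
    using \<phi>F by (intro l2_norm_cong_AE) (auto simp: l2_def)
  then have "l2_lim (face_measure F) \<phi> (\<lambda>x. 0)" using \<phi>F by (simp add: l2_lim_def l2_norm_def)
  then show ?thesis unfolding is_trace_def using \<phi>(2) h1_lim_element[OF \<phi>(3) K(1)] by blast
qed

lemma h10_component: "u \<in> h1_0_vec \<Omega> \<Longrightarrow> (\<lambda>x. u x $ i) \<in> h1_0 \<Omega>"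
  by (simp add: h1_0_vec_def)

lemma h10_adm: assumes "u \<in> h1_0_vec \<Omega>" shows "adm u"
  unfolding adm_def
proof (intro ballI)
  fix K and b :: "real^'n" assume "K \<in> M" "b \<in> Basis"
  then show "(\<lambda>x. u x \<bullet> b) \<in> h1s (interior K)"
    using h1_0_h1s[OF h10_component[OF assms]] by (auto simp: basis_vec inner_axis)
qed

lemma h10_vgrad_l2: assumes "u \<in> h1_0_vec \<Omega>" shows "vgrad \<Omega> u \<in> l2 (lebesgue_on \<Omega>)"
proof (rule l2_vec)
  fix i
  show "(\<lambda>x. vgrad \<Omega> u x $ i) \<in> l2 (lebesgue_on \<Omega>)"
    using h1_0_weak_gradient[OF h10_component[OF assms]] by (simp add: vgrad_nth weak_gradient_def)
qed

lemma h10_broken_grad: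
  assumes "u \<in> h1_0_vec \<Omega>" shows "AE x in lebesgue_on \<Omega>. broken_grad M u x = vgrad \<Omega> u x"
proof (rule AE_\<Omega>I)
  fix K assume K: "K \<in> M"
  have "AE x in lebesgue_on (interior K). vgrad (interior K) u x = vgrad \<Omega> u x"
    by (rule AE_vecI) (simp add: vgrad_nth h1_0_wgrad_element[OF h10_component[OF assms] K])
  moreover have "AE x in lebesgue_on (interior K). x \<in> interior K" using AE_space by eventually_elim simp
  ultimately show "AE x in lebesgue_on (interior K). broken_grad M u x = vgrad \<Omega> u x"
    by eventually_elim (simp add: broken_grad_interior[OF K])
qed

text \<open>A sequence that approximates on \<open>\<Omega>\<close> does so on every element, so a
  trace from \<open>\<Omega>\<close> is a trace from each side, and uniqueness on \<open>K\<close>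
  gives equality. Hence such a field has no interior jumps.\<close>

lemma h10_trace:
  assumes u: "u \<in> h1_0_vec \<Omega>" and K: "K \<in> M" "F facet_of K"
  shows "AE x in face_measure F. tr K F u x = face_trace \<Omega> F u x"
proof (rule tr_eqI[OF h10_adm[OF u] K])
  fix b :: "real^'n" assume b: "b \<in> Basis"
  have F: "F \<in> faces M" using K by (auto simp: faces_def)
  have "(\<lambda>x. u x \<bullet> b) \<in> h1_0 \<Omega>" using h10_component[OF u] b by (auto simp: basis_vec inner_axis)
  from h1_0_trace_exists[OF this F] show "is_trace (interior K) F (\<lambda>y. u y \<bullet> b) (\<lambda>x. face_trace \<Omega> F u x \<bullet> b)"
    by (intro is_trace_element face_trace_is_trace b K)
qed

lemma h10_trace_boundary:
  assumes u: "u \<in> h1_0_vec \<Omega>" and F: "F \<in> faces M" "F \<notin> interior_faces \<Omega> M"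
  shows "AE x in face_measure F. tr (K1 F) F u x = 0"
proof (rule tr_eqI[OF h10_adm[OF u] K1_facet(1,2)[OF F(1)]])
  fix b :: "real^'n" assume b: "b \<in> Basis"
  have "(\<lambda>x. u x \<bullet> b) \<in> h1_0 \<Omega>" using h10_component[OF u] b by (auto simp: basis_vec inner_axis)
  from h1_0_trace_boundary[OF this F] show "is_trace (interior (K1 F)) F (\<lambda>y. u y \<bullet> b) (\<lambda>x. 0 \<bullet> b)" by simp
qed

lemma h10_jump:
  assumes u: "u \<in> h1_0_vec \<Omega>" and F: "F \<in> faces M"
  shows "AE x in face_measure F. jump \<Omega> M n F u x = 0"
proof (cases "F \<in> interior_faces \<Omega> M")
  case True
  from h10_trace[OF u interior_face(1,2)[OF True]] h10_trace[OF u interior_face(4,5)[OF True]] show ?thesis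
    by eventually_elim (simp add: jump_eq[OF F] True)
next
  case False
  from h10_trace_boundary[OF u F False] show ?thesis by eventually_elim (simp add: jump_eq[OF F] False)
qed

text \<open>Green's formula for a vector field against a smooth matrix field, assembled entry by
  entry from \<open>element_parts\<close>. The last vector in the volume term is the row-wise
  divergence of the matrix field.\<close>

lemma element_identity:
  fixes D :: "real^'n \<Rightarrow> real^'n"
  assumes K: "K \<in> M" and D: "adm D" and q: "\<And>i j. smooth (q i j)"
  shows "(\<integral>x. vgrad (interior K) D x \<bullet> (\<chi> i j. q i j x) + D x \<bullet> (\<chi> i. \<Sum>j\<in>UNIV. gradient (q i j) x $ j) \<partial>lebesgue_on (interior K))
    = (\<Sum>F | F facet_of K. \<integral>x. tr K F D x \<bullet> ((\<chi> i j. q i j x) *v onormal K F) \<partial>face_measure F)"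
proof -
  let ?M = "lebesgue_on (interior K)"
  have Di: "(\<lambda>x. D x $ i) \<in> h1s (interior K)" for i by (rule adm_component[OF D K])
  have Dl: "(\<lambda>x. D x $ i) \<in> l2 ?M" "(\<lambda>x. wgrad (interior K) (\<lambda>y. D y $ i) x $ j) \<in> l2 ?M" for i j
    using h1s_weak_gradient[OF Di, of i] by (auto simp: weak_gradient_def intro: l2_nth)
  have ql: "q i j \<in> l2 ?M" "(\<lambda>x. gradient (q i j) x $ j) \<in> l2 ?M" for i j
    using element_facts(1)[OF K q, of i j] by (auto simp: weak_gradient_def intro: l2_nth)
  have int: "integrable ?M (\<lambda>x. wgrad (interior K) (\<lambda>y. D y $ i) x $ j * q i j x + D x $ i * gradient (q i j) x $ j)" for i j
    using l2_inner_integrable[OF Dl(2) ql(1), of i j i j] l2_inner_integrable[OF Dl(1) ql(2), of i i j] by simp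
  have trn: "is_trace (interior K) F (\<lambda>y. D y $ i) (\<lambda>x. tr K F D x $ i)" if "F facet_of K" for F i
    using tr_is_trace[OF D K that, of "axis i 1"] by (auto simp: basis_vec inner_axis)
  have parts: "(\<integral>x. wgrad (interior K) (\<lambda>y. D y $ i) x $ j * q i j x + D x $ i * gradient (q i j) x $ j \<partial>?M)
      = (\<Sum>F | F facet_of K. onormal K F $ j * (\<integral>x. tr K F D x $ i * q i j x \<partial>face_measure F))" for i j
    using element_parts[where v = "axis j 1", OF K Di[of i] q[of i j] trn[of _ i]] by (simp add: inner_axis)
  have "(\<integral>x. vgrad (interior K) D x \<bullet> (\<chi> i j. q i j x) + D x \<bullet> (\<chi> i. \<Sum>j\<in>UNIV. gradient (q i j) x $ j) \<partial>?M)
      = (\<integral>x. (\<Sum>i\<in>UNIV. \<Sum>j\<in>UNIV. wgrad (interior K) (\<lambda>y. D y $ i) x $ j * q i j x + D x $ i * gradient (q i j) x $ j) \<partial>?M)"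
    by (simp add: inner_vec_def vgrad_nth sum.distrib sum_distrib_left)
  also have "\<dots> = (\<Sum>i\<in>UNIV. \<Sum>j\<in>UNIV. \<Sum>F | F facet_of K. onormal K F $ j * (\<integral>x. tr K F D x $ i * q i j x \<partial>face_measure F))"
    using int by (simp add: Bochner_Integration.integral_sum parts)
  also have "\<dots> = (\<Sum>F | F facet_of K. \<Sum>i\<in>UNIV. \<Sum>j\<in>UNIV. onormal K F $ j * (\<integral>x. tr K F D x $ i * q i j x \<partial>face_measure F))"
    by (simp only: sum.swap[of _ "{F. F facet_of K}" UNIV])
  also have "\<dots> = (\<Sum>F | F facet_of K. \<integral>x. tr K F D x \<bullet> ((\<chi> i j. q i j x) *v onormal K F) \<partial>face_measure F)"
  proof (intro sum.cong refl)
    fix F assume "F \<in> {F. F facet_of K}"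
    then have F: "F facet_of K" by simp
    have "integrable (face_measure F) (\<lambda>x. onormal K F $ j * (tr K F D x $ i * q i j x))" for i j
      using l2_inner_integrable[OF l2_nth[OF tr_l2[OF D K F], of i] facet_facts(4)[OF K F smooth_continuous[OF q[of i j]]]]
      by simp
    then have "(\<Sum>i\<in>UNIV. \<Sum>j\<in>UNIV. onormal K F $ j * (\<integral>x. tr K F D x $ i * q i j x \<partial>face_measure F))
        = (\<integral>x. (\<Sum>i\<in>UNIV. \<Sum>j\<in>UNIV. onormal K F $ j * (tr K F D x $ i * q i j x)) \<partial>face_measure F)"
      by (simp add: Bochner_Integration.integral_sum)
    also have "\<dots> = (\<integral>x. tr K F D x \<bullet> ((\<chi> i j. q i j x) *v onormal K F) \<partial>face_measure F)"
      by (simp add: inner_vec_def matrix_vector_mult_def sum_distrib_left ac_simps)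
    finally show "(\<Sum>i\<in>UNIV. \<Sum>j\<in>UNIV. onormal K F $ j * (\<integral>x. tr K F D x $ i * q i j x \<partial>face_measure F))
        = (\<integral>x. tr K F D x \<bullet> ((\<chi> i j. q i j x) *v onormal K F) \<partial>face_measure F)" .
  qed
  finally show ?thesis .
qed

lemma onormal_K: "onormal (K1 F) F = n F" "F \<in> interior_faces \<Omega> M \<Longrightarrow> onormal (K2 F) F = - n F"
  using interior_face(7)[of F] by (auto simp: onormal_def)

lemma matrix_l2:
  fixes Q :: "real^'n \<Rightarrow> real^'n^'n"
  assumes "Q \<in> l2 N" shows "(\<lambda>x. Q x *v \<nu>) \<in> l2 N"
proof -
  have "bounded_linear (\<lambda>A::real^'n^'n. A *v \<nu>)"
    by (intro linear_conv_bounded_linear[THEN iffD1] linearI)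
      (simp_all add: matrix_vector_mult_add_rdistrib scaleR_matrix_vector_assoc)
  then show ?thesis using l2_linear_image[OF assms, of "\<lambda>A. A *v \<nu>"] by simp
qed

text \<open>On an open simplex the set where a component is nonzero is open and null, hence empty.
  Elsewhere the normalisation in \<open>pw_poly\<close> gives 0, so equality holds
  everywhere.\<close>

lemma pw_poly_eq_0:
  assumes v: "v \<in> pw_poly k M" and ae: "AE x in lebesgue_on \<Omega>. v x = 0" shows "v = (\<lambda>x. 0)"
proof
  fix x show "v x = 0"
  proof (cases "x \<in> (\<Union>K\<in>M. interior K)")
    case True
    then obtain K where K: "K \<in> M" "x \<in> interior K" by blast
    show ?thesis
    proof (rule euclidean_eqI)
      fix b :: 'a assume b: "b \<in> Basis"
      obtain p where p: "p \<in> polynomials k" "\<And>y. y \<in> interior K \<Longrightarrow> v y \<bullet> b = p y"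
        using pw_poly_piece[OF v K(1) b] by blast
      define N where "N = interior K \<inter> {y. p y \<noteq> 0}"
      have "open {y. p y \<noteq> 0}" using smooth_continuous[OF polynomials_smooth[OF p(1)]]
        by (intro open_Collect_neq continuous_on_const)
      then have oN: "open N" by (simp add: N_def open_Int)
      have "AE y in lebesgue_on (interior K). v y = 0" by (rule AE_\<Omega>D[OF ae K(1)])
      then have "AE y in lebesgue. y \<in> interior K \<longrightarrow> v y = 0" using M_sets(2)[OF K(1)] by (simp add: AE_restrict_space_iff)
      then have "AE y in lebesgue. y \<notin> N"
      proof eventually_elim
        case (elim y)
        then show ?case using p(2)[of y] by (auto simp: N_def)
      qed
      then have "negligible N" using oN AE_iff_null_sets[of N lebesgue] by (simp add: negligible_iff_null_sets)
      then have "N = {}" using open_not_negligible[OF oN] by blast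
      then show "v x \<bullet> b = 0 \<bullet> b" using K(2) p(2)[OF K(2)] by (auto simp: N_def)
    qed
  next
    case False
    then show ?thesis using v by (simp add: pw_poly_def)
  qed
qed

text \<open>A primitive of the bump in one coordinate. It is smooth but need not have compact
  support, which suits fields without jumps on any face, boundary included: they may be tested with
  every smooth function.\<close>

lemma antiderivative_bump:
  fixes a b :: "real^'n" and j :: 'n
  obtains \<phi> where "smooth \<phi>" "\<And>x. gradient \<phi> x $ j = box_bump a b k x"
proof -
  let ?b = "\<lambda>i t. flat 0 (real (Suc k) * (t - a $ i)) * flat 0 (real (Suc k) * (b $ i - t))"
  have flat_c: "isCont (flat 0) t" for t using flat_DERIV[of 0 t] by (rule DERIV_isCont)
  have "isCont (?b j) t" for t
    by (intro continuous_intros isCont_o2[of _ "\<lambda>t. real (Suc k) * (t - a $ j)" "flat 0"]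
        isCont_o2[of _ "\<lambda>t. real (Suc k) * (b $ j - t)" "flat 0"] flat_c)
  then obtain B where B: "\<And>t. (B has_real_derivative ?b j t) (at t)"
    using einterval_antiderivative[of "-\<infinity>" "\<infinity>" "?b j"]
    by (auto simp: has_real_derivative_iff_has_vector_derivative)
  define \<phi> where "\<phi> x = B (x $ j) * (\<Prod>i\<in>UNIV - {j}. ?b i (x $ i))" for x :: "real^'n"
  have 1: "elementary (\<lambda>x. real (Suc k) * (x $ i + (- c)))" for i :: 'n and c :: real
    by (intro elementary_intros)
  have 2: "elementary (\<lambda>x. real (Suc k) * (c + (- 1) * x $ i))" for i :: 'n and c :: real
    by (intro elementary_intros)
  have bi: "elementary (\<lambda>x. ?b i (x $ i))" for i
  proof -
    have "elementary (\<lambda>x. flat 0 (real (Suc k) * (x $ i + (- a $ i))) * flat 0 (real (Suc k) * (b $ i + (- 1) * x $ i)))"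
      by (intro elementary.mult elementary.flat 1 2)
    then show ?thesis by simp
  qed
  have "elementary \<phi>" unfolding \<phi>_def
    by (intro elementary.mult elementary_prod bi elementary.antiderivative[OF B])
  then have s: "smooth \<phi>" by (rule elementary_smooth)
  have "gradient \<phi> x $ j = box_bump a b k x" for x
  proof (rule gradient_nth_eqI[OF s])
    let ?R = "\<Prod>i\<in>UNIV - {j}. ?b i (x $ i)"
    have line: "\<phi> (x + t *\<^sub>R axis j 1) = B (x $ j + t) * ?R" for t
      unfolding \<phi>_def by (auto simp: axis_def intro!: prod.cong)
    have "((\<lambda>t. B (x $ j + t)) has_real_derivative ?b j (x $ j)) (at 0)"
      using B[of "x $ j"] DERIV_at_within_shift[of B "?b j (x $ j)" "x $ j" 0 UNIV] by simp
    then have "((\<lambda>t. B (x $ j + t) * ?R) has_real_derivative ?b j (x $ j) * ?R) (at 0)"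
      by (rule DERIV_cmult_right)
    moreover have "box_bump a b k x = ?b j (x $ j) * ?R"
      unfolding box_bump_def by (rule prod.remove) auto
    ultimately show "((\<lambda>t. \<phi> (x + t *\<^sub>R axis j 1)) has_real_derivative box_bump a b k x) (at 0)"
      by (simp only: line)
  qed
  with s show ?thesis using that by blast
qed

text \<open>With vanishing broken gradient and jumps, elementwise integration by parts gives 0 for
  the integral of \<open>v x $ i\<close> against every partial derivative of a smooth function.
  Bumps are such derivatives by \<open>antiderivative_bump\<close>, so the fundamental lemma
  applies. The boundary faces are part of the jump term; this excludes constants.\<close>

lemma norm_dG_definite:
  assumes v: "v \<in> pw_poly k M" and \<eta>: "0 < \<eta>" and zero: "Gf v v + Jf \<eta> v v = 0"
  shows "v = (\<lambda>x. 0)"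
proof (rule pw_poly_eq_0[OF v])
  note av = pw_poly_adm[OF v]
  have G0: "Gf v v = 0" and J0: "Jf \<eta> v v = 0"
    using zero Gf_nonneg[of v] Jf_nonneg[OF \<eta>, of v] by linarith+
  have "l2_norm (lebesgue_on \<Omega>) (broken_grad M v) = 0" using G0 by (simp add: Gf_def l2_norm_eq)
  then have bg: "AE x in lebesgue_on \<Omega>. broken_grad M v x = 0" by (rule l2_norm_eq_0[OF broken_grad_l2[OF av]])
  have jump0: "AE x in face_measure F. jump \<Omega> M n F v x = 0" if F: "F \<in> faces M" for F
  proof -
    have "\<forall>F\<in>faces M. \<eta> / diameter F * (\<integral>x. jump \<Omega> M n F v x \<bullet> jump \<Omega> M n F v x \<partial>face_measure F) = 0"
      using J0 unfolding Jf_eq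
    proof (subst (asm) sum_nonneg_eq_0_iff[OF finite_faces])
      fix F assume "F \<in> faces M"
      then show "0 \<le> \<eta> / diameter F * (\<integral>x. jump \<Omega> M n F v x \<bullet> jump \<Omega> M n F v x \<partial>face_measure F)"
        using \<eta> diameter_face_pos[of F]
        by (intro mult_nonneg_nonneg divide_nonneg_nonneg Bochner_Integration.integral_nonneg inner_ge_zero) auto
    qed
    from bspec[OF this F] have "(\<integral>x. jump \<Omega> M n F v x \<bullet> jump \<Omega> M n F v x \<partial>face_measure F) = 0"
      using \<eta> diameter_face_pos[OF F] by simp
    then have "l2_norm (face_measure F) (jump \<Omega> M n F v) = 0" by (simp add: l2_norm_eq)
    then show ?thesis by (rule l2_norm_eq_0[OF jump_l2[OF av F]])
  qed
  have vi: "(\<lambda>x. v x $ i) \<in> l2 (lebesgue_on \<Omega>)" for i by (rule l2_nth[OF pw_poly_l2[OF v]])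
  have test: "(\<integral>x. v x $ i * gradient \<phi> x $ j \<partial>lebesgue_on \<Omega>) = 0" if \<phi>: "smooth \<phi>" for \<phi> i j
  proof -
    \<comment> \<open>The matrix field with the single entry \<open>\<phi>\<close> at
      \<open>(i, j)\<close>: its row-wise divergence is the \<open>j\<close>-th derivative of
      \<open>\<phi>\<close> in component \<open>i\<close>.\<close>
    define q where "q i' j' = (if i' = i \<and> j' = j then \<phi> else (\<lambda>x. 0))" for i' j'
    define Q where "Q x = (\<chi> i' j'. q i' j' x)" for x
    have qs: "smooth (q i' j')" for i' j' using \<phi> by (simp add: q_def smooth_zero)
    have Qc: "continuous_on UNIV (\<lambda>x. Q x *v \<nu>)" for \<nu>
      unfolding Q_def matrix_vector_mult_def
      by (simp add: continuous_on_vec_lambda continuous_on_sum continuous_on_mult smooth_continuous[OF qs] continuous_on_const)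
    have g0: "gradient (\<lambda>x. 0 :: real) x = (0 :: real^'n)" for x by (rule gradient_eqI) simp
    have div: "v x \<bullet> (\<chi> i'. \<Sum>j'\<in>UNIV. gradient (q i' j') x $ j') = v x $ i * gradient \<phi> x $ j" for x
    proof -
      have s: "(\<Sum>j'\<in>UNIV. gradient (q i' j') x $ j') = (if i' = i then gradient \<phi> x $ j else 0)" for i'
      proof -
        have "gradient (q i' j') x $ j' = (if j' = j then (if i' = i then gradient \<phi> x $ j else 0) else 0)" for j'
          by (simp add: q_def g0)
        then show ?thesis by simp
      qed
      have "v x \<bullet> (\<chi> i'. \<Sum>j'\<in>UNIV. gradient (q i' j') x $ j') = (\<Sum>i'\<in>UNIV. if i' = i then v x $ i * gradient \<phi> x $ j else 0)"
        unfolding s inner_vec_def by (intro sum.cong) auto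
      then show ?thesis by simp
    qed
    have int: "integrable (lebesgue_on \<Omega>) (\<lambda>x. v x $ i * gradient \<phi> x $ j)"
      using l2_inner_integrable[OF vi[of i] l2_nth[OF continuous_l2[OF smooth_continuous_gradient[OF \<phi>] bounded_\<Omega> \<Omega>_sets], of j]]
      by simp
    have "(\<integral>x. v x $ i * gradient \<phi> x $ j \<partial>lebesgue_on \<Omega>) = (\<Sum>K\<in>M. \<integral>x. v x $ i * gradient \<phi> x $ j \<partial>lebesgue_on (interior K))"
      by (rule integral_\<Omega>[OF int])
    also have "\<dots> = (\<Sum>K\<in>M. \<Sum>F | F facet_of K. \<integral>x. tr K F v x \<bullet> (Q x *v onormal K F) \<partial>face_measure F)"
    proof (intro sum.cong refl)
      fix K assume K: "K \<in> M"
      have "AE x in lebesgue_on (interior K). x \<in> interior K" using AE_space by eventually_elim simp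
      with AE_\<Omega>D[OF bg K] have z: "AE x in lebesgue_on (interior K). vgrad (interior K) v x = 0"
        by eventually_elim (simp add: broken_grad_interior[OF K])
      have m1: "vgrad (interior K) v \<in> borel_measurable (lebesgue_on (interior K))" by (rule l2_measurable[OF vgrad_l2[OF av K]])
      have m2: "Q \<in> borel_measurable (lebesgue_on (interior K))"
        unfolding Q_def
        using continuous_l2[of "\<lambda>x. \<chi> i' j'. q i' j' x", OF continuous_on_vec_lambda[OF continuous_on_vec_lambda[OF smooth_continuous[OF qs]]] M_sets(3,2)[OF K]]
        by (simp add: l2_def)
      have m3: "(\<lambda>x. v x $ i * gradient \<phi> x $ j) \<in> borel_measurable (lebesgue_on (interior K))"
        using integrable_lebesgue_on_mono[OF int interior_subset_\<Omega>[OF K] M_sets(2)[OF K] \<Omega>_sets] by auto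
      have "(\<integral>x. v x $ i * gradient \<phi> x $ j \<partial>lebesgue_on (interior K))
          = (\<integral>x. vgrad (interior K) v x \<bullet> Q x + v x $ i * gradient \<phi> x $ j \<partial>lebesgue_on (interior K))"
      proof (rule integral_cong_AE)
        show "AE x in lebesgue_on (interior K). v x $ i * gradient \<phi> x $ j = vgrad (interior K) v x \<bullet> Q x + v x $ i * gradient \<phi> x $ j"
          using z by eventually_elim simp
        show "(\<lambda>x. vgrad (interior K) v x \<bullet> Q x + v x $ i * gradient \<phi> x $ j) \<in> borel_measurable (lebesgue_on (interior K))"
          by (rule borel_measurable_add[OF borel_measurable_inner[OF m1 m2] m3])
      qed (rule m3)
      also have "\<dots> = (\<Sum>F | F facet_of K. \<integral>x. tr K F v x \<bullet> (Q x *v onormal K F) \<partial>face_measure F)"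
        using element_identity[OF K av, of q, OF qs] by (simp only: div Q_def[symmetric])
      finally show "(\<integral>x. v x $ i * gradient \<phi> x $ j \<partial>lebesgue_on (interior K))
          = (\<Sum>F | F facet_of K. \<integral>x. tr K F v x \<bullet> (Q x *v onormal K F) \<partial>face_measure F)" .
    qed
    also have "\<dots> = 0"
      unfolding sum_facets
    proof (intro sum.neutral ballI)
      fix F assume F: "F \<in> faces M"
      have Ql: "(\<lambda>x. Q x *v n F) \<in> l2 (face_measure F)" by (rule facet_facts(4)[OF K1_facet(1,2)[OF F] Qc])
      have J: "(\<integral>x. jump \<Omega> M n F v x \<bullet> (Q x *v n F) \<partial>face_measure F) = 0"
        by (rule integral_eq_zero_AE) (use jump0[OF F] in eventually_elim, simp)
      show "(if F \<in> interior_faces \<Omega> M then (\<integral>x. tr (K1 F) F v x \<bullet> (Q x *v onormal (K1 F) F) \<partial>face_measure F)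
          + (\<integral>x. tr (K2 F) F v x \<bullet> (Q x *v onormal (K2 F) F) \<partial>face_measure F)
        else (\<integral>x. tr (K1 F) F v x \<bullet> (Q x *v onormal (K1 F) F) \<partial>face_measure F)) = 0"
      proof (cases "F \<in> interior_faces \<Omega> M")
        case True
        have mv: "Q x *v (- n F) = - (Q x *v n F)" for x by (simp add: matrix_vector_mult_def vec_eq_iff sum_negf)
        have "(\<integral>x. (tr (K1 F) F v x - tr (K2 F) F v x) \<bullet> (Q x *v n F) \<partial>face_measure F) = 0"
          using J by (simp add: jump_eq[OF F] True)
        then show ?thesis
          using True l2_form.form_diff[OF tr_face_l2(1)[OF av F] tr_face_l2(2)[OF av F True] Ql]
          by (simp add: onormal_K mv)
      next
        case False
        then show ?thesis using J by (simp add: onormal_K jump_eq[OF F])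
      qed
    qed
    finally show ?thesis .
  qed
  have "AE x in lebesgue_on \<Omega>. v x $ i = 0" for i
  proof (rule fundamental_lemma[OF open_\<Omega> bounded_\<Omega> vi])
    fix a b k
    obtain \<phi> :: "real^'n \<Rightarrow> real" where "smooth \<phi>" "\<And>x. gradient \<phi> x $ i = box_bump a b k x" using antiderivative_bump by blast
    with test[of \<phi> i i] show "(\<integral>x. box_bump a b k x * v x $ i \<partial>lebesgue_on \<Omega>) = 0" by (simp add: mult.commute)
  qed
  then show "AE x in lebesgue_on \<Omega>. v x = 0" by (intro AE_vecI) simp
qed

end

text \<open>For positive \<open>a\<close> and \<open>b\<close> the minimum over \<open>t\<close> is
  attained at \<open>sqrt b / sqrt a\<close>; if one of them is 0, large or small \<open>t\<close>
  show that \<open>x\<close> is at most 0. This turns a facewise Young inequality with a common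
  parameter into a Cauchy-Schwarz inequality for the sum over all faces.\<close>

lemma young_optimal:
  fixes x a b :: real
  assumes "0 \<le> a" "0 \<le> b" "\<And>t. 0 < t \<Longrightarrow> x \<le> t / 2 * a + b / (2 * t)"
  shows "x \<le> sqrt a * sqrt b"
proof (cases "a = 0 \<or> b = 0")
  case True
  have "x \<le> e" if e: "0 < e" for e
  proof -
  have half: "e * y / 2 \<le> e" if "y \<le> 1" for y
  proof -
    have "e * y \<le> e" using mult_left_mono[OF that, of e] e by simp
    then show ?thesis using e by linarith
  qed
  show ?thesis
  proof (cases "a = 0")
    case True
    \<comment> \<open>This \<open>t\<close> makes \<open>b / (2 * t)\<close> at most
      \<open>e\<close>; the added 1 keeps it positive when \<open>b = 0\<close>.\<close>
    have "x \<le> (b + 1) / e / 2 * a + b / (2 * ((b + 1) / e))" using e assms(2) by (intro assms(3)) auto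
    also have "\<dots> = e * (b / (b + 1)) / 2" using True assms(2) e by (simp add: field_simps)
    also have "\<dots> \<le> e"
      by (rule half) (use assms in simp)
    finally show ?thesis .
  next
    case False
    then have b: "b = 0" using \<open>a = 0 \<or> b = 0\<close> by simp
    have "x \<le> e / (a + 1) / 2 * a + b / (2 * (e / (a + 1)))" using e assms(1) by (intro assms(3)) auto
    also have "\<dots> = e * (a / (a + 1)) / 2" using b by simp
    also have "\<dots> \<le> e"
      by (rule half) (use assms in simp)
    finally show ?thesis .
  qed
  qed
  then have "x \<le> 0" by - (rule field_le_epsilon, simp)
  then show ?thesis using True by auto
next
  case False
  then have ab: "0 < sqrt a" "0 < sqrt b" using assms by auto
  have "x \<le> (sqrt b / sqrt a) / 2 * a + b / (2 * (sqrt b / sqrt a))" using ab by (intro assms(3)) simp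
  also have "\<dots> = sqrt b / sqrt a / 2 * (sqrt a * sqrt a) + (sqrt b * sqrt b) / (2 * (sqrt b / sqrt a))"
    using assms(1,2) by simp
  also have "\<dots> = sqrt a * sqrt b" using ab by (simp add: field_simps del: real_sqrt_mult_self)
  finally show ?thesis .
qed

lemma norm_matrix_vector_le:
  fixes A :: "real^'n^'m"
  shows "norm (A *v x) \<le> norm A * norm x"
proof -
  have "norm (A *v x) = L2_set (\<lambda>i. norm ((A *v x) $ i)) UNIV" by (simp add: norm_vec_def)
  also have "\<dots> \<le> L2_set (\<lambda>i. norm (A $ i) * norm x) UNIV"
    by (intro L2_set_mono) (simp_all add: matrix_vector_mul_component Cauchy_Schwarz_ineq2)
  also have "\<dots> = norm A * norm x" by (simp add: L2_set_left_distrib norm_vec_def)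
  finally show ?thesis .
qed

text \<open>\<open>t1\<close>, \<open>t2\<close> stand for the trace of \<open>E w\<close> against
  the fluxes \<open>?A1\<close>, \<open>?A2\<close> of the two sides of a face, \<open>a\<close>,
  \<open>b\<close> for the trace of \<open>w\<close> from the first side against them,
  \<open>c\<close>, \<open>d\<close> for the one from the second. The first assumption sums the two
  element boundaries, the second is the moment condition for the flux jump, and the conclusion is
  minus the average flux against the jump of \<open>w\<close>.\<close>

lemma moment_arithmetic:
  fixes s t1 t2 a b c d :: real
  assumes "s = t1 + (-1) * a - (t2 + (-1) * d)" "t1 - t2 = (1/2) * (a - b + c - d)"
  shows "s = - ((1/2) * (a + b - (c + d)))"
  using assms by (simp add: field_simps)

section \<open>Consistency and coercivity\<close>

locale dg_lift = dg_mesh \<Omega> M n for \<Omega> :: "(real^'n) set" and M n +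
  fixes l :: nat and E :: "(real^'n \<Rightarrow> real^'n) \<Rightarrow> real^'n \<Rightarrow> real^'n" and \<eta>bar \<eta> :: real
  assumes E: "linear_into_h1_0 \<Omega> (pw_poly (int l) M) E"
    and face_moments: "\<And>v F m. \<lbrakk>v \<in> pw_poly (int l) M; F \<in> interior_faces \<Omega> M; m \<in> polynomials_vec (int l - 1)\<rbrakk> \<Longrightarrow>
         (\<integral>x. face_trace \<Omega> F (E v) x \<bullet> m x \<partial>face_measure F) = (\<integral>x. average \<Omega> M n F v x \<bullet> m x \<partial>face_measure F)"
    and element_moments: "\<And>v K m. \<lbrakk>v \<in> pw_poly (int l) M; K \<in> M; m \<in> polynomials_vec (int l - 2)\<rbrakk> \<Longrightarrow>
         (\<integral>x. E v x \<bullet> m x \<partial>lebesgue_on K) = (\<integral>x. v x \<bullet> m x \<partial>lebesgue_on K)"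
    and \<eta>bar: "0 < \<eta>bar" and \<eta>: "\<eta>bar < \<eta>"
    and average_bound: "\<And>v :: real^'n \<Rightarrow> real^'n^'n. v \<in> pw_poly (int l) M \<Longrightarrow>
         skeleton_integral M (\<lambda>F x. diameter F * (norm (average \<Omega> M n F v x))\<^sup>2)
         \<le> \<eta>bar * (l2_norm (lebesgue_on \<Omega>) v)\<^sup>2"
begin

abbreviation "V \<equiv> (pw_poly (int l) M :: (real^'n \<Rightarrow> real^'n) set)"
abbreviation "dG_norm \<equiv> norm_dG \<Omega> M n \<eta>"

lemma \<eta>_pos: "0 < \<eta>"
  using \<eta>bar \<eta> by simp

lemma E_h10: "v \<in> V \<Longrightarrow> E v \<in> h1_0_vec \<Omega>"
  using E by (simp add: linear_into_h1_0_def)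

lemma V_adm: "v \<in> V \<Longrightarrow> adm v"
  by (rule pw_poly_adm)

lemma E_adm: "v \<in> V \<Longrightarrow> adm (E v)"
  by (intro h10_adm E_h10)

lemma V_diff: assumes "v \<in> V" "w \<in> V" shows "(\<lambda>x. v x - w x) \<in> V"
  using pw_poly_add[OF assms(1) pw_poly_scale[OF assms(2), of "-1"]] by simp

text \<open>The moment conditions make \<open>E w\<close> indistinguishable from \<open>w\<close> in the elementwise integration by
  parts against a piecewise polynomial gradient.\<close>

lemma grad_identity:
  assumes z: "z \<in> V" and w: "w \<in> V"
  shows "Gf z (E w) = Gf z w - Sf z w"
proof -
  obtain p where p: "\<And>K i. K \<in> M \<Longrightarrow> p K i \<in> polynomials (int l)"
    "\<And>K i x. \<lbrakk>K \<in> M; x \<in> interior K\<rbrakk> \<Longrightarrow> z x $ i = p K i x"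
    using pw_poly_pieces_vec[OF z] by blast
  obtain g where g: "g \<in> pw_poly (int l - 1) M" "\<And>K x. \<lbrakk>K \<in> M; x \<in> interior K\<rbrakk> \<Longrightarrow> g x = (\<chi> i. gradient (p K i) x)"
    "AE x in lebesgue_on \<Omega>. broken_grad M z x = g x" "\<And>K F. K \<in> M \<Longrightarrow> tr K F (broken_grad M z) = tr K F g"
    using broken_grad_pw_poly[where p = p, OF z p] by blast
  define q where "q K i j x = gradient (p K i) x $ j" for K i j x
  define Q where "Q K x = (\<chi> i j. q K i j x)" for K x
  have qp: "q K i j \<in> polynomials (int l - 1)" if "K \<in> M" for K i j
    unfolding q_def by (rule polynomials_gradient[OF p(1)[OF that]])
  have qs: "smooth (q K i j)" if "K \<in> M" for K i j using polynomials_smooth[OF qp[OF that]] .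
  have Qg: "Q K x = (\<chi> i. gradient (p K i) x)" for K x by (simp add: Q_def q_def vec_eq_iff)
  have Qc: "continuous_on UNIV (Q K)" if "K \<in> M" for K
    unfolding Q_def by (intro continuous_on_vec_lambda smooth_continuous qs that)
  have aw: "adm w" and aE: "adm (E w)" and az: "adm z" using V_adm E_adm z w by auto
  \<comment> \<open>This difference is integrated by parts elementwise: the volume term vanishes by
    the element moments, and the interior face terms are evaluated by the face moments.\<close>
  define D where "D = (\<lambda>x. E w x + (- 1) *\<^sub>R w x)"
  have aD: "adm D" unfolding D_def by (rule adm_combine[OF aE aw])
  have gl: "g \<in> l2 (lebesgue_on \<Omega>)" by (rule pw_poly_l2[OF g(1)])
  have "Gf D z = Gf (E w) z + (- 1) * Gf w z" unfolding D_def by (rule Gf_combine[OF aE aw az])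
  then have GD: "Gf D z = Gf z (E w) - Gf z w" by (simp add: Gf_def inner_commute)
  have elem0: "(\<integral>x. D x \<bullet> (\<chi> i. \<Sum>j\<in>UNIV. gradient (q K i j) x $ j) \<partial>lebesgue_on (interior K)) = 0"
    and elemint: "integrable (lebesgue_on (interior K)) (\<lambda>x. D x \<bullet> (\<chi> i. \<Sum>j\<in>UNIV. gradient (q K i j) x $ j))"
    if K: "K \<in> M" for K
  proof -
    define m where "m x = (\<chi> i. \<Sum>j\<in>UNIV. gradient (q K i j) x $ j)" for x
    \<comment> \<open>Second derivatives of a polynomial of degree \<open>l\<close>; for
      \<open>l = 1\<close> the degree bound -1 makes \<open>m\<close> zero.\<close>
    have mi: "(\<lambda>x. m x $ i) \<in> polynomials (int l - 2)" for i
    proof -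
      have "(\<lambda>x. gradient (q K i j) x $ j) \<in> polynomials (int l - 2)" for j
        using polynomials_gradient[OF qp[OF K, of i j], of j] by simp
      then show ?thesis by (simp add: m_def polynomials_sum)
    qed
    then have "m \<in> polynomials_vec (int l - 2)" by (simp add: polynomials_vec_def)
    from element_moments[OF w K this]
    have eq: "(\<integral>x. E w x \<bullet> m x \<partial>lebesgue_on (interior K)) = (\<integral>x. w x \<bullet> m x \<partial>lebesgue_on (interior K))"
      by (simp add: integral_lebesgue_on_null_diff[OF M_sets(2,1)[OF K] interior_subset M_sets(4)[OF K]])
    have ml: "m \<in> l2 (lebesgue_on (interior K))"
    proof (rule l2_vec)
      fix i show "(\<lambda>x. m x $ i) \<in> l2 (lebesgue_on (interior K))"
        by (intro continuous_l2 smooth_continuous polynomials_smooth[OF mi] M_sets[OF K])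
    qed
    have l: "E w \<in> l2 (lebesgue_on (interior K))" "w \<in> l2 (lebesgue_on (interior K))" "D \<in> l2 (lebesgue_on (interior K))"
    proof -
      have "v \<in> l2 (lebesgue_on (interior K))" if "adm v" for v :: "real^'n \<Rightarrow> real^'n"
        by (rule l2_vec) (use h1s_weak_gradient[OF adm_component[OF that K]] in \<open>simp add: weak_gradient_def\<close>)
      then show "E w \<in> l2 (lebesgue_on (interior K))" "w \<in> l2 (lebesgue_on (interior K))" "D \<in> l2 (lebesgue_on (interior K))"
        using aE aw aD by blast+
    qed
    have "(\<integral>x. D x \<bullet> m x \<partial>lebesgue_on (interior K)) = (\<integral>x. E w x \<bullet> m x \<partial>lebesgue_on (interior K)) + (- 1) * (\<integral>x. w x \<bullet> m x \<partial>lebesgue_on (interior K))"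
      by (rule l2_inner_combine[OF l(1,2) ml l(3)]) (simp add: D_def)
    then show "(\<integral>x. D x \<bullet> (\<chi> i. \<Sum>j\<in>UNIV. gradient (q K i j) x $ j) \<partial>lebesgue_on (interior K)) = 0"
      using eq by (simp add: m_def)
    show "integrable (lebesgue_on (interior K)) (\<lambda>x. D x \<bullet> (\<chi> i. \<Sum>j\<in>UNIV. gradient (q K i j) x $ j))"
      using l2_inner_integrable[OF l(3) ml] by (simp add: m_def)
  qed
  have "Gf D z = (\<integral>x. broken_grad M D x \<bullet> g x \<partial>lebesgue_on \<Omega>)"
    unfolding Gf_def
    by (rule integral_cong_AE)
      (use g(3) l2_measurable[OF broken_grad_l2[OF aD]] l2_measurable[OF broken_grad_l2[OF az]] l2_measurable[OF gl]
        in \<open>auto intro!: borel_measurable_inner\<close>)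
  also have "\<dots> = (\<Sum>K\<in>M. \<integral>x. broken_grad M D x \<bullet> g x \<partial>lebesgue_on (interior K))"
    by (rule integral_\<Omega>[OF l2_inner_integrable[OF broken_grad_l2[OF aD] gl]])
  also have "\<dots> = (\<Sum>K\<in>M. \<Sum>F | F facet_of K. \<integral>x. tr K F D x \<bullet> (Q K x *v onormal K F) \<partial>face_measure F)"
  proof (intro sum.cong refl)
    fix K assume K: "K \<in> M"
    have Ql: "Q K \<in> l2 (lebesgue_on (interior K))" by (rule continuous_l2[OF Qc[OF K] M_sets(3,2)[OF K]])
    have "(\<integral>x. broken_grad M D x \<bullet> g x \<partial>lebesgue_on (interior K)) = (\<integral>x. vgrad (interior K) D x \<bullet> Q K x \<partial>lebesgue_on (interior K))"
      by (intro Bochner_Integration.integral_cong refl) (simp add: broken_grad_interior[OF K] g(2)[OF K] Qg)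
    also have "\<dots> = (\<integral>x. vgrad (interior K) D x \<bullet> Q K x + D x \<bullet> (\<chi> i. \<Sum>j\<in>UNIV. gradient (q K i j) x $ j) \<partial>lebesgue_on (interior K))"
      using elem0[OF K] elemint[OF K] l2_inner_integrable[OF vgrad_l2[OF aD K] Ql] by simp
    also have "\<dots> = (\<Sum>F | F facet_of K. \<integral>x. tr K F D x \<bullet> (Q K x *v onormal K F) \<partial>face_measure F)"
      unfolding Q_def by (rule element_identity[OF K aD, of "q K", OF qs[OF K]])
    finally show "(\<integral>x. broken_grad M D x \<bullet> g x \<partial>lebesgue_on (interior K))
        = (\<Sum>F | F facet_of K. \<integral>x. tr K F D x \<bullet> (Q K x *v onormal K F) \<partial>face_measure F)" .
  qed
  also have "\<dots> = - Sf z w"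
    unfolding sum_facets Sf_def skeleton_integral_def sum_negf[symmetric]
  proof (intro sum.cong refl)
    fix F assume F: "F \<in> faces M"
    let ?\<mu> = "face_measure F"
    note K1F = K1_facet(1,2)[OF F]
    have tr_g: "AE x in ?\<mu>. tr K F g x = Q K x" if K: "K \<in> M" "F facet_of K" for K
    proof (rule tr_eqI[OF pw_poly_adm[OF g(1)] K])
      fix b :: "real^'n^'n" assume "b \<in> Basis"
      then obtain i j where b: "b = axis i (axis j 1)" by (auto simp: Basis_vec_def)
      show "is_trace (interior K) F (\<lambda>y. g y \<bullet> b) (\<lambda>x. Q K x \<bullet> b)"
        unfolding b Q_def using locally_smooth(4)[OF K(1) qs[OF K(1), of i j], of "\<lambda>y. g y \<bullet> axis i (axis j 1)" F]
        by (simp add: inner_axis g(2)[OF K(1)] q_def[abs_def])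
    qed
    have tr_D: "AE x in ?\<mu>. tr K F D x = tr K F (E w) x + (- 1) *\<^sub>R tr K F w x" if K: "K \<in> M" "F facet_of K" for K
      unfolding D_def by (rule tr_combine[OF aE aw K])
    have Q1: "(\<lambda>x. Q K x *v n F) \<in> l2 ?\<mu>" if "K \<in> M" "F facet_of K" for K
      by (rule matrix_l2[OF facet_facts(4)[OF that Qc[OF that(1)]]])
    show "(if F \<in> interior_faces \<Omega> M
        then (\<integral>x. tr (K1 F) F D x \<bullet> (Q (K1 F) x *v onormal (K1 F) F) \<partial>?\<mu>)
          + (\<integral>x. tr (K2 F) F D x \<bullet> (Q (K2 F) x *v onormal (K2 F) F) \<partial>?\<mu>)
        else (\<integral>x. tr (K1 F) F D x \<bullet> (Q (K1 F) x *v onormal (K1 F) F) \<partial>?\<mu>))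
      = - (\<integral>x. (average \<Omega> M n F (broken_grad M z) x *v n F) \<bullet> jump \<Omega> M n F w x \<partial>?\<mu>)"
    proof (cases "F \<in> interior_faces \<Omega> M")
      case False
      \<comment> \<open>On the boundary the zero trace of \<open>E w\<close> leaves
        \<open>- w\<close> as the trace of \<open>D\<close>.\<close>
      have "(\<integral>x. tr (K1 F) F D x \<bullet> (Q (K1 F) x *v n F) \<partial>?\<mu>)
          = (\<integral>x. - ((average \<Omega> M n F (broken_grad M z) x *v n F) \<bullet> jump \<Omega> M n F w x) \<partial>?\<mu>)"
      proof (rule integral_cong_AE)
        show "AE x in ?\<mu>. tr (K1 F) F D x \<bullet> (Q (K1 F) x *v n F)
            = - ((average \<Omega> M n F (broken_grad M z) x *v n F) \<bullet> jump \<Omega> M n F w x)"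
          using tr_D[OF K1F] tr_g[OF K1F] h10_trace_boundary[OF E_h10[OF w] F False]
          by eventually_elim (simp add: average_eq jump_eq[OF F] False g(4)[OF K1F(1)] inner_commute)
        show "(\<lambda>x. tr (K1 F) F D x \<bullet> (Q (K1 F) x *v n F)) \<in> borel_measurable ?\<mu>"
          by (intro borel_measurable_inner l2_measurable tr_l2 aD K1F Q1)
        have "average \<Omega> M n F (broken_grad M z) \<in> l2 ?\<mu>"
          using tr_l2[OF pw_poly_adm[OF g(1)] K1F] by (simp add: average_eq[abs_def] False g(4)[OF K1F(1)])
        then show "(\<lambda>x. - ((average \<Omega> M n F (broken_grad M z) x *v n F) \<bullet> jump \<Omega> M n F w x)) \<in> borel_measurable ?\<mu>"
          by (intro borel_measurable_uminus borel_measurable_inner l2_measurable[OF matrix_l2] l2_measurable[OF jump_l2] aw F)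
      qed
      then show ?thesis using False by (simp add: onormal_K)
    next
      case True
      note K2F = interior_face(4,5)[OF True]
      let ?A1 = "\<lambda>x. Q (K1 F) x *v n F" and ?A2 = "\<lambda>x. Q (K2 F) x *v n F"
      let ?T = "face_trace \<Omega> F (E w)" and ?w1 = "tr (K1 F) F w" and ?w2 = "tr (K2 F) F w"
      \<comment> \<open>The jump of the normal flux of \<open>z\<close>, a polynomial field. In the
        product rule [A w] = {A} [w] + [A] {w} for jumps and averages, the face moments tested with
        \<open>?m\<close> account for the last term.\<close>
      let ?m = "\<lambda>x. ?A1 x - ?A2 x"
      have Al: "?A1 \<in> l2 ?\<mu>" "?A2 \<in> l2 ?\<mu>" by (rule Q1[OF K1F] Q1[OF K2F])+
      have ml: "?m \<in> l2 ?\<mu>" by (rule l2_form.diff[OF Al])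
      have wl: "?w1 \<in> l2 ?\<mu>" "?w2 \<in> l2 ?\<mu>" by (rule tr_l2[OF aw K1F] tr_l2[OF aw K2F])+
      have t1: "AE x in ?\<mu>. tr (K1 F) F (E w) x = ?T x" and t2: "AE x in ?\<mu>. tr (K2 F) F (E w) x = ?T x"
        by (rule h10_trace[OF E_h10[OF w] K1F] h10_trace[OF E_h10[OF w] K2F])+
      have Tl: "?T \<in> l2 ?\<mu>"
      proof (rule l2_componentwise)
        fix b :: "real^'n" assume b: "b \<in> Basis"
        have "(\<lambda>x. E w x \<bullet> b) \<in> h1_0 \<Omega>" using h10_component[OF E_h10[OF w]] b by (auto simp: basis_vec inner_axis)
        from h1_0_trace_exists[OF this F] show "(\<lambda>x. ?T x \<bullet> b) \<in> l2 ?\<mu>"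
          by (intro facet_facts(6)[OF K1F, of "\<lambda>x. E w x \<bullet> b"] is_trace_element face_trace_is_trace b K1F(1))
      qed
      have mpoly: "?m \<in> polynomials_vec (int l - 1)"
        unfolding polynomials_vec_def
      proof (intro CollectI allI)
        fix i
        have pq: "(\<lambda>x. \<Sum>j\<in>UNIV. n F $ j * q K i j x) \<in> polynomials (int l - 1)" if "K \<in> M" for K
          by (intro polynomials_sum polynomials_scale qp that)
        have "(\<lambda>x. (\<Sum>j\<in>UNIV. n F $ j * q (K1 F) i j x) + (- 1) * (\<Sum>j\<in>UNIV. n F $ j * q (K2 F) i j x)) \<in> polynomials (int l - 1)"
          by (rule polynomials_combine[OF pq[OF K1F(1)] pq[OF K2F(1)]])
        then show "(\<lambda>x. ?m x $ i) \<in> polynomials (int l - 1)"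
          by (simp add: matrix_vector_mult_def Q_def mult.commute)
      qed
      have D1: "(\<integral>x. tr (K1 F) F D x \<bullet> ?A1 x \<partial>?\<mu>) = (\<integral>x. ?T x \<bullet> ?A1 x \<partial>?\<mu>) + (- 1) * (\<integral>x. ?w1 x \<bullet> ?A1 x \<partial>?\<mu>)"
        by (rule l2_inner_combine[OF Tl wl(1) Al(1) tr_l2[OF aD K1F]])
          (use tr_D[OF K1F] t1 in eventually_elim, simp)
      have D2: "(\<integral>x. tr (K2 F) F D x \<bullet> ?A2 x \<partial>?\<mu>) = (\<integral>x. ?T x \<bullet> ?A2 x \<partial>?\<mu>) + (- 1) * (\<integral>x. ?w2 x \<bullet> ?A2 x \<partial>?\<mu>)"
        by (rule l2_inner_combine[OF Tl wl(2) Al(2) tr_l2[OF aD K2F]])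
          (use tr_D[OF K2F] t2 in eventually_elim, simp)
      have mom: "(\<integral>x. ?T x \<bullet> ?A1 x \<partial>?\<mu>) - (\<integral>x. ?T x \<bullet> ?A2 x \<partial>?\<mu>)
          = (1/2) * ((\<integral>x. ?w1 x \<bullet> ?A1 x \<partial>?\<mu>) - (\<integral>x. ?w1 x \<bullet> ?A2 x \<partial>?\<mu>) + (\<integral>x. ?w2 x \<bullet> ?A1 x \<partial>?\<mu>) - (\<integral>x. ?w2 x \<bullet> ?A2 x \<partial>?\<mu>))"
      proof -
        have "(\<integral>x. ?T x \<bullet> ?m x \<partial>?\<mu>) = (\<integral>x. average \<Omega> M n F w x \<bullet> ?m x \<partial>?\<mu>)"
          by (rule face_moments[OF w True mpoly])
        also have "\<dots> = (\<integral>x. ((1/2) *\<^sub>R (?w1 x + ?w2 x)) \<bullet> ?m x \<partial>?\<mu>)" by (simp add: average_eq True)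
        also have "\<dots> = (1/2) * (\<integral>x. (?w1 x + ?w2 x) \<bullet> ?m x \<partial>?\<mu>)" by (rule l2_form.form_scale[OF l2_add[OF wl] ml])
        also have "(\<integral>x. (?w1 x + ?w2 x) \<bullet> ?m x \<partial>?\<mu>) = (\<integral>x. ?w1 x \<bullet> ?m x \<partial>?\<mu>) + (\<integral>x. ?w2 x \<bullet> ?m x \<partial>?\<mu>)"
          by (rule l2_form.form_add[OF wl ml])
        finally show ?thesis
          by (simp only: l2_form.form_diff_right[OF Al Tl] l2_form.form_diff_right[OF Al wl(1)] l2_form.form_diff_right[OF Al wl(2)])
            (simp add: algebra_simps)
      qed
      have "(\<integral>x. (average \<Omega> M n F (broken_grad M z) x *v n F) \<bullet> jump \<Omega> M n F w x \<partial>?\<mu>)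
          = (\<integral>x. (?w1 x - ?w2 x) \<bullet> ((1/2) *\<^sub>R (?A1 x + ?A2 x)) \<partial>?\<mu>)"
      proof (rule integral_cong_AE)
        show "AE x in ?\<mu>. (average \<Omega> M n F (broken_grad M z) x *v n F) \<bullet> jump \<Omega> M n F w x
            = (?w1 x - ?w2 x) \<bullet> ((1/2) *\<^sub>R (?A1 x + ?A2 x))"
          using tr_g[OF K1F] tr_g[OF K2F]
          by eventually_elim (simp add: average_eq True jump_eq[OF F] g(4)[OF K1F(1)] g(4)[OF K2F(1)]
            matrix_vector_mult_add_rdistrib scaleR_matrix_vector_assoc[symmetric] inner_commute)
        have "(\<lambda>x. (1/2) *\<^sub>R (tr (K1 F) F g x + tr (K2 F) F g x)) \<in> l2 ?\<mu>"
          by (intro l2_scale l2_add tr_l2 pw_poly_adm[OF g(1)] K1F K2F)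
        then have "average \<Omega> M n F (broken_grad M z) \<in> l2 ?\<mu>"
          by (simp add: average_eq[abs_def] True g(4)[OF K1F(1)] g(4)[OF K2F(1)])
        then show "(\<lambda>x. (average \<Omega> M n F (broken_grad M z) x *v n F) \<bullet> jump \<Omega> M n F w x) \<in> borel_measurable ?\<mu>"
          by (intro borel_measurable_inner l2_measurable[OF matrix_l2] l2_measurable[OF jump_l2] aw F)
        show "(\<lambda>x. (?w1 x - ?w2 x) \<bullet> ((1/2) *\<^sub>R (?A1 x + ?A2 x))) \<in> borel_measurable ?\<mu>"
          by (intro borel_measurable_inner l2_measurable[OF l2_form.diff[OF wl]] l2_measurable[OF l2_scale[OF l2_add[OF Al]]])
      qed
      also have "\<dots> = (1/2) * (\<integral>x. (?w1 x - ?w2 x) \<bullet> (?A1 x + ?A2 x) \<partial>?\<mu>)"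
        by (rule l2_form.form_scale_right[OF l2_add[OF Al] l2_form.diff[OF wl]])
      also have "(\<integral>x. (?w1 x - ?w2 x) \<bullet> (?A1 x + ?A2 x) \<partial>?\<mu>)
          = (\<integral>x. ?w1 x \<bullet> ?A1 x \<partial>?\<mu>) + (\<integral>x. ?w1 x \<bullet> ?A2 x \<partial>?\<mu>) - ((\<integral>x. ?w2 x \<bullet> ?A1 x \<partial>?\<mu>) + (\<integral>x. ?w2 x \<bullet> ?A2 x \<partial>?\<mu>))"
        by (simp only: l2_form.form_diff[OF wl l2_add[OF Al]] l2_form.form_add_right[OF Al wl(1)] l2_form.form_add_right[OF Al wl(2)])
      finally have S: "(\<integral>x. (average \<Omega> M n F (broken_grad M z) x *v n F) \<bullet> jump \<Omega> M n F w x \<partial>?\<mu>)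
          = (1/2) * ((\<integral>x. ?w1 x \<bullet> ?A1 x \<partial>?\<mu>) + (\<integral>x. ?w1 x \<bullet> ?A2 x \<partial>?\<mu>) - ((\<integral>x. ?w2 x \<bullet> ?A1 x \<partial>?\<mu>) + (\<integral>x. ?w2 x \<bullet> ?A2 x \<partial>?\<mu>)))" .
      have mv: "Q (K2 F) x *v (- n F) = - ?A2 x" for x by (simp add: matrix_vector_mult_def vec_eq_iff sum_negf)
      have "(\<integral>x. tr (K1 F) F D x \<bullet> (Q (K1 F) x *v onormal (K1 F) F) \<partial>?\<mu>) + (\<integral>x. tr (K2 F) F D x \<bullet> (Q (K2 F) x *v onormal (K2 F) F) \<partial>?\<mu>)
          = (\<integral>x. tr (K1 F) F D x \<bullet> ?A1 x \<partial>?\<mu>) - (\<integral>x. tr (K2 F) F D x \<bullet> ?A2 x \<partial>?\<mu>)"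
        by (simp add: onormal_K True mv)
      then show ?thesis unfolding D1 D2 S if_P[OF True] by (rule moment_arithmetic[OF _ mom])
    qed
  qed
  finally show ?thesis using GD by simp
qed

text \<open>Young's inequality on each face splits the flux into an average term, controlled by
  \<open>average_bound\<close>, and the penalty; \<open>young_optimal\<close> then optimises the
  parameter. The broken gradient is first replaced by a genuine piecewise polynomial, since
  \<open>average_bound\<close> speaks of those.\<close>

lemma Sf_bound:
  assumes w: "w \<in> V" and z: "adm z"
  shows "\<bar>Sf w z\<bar> \<le> sqrt (\<eta>bar / \<eta>) * sqrt (Gf w w) * sqrt (Jf \<eta> z z)"
proof -
  obtain g where g: "g \<in> pw_poly (int l - 1) M" "AE x in lebesgue_on \<Omega>. broken_grad M w x = g x"
    "\<And>F. F \<in> faces M \<Longrightarrow> average \<Omega> M n F (broken_grad M w) = average \<Omega> M n F g"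
    using average_broken_grad[OF w] by blast
  have gV: "g \<in> pw_poly (int l) M" using g(1) pw_poly_mono[of "int l - 1" "int l" M] by auto
  have ag: "adm g" by (rule pw_poly_adm[OF g(1)])
  let ?A = "\<lambda>F. average \<Omega> M n F g" and ?j = "\<lambda>F. jump \<Omega> M n F z"
  have Al: "?A F \<in> l2 (face_measure F)" and jl: "?j F \<in> l2 (face_measure F)" if "F \<in> faces M" for F
    using average_l2[OF ag that] jump_l2[OF z that] by auto
  have gnorm: "(l2_norm (lebesgue_on \<Omega>) g)\<^sup>2 = Gf w w"
  proof -
    have "l2_norm (lebesgue_on \<Omega>) (broken_grad M w) = l2_norm (lebesgue_on \<Omega>) g"
      by (rule l2_norm_cong_AE[OF l2_measurable[OF broken_grad_l2[OF V_adm[OF w]]] l2_measurable[OF pw_poly_l2[OF g(1)]] g(2)])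
    then show ?thesis by (metis Gf_def l2_norm_sq)
  qed
  have sum_A: "(\<Sum>F\<in>faces M. diameter F * (\<integral>x. (norm (?A F x))\<^sup>2 \<partial>face_measure F)) \<le> \<eta>bar * Gf w w"
    using average_bound[OF gV] by (simp add: skeleton_integral_def gnorm)
  have S: "Sf w z = (\<Sum>F\<in>faces M. \<integral>x. (?A F x *v n F) \<bullet> ?j F x \<partial>face_measure F)"
    unfolding Sf_def skeleton_integral_def by (intro sum.cong refl) (simp add: g(3))
  \<comment> \<open>\<open>s\<close> is a sign, from which the modulus is obtained in the end;
    \<open>t\<close> is the same on all faces, so that it can be optimised after summation.\<close>
  have main: "s * Sf w z \<le> t / 2 * ((\<eta>bar / \<eta>) * Gf w w) + Jf \<eta> z z / (2 * t)" if t: "0 < t" and s: "\<bar>s\<bar> = 1" for s t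
  proof -
    have face: "s * (\<integral>x. (?A F x *v n F) \<bullet> ?j F x \<partial>face_measure F)
        \<le> t / 2 * (1 / \<eta>) * (diameter F * (\<integral>x. (norm (?A F x))\<^sup>2 \<partial>face_measure F))
          + (\<eta> / diameter F * (\<integral>x. ?j F x \<bullet> ?j F x \<partial>face_measure F)) / (2 * t)" if F: "F \<in> faces M" for F
    proof -
      let ?d = "diameter F" and ?\<mu> = "face_measure F"
      have d: "0 < ?d" by (rule diameter_face_pos[OF F])
      have nF: "norm (n F) = 1" using K1_facet(3)[OF F] by (simp add: outward_def)
      have int: "integrable ?\<mu> (\<lambda>x. (norm (?A F x))\<^sup>2)" "integrable ?\<mu> (\<lambda>x. ?j F x \<bullet> ?j F x)"
        using Al[OF F] l2_inner_integrable[OF jl[OF F] jl[OF F]] by (auto simp: l2_def)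
      have "s * (\<integral>x. (?A F x *v n F) \<bullet> ?j F x \<partial>?\<mu>) = (\<integral>x. s * ((?A F x *v n F) \<bullet> ?j F x) \<partial>?\<mu>)" by simp
      also have "\<dots> \<le> (\<integral>x. t * ?d / (2 * \<eta>) * (norm (?A F x))\<^sup>2 + \<eta> / (2 * t * ?d) * (?j F x \<bullet> ?j F x) \<partial>?\<mu>)"
      proof (rule integral_mono)
        show "integrable ?\<mu> (\<lambda>x. s * ((?A F x *v n F) \<bullet> ?j F x))"
          using l2_inner_integrable[OF matrix_l2[OF Al[OF F]] jl[OF F]] by simp
        show "integrable ?\<mu> (\<lambda>x. t * ?d / (2 * \<eta>) * (norm (?A F x))\<^sup>2 + \<eta> / (2 * t * ?d) * (?j F x \<bullet> ?j F x))"
          using int by simp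
        fix x
        let ?a = "norm (?A F x)" and ?b = "norm (?j F x)"
        have "s * ((?A F x *v n F) \<bullet> ?j F x) \<le> \<bar>s * ((?A F x *v n F) \<bullet> ?j F x)\<bar>" by (rule abs_ge_self)
        also have "\<dots> = \<bar>(?A F x *v n F) \<bullet> ?j F x\<bar>" using s by (simp add: abs_mult)
        also have "\<dots> \<le> norm (?A F x *v n F) * ?b" by (rule Cauchy_Schwarz_ineq2)
        also have "\<dots> \<le> ?a * ?b"
        proof (rule mult_right_mono)
          have "norm (?A F x *v n F) \<le> (norm (?A F x)) * norm (n F)" by (rule norm_matrix_vector_le)
          then show "norm (?A F x *v n F) \<le> ?a" using nF by simp
        qed simp
        also have "\<dots> \<le> t * ?d / (2 * \<eta>) * ?a\<^sup>2 + \<eta> / (2 * t * ?d) * ?b\<^sup>2"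
        proof -
          \<comment> \<open>Balances the two summands so that their face weights become
            \<open>diameter F\<close> and \<open>\<eta> / diameter F\<close>.\<close>
          define c where "c = t * ?d / \<eta>"
          have c: "0 < c" using t d \<eta>_pos by (simp add: c_def)
          have "0 \<le> (c * ?a - ?b)\<^sup>2 / (2 * c)" using c by simp
          also have "\<dots> = c / 2 * ?a\<^sup>2 + 1 / (2 * c) * ?b\<^sup>2 - ?a * ?b" using c by (simp add: power2_eq_square field_simps)
          finally show ?thesis using t d \<eta>_pos by (simp add: c_def)
        qed
        finally show "s * ((?A F x *v n F) \<bullet> ?j F x) \<le> t * ?d / (2 * \<eta>) * (norm (?A F x))\<^sup>2 + \<eta> / (2 * t * ?d) * (?j F x \<bullet> ?j F x)"
          by (simp add: power2_norm_eq_inner)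
      qed
      also have "\<dots> = t / 2 * (1 / \<eta>) * (?d * (\<integral>x. (norm (?A F x))\<^sup>2 \<partial>?\<mu>)) + (\<eta> / ?d * (\<integral>x. ?j F x \<bullet> ?j F x \<partial>?\<mu>)) / (2 * t)"
        using int by (simp add: ac_simps)
      finally show ?thesis .
    qed
    have "s * Sf w z \<le> (\<Sum>F\<in>faces M. t / 2 * (1 / \<eta>) * (diameter F * (\<integral>x. (norm (?A F x))\<^sup>2 \<partial>face_measure F))
          + (\<eta> / diameter F * (\<integral>x. ?j F x \<bullet> ?j F x \<partial>face_measure F)) / (2 * t))"
      unfolding S sum_distrib_left by (rule sum_mono[OF face])
    also have "\<dots> = t / 2 * (1 / \<eta>) * (\<Sum>F\<in>faces M. diameter F * (\<integral>x. (norm (?A F x))\<^sup>2 \<partial>face_measure F)) + Jf \<eta> z z / (2 * t)"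
      by (simp only: sum.distrib sum_distrib_left sum_divide_distrib Jf_eq)
    also have "\<dots> \<le> t / 2 * (1 / \<eta>) * (\<eta>bar * Gf w w) + Jf \<eta> z z / (2 * t)"
      using mult_left_mono[OF sum_A, of "t / 2 * (1 / \<eta>)"] t \<eta>_pos by simp
    finally show ?thesis by (simp add: ac_simps)
  qed
  have nn: "0 \<le> (\<eta>bar / \<eta>) * Gf w w" using \<eta>bar \<eta>_pos Gf_nonneg[of w] by simp
  have "s * Sf w z \<le> sqrt ((\<eta>bar / \<eta>) * Gf w w) * sqrt (Jf \<eta> z z)" if "\<bar>s\<bar> = 1" for s
    by (rule young_optimal[OF nn Jf_nonneg[OF \<eta>_pos]]) (rule main[OF _ that])
  from this[of 1] this[of "-1"] show ?thesis unfolding real_sqrt_mult by (simp add: abs_le_iff)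
qed

end

lemma psd_form_subset:
  assumes "psd_form U A" "V \<subseteq> U"
    and "\<And>v w. \<lbrakk>v \<in> V; w \<in> V\<rbrakk> \<Longrightarrow> (\<lambda>x. v x + w x) \<in> V" "\<And>v c. v \<in> V \<Longrightarrow> (\<lambda>x. c *\<^sub>R v x) \<in> V"
  shows "psd_form V A"
proof -
  interpret U: psd_form U A by fact
  show ?thesis
  proof
    fix v w z c assume "v \<in> V" "w \<in> V" "z \<in> V"
    then have U: "v \<in> U" "w \<in> U" "z \<in> U" using assms(2) by auto
    show "A (\<lambda>x. v x + w x) z = A v z + A w z" by (rule U.form_add[OF U])
  next
    fix v z c assume "v \<in> V" "z \<in> V"
    then have U: "v \<in> U" "z \<in> U" using assms(2) by auto
    show "A v z = A z v" by (rule U.sym[OF U])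
    show "A (\<lambda>x. c *\<^sub>R v x) z = c * A v z" by (rule U.form_scale[OF U])
    show "0 \<le> A v v" by (rule U.nonneg[OF U(1)])
  qed (fact assms(3) assms(4))+
qed

section \<open>Finite dimension of piecewise polynomials, linearity of the divergence form\<close>

context dg_mesh
begin

text \<open>The generators are monomials cut off to one open simplex, times a basis vector; they
  reproduce every value because members of \<open>pw_poly\<close> vanish off the open
  simplices.\<close>

lemma pw_poly_fspan:
  "\<exists>(I :: ((real^'n) set \<times> 'b \<times> ('n \<Rightarrow> nat)) set) e. finite I \<and> (\<forall>i\<in>I. e i \<in> pw_poly k M)
    \<and> (pw_poly k M :: (real^'n \<Rightarrow> 'b::euclidean_space) set) \<subseteq> fspan I e"
proof -
  define e :: "(real^'n) set \<times> 'b \<times> ('n \<Rightarrow> nat) \<Rightarrow> real^'n \<Rightarrow> 'b" where "e = (\<lambda>(K, b :: 'b, \<alpha>) x. (indicat_real (interior K) x * monomial \<alpha> x) *\<^sub>R b)"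
  define I where "I = M \<times> (Basis :: 'b set) \<times> (multi_indices k :: ('n \<Rightarrow> nat) set)"
  have ind: "indicat_real (interior L) x = (if L = K then 1 else 0)" if "K \<in> M" "L \<in> M" "x \<in> interior K" for K L x
  proof (cases "L = K")
    case False
    then have "x \<notin> interior L" using disjoint_interiors[OF that] by argo
    then show ?thesis using False by simp
  qed (use that(3) in simp)
  have "finite I" unfolding I_def using finite_M finite_multi_indices by (intro finite_cartesian_product) auto
  moreover have "e i \<in> pw_poly k M" if "i \<in> I" for i
  proof -
    obtain K b \<alpha> where i: "i = (K, b, \<alpha>)" "K \<in> M" "b \<in> Basis" "\<alpha> \<in> multi_indices k" using \<open>i \<in> I\<close> by (auto simp: I_def)
    show ?thesis
      unfolding pw_poly_def
    proof (intro CollectI conjI ballI allI impI)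
      fix L and b' :: 'b assume L: "L \<in> M" and "b' \<in> Basis"
      have "e i x \<bullet> b' = ((if K = L then 1 else 0) * (b \<bullet> b')) * monomial \<alpha> x" if "x \<in> interior L" for x
        using ind[OF L i(2) that] by (simp add: e_def i(1))
      then show "\<exists>p\<in>polynomials k. \<forall>x\<in>interior L. e i x \<bullet> b' = p x"
        by (intro bexI[of _ "\<lambda>x. ((if K = L then 1 else 0) * (b \<bullet> b')) * monomial \<alpha> x"] polynomials_scale monomial_mem i(4)) auto
    next
      fix x assume "x \<notin> (\<Union>K\<in>M. interior K)"
      then show "e i x = 0" using i(2) by (auto simp: e_def i(1) indicator_def)
    qed
  qed
  moreover have "v \<in> fspan I e" if v: "v \<in> pw_poly k M" for v :: "real^'n \<Rightarrow> 'b"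
  proof -
    have "\<forall>K b. \<exists>c. K \<in> M \<longrightarrow> b \<in> Basis \<longrightarrow> (\<forall>x\<in>interior K. v x \<bullet> b = (\<Sum>\<alpha>\<in>multi_indices k. c \<alpha> * monomial \<alpha> x))"
    proof (intro allI)
      fix K b
      show "\<exists>c. K \<in> M \<longrightarrow> b \<in> Basis \<longrightarrow> (\<forall>x\<in>interior K. v x \<bullet> b = (\<Sum>\<alpha>\<in>multi_indices k. c \<alpha> * monomial \<alpha> x))"
      proof (cases "K \<in> M \<and> b \<in> Basis")
        case True
        then obtain p where "p \<in> polynomials k" "\<And>x. x \<in> interior K \<Longrightarrow> v x \<bullet> b = p x" using pw_poly_piece[OF v] by blast
        then show ?thesis by (auto simp: polynomials_eq_fspan fspan_def)
      qed auto
    qed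
    then obtain c where c: "\<And>K b x. \<lbrakk>K \<in> M; b \<in> Basis; x \<in> interior K\<rbrakk> \<Longrightarrow>
        v x \<bullet> b = (\<Sum>\<alpha>\<in>multi_indices k. c K b \<alpha> * monomial \<alpha> x)"
      by (simp only: choice_iff) blast
    have "v x = (\<Sum>i\<in>I. (case i of (K, b, \<alpha>) \<Rightarrow> c K b \<alpha>) *\<^sub>R e i x)" for x
    proof -
      have "(\<Sum>i\<in>I. (case i of (K, b, \<alpha>) \<Rightarrow> c K b \<alpha>) *\<^sub>R e i x)
          = (\<Sum>K\<in>M. \<Sum>b\<in>Basis. \<Sum>\<alpha>\<in>multi_indices k. c K b \<alpha> *\<^sub>R e (K, b, \<alpha>) x)"
        unfolding I_def by (simp add: sum.cartesian_product case_prod_unfold)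
      also have "\<dots> = v x"
      proof (cases "x \<in> (\<Union>K\<in>M. interior K)")
        case True
        then obtain K where K: "K \<in> M" "x \<in> interior K" by blast
        have "(\<Sum>L\<in>M. \<Sum>b\<in>Basis. \<Sum>\<alpha>\<in>multi_indices k. c L b \<alpha> *\<^sub>R e (L, b, \<alpha>) x)
            = (\<Sum>L\<in>M. if L = K then (\<Sum>b\<in>Basis. (v x \<bullet> b) *\<^sub>R b) else 0)"
        proof (intro sum.cong refl)
          fix L assume L: "L \<in> M"
          show "(\<Sum>b\<in>Basis. \<Sum>\<alpha>\<in>multi_indices k. c L b \<alpha> *\<^sub>R e (L, b, \<alpha>) x)
              = (if L = K then (\<Sum>b\<in>Basis. (v x \<bullet> b) *\<^sub>R b) else 0)"
          proof (cases "L = K")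
            case True
            have "(\<Sum>\<alpha>\<in>multi_indices k. c L b \<alpha> *\<^sub>R e (L, b, \<alpha>) x) = (v x \<bullet> b) *\<^sub>R b" if "b \<in> Basis" for b
              using True ind[OF K(1) L K(2)] c[OF K(1) that K(2)] by (simp add: e_def scaleR_sum_left)
            then show ?thesis using True by simp
          next
            case False
            then show ?thesis using ind[OF K(1) L K(2)] by (simp add: e_def)
          qed
        qed
        also have "\<dots> = v x" using finite_M K(1) by (simp add: euclidean_representation)
        finally show ?thesis .
      next
        case False
        then have "e (K, b, \<alpha>) x = 0" if "K \<in> M" for K b \<alpha> using that by (auto simp: e_def indicator_def)
        then show ?thesis using v False by (simp add: pw_poly_def)
      qed
      finally show ?thesis by simp
    qed
    then have "v = (\<lambda>x. \<Sum>i\<in>I. (case i of (K, b, \<alpha>) \<Rightarrow> c K b \<alpha>) *\<^sub>R e i x)" by auto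
    then show ?thesis by (simp only: fspanI)
  qed
  ultimately show ?thesis by (intro exI[of _ I] exI[of _ e]) auto
qed

lemma riesz_pw_poly:
  fixes L :: "(real^'n \<Rightarrow> real) \<Rightarrow> real"
  assumes "\<And>v w c. \<lbrakk>v \<in> pw_poly k M; w \<in> pw_poly k M\<rbrakk> \<Longrightarrow> L (\<lambda>x. v x + c * w x) = L v + c * L w"
  shows "\<exists>g\<in>pw_poly k M. \<forall>q\<in>pw_poly k M. (\<integral>x. q x * g x \<partial>lebesgue_on \<Omega>) = L q"
proof -
  let ?Q = "pw_poly k M :: (real^'n \<Rightarrow> real) set"
  have "psd_form ?Q (\<lambda>f g. \<integral>x. f x \<bullet> g x \<partial>lebesgue_on \<Omega>)"
  proof (rule psd_form_subset[OF l2_form.psd_form_axioms])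
    show "?Q \<subseteq> l2 (lebesgue_on \<Omega>)" using pw_poly_l2 by (rule subsetI)
    show "(\<lambda>x. v x + w x) \<in> ?Q" if "v \<in> ?Q" "w \<in> ?Q" for v w using that by (rule pw_poly_add)
    show "(\<lambda>x. c *\<^sub>R v x) \<in> ?Q" if "v \<in> ?Q" for v c using that by (rule pw_poly_scale)
  qed
  then interpret Q: psd_form ?Q "\<lambda>f g. \<integral>x. f x \<bullet> g x \<partial>lebesgue_on \<Omega>" .
  obtain I :: "((real^'n) set \<times> real \<times> ('n \<Rightarrow> nat)) set" and e where Ie: "finite I" "\<forall>i\<in>I. e i \<in> ?Q" "?Q \<subseteq> fspan I e"
    using pw_poly_fspan[where k = k and 'b = real] by (elim exE conjE)
  note z = pw_poly_zero[of k M]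
  have L0: "L (\<lambda>x. 0) = 0" using assms[OF z z, of "-1"] by simp
  have "\<exists>g\<in>fspan I e. \<forall>v\<in>fspan I e. (\<integral>x. v x \<bullet> g x \<partial>lebesgue_on \<Omega>) = L v"
  proof (rule Q.riesz_fspan[OF Ie(1) Ie(2)[rule_format] z])
    show "L (\<lambda>x. v x + w x) = L v + L w" if "v \<in> ?Q" "w \<in> ?Q" for v w using assms[OF that, of 1] by simp
    show "L (\<lambda>x. c *\<^sub>R v x) = c * L v" if "v \<in> ?Q" for v c using assms[OF z that, of c] L0 by simp
    show "L v = 0" if v: "v \<in> ?Q" "(\<integral>x. v x \<bullet> v x \<partial>lebesgue_on \<Omega>) = 0" for v
    proof -
      have "AE x in lebesgue_on \<Omega>. v x = 0" using v by (intro l2_norm_eq_0 pw_poly_l2) (auto simp: l2_norm_eq)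
      then show ?thesis using pw_poly_eq_0[OF v(1)] L0 by simp
    qed
  qed
  then obtain g where g: "g \<in> fspan I e" "\<forall>v\<in>fspan I e. (\<integral>x. v x \<bullet> g x \<partial>lebesgue_on \<Omega>) = L v" by (rule bexE)
  have "g \<in> ?Q" using Q.fspan_subset[OF Ie(1) Ie(2)[rule_format] z] g(1) by (rule subsetD)
  moreover have "\<forall>q\<in>?Q. (\<integral>x. q x * g x \<partial>lebesgue_on \<Omega>) = L q"
    using g(2) Ie(3) by (simp add: subset_iff)
  ultimately show ?thesis by (intro bexI[of _ g])
qed

lemma broken_div_eq: "broken_div M v x = trace (broken_grad M v x)"
proof -
  have "linear (trace :: real^'n^'n \<Rightarrow> real)"
    by (rule linearI) (simp_all add: trace_def sum.distrib sum_distrib_left)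
  then show ?thesis unfolding broken_div_def broken_grad_def vdiv_def
    by (simp add: linear_sum linear_cmul)
qed

lemma trace_bounded_linear: "bounded_linear (trace :: real^'n^'n \<Rightarrow> real)"
  by (intro linear_conv_bounded_linear[THEN iffD1] linearI) (simp_all add: trace_def sum.distrib sum_distrib_left)

lemma broken_div_l2: "adm v \<Longrightarrow> broken_div M v \<in> l2 (lebesgue_on \<Omega>)"
  unfolding broken_div_eq[abs_def] by (rule l2_linear_image[OF broken_grad_l2 trace_bounded_linear])

lemma broken_div_combine:
  assumes "adm v" "adm u"
  shows "AE x in lebesgue_on \<Omega>. broken_div M (\<lambda>x. v x + c *\<^sub>R u x) x = broken_div M v x + c *\<^sub>R broken_div M u x"
  using broken_grad_combine[OF assms, of c]
proof eventually_elim
  case (elim x)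
  have "linear (trace :: real^'n^'n \<Rightarrow> real)" using trace_bounded_linear by (rule bounded_linear.linear)
  then show ?case by (simp add: broken_div_eq elim linear_add linear_cmul)
qed

lemma b_dG_eq: "b_dG \<Omega> M n w q = - (\<integral>x. broken_div M w x \<bullet> q x \<partial>lebesgue_on \<Omega>)
    + (\<Sum>F\<in>faces M. \<integral>x. (jump \<Omega> M n F w x \<bullet> n F) \<bullet> average \<Omega> M n F q x \<partial>face_measure F)"
  by (simp add: b_dG_def skeleton_integral_def mult.commute)

lemma jump_normal_l2: "adm w \<Longrightarrow> F \<in> faces M \<Longrightarrow> (\<lambda>x. jump \<Omega> M n F w x \<bullet> n F) \<in> l2 (face_measure F)"
  by (rule l2_linear_image[OF jump_l2 bounded_linear_inner_left])

lemma b_dG_combine_left: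
  assumes v: "adm v" and w: "adm w" and q: "q \<in> pw_poly k M"
  shows "b_dG \<Omega> M n (\<lambda>x. v x + c *\<^sub>R w x) q = b_dG \<Omega> M n v q + c * b_dG \<Omega> M n w q"
proof -
  note vw = adm_combine[OF v w, of c]
  have "(\<integral>x. broken_div M (\<lambda>x. v x + c *\<^sub>R w x) x \<bullet> q x \<partial>lebesgue_on \<Omega>)
      = (\<integral>x. broken_div M v x \<bullet> q x \<partial>lebesgue_on \<Omega>) + c * (\<integral>x. broken_div M w x \<bullet> q x \<partial>lebesgue_on \<Omega>)"
    by (rule l2_inner_combine[OF broken_div_l2[OF v] broken_div_l2[OF w] pw_poly_l2[OF q] broken_div_l2[OF vw] broken_div_combine[OF v w]])
  moreover have "(\<integral>x. (jump \<Omega> M n F (\<lambda>x. v x + c *\<^sub>R w x) x \<bullet> n F) \<bullet> average \<Omega> M n F q x \<partial>face_measure F)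
      = (\<integral>x. (jump \<Omega> M n F v x \<bullet> n F) \<bullet> average \<Omega> M n F q x \<partial>face_measure F)
        + c * (\<integral>x. (jump \<Omega> M n F w x \<bullet> n F) \<bullet> average \<Omega> M n F q x \<partial>face_measure F)" if F: "F \<in> faces M" for F
  proof (rule l2_inner_combine[OF jump_normal_l2[OF v F] jump_normal_l2[OF w F] average_l2[OF pw_poly_adm[OF q] F] jump_normal_l2[OF vw F]])
    show "AE x in face_measure F. jump \<Omega> M n F (\<lambda>x. v x + c *\<^sub>R w x) x \<bullet> n F = jump \<Omega> M n F v x \<bullet> n F + c *\<^sub>R (jump \<Omega> M n F w x \<bullet> n F)"
      using jump_combine[OF v w F, of c] by eventually_elim (simp add: inner_add_left)
  qed
  ultimately show ?thesis
    unfolding b_dG_eq by (simp add: sum.distrib sum_distrib_left[symmetric] right_diff_distrib)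
qed

lemma b_dG_combine_right:
  assumes v: "adm v" and q: "q \<in> pw_poly k M" and r: "r \<in> pw_poly k M"
  shows "b_dG \<Omega> M n v (\<lambda>x. q x + c * r x) = b_dG \<Omega> M n v q + c * b_dG \<Omega> M n v r"
proof -
  have qr: "(\<lambda>x. q x + c * r x) \<in> pw_poly k M" using pw_poly_add[OF q pw_poly_scale[OF r, of c]] by simp
  have "(\<integral>x. (q x + c * r x) \<bullet> broken_div M v x \<partial>lebesgue_on \<Omega>)
      = (\<integral>x. q x \<bullet> broken_div M v x \<partial>lebesgue_on \<Omega>) + c * (\<integral>x. r x \<bullet> broken_div M v x \<partial>lebesgue_on \<Omega>)"
    by (rule l2_inner_combine[OF pw_poly_l2[OF q] pw_poly_l2[OF r] broken_div_l2[OF v] pw_poly_l2[OF qr]]) simp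
  moreover have "(\<integral>x. average \<Omega> M n F (\<lambda>x. q x + c * r x) x \<bullet> (jump \<Omega> M n F v x \<bullet> n F) \<partial>face_measure F)
      = (\<integral>x. average \<Omega> M n F q x \<bullet> (jump \<Omega> M n F v x \<bullet> n F) \<partial>face_measure F)
        + c * (\<integral>x. average \<Omega> M n F r x \<bullet> (jump \<Omega> M n F v x \<bullet> n F) \<partial>face_measure F)" if F: "F \<in> faces M" for F
    by (rule l2_inner_combine[OF average_l2[OF pw_poly_adm[OF q] F] average_l2[OF pw_poly_adm[OF r] F] jump_normal_l2[OF v F]
          average_l2[OF pw_poly_adm[OF qr] F]])
      (use average_combine[OF pw_poly_adm[OF q] pw_poly_adm[OF r] F, of c] in simp)
  ultimately show ?thesis
    unfolding b_dG_eq by (simp add: sum.distrib sum_distrib_left[symmetric] right_diff_distrib inner_commute mult.commute)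
qed

text \<open>Stated for \<open>u\<close> equal to the combination almost everywhere, because the
  linearity of \<open>E\<close> holds in this sense.\<close>

lemma h10_vgrad_combine:
  assumes u: "u \<in> h1_0_vec \<Omega>" and v: "v \<in> h1_0_vec \<Omega>" and w: "w \<in> h1_0_vec \<Omega>"
    and ae: "AE x in lebesgue_on \<Omega>. u x = v x + c *\<^sub>R w x"
  shows "AE x in lebesgue_on \<Omega>. vgrad \<Omega> u x = vgrad \<Omega> v x + c *\<^sub>R vgrad \<Omega> w x"
proof (rule AE_vecI)
  fix i
  note U = open_\<Omega> bounded_\<Omega>
  have "weak_gradient \<Omega> (\<lambda>x. v x $ i + c * w x $ i) (\<lambda>x. wgrad \<Omega> (\<lambda>y. v y $ i) x + c *\<^sub>R wgrad \<Omega> (\<lambda>y. w y $ i) x)"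
    by (intro weak_gradient_combine[OF U] h1_0_weak_gradient h10_component v w)
  moreover have "AE x in lebesgue_on \<Omega>. v x $ i + c * w x $ i = u x $ i" using ae by eventually_elim simp
  moreover have "(\<lambda>x. u x $ i) \<in> borel_measurable (lebesgue_on \<Omega>)"
    using h1_0_weak_gradient[OF h10_component[OF u, of i]] by (simp add: weak_gradient_def l2_def)
  ultimately have "weak_gradient \<Omega> (\<lambda>x. u x $ i) (\<lambda>x. wgrad \<Omega> (\<lambda>y. v y $ i) x + c *\<^sub>R wgrad \<Omega> (\<lambda>y. w y $ i) x)"
    by (rule weak_gradient_cong_AE[OF U])
  from wgrad_AE[OF U this]
  show "AE x in lebesgue_on \<Omega>. vgrad \<Omega> u x $ i = (vgrad \<Omega> v x + c *\<^sub>R vgrad \<Omega> w x) $ i" by (simp add: vgrad_nth)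
qed

lemma Gf_h10_left:
  assumes u: "u \<in> h1_0_vec \<Omega>" and v: "v \<in> h1_0_vec \<Omega>"
  shows "(\<integral>x. vgrad \<Omega> u x \<bullet> vgrad \<Omega> v x \<partial>lebesgue_on \<Omega>) = Gf u v"
  unfolding Gf_def
proof (rule integral_cong_AE)
  show "AE x in lebesgue_on \<Omega>. vgrad \<Omega> u x \<bullet> vgrad \<Omega> v x = broken_grad M u x \<bullet> broken_grad M v x"
    using h10_broken_grad[OF u] h10_broken_grad[OF v] by eventually_elim simp
  show "(\<lambda>x. vgrad \<Omega> u x \<bullet> vgrad \<Omega> v x) \<in> borel_measurable (lebesgue_on \<Omega>)"
    by (intro borel_measurable_inner l2_measurable[OF h10_vgrad_l2[OF u]] l2_measurable[OF h10_vgrad_l2[OF v]])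
  show "(\<lambda>x. broken_grad M u x \<bullet> broken_grad M v x) \<in> borel_measurable (lebesgue_on \<Omega>)"
    by (intro borel_measurable_inner l2_measurable[OF broken_grad_l2[OF h10_adm[OF u]]] l2_measurable[OF broken_grad_l2[OF h10_adm[OF v]]])
qed

lemma h1_0_norm_eq: "v \<in> h1_0_vec \<Omega> \<Longrightarrow> h1_0_norm \<Omega> v = sqrt (Gf v v)"
  using Gf_h10_left[of v v] by (simp add: h1_0_norm_def l2_norm_eq)

lemma Jf_h10: assumes "u \<in> h1_0_vec \<Omega>" shows "Jf \<eta> u v = 0"
proof -
  have "(\<integral>x. jump \<Omega> M n F u x \<bullet> jump \<Omega> M n F v x \<partial>face_measure F) = 0" if "F \<in> faces M" for F
    by (rule integral_eq_zero_AE) (use h10_jump[OF assms that] in eventually_elim, simp)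
  then show ?thesis by (simp add: Jf_eq)
qed

end

section \<open>Boundedness of the lifting, consistency error, coercivity\<close>

context dg_lift
begin

abbreviation "opnorm \<equiv> opnorm_dG \<Omega> M n l \<eta> E"

text \<open>The coefficients are written as \<open>1\<close> and \<open>c - 1\<close> so that
  additivity and homogeneity both have the shape expected by
  \<open>h10_vgrad_combine\<close>.\<close>

lemma E_combine:
  assumes "v \<in> V" "w \<in> V"
  shows "AE x in lebesgue_on \<Omega>. E (\<lambda>x. v x + w x) x = E v x + 1 *\<^sub>R E w x"
    "AE x in lebesgue_on \<Omega>. E (\<lambda>x. c *\<^sub>R v x) x = E v x + (c - 1) *\<^sub>R E v x"
  using E assms unfolding linear_into_h1_0_def by (auto simp: algebra_simps)

lemma h1_0_norm_E_combine:
  assumes u: "u \<in> h1_0_vec \<Omega>" and v: "v \<in> h1_0_vec \<Omega>" and w: "w \<in> h1_0_vec \<Omega>"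
    and ae: "AE x in lebesgue_on \<Omega>. u x = v x + c *\<^sub>R w x"
  shows "h1_0_norm \<Omega> u = l2_norm (lebesgue_on \<Omega>) (\<lambda>x. vgrad \<Omega> v x + c *\<^sub>R vgrad \<Omega> w x)"
  unfolding h1_0_norm_def
  by (rule l2_norm_cong_AE[OF l2_measurable[OF h10_vgrad_l2[OF u]]
        l2_measurable[OF l2_add[OF h10_vgrad_l2[OF v] l2_scale[OF h10_vgrad_l2[OF w]]]] h10_vgrad_combine[OF assms]])

text \<open>By finite dimension some bound exists: the seminorm of \<open>E v\<close> vanishes where
  the dG norm does, as the latter is definite on \<open>V\<close>. It makes the supremum in
  \<open>opnorm_dG\<close> one of a bounded set.\<close>

lemma E_bounded: "\<exists>C\<ge>0. \<forall>v\<in>V. h1_0_norm \<Omega> (E v) \<le> C * dG_norm v"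
proof -
  have "psd_form V (\<lambda>w v. Gf w v + Jf \<eta> w v)"
  proof (rule psd_form_subset[OF psd_dG[OF \<eta>_pos]])
    show "V \<subseteq> Collect adm" using V_adm by blast
    show "(\<lambda>x. v x + w x) \<in> V" if "v \<in> V" "w \<in> V" for v w using that by (rule pw_poly_add)
    show "(\<lambda>x. c *\<^sub>R v x) \<in> V" if "v \<in> V" for v c using that by (rule pw_poly_scale)
  qed
  then interpret A: psd_form V "\<lambda>w v. Gf w v + Jf \<eta> w v" .
  obtain I :: "((real^'n) set \<times> (real^'n) \<times> ('n \<Rightarrow> nat)) set" and e where Ie: "finite I" "\<forall>i\<in>I. e i \<in> V" "V \<subseteq> fspan I e"
    using pw_poly_fspan[where k = "int l" and 'b = "real^'n"] by (elim exE conjE)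
  have scale: "h1_0_norm \<Omega> (E (\<lambda>x. c *\<^sub>R v x)) = \<bar>c\<bar> * h1_0_norm \<Omega> (E v)" if v: "v \<in> V" for v c
  proof -
    have "h1_0_norm \<Omega> (E (\<lambda>x. c *\<^sub>R v x)) = l2_norm (lebesgue_on \<Omega>) (\<lambda>x. vgrad \<Omega> (E v) x + (c - 1) *\<^sub>R vgrad \<Omega> (E v) x)"
      by (rule h1_0_norm_E_combine[OF E_h10[OF pw_poly_scale[OF v]] E_h10[OF v] E_h10[OF v] E_combine(2)[OF v v]])
    also have "(\<lambda>x. vgrad \<Omega> (E v) x + (c - 1) *\<^sub>R vgrad \<Omega> (E v) x) = (\<lambda>x. c *\<^sub>R vgrad \<Omega> (E v) x)"
      by (simp add: algebra_simps)
    finally show ?thesis using l2_norm_scale[OF h10_vgrad_l2[OF E_h10[OF v]], of c] by (simp add: h1_0_norm_def)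
  qed
  have "\<exists>C\<ge>0. \<forall>v\<in>fspan I e. h1_0_norm \<Omega> (E v) \<le> C * sqrt (Gf v v + Jf \<eta> v v)"
  proof (rule A.seminorm_bounded_fspan[OF Ie(1) Ie(2)[rule_format] pw_poly_zero])
    fix v w assume v: "v \<in> V" and w: "w \<in> V"
    have "h1_0_norm \<Omega> (E (\<lambda>x. v x + w x)) = l2_norm (lebesgue_on \<Omega>) (\<lambda>x. vgrad \<Omega> (E v) x + 1 *\<^sub>R vgrad \<Omega> (E w) x)"
      by (rule h1_0_norm_E_combine[OF E_h10[OF pw_poly_add[OF v w]] E_h10[OF v] E_h10[OF w] E_combine(1)[OF v w]])
    also have "\<dots> \<le> l2_norm (lebesgue_on \<Omega>) (vgrad \<Omega> (E v)) + l2_norm (lebesgue_on \<Omega>) (vgrad \<Omega> (E w))"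
      using l2_norm_triangle[OF h10_vgrad_l2[OF E_h10[OF v]] h10_vgrad_l2[OF E_h10[OF w]]] by simp
    finally show "h1_0_norm \<Omega> (E (\<lambda>x. v x + w x)) \<le> h1_0_norm \<Omega> (E v) + h1_0_norm \<Omega> (E w)" by (simp add: h1_0_norm_def)
  next
    fix v assume v: "v \<in> V" and zero: "Gf v v + Jf \<eta> v v = 0"
    have "v = (\<lambda>x. 0)" by (rule norm_dG_definite[OF v \<eta>_pos zero])
    then have "(\<lambda>x. 0 *\<^sub>R v x) = v" by simp
    with scale[OF v, of 0] show "h1_0_norm \<Omega> (E v) = 0" by simp
  qed (assumption, rule scale, assumption, simp add: h1_0_norm_def l2_norm_nonneg)
  then show ?thesis using Ie(3) unfolding norm_dG_eq by blast
qed

lemma norm_nonneg: "0 \<le> dG_norm v"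
  unfolding norm_dG_eq using Gf_nonneg[of v] Jf_nonneg[OF \<eta>_pos, of v] by simp

lemma opnorm_bdd: "bdd_above ((\<lambda>v. h1_0_norm \<Omega> (E v) / dG_norm v) ` V)"
proof -
  obtain C where C: "C \<ge> 0" "\<And>v. v \<in> V \<Longrightarrow> h1_0_norm \<Omega> (E v) \<le> C * dG_norm v" using E_bounded by blast
  have "h1_0_norm \<Omega> (E v) / dG_norm v \<le> C" if "v \<in> V" for v
    using C(1) C(2)[OF that] norm_nonneg[of v] by (cases "dG_norm v = 0") (auto simp: divide_le_eq)
  then show ?thesis by (intro bdd_aboveI2)
qed

lemma opnorm_bound: assumes "v \<in> V" shows "h1_0_norm \<Omega> (E v) \<le> opnorm * dG_norm v"
proof (cases "dG_norm v = 0")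
  \<comment> \<open>Here the quotient in the supremum is 0 and carries no information;
    \<open>E_bounded\<close> forces the norm of \<open>E v\<close> to be 0.\<close>
  case True
  then show ?thesis using E_bounded assms by fastforce
next
  case False
  have "h1_0_norm \<Omega> (E v) / dG_norm v \<le> opnorm"
    unfolding opnorm_dG_def by (rule cSUP_upper[OF assms opnorm_bdd])
  then show ?thesis using False norm_nonneg[of v] by (simp add: divide_le_eq)
qed

lemma opnorm_nonneg: "0 \<le> opnorm"
proof -
  have "0 \<le> h1_0_norm \<Omega> (E (\<lambda>x. 0)) / dG_norm (\<lambda>x. 0)"
    using norm_nonneg by (simp add: h1_0_norm_def l2_norm_nonneg)
  also have "\<dots> \<le> opnorm" unfolding opnorm_dG_def by (rule cSUP_upper[OF pw_poly_zero opnorm_bdd])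
  finally show ?thesis .
qed

lemma ratio: "0 \<le> sqrt (\<eta>bar / \<eta>)" "sqrt (\<eta>bar / \<eta>) < 1"
  using \<eta>bar \<eta> by simp_all

lemma sqrt_parts: "sqrt (Gf v v) \<le> dG_norm v" "sqrt (Jf \<eta> v v) \<le> dG_norm v"
  unfolding norm_dG_eq using Gf_nonneg[of v] Jf_nonneg[OF \<eta>_pos, of v] by simp_all

text \<open>In \<open>2 + opnorm\<close> the norm of \<open>E\<close> comes from the gradient term
  and the two units from flux and penalty; for the flux \<open>sqrt (\<eta>bar / \<eta>) < 1\<close>
  is used.\<close>

lemma consistency:
  assumes u: "u \<in> h1_0_vec \<Omega>" and z: "z \<in> V" and w: "w \<in> V"
  shows "\<bar>Gf u (E w) - a_dG \<Omega> M n \<eta> z w\<bar> \<le> (2 + opnorm) * dG_norm (\<lambda>x. u x - z x) * dG_norm w"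
proof -
  interpret G: psd_form "Collect adm" Gf by (rule psd_G)
  interpret J: psd_form "Collect adm" "Jf \<eta>" by (rule psd_J[OF \<eta>_pos])
  define d where "d = (\<lambda>x. u x - z x)"
  have au: "u \<in> Collect adm" and az: "z \<in> Collect adm" and aw: "w \<in> Collect adm" and aE: "E w \<in> Collect adm"
    using h10_adm[OF u] V_adm[OF z] V_adm[OF w] E_adm[OF w] by auto
  have ad: "d \<in> Collect adm" unfolding d_def by (rule G.diff[OF au az])
  have "Gf d (E w) = Gf u (E w) - Gf z (E w)" unfolding d_def by (rule G.form_diff[OF au az aE])
  \<comment> \<open>\<open>grad_identity\<close> trades \<open>Gf z w - Sf z w\<close> for
    \<open>Gf z (E w)\<close>; the remaining terms see \<open>z\<close> only through its
    jumps.\<close>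
  then have R: "Gf u (E w) - a_dG \<Omega> M n \<eta> z w = Gf d (E w) + Sf w z - Jf \<eta> z w"
    using grad_identity[OF z w] by (simp add: a_dG_eq)
  \<comment> \<open>As \<open>u\<close> has no jumps, the jumps of \<open>z\<close> and of
    \<open>u - z\<close> have the same size.\<close>
  have "Jf \<eta> d d = Jf \<eta> u d - Jf \<eta> z d" unfolding d_def[of] by (rule J.form_diff[OF au az ad[unfolded d_def]])
  also have "\<dots> = - Jf \<eta> d z" using Jf_h10[OF u] J.sym[OF az ad] by simp
  also have "Jf \<eta> d z = Jf \<eta> u z - Jf \<eta> z z" unfolding d_def by (rule J.form_diff[OF au az az])
  finally have Jd: "Jf \<eta> d d = Jf \<eta> z z" using Jf_h10[OF u] by simp
  have "\<bar>Gf d (E w)\<bar> \<le> sqrt (Gf d d) * sqrt (Gf (E w) (E w))" by (rule G.cauchy_schwarz[OF ad aE])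
  also have "\<dots> \<le> dG_norm d * (opnorm * dG_norm w)"
    using opnorm_bound[OF w] h1_0_norm_eq[OF E_h10[OF w]] sqrt_parts(1)[of d] norm_nonneg Gf_nonneg
    by (intro mult_mono) auto
  finally have 1: "\<bar>Gf d (E w)\<bar> \<le> opnorm * dG_norm d * dG_norm w" by (simp add: ac_simps)
  have "\<bar>Sf w z\<bar> \<le> sqrt (\<eta>bar / \<eta>) * sqrt (Gf w w) * sqrt (Jf \<eta> z z)" by (rule Sf_bound[OF w]) (use az in simp)
  also have "\<dots> \<le> 1 * dG_norm w * dG_norm d"
    using ratio sqrt_parts(1)[of w] sqrt_parts(2)[of d] norm_nonneg Gf_nonneg Jf_nonneg[OF \<eta>_pos] unfolding Jd[symmetric]
    by (intro mult_mono) auto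
  finally have 2: "\<bar>Sf w z\<bar> \<le> dG_norm d * dG_norm w" by (simp add: ac_simps)
  have "\<bar>Jf \<eta> z w\<bar> \<le> sqrt (Jf \<eta> z z) * sqrt (Jf \<eta> w w)" by (rule J.cauchy_schwarz[OF az aw])
  also have "\<dots> \<le> dG_norm d * dG_norm w"
    using sqrt_parts(2)[of w] sqrt_parts(2)[of d] norm_nonneg Jf_nonneg[OF \<eta>_pos] unfolding Jd[symmetric]
    by (intro mult_mono) auto
  finally have 3: "\<bar>Jf \<eta> z w\<bar> \<le> dG_norm d * dG_norm w" .
  have "\<bar>Gf u (E w) - a_dG \<Omega> M n \<eta> z w\<bar> \<le> opnorm * dG_norm d * dG_norm w + dG_norm d * dG_norm w + dG_norm d * dG_norm w"
    unfolding R using 1 2 3 by linarith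
  also have "\<dots> = (2 + opnorm) * dG_norm d * dG_norm w" by (simp add: algebra_simps)
  finally show ?thesis by (simp add: d_def)
qed

text \<open>The flux enters twice, and
  \<open>2 * r * g * j \<le> r * (g\<^sup>2 + j\<^sup>2)\<close> for
  \<open>r = sqrt (\<eta>bar / \<eta>)\<close> and the roots \<open>g\<close>, \<open>j\<close> of
  gradient and penalty part; this is the origin of the factor \<open>1 - r\<close>.\<close>

lemma coercive: assumes w: "w \<in> V" shows "(1 - sqrt (\<eta>bar / \<eta>)) * (dG_norm w)\<^sup>2 \<le> a_dG \<Omega> M n \<eta> w w"
proof -
  let ?r = "sqrt (\<eta>bar / \<eta>)" and ?g = "sqrt (Gf w w)" and ?j = "sqrt (Jf \<eta> w w)"
  have "\<bar>Sf w w\<bar> \<le> ?r * ?g * ?j" by (rule Sf_bound[OF w V_adm[OF w]])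
  moreover have "?r * (2 * ?g * ?j) \<le> ?r * (Gf w w + Jf \<eta> w w)"
    using sum_squares_bound[of ?g ?j] ratio(1) Gf_nonneg[of w] Jf_nonneg[OF \<eta>_pos, of w] by (intro mult_left_mono) auto
  ultimately have "2 * Sf w w \<le> ?r * (Gf w w + Jf \<eta> w w)" by (simp add: ac_simps abs_le_iff)
  then show ?thesis by (simp add: a_dG_eq norm_dG_sq[OF \<eta>_pos] algebra_simps)
qed

end

section \<open>Mean-free pressures, discrete divergence and its kernel\<close>

context dg_mesh
begin

text \<open>The representative of the constant 1 in \<open>pw_poly\<close>, whose members vanish off
  the open simplices. Mean 0 becomes orthogonality to it.\<close>

abbreviation "mesh_ind \<equiv> indicat_real (\<Union>K\<in>M. interior K)"

lemma mesh_ind_pw_poly: assumes "0 \<le> k" shows "mesh_ind \<in> pw_poly k M"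
proof -
  have "\<exists>p\<in>polynomials k. \<forall>x\<in>interior K. mesh_ind x \<bullet> b = p x" if "K \<in> M" "b \<in> Basis" for K and b :: real
    using that constant_polynomial[OF assms, of 1] by (intro bexI[of _ "\<lambda>x. 1"]) (auto simp: indicator_def)
  then show ?thesis by (simp add: pw_poly_def)
qed

lemma AE_mesh_ind: "AE x in lebesgue_on \<Omega>. mesh_ind x = 1"
proof (rule AE_\<Omega>I)
  fix K assume K: "K \<in> M"
  have "mesh_ind x = 1" if "x \<in> interior K" for x using K that by (auto simp: indicator_def)
  then show "AE x in lebesgue_on (interior K). mesh_ind x = 1" by (intro AE_I2) simp
qed

lemma mesh_ind_l2: "mesh_ind \<in> l2 (lebesgue_on \<Omega>)"
  by (rule pw_poly_l2[OF mesh_ind_pw_poly[OF order_refl]])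

lemma integral_mesh_ind:
  assumes "q \<in> l2 (lebesgue_on \<Omega>)"
  shows "(\<integral>x. q x \<partial>lebesgue_on \<Omega>) = (\<integral>x. q x \<bullet> mesh_ind x \<partial>lebesgue_on \<Omega>)"
proof (rule integral_cong_AE)
  show "AE x in lebesgue_on \<Omega>. q x = q x \<bullet> mesh_ind x" using AE_mesh_ind by eventually_elim simp
  show "q \<in> borel_measurable (lebesgue_on \<Omega>)" by (rule l2_measurable[OF assms])
  show "(\<lambda>x. q x \<bullet> mesh_ind x) \<in> borel_measurable (lebesgue_on \<Omega>)"
    by (rule borel_measurable_integrable[OF l2_inner_integrable[OF assms mesh_ind_l2]])
qed

lemma pw_poly_0_iff:
  "q \<in> pw_poly_0 k \<Omega> M \<longleftrightarrow> q \<in> pw_poly k M \<and> (\<integral>x. q x \<bullet> mesh_ind x \<partial>lebesgue_on \<Omega>) = 0"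
  using pw_poly_l2[of q k] integral_mesh_ind[of q] by (auto simp: pw_poly_0_def l2_0_def)

lemma pw_poly_combine:
  assumes "q \<in> pw_poly k M" "r \<in> pw_poly k M" shows "(\<lambda>x. q x + c * r x :: real) \<in> pw_poly k M"
  using pw_poly_add[OF assms(1) pw_poly_scale[OF assms(2), of c]] by simp

lemma l2_combine:
  assumes "q \<in> l2 N" "r \<in> l2 N" shows "(\<lambda>x. q x + c * r x :: real) \<in> l2 N"
  using l2_add[OF assms(1) l2_scale[OF assms(2), of c]] by simp

lemma integral_combine:
  fixes q r h :: "'a \<Rightarrow> real"
  assumes "q \<in> l2 N" "r \<in> l2 N" "h \<in> l2 N"
  shows "(\<integral>x. (q x + c * r x) \<bullet> h x \<partial>N) = (\<integral>x. q x \<bullet> h x \<partial>N) + c * (\<integral>x. r x \<bullet> h x \<partial>N)"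
  by (rule l2_inner_combine[OF assms l2_combine[OF assms(1,2)]]) simp

lemma pw_poly_0_combine:
  assumes q: "q \<in> pw_poly_0 k \<Omega> M" and r: "r \<in> pw_poly_0 k \<Omega> M"
  shows "(\<lambda>x. q x + c * r x) \<in> pw_poly_0 k \<Omega> M"
proof -
  have p: "q \<in> pw_poly k M" "r \<in> pw_poly k M" using q r by (simp_all add: pw_poly_0_iff)
  have "(\<integral>x. (q x + c * r x) \<bullet> mesh_ind x \<partial>lebesgue_on \<Omega>) = 0"
    unfolding integral_combine[OF pw_poly_l2[OF p(1)] pw_poly_l2[OF p(2)] mesh_ind_l2]
    using q r by (simp only: pw_poly_0_iff mult_zero_right add_0)
  with pw_poly_combine[OF p] show ?thesis by (simp only: pw_poly_0_iff)
qed

lemma pw_poly_0_zero: "(\<lambda>x. 0) \<in> pw_poly_0 k \<Omega> M"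
  by (simp add: pw_poly_0_iff pw_poly_zero)

text \<open>The mean is removed from the representer; if \<open>mesh_ind\<close> had norm 0, the quotient below would
  be 0, and so would be the mean.\<close>

lemma riesz_pw_poly_0:
  fixes L :: "(real^'n \<Rightarrow> real) \<Rightarrow> real"
  assumes k: "0 \<le> k"
    and L: "\<And>v w c. \<lbrakk>v \<in> pw_poly k M; w \<in> pw_poly k M\<rbrakk> \<Longrightarrow> L (\<lambda>x. v x + c * w x) = L v + c * L w"
  shows "\<exists>g\<in>pw_poly_0 k \<Omega> M. \<forall>q\<in>pw_poly_0 k \<Omega> M. (\<integral>x. q x \<bullet> g x \<partial>lebesgue_on \<Omega>) = L q"
proof -
  let ?I = "\<lambda>f g. \<integral>x. f x \<bullet> (g x :: real) \<partial>lebesgue_on \<Omega>"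
  obtain g where g: "g \<in> pw_poly k M" "\<forall>q\<in>pw_poly k M. (\<integral>x. q x * g x \<partial>lebesgue_on \<Omega>) = L q"
    using riesz_pw_poly[OF L] by (rule bexE)
  note gl = pw_poly_l2[OF g(1)]
  define c where "c = - (?I g mesh_ind / ?I mesh_ind mesh_ind)"
  let ?g = "\<lambda>x. g x + c * mesh_ind x"
  have "\<bar>?I g mesh_ind\<bar> \<le> l2_norm (lebesgue_on \<Omega>) g * l2_norm (lebesgue_on \<Omega>) mesh_ind"
    by (rule l2_cauchy_schwarz[OF gl mesh_ind_l2])
  then have "?I g mesh_ind + c * ?I mesh_ind mesh_ind = 0"
    unfolding c_def l2_norm_eq by (cases "?I mesh_ind mesh_ind = 0") simp_all
  then have "?I ?g mesh_ind = 0" unfolding integral_combine[OF gl mesh_ind_l2 mesh_ind_l2] .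
  with pw_poly_combine[OF g(1) mesh_ind_pw_poly[OF k]] have gm: "?g \<in> pw_poly_0 k \<Omega> M"
    by (simp only: pw_poly_0_iff)
  have "?I q ?g = L q" if q: "q \<in> pw_poly_0 k \<Omega> M" for q
  proof -
    have qp: "q \<in> pw_poly k M" and q0: "?I q mesh_ind = 0" using q by (simp_all only: pw_poly_0_iff)
    have "?I q ?g = ?I ?g q" by (simp only: inner_commute)
    also have "\<dots> = ?I g q + c * ?I mesh_ind q" by (rule integral_combine[OF gl mesh_ind_l2 pw_poly_l2[OF qp]])
    also have "\<dots> = ?I q g + c * ?I q mesh_ind" by (simp only: inner_commute)
    also have "\<dots> = L q" unfolding q0 using g(2) qp by simp
    finally show ?thesis .
  qed
  with gm show ?thesis by (intro bexI[of _ ?g]) auto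
qed

lemma pw_poly_0_unique:
  assumes g: "g \<in> pw_poly_0 k \<Omega> M" and h: "h \<in> pw_poly_0 k \<Omega> M"
    and eq: "\<And>q. q \<in> pw_poly_0 k \<Omega> M \<Longrightarrow> (\<integral>x. q x \<bullet> g x \<partial>lebesgue_on \<Omega>) = (\<integral>x. q x \<bullet> h x \<partial>lebesgue_on \<Omega>)"
  shows "g = h"
proof -
  let ?d = "\<lambda>x. g x + (-1) * h x"
  have p: "g \<in> pw_poly k M" "h \<in> pw_poly k M" using g h by (simp_all only: pw_poly_0_iff)
  have d0: "?d \<in> pw_poly_0 k \<Omega> M" by (rule pw_poly_0_combine[OF g h])
  have d: "?d \<in> pw_poly k M" by (rule pw_poly_combine[OF p])
  have "(\<integral>x. ?d x \<bullet> ?d x \<partial>lebesgue_on \<Omega>)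
      = (\<integral>x. g x \<bullet> ?d x \<partial>lebesgue_on \<Omega>) + (-1) * (\<integral>x. h x \<bullet> ?d x \<partial>lebesgue_on \<Omega>)"
    by (rule integral_combine[OF pw_poly_l2[OF p(1)] pw_poly_l2[OF p(2)] pw_poly_l2[OF d]])
  also have "\<dots> = 0" using eq[OF d0] by (simp add: inner_commute mult.commute)
  finally have "l2_norm (lebesgue_on \<Omega>) ?d = 0" unfolding l2_norm_eq by simp
  from l2_norm_eq_0[OF pw_poly_l2[OF d] this] have "?d = (\<lambda>x. 0)" by (rule pw_poly_eq_0[OF d])
  then show ?thesis by (simp add: fun_eq_iff)
qed

text \<open>A definite description says nothing before existence and uniqueness: existence is the
  Riesz argument on mean-free piecewise polynomials, uniqueness the definiteness of the L2 product
  there.\<close>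

lemma div_dG_spec:
  assumes w: "adm w" and l: "1 \<le> l"
  shows "div_dG \<Omega> M n l w \<in> pw_poly_0 (int l - 1) \<Omega> M
    \<and> (\<forall>q\<in>pw_poly_0 (int l - 1) \<Omega> M. (\<integral>x. q x * div_dG \<Omega> M n l w x \<partial>lebesgue_on \<Omega>) = - b_dG \<Omega> M n w q)"
proof -
  let ?Q = "pw_poly_0 (int l - 1) \<Omega> M"
  have "\<exists>g\<in>?Q. \<forall>q\<in>?Q. (\<integral>x. q x \<bullet> g x \<partial>lebesgue_on \<Omega>) = - b_dG \<Omega> M n w q"
    by (rule riesz_pw_poly_0) (use l in \<open>simp_all add: b_dG_combine_right[OF w]\<close>)
  then obtain g where g: "g \<in> ?Q" "\<forall>q\<in>?Q. (\<integral>x. q x * g x \<partial>lebesgue_on \<Omega>) = - b_dG \<Omega> M n w q"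
    unfolding inner_real_def by (rule bexE)
  have "\<exists>!g. g \<in> ?Q \<and> (\<forall>q\<in>?Q. (\<integral>x. q x * g x \<partial>lebesgue_on \<Omega>) = - b_dG \<Omega> M n w q)"
  proof (rule ex1I[of _ g], rule conjI[OF g])
    fix h assume "h \<in> ?Q \<and> (\<forall>q\<in>?Q. (\<integral>x. q x * h x \<partial>lebesgue_on \<Omega>) = - b_dG \<Omega> M n w q)"
    then have h: "h \<in> ?Q" "\<forall>q\<in>?Q. (\<integral>x. q x * h x \<partial>lebesgue_on \<Omega>) = - b_dG \<Omega> M n w q" by blast+
    show "h = g"
    proof (rule pw_poly_0_unique[OF h(1) g(1)])
      fix q assume "q \<in> ?Q"
      from bspec[OF h(2) this] bspec[OF g(2) this]
      show "(\<integral>x. q x \<bullet> h x \<partial>lebesgue_on \<Omega>) = (\<integral>x. q x \<bullet> g x \<partial>lebesgue_on \<Omega>)" unfolding inner_real_def by (rule trans[OF _ sym])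
    qed
  qed
  then show ?thesis unfolding div_dG_def by (rule theI')
qed

text \<open>Puts membership into the variational form in which \<open>dG_solution\<close> provides
  it for the discrete velocity.\<close>

lemma Z_dG_iff:
  assumes l: "1 \<le> l"
  shows "z \<in> Z_dG \<Omega> M n l \<longleftrightarrow> z \<in> pw_poly (int l) M \<and> (\<forall>q\<in>pw_poly_0 (int l - 1) \<Omega> M. b_dG \<Omega> M n z q = 0)"
proof (cases "z \<in> pw_poly (int l) M")
  case True
  note spec = div_dG_spec[OF pw_poly_adm[OF True] l]
  have "div_dG \<Omega> M n l z = (\<lambda>x. 0)" if "\<forall>q\<in>pw_poly_0 (int l - 1) \<Omega> M. b_dG \<Omega> M n z q = 0"
    by (rule pw_poly_0_unique[OF conjunct1[OF spec] pw_poly_0_zero]) (use conjunct2[OF spec] that in simp)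
  moreover have "b_dG \<Omega> M n z q = 0" if "div_dG \<Omega> M n l z = (\<lambda>x. 0)" "q \<in> pw_poly_0 (int l - 1) \<Omega> M" for q
    using conjunct2[OF spec] that by simp
  ultimately show ?thesis using True unfolding Z_dG_def by blast
qed (simp add: Z_dG_def)

lemma vdiv_l2: assumes "v \<in> h1_0_vec \<Omega>" shows "vdiv \<Omega> v \<in> l2 (lebesgue_on \<Omega>)"
  unfolding vdiv_def[abs_def] by (rule l2_linear_image[OF h10_vgrad_l2[OF assms] trace_bounded_linear])

text \<open>The first argument is piecewise polynomial, so that its broken gradient has square
  integrable traces and the face integrals can be split.\<close>

lemma Sf_diff_right:
  fixes v z :: "real^'n \<Rightarrow> real^'n"
  assumes w: "w \<in> pw_poly k M" and v: "adm v" and z: "adm z"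
  shows "Sf w (\<lambda>x. v x - z x) = Sf w v - Sf w z"
proof -
  obtain g where g: "g \<in> pw_poly (k - 1) M"
    "\<And>F. F \<in> faces M \<Longrightarrow> average \<Omega> M n F (broken_grad M w) = average \<Omega> M n F g"
    using average_broken_grad[OF w] by blast
  have d: "adm (\<lambda>x. v x - z x)" using adm_combine[OF v z, of "-1"] by simp
  have "(\<integral>x. jump \<Omega> M n F (\<lambda>x. v x - z x) x \<bullet> (average \<Omega> M n F g x *v n F) \<partial>face_measure F)
      = (\<integral>x. jump \<Omega> M n F v x \<bullet> (average \<Omega> M n F g x *v n F) \<partial>face_measure F)
        + (-1) * (\<integral>x. jump \<Omega> M n F z x \<bullet> (average \<Omega> M n F g x *v n F) \<partial>face_measure F)" if F: "F \<in> faces M" for F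
    by (rule l2_inner_combine[OF jump_l2[OF v F] jump_l2[OF z F] matrix_l2[OF average_l2[OF pw_poly_adm[OF g(1)] F]] jump_l2[OF d F]])
      (use jump_combine[OF v z F, of "-1"] in simp)
  then show ?thesis
    unfolding Sf_def skeleton_integral_def by (simp add: g(2) inner_commute sum_subtractf)
qed

end

section \<open>Error estimates\<close>

locale dg_stokes = dg_lift \<Omega> M n l E \<eta>bar \<eta> for \<Omega> :: "(real^'n) set" and M n l E \<eta>bar \<eta> +
  fixes \<mu> :: real and f :: "(real^'n \<Rightarrow> real^'n) \<Rightarrow> real" and u u\<^sub>h :: "real^'n \<Rightarrow> real^'n" and p p\<^sub>h :: "real^'n \<Rightarrow> real"
  assumes l: "1 \<le> l" and \<mu>: "0 < \<mu>"
    and E_div: "\<And>v. v \<in> pw_poly (int l) M \<Longrightarrow> AE x in lebesgue_on \<Omega>. vdiv \<Omega> (E v) x = div_dG \<Omega> M n l v x"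
    and stokes: "stokes_solution \<Omega> \<mu> f u p"
    and discrete: "dG_solution \<Omega> M n l \<eta> \<mu> f E u\<^sub>h p\<^sub>h"
begin

abbreviation "Q \<equiv> pw_poly_0 (int l - 1) \<Omega> M"
abbreviation "Z \<equiv> Z_dG \<Omega> M n l"
abbreviation "b \<equiv> b_dG \<Omega> M n"
abbreviation "a \<equiv> a_dG \<Omega> M n \<eta>"
abbreviation "\<alpha> \<equiv> 1 - sqrt (\<eta>bar / \<eta>)"

lemma u: "u \<in> h1_0_vec \<Omega>" and p: "p \<in> l2 (lebesgue_on \<Omega>)" "(\<integral>x. p x \<partial>lebesgue_on \<Omega>) = 0"
  using stokes by (simp_all add: stokes_solution_def l2_0_def)

lemma uh: "u\<^sub>h \<in> V" and ph: "p\<^sub>h \<in> Q" and uh_Z: "u\<^sub>h \<in> Z"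
  using discrete by (simp_all add: dG_solution_def Z_dG_iff[OF l])

lemma Z_V: "z \<in> Z \<Longrightarrow> z \<in> V"
  by (simp add: Z_dG_def)

lemma Z_diff: assumes "v \<in> Z" "z \<in> Z" shows "(\<lambda>x. v x - z x) \<in> Z"
proof -
  have "b (\<lambda>x. v x - z x) q = 0" if q: "q \<in> Q" for q
  proof -
    have "q \<in> pw_poly (int l - 1) M" using q by (simp add: pw_poly_0_iff)
    from b_dG_combine_left[OF V_adm[OF Z_V[OF assms(1)]] V_adm[OF Z_V[OF assms(2)]] this, of "-1"]
    show ?thesis using assms q by (simp add: Z_dG_iff[OF l])
  qed
  then show ?thesis using V_diff[OF Z_V Z_V, OF assms] by (simp add: Z_dG_iff[OF l])
qed

lemma \<alpha>_bounds: "0 < \<alpha>" "\<alpha> \<le> 1"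
  using ratio by simp_all

text \<open>Since \<open>E\<close> preserves the divergence, testing the Stokes problem with \<open>E v\<close> and the discrete
  problem with \<open>v\<close> makes the load drop out.\<close>

lemma pressure_identity:
  assumes v: "v \<in> V"
  shows "\<mu> * (Gf u (E v) - a u\<^sub>h v) = (\<integral>x. p x \<bullet> div_dG \<Omega> M n l v x \<partial>lebesgue_on \<Omega>) + b v p\<^sub>h"
proof -
  have "\<mu> * Gf u (E v) - (\<integral>x. p x * vdiv \<Omega> (E v) x \<partial>lebesgue_on \<Omega>) = f (E v)"
  proof -
    have "\<forall>v\<in>h1_0_vec \<Omega>. \<mu> * (\<integral>x. vgrad \<Omega> u x \<bullet> vgrad \<Omega> v x \<partial>lebesgue_on \<Omega>)
        - (\<integral>x. p x * vdiv \<Omega> v x \<partial>lebesgue_on \<Omega>) = f v"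
      using stokes unfolding stokes_solution_def by (elim conjE)
    from bspec[OF this E_h10[OF v]] show ?thesis unfolding Gf_h10_left[OF u E_h10[OF v]] .
  qed
  moreover have "\<mu> * a u\<^sub>h v + b v p\<^sub>h = f (E v)" using discrete v by (simp add: dG_solution_def)
  moreover have "(\<integral>x. p x * vdiv \<Omega> (E v) x \<partial>lebesgue_on \<Omega>) = (\<integral>x. p x * div_dG \<Omega> M n l v x \<partial>lebesgue_on \<Omega>)"
  proof (rule integral_cong_AE)
    show "AE x in lebesgue_on \<Omega>. p x * vdiv \<Omega> (E v) x = p x * div_dG \<Omega> M n l v x"
      using E_div[OF v] by eventually_elim simp
    have "div_dG \<Omega> M n l v \<in> pw_poly (int l - 1) M" using div_dG_spec[OF V_adm[OF v] l] by (simp add: pw_poly_0_iff)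
    from l2_inner_integrable[OF p(1) pw_poly_l2[OF this]]
    show "(\<lambda>x. p x * div_dG \<Omega> M n l v x) \<in> borel_measurable (lebesgue_on \<Omega>)" by simp
    from l2_inner_integrable[OF p(1) vdiv_l2[OF E_h10[OF v]]]
    show "(\<lambda>x. p x * vdiv \<Omega> (E v) x) \<in> borel_measurable (lebesgue_on \<Omega>)" by simp
  qed
  ultimately show ?thesis by (simp add: right_diff_distrib)
qed

lemma velocity_quasi_opt:
  assumes z: "z \<in> Z"
  shows "dG_norm (\<lambda>x. u x - u\<^sub>h x) \<le> 3 * ((1 + opnorm) / \<alpha>) * dG_norm (\<lambda>x. u x - z x)"
proof -
  interpret G: psd_form "Collect adm" Gf by (rule psd_G)
  interpret J: psd_form "Collect adm" "Jf \<eta>" by (rule psd_J[OF \<eta>_pos])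
  interpret D: psd_form "Collect adm" "\<lambda>w v. Gf w v + Jf \<eta> w v" by (rule psd_dG[OF \<eta>_pos])
  define w where "w = (\<lambda>x. u\<^sub>h x - z x)"
  have wZ: "w \<in> Z" unfolding w_def by (rule Z_diff[OF uh_Z z])
  note V = Z_V[OF z] Z_V[OF wZ]
  have adm: "u \<in> Collect adm" "u\<^sub>h \<in> Collect adm" "z \<in> Collect adm" "w \<in> Collect adm" "E w \<in> Collect adm"
    using h10_adm[OF u] V_adm[OF uh] V_adm[OF V(1)] V_adm[OF V(2)] E_adm[OF V(2)] by auto
  have "div_dG \<Omega> M n l w = (\<lambda>x. 0)" "b w p\<^sub>h = 0"
    using wZ ph by (simp add: Z_dG_def, simp add: Z_dG_iff[OF l])
  then have "\<mu> * (Gf u (E w) - a u\<^sub>h w) = 0" using pressure_identity[OF V(2)] by simp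
  then have "Gf u (E w) = a u\<^sub>h w" using \<mu> by simp
  moreover have "a u\<^sub>h w - a z w = a w w"
  proof -
    have G: "Gf w x = Gf u\<^sub>h x - Gf z x" if "x \<in> Collect adm" for x
      unfolding w_def by (rule G.form_diff[OF adm(2,3) that])
    have J: "Jf \<eta> w w = Jf \<eta> u\<^sub>h w - Jf \<eta> z w" using J.form_diff[OF adm(2,3,4)] by (simp add: w_def)
    have S: "Sf w w = Sf w u\<^sub>h - Sf w z" using Sf_diff_right[OF V(2), of u\<^sub>h z] adm by (simp add: w_def)
    \<comment> \<open>Through \<open>grad_identity\<close> the flux of the first argument is
      absorbed into \<open>Gf v (E w)\<close>, so the difference in that argument is taken in
      \<open>Gf\<close>, \<open>Jf\<close> and the second slot of \<open>Sf\<close>.\<close>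
    have A: "a v w = Gf v (E w) - Sf w v + Jf \<eta> v w" if "v \<in> V" for v
      using grad_identity[OF that V(2)] by (simp add: a_dG_eq)
    show ?thesis unfolding A[OF uh] A[OF V(1)] A[OF V(2)] G[OF adm(5)] J S by simp
  qed
  ultimately have "\<alpha> * (dG_norm w)\<^sup>2 \<le> (2 + opnorm) * dG_norm (\<lambda>x. u x - z x) * dG_norm w"
    using coercive[OF V(2)] consistency[OF u V] by linarith
  then have "dG_norm w * (\<alpha> * dG_norm w) \<le> dG_norm w * ((2 + opnorm) * dG_norm (\<lambda>x. u x - z x))"
    by (simp add: power2_eq_square ac_simps)
  moreover have nn: "0 \<le> (2 + opnorm) * dG_norm (\<lambda>x. u x - z x)" using opnorm_nonneg norm_nonneg by simp
  ultimately have "\<alpha> * dG_norm w \<le> (2 + opnorm) * dG_norm (\<lambda>x. u x - z x)"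
    using norm_nonneg[of w] by (cases "dG_norm w = 0") (simp, simp add: mult_le_cancel_left)
  then have w: "dG_norm w \<le> (2 + opnorm) / \<alpha> * dG_norm (\<lambda>x. u x - z x)"
    using \<alpha>_bounds by (simp add: field_simps)
  have "dG_norm (\<lambda>x. (u x - z x) - w x) \<le> dG_norm (\<lambda>x. u x - z x) + dG_norm w"
    unfolding norm_dG_eq by (rule D.minkowski_diff[OF G.diff[OF adm(1,3)] adm(4)])
  also have "(\<lambda>x. (u x - z x) - w x) = (\<lambda>x. u x - u\<^sub>h x)" by (simp add: w_def)
  also have "dG_norm (\<lambda>x. u x - z x) + dG_norm w \<le> (1 + (2 + opnorm) / \<alpha>) * dG_norm (\<lambda>x. u x - z x)"
    using w by (simp add: distrib_right)
  also have "\<dots> \<le> 3 * ((1 + opnorm) / \<alpha>) * dG_norm (\<lambda>x. u x - z x)"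
  proof (rule mult_right_mono)
    have "\<alpha> \<noteq> 0" using \<alpha>_bounds(1) by linarith
    then have "1 + (2 + opnorm) / \<alpha> = (\<alpha> + (2 + opnorm)) / \<alpha>" by (simp only: add_divide_distrib divide_self simp_thms)
    \<comment> \<open>\<open>\<alpha> \<le> 1\<close> absorbs the summand 1 of the triangle
      inequality.\<close>
    also have "\<dots> \<le> (3 * (1 + opnorm)) / \<alpha>"
    proof (rule divide_right_mono)
      have "x + (2 + y) \<le> 3 * (1 + y)" if "x \<le> 1" "0 \<le> y" for x y :: real using that by simp
      then show "\<alpha> + (2 + opnorm) \<le> 3 * (1 + opnorm)" using \<alpha>_bounds(2) opnorm_nonneg .
      show "0 \<le> \<alpha>" using \<alpha>_bounds(1) by (rule less_imp_le)
    qed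
    finally show "1 + (2 + opnorm) / \<alpha> \<le> 3 * ((1 + opnorm) / \<alpha>)" by simp
  qed (rule norm_nonneg)
  finally show ?thesis .
qed

text \<open>The best approximation is the Riesz representer of integration against \<open>p\<close>;
  minimality is Pythagoras for the orthogonal splitting of \<open>p - q\<close> into
  \<open>p - g\<close> and \<open>g - q\<close>.\<close>

lemma pressure_projection:
  "\<exists>g\<in>Q. (\<forall>q\<in>Q. (\<integral>x. q x \<bullet> g x \<partial>lebesgue_on \<Omega>) = (\<integral>x. q x \<bullet> p x \<partial>lebesgue_on \<Omega>))
    \<and> (\<forall>q\<in>Q. l2_norm (lebesgue_on \<Omega>) (\<lambda>x. p x - g x) \<le> l2_norm (lebesgue_on \<Omega>) (\<lambda>x. p x - q x))"
proof -
  let ?N = "lebesgue_on \<Omega>" and ?P = "pw_poly (int l - 1) M :: (real^'n \<Rightarrow> real) set"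
  let ?I = "\<lambda>f g. \<integral>x. f x \<bullet> (g x :: real) \<partial>?N"
  have Ql: "q \<in> l2 ?N" if "q \<in> Q" for q using that pw_poly_l2[of q "int l - 1"] by (simp add: pw_poly_0_iff)
  have "\<exists>g\<in>Q. \<forall>q\<in>Q. ?I q g = ?I q p"
    by (rule riesz_pw_poly_0[of _ "\<lambda>q. ?I q p"], use l in simp, rule integral_combine[OF pw_poly_l2 pw_poly_l2 p(1)])
  then obtain g where g: "g \<in> Q" "\<forall>q\<in>Q. ?I q g = ?I q p" by (rule bexE)
  have "l2_norm ?N (\<lambda>x. p x - g x) \<le> l2_norm ?N (\<lambda>x. p x - q x)" if q: "q \<in> Q" for q
  proof -
    let ?e = "\<lambda>x. p x - g x" and ?r = "\<lambda>x. g x + (-1) * q x"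
    have r: "?r \<in> Q" by (rule pw_poly_0_combine[OF g(1) q])
    have e: "?e \<in> l2 ?N" by (rule l2_form.diff[OF p(1) Ql[OF g(1)]])
    have "?I ?e ?r = ?I p ?r - ?I g ?r" by (rule l2_form.form_diff[OF p(1) Ql[OF g(1)] Ql[OF r]])
    also have "\<dots> = ?I ?r p - ?I ?r g" by (simp only: inner_commute)
    finally have er: "?I ?e ?r = 0" unfolding bspec[OF g(2) r] by simp
    have "?I (\<lambda>x. ?e x + 1 * ?r x) (\<lambda>x. ?e x + 1 * ?r x) = ?I ?e (\<lambda>x. ?e x + 1 * ?r x) + 1 * ?I ?r (\<lambda>x. ?e x + 1 * ?r x)"
      by (rule integral_combine[OF e Ql[OF r] l2_combine[OF e Ql[OF r]]])
    also have "?I ?e (\<lambda>x. ?e x + 1 * ?r x) = ?I (\<lambda>x. ?e x + 1 * ?r x) ?e" by (simp only: inner_commute)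
    also have "\<dots> = ?I ?e ?e + 1 * ?I ?r ?e" by (rule integral_combine[OF e Ql[OF r] e])
    also have "?I ?r (\<lambda>x. ?e x + 1 * ?r x) = ?I (\<lambda>x. ?e x + 1 * ?r x) ?r" by (simp only: inner_commute)
    also have "\<dots> = ?I ?e ?r + 1 * ?I ?r ?r" by (rule integral_combine[OF e Ql[OF r] Ql[OF r]])
    also have "?I ?r ?e = ?I ?e ?r" by (simp only: inner_commute)
    finally have "?I (\<lambda>x. ?e x + 1 * ?r x) (\<lambda>x. ?e x + 1 * ?r x) = ?I ?e ?e + ?I ?r ?r" unfolding er by simp
    also have "(\<lambda>x. ?e x + 1 * ?r x) = (\<lambda>x. p x - q x)" by simp
    finally have "?I ?e ?e \<le> ?I (\<lambda>x. p x - q x) (\<lambda>x. p x - q x)"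
      using l2_form.nonneg[OF Ql[OF r]] by linarith
    then show ?thesis unfolding l2_norm_eq by (rule real_sqrt_le_mono)
  qed
  with g show ?thesis by (intro bexI[of _ g]) auto
qed

text \<open>The divergence of \<open>E v\<close> is the discrete one, an element of
  \<open>Q\<close>; so in \<open>pressure_identity\<close> the pressure \<open>p\<close> may be
  replaced by its projection \<open>g\<close> without error. The approximation error of the pressure
  thus enters only through \<open>p - g\<close>, with factor 1.\<close>

lemma pressure_error:
  assumes \<beta>: "0 < \<beta>"
    and infsup: "\<And>q. q \<in> Q \<Longrightarrow> \<beta> * l2_norm (lebesgue_on \<Omega>) q \<le> (SUP w\<in>V. b w q / dG_norm w)"
  shows "l2_norm (lebesgue_on \<Omega>) (\<lambda>x. p x - p\<^sub>h x)
    \<le> \<mu> * (2 + opnorm) / \<beta> * dG_norm (\<lambda>x. u x - u\<^sub>h x) + (INF q\<in>Q. l2_norm (lebesgue_on \<Omega>) (\<lambda>x. p x - q x))"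
proof -
  let ?N = "lebesgue_on \<Omega>"
  obtain g where g: "g \<in> Q" "\<forall>q\<in>Q. (\<integral>x. q x \<bullet> g x \<partial>?N) = (\<integral>x. q x \<bullet> p x \<partial>?N)"
    "\<forall>q\<in>Q. l2_norm ?N (\<lambda>x. p x - g x) \<le> l2_norm ?N (\<lambda>x. p x - q x)"
    using pressure_projection by blast
  have Ql: "q \<in> l2 ?N" and QP: "q \<in> pw_poly (int l - 1) M" if "q \<in> Q" for q
    using that pw_poly_l2[of q "int l - 1"] by (simp_all add: pw_poly_0_iff)
  let ?r = "\<lambda>x. p\<^sub>h x + (-1) * g x"
  have r: "?r \<in> Q" by (rule pw_poly_0_combine[OF ph g(1)])
  let ?B = "\<mu> * (2 + opnorm) * dG_norm (\<lambda>x. u x - u\<^sub>h x)"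
  have B: "0 \<le> ?B" using \<mu> opnorm_nonneg norm_nonneg by simp
  have "b v ?r / dG_norm v \<le> ?B" if v: "v \<in> V" for v
  proof -
    let ?d = "div_dG \<Omega> M n l v"
    note spec = div_dG_spec[OF V_adm[OF v] l]
    have "b v ?r = b v p\<^sub>h + (-1) * b v g" by (rule b_dG_combine_right[OF V_adm[OF v] QP[OF ph] QP[OF g(1)]])
    moreover have "(\<integral>x. p x \<bullet> ?d x \<partial>?N) = - b v g"
    proof -
      have "(\<integral>x. p x \<bullet> ?d x \<partial>?N) = (\<integral>x. ?d x \<bullet> p x \<partial>?N)" by (simp only: inner_commute)
      also have "\<dots> = (\<integral>x. ?d x \<bullet> g x \<partial>?N)" by (rule bspec[OF g(2) conjunct1[OF spec], symmetric])
      also have "\<dots> = (\<integral>x. g x \<bullet> ?d x \<partial>?N)" by (simp only: inner_commute)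
      also have "\<dots> = - b v g" unfolding inner_real_def by (rule bspec[OF conjunct2[OF spec] g(1)])
      finally show ?thesis .
    qed
    ultimately have "b v ?r = \<mu> * (Gf u (E v) - a u\<^sub>h v)" using pressure_identity[OF v] by simp
    also have "\<dots> \<le> \<mu> * ((2 + opnorm) * dG_norm (\<lambda>x. u x - u\<^sub>h x) * dG_norm v)"
      using \<mu> consistency[OF u uh v] by (intro mult_left_mono) auto
    finally have "b v ?r \<le> ?B * dG_norm v" by (simp add: ac_simps)
    \<comment> \<open>If the norm of \<open>v\<close> is 0 the quotient is 0, which is below
      \<open>?B\<close> too.\<close>
    then show ?thesis using B norm_nonneg[of v] by (cases "dG_norm v = 0") (simp_all add: divide_le_eq)
  qed
  moreover have "V \<noteq> {}" using uh by blast
  ultimately have "(SUP w\<in>V. b w ?r / dG_norm w) \<le> ?B" by (intro cSUP_least)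
  with infsup[OF r] have "\<beta> * l2_norm ?N ?r \<le> ?B" by (rule order_trans)
  then have R: "l2_norm ?N ?r \<le> \<mu> * (2 + opnorm) / \<beta> * dG_norm (\<lambda>x. u x - u\<^sub>h x)"
    using \<beta> by (simp add: field_simps)
  have "l2_norm ?N (\<lambda>x. (p x - g x) - ?r x) \<le> l2_norm ?N (\<lambda>x. p x - g x) + l2_norm ?N ?r"
    by (rule l2_norm_triangle_diff[OF l2_form.diff[OF p(1) Ql[OF g(1)]] Ql[OF r]])
  also have "(\<lambda>x. (p x - g x) - ?r x) = (\<lambda>x. p x - p\<^sub>h x)" by simp
  also have "l2_norm ?N (\<lambda>x. p x - g x) \<le> (INF q\<in>Q. l2_norm ?N (\<lambda>x. p x - q x))"
    using g(1,3) by (intro cINF_greatest) auto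
  finally show ?thesis using R by simp
qed

text \<open>Division by the positive factor \<open>?c\<close> isolates the infimum over the kernel.
  The product \<open>\<delta> * B\<close> is kept whole, as \<open>\<delta>\<close> comes without a
  sign.\<close>

lemma velocity_error:
  assumes \<delta>: "(INF z\<in>Z. dG_norm (\<lambda>x. u x - z x)) \<le> \<delta> * B"
  shows "dG_norm (\<lambda>x. u x - u\<^sub>h x) \<le> 3 * ((1 + opnorm) / \<alpha>) * (\<delta> * B)"
proof -
  let ?c = "3 * ((1 + opnorm) / \<alpha>)"
  have c: "0 < ?c" using opnorm_nonneg \<alpha>_bounds by simp
  have "dG_norm (\<lambda>x. u x - u\<^sub>h x) / ?c \<le> (INF z\<in>Z. dG_norm (\<lambda>x. u x - z x))"
  proof (rule cINF_greatest)
    show "dG_norm (\<lambda>x. u x - u\<^sub>h x) / ?c \<le> dG_norm (\<lambda>x. u x - z x)" if "z \<in> Z" for z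
      using velocity_quasi_opt[OF that] c by (simp only: pos_divide_le_eq mult.commute)
  qed (use uh_Z in blast)
  then have "dG_norm (\<lambda>x. u x - u\<^sub>h x) / ?c \<le> \<delta> * B" using \<delta> by (rule order_trans)
  then show ?thesis using c by (simp only: pos_divide_le_eq mult.commute)
qed

lemma quasi_optimality:
  assumes \<beta>: "0 < \<beta>"
    and infsup: "\<And>q. q \<in> Q \<Longrightarrow> \<beta> * l2_norm (lebesgue_on \<Omega>) q \<le> (SUP w\<in>V. b w q / dG_norm w)"
    and \<delta>: "(INF z\<in>Z. dG_norm (\<lambda>x. u x - z x)) \<le> \<delta> * B"
  shows "dG_norm (\<lambda>x. u x - u\<^sub>h x) \<le> 6 * \<delta> * ((1 + opnorm) / \<alpha>) * B
    \<and> l2_norm (lebesgue_on \<Omega>) (\<lambda>x. p x - p\<^sub>h x)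
      \<le> 6 * \<delta> * ((1 + opnorm)\<^sup>2 / (\<alpha> * \<beta>)) * \<mu> * B + (INF q\<in>Q. l2_norm (lebesgue_on \<Omega>) (\<lambda>x. p x - q x))"
proof -
  let ?e = opnorm and ?X = "dG_norm (\<lambda>x. u x - u\<^sub>h x)"
  let ?c = "(1 + ?e) / \<alpha>"
  note X = velocity_error[OF \<delta>]
  have c: "0 < ?c" using opnorm_nonneg \<alpha>_bounds by simp
  \<comment> \<open>The sign of the product is read off from the velocity estimate, whose left-hand
    side is nonnegative; this permits enlarging 3 to 6.\<close>
  have "0 \<le> 3 * ?c * (\<delta> * B)" using norm_nonneg X by (rule order_trans)
  then have dB: "0 \<le> ?c * (\<delta> * B)" unfolding mult.assoc by linarith
  have "6 * \<delta> * ?c * B = 6 * (?c * (\<delta> * B))" by (simp only: ac_simps)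
  moreover have "?X \<le> 3 * (?c * (\<delta> * B))" using X by (simp only: mult.assoc)
  ultimately have "?X \<le> 6 * \<delta> * ?c * B" using dB by linarith
  moreover have "\<mu> * (2 + ?e) / \<beta> * ?X \<le> \<mu> * (2 * (1 + ?e)) / \<beta> * (3 * ?c * (\<delta> * B))"
    using X \<mu> \<beta> opnorm_nonneg norm_nonneg by (intro mult_mono divide_right_mono) auto
  moreover have "\<mu> * (2 * (1 + ?e)) / \<beta> * (3 * ?c * (\<delta> * B)) = 6 * \<delta> * ((1 + ?e)\<^sup>2 / (\<alpha> * \<beta>)) * \<mu> * B"
  proof -
    have "\<mu> * (2 * (1 + x)) / \<beta> * (3 * ((1 + x) / y) * (\<delta> * B)) = 6 * \<delta> * ((1 + x)\<^sup>2 / (y * \<beta>)) * \<mu> * B" if "0 < y" for x y :: real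
      using \<beta> that by (simp add: power2_eq_square field_simps)
    then show ?thesis using \<alpha>_bounds(1) .
  qed
  ultimately show ?thesis using pressure_error[OF \<beta> infsup] by linarith
qed

end

theorem theorem11:
  fixes \<Omega> :: "(real^'n) set" and l :: nat
  assumes "CARD('n) \<in> {2, 3}" and "1 \<le> l" and "polyhedral_domain \<Omega>"
  shows "\<exists>C :: real \<Rightarrow> real. mono C \<and> (\<forall>\<gamma>. 0 < C \<gamma>) \<and>
    (\<forall>(M :: (real^'n) set set) (n :: (real^'n) set \<Rightarrow> real^'n)
      (E :: (real^'n \<Rightarrow> real^'n) \<Rightarrow> real^'n \<Rightarrow> real^'n)
      (\<eta>bar :: real) (\<eta> :: real) (\<mu> :: real) (f :: (real^'n \<Rightarrow> real^'n) \<Rightarrow> real)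
      (u :: real^'n \<Rightarrow> real^'n) (p :: real^'n \<Rightarrow> real)
      (u\<^sub>h :: real^'n \<Rightarrow> real^'n) (p\<^sub>h :: real^'n \<Rightarrow> real) (\<beta> :: real) (\<delta> :: real).
      simplicial_mesh \<Omega> M \<longrightarrow>
      face_normals \<Omega> M n \<longrightarrow>
      linear_into_h1_0 \<Omega> (pw_poly (int l) M) E \<longrightarrow>
      (\<forall>v\<in>pw_poly (int l) M. \<forall>F\<in>interior_faces \<Omega> M. \<forall>m\<in>polynomials_vec (int l - 1).
         (\<integral>x. face_trace \<Omega> F (E v) x \<bullet> m x \<partial>face_measure F)
         = (\<integral>x. average \<Omega> M n F v x \<bullet> m x \<partial>face_measure F)) \<longrightarrow>
      (\<forall>v\<in>pw_poly (int l) M. \<forall>K\<in>M. \<forall>m\<in>polynomials_vec (int l - 2).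
         (\<integral>x. E v x \<bullet> m x \<partial>lebesgue_on K) = (\<integral>x. v x \<bullet> m x \<partial>lebesgue_on K)) \<longrightarrow>
      (\<forall>v\<in>pw_poly (int l) M. AE x in lebesgue_on \<Omega>. vdiv \<Omega> (E v) x = div_dG \<Omega> M n l v x) \<longrightarrow>
      0 < \<eta>bar \<longrightarrow>
      (\<forall>v :: real^'n \<Rightarrow> real^'n^'n. v \<in> pw_poly (int l) M \<longrightarrow>
         skeleton_integral M (\<lambda>F x. diameter F * (norm (average \<Omega> M n F v x))\<^sup>2)
         \<le> \<eta>bar * (l2_norm (lebesgue_on \<Omega>) v)\<^sup>2) \<longrightarrow>
      \<eta>bar < \<eta> \<longrightarrow>
      0 < \<mu> \<longrightarrow>
      f \<in> h_minus1 \<Omega> \<longrightarrow>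
      stokes_solution \<Omega> \<mu> f u p \<longrightarrow>
      dG_solution \<Omega> M n l \<eta> \<mu> f E u\<^sub>h p\<^sub>h \<longrightarrow>
      0 < \<beta> \<longrightarrow> \<beta> \<le> 1 \<longrightarrow>
      (\<forall>q\<in>pw_poly_0 (int l - 1) \<Omega> M.
         \<beta> * l2_norm (lebesgue_on \<Omega>) q
         \<le> (SUP w\<in>pw_poly (int l) M. b_dG \<Omega> M n w q / norm_dG \<Omega> M n \<eta> w)) \<longrightarrow>
      (INF z\<in>Z_dG \<Omega> M n l. norm_dG \<Omega> M n \<eta> (\<lambda>x. u x - z x))
        \<le> \<delta> * (INF w\<in>pw_poly (int l) M. norm_dG \<Omega> M n \<eta> (\<lambda>x. u x - w x)) \<longrightarrow>
      (let \<alpha> = 1 - sqrt (\<eta>bar / \<eta>);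
           best_u = (INF w\<in>pw_poly (int l) M. norm_dG \<Omega> M n \<eta> (\<lambda>x. u x - w x));
           best_p = (INF q\<in>pw_poly_0 (int l - 1) \<Omega> M. l2_norm (lebesgue_on \<Omega>) (\<lambda>x. p x - q x))
       in
         norm_dG \<Omega> M n \<eta> (\<lambda>x. u x - u\<^sub>h x)
           \<le> C (shape_constant M) * \<delta> * ((1 + opnorm_dG \<Omega> M n l \<eta> E) / \<alpha>) * best_u
         \<and> l2_norm (lebesgue_on \<Omega>) (\<lambda>x. p x - p\<^sub>h x)
           \<le> C (shape_constant M) * \<delta> * ((1 + opnorm_dG \<Omega> M n l \<eta> E)\<^sup>2 / (\<alpha> * \<beta>)) * \<mu> * best_u
             + best_p))"
proof (intro exI[of _ "\<lambda>_. 6"] conjI allI impI)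
  fix M :: "(real^'n) set set" and n :: "(real^'n) set \<Rightarrow> real^'n" and E :: "(real^'n \<Rightarrow> real^'n) \<Rightarrow> real^'n \<Rightarrow> real^'n"
    and \<eta>bar \<eta> \<mu> :: real and f :: "(real^'n \<Rightarrow> real^'n) \<Rightarrow> real" and u u\<^sub>h :: "real^'n \<Rightarrow> real^'n" and p p\<^sub>h :: "real^'n \<Rightarrow> real"
    and \<beta> \<delta> :: real
  assume mesh: "simplicial_mesh \<Omega> M" "face_normals \<Omega> M n" and lift: "linear_into_h1_0 \<Omega> (pw_poly (int l) M) E"
    "\<forall>v\<in>pw_poly (int l) M. \<forall>F\<in>interior_faces \<Omega> M. \<forall>m\<in>polynomials_vec (int l - 1).
         (\<integral>x. face_trace \<Omega> F (E v) x \<bullet> m x \<partial>face_measure F)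
         = (\<integral>x. average \<Omega> M n F v x \<bullet> m x \<partial>face_measure F)"
    "\<forall>v\<in>pw_poly (int l) M. \<forall>K\<in>M. \<forall>m\<in>polynomials_vec (int l - 2).
         (\<integral>x. E v x \<bullet> m x \<partial>lebesgue_on K) = (\<integral>x. v x \<bullet> m x \<partial>lebesgue_on K)"
    and div: "\<forall>v\<in>pw_poly (int l) M. AE x in lebesgue_on \<Omega>. vdiv \<Omega> (E v) x = div_dG \<Omega> M n l v x"
    and penalty: "0 < \<eta>bar" "\<forall>v :: real^'n \<Rightarrow> real^'n^'n. v \<in> pw_poly (int l) M \<longrightarrow>
         skeleton_integral M (\<lambda>F x. diameter F * (norm (average \<Omega> M n F v x))\<^sup>2)
         \<le> \<eta>bar * (l2_norm (lebesgue_on \<Omega>) v)\<^sup>2" "\<eta>bar < \<eta>"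
    and data: "0 < \<mu>" "stokes_solution \<Omega> \<mu> f u p" "dG_solution \<Omega> M n l \<eta> \<mu> f E u\<^sub>h p\<^sub>h"
    and \<beta>: "0 < \<beta>"
    and infsup: "\<forall>q\<in>pw_poly_0 (int l - 1) \<Omega> M. \<beta> * l2_norm (lebesgue_on \<Omega>) q
         \<le> (SUP w\<in>pw_poly (int l) M. b_dG \<Omega> M n w q / norm_dG \<Omega> M n \<eta> w)"
    and \<delta>: "(INF z\<in>Z_dG \<Omega> M n l. norm_dG \<Omega> M n \<eta> (\<lambda>x. u x - z x))
        \<le> \<delta> * (INF w\<in>pw_poly (int l) M. norm_dG \<Omega> M n \<eta> (\<lambda>x. u x - w x))"
  have "2 \<le> CARD('n)" using assms(1) by auto
  then interpret dg_mesh \<Omega> M n using assms(3) mesh by unfold_locales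
  interpret dg_lift \<Omega> M n l E \<eta>bar \<eta>
    by unfold_locales (fact lift(1), (rule lift(2,3)[rule_format]; assumption)+, fact penalty(1), fact penalty(3), rule penalty(2)[rule_format])
  interpret dg_stokes \<Omega> M n l E \<eta>bar \<eta> \<mu> f u u\<^sub>h p p\<^sub>h
    by unfold_locales (fact assms(2), fact data(1), rule div[rule_format], assumption, fact data(2), fact data(3))
  from quasi_optimality[OF \<beta> infsup[rule_format] \<delta>]
  show "let \<alpha> = 1 - sqrt (\<eta>bar / \<eta>);
           best_u = (INF w\<in>pw_poly (int l) M. norm_dG \<Omega> M n \<eta> (\<lambda>x. u x - w x));
           best_p = (INF q\<in>pw_poly_0 (int l - 1) \<Omega> M. l2_norm (lebesgue_on \<Omega>) (\<lambda>x. p x - q x))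
       in
         norm_dG \<Omega> M n \<eta> (\<lambda>x. u x - u\<^sub>h x)
           \<le> 6 * \<delta> * ((1 + opnorm_dG \<Omega> M n l \<eta> E) / \<alpha>) * best_u
         \<and> l2_norm (lebesgue_on \<Omega>) (\<lambda>x. p x - p\<^sub>h x)
           \<le> 6 * \<delta> * ((1 + opnorm_dG \<Omega> M n l \<eta> E)\<^sup>2 / (\<alpha> * \<beta>)) * \<mu> * best_u
             + best_p"
    unfolding Let_def .
qed (simp_all add: mono_def)

end
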